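(* For any $\mu_0,\mu_1\in\mathcal M$, $$\frac12\,\mathcal W^{a,b}_p(\mu_0,\mu_1)^2=\sup\left\{\langle\phi_1,\mu_1\rangle_\varpi-\langle\phi_0,\mu_0\rangle_\varpi-\frac1{2a^2}\int_0^1\langle\phi_t,p\rangle_\varpi^2\,dt\ \middle|\ \phi\in\mathsf{HJ}^{1,b}_{\mathcal X}\right\}.$$ Moreover, the same identity holds if the supremum is taken only over $\phi\in C^1([0,1];\mathbb R^{\mathcal X})$ satisfying, for almost every $t\in(0,1)$, $$\langle\dot\phi_t,\mu\rangle_\varpi+\frac1{2b^2}\|\nabla\phi_t\|_\mu^2\le0\qquad\text{for all }\mu\in\mathcal M.$$
   Context: Setting. $\mathcal X$ is a finite set, $K:\mathcal X\times\mathcal X\to[0,\infty)$ an irreducible Markov kernel ($\sum_y K(x,y)=1$) with unique invariant probability $\varpi$ ($\varpi(x)=\sum_y\varpi(y)K(y,x)$, $\sum_y\varpi(y)=1$), assumed reversible: $K(x,y)\varpi(x)=K(y,x)\varpi(y)$. $\mathcal M$ is the set of $\mu:\mathcal X\to[0,\infty)$ and $\mathcal M_+$ the set of $\mu:\mathcal X\to(0,\infty)$. Fix $a,b>0$ and $p\in\mathcal M_+$ with $\sum_x p(x)\varpi(x)=1$. Notation. $\langle\varphi,\psi\rangle_\varpi=\sum_x\varphi(x)\psi(x)\varpi(x)$ for $\varphi,\psi\in\mathbb R^{\mathcal X}$; $\nabla\psi(x,y)=\psi(y)-\psi(x)$. Logarithmic mean: $\theta(u,v)=\int_0^1u^\xi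 v^{1-\xi}\,d\xi$ for $u,v\ge0$, i.e. $\theta(u,u)=u$, $\theta(u,v)=\frac{u-v}{\log u-\log v}$ for $u\ne v$ positive, and $\theta(u,v)=0$ if $u=0$ or $v=0$. $\hat\mu(x,y)=\theta(\mu(x),\mu(y))$ and $\|\Phi\|_\mu^2=\frac12\sum_{x,y}\Phi(x,y)^2\hat\mu(x,y)K(x,y)\varpi(x)$ for $\Phi\in\mathbb R^{\mathcal X\times\mathcal X}$. Metric. $\mathcal W^{a,b}_p(\mu_0,\mu_1)^2$ is the infimum of $a^2\int_0^1h_t^2\,dt+b^2\int_0^1\|\nabla\psi_t\|_{\mu_t}^2\,dt$ over all triples $(\mu_t,\psi_t,h_t)_{t\in[0,1]}$ with $t\mapsto\mu_t\in\mathcal M$ absolutely continuous on $[0,1]$ with the given endpoints $\mu_0,\mu_1$, $\psi:[0,1]\to\mathbb R^{\mathcal X}$ and $h:[0,1]\to\mathbb R$ measurable, and $\dot\mu_t(x)+\sum_y(\psi_t(y)-\psi_t(x))\hat\mu_t(x,y)K(x,y)=h_tp(x)$ for a.e. $t$ and all $x$. Hamilton--Jacobi subsolutions. $\mathsf{HJ}^{1,b}_{\mathcal X}$ is the set of $\phi\in H^1((0,1);\mathbb R^{\mathcal X})$ (identified with their continuous representatives on $[0,1]$) such that for almost every $t\in(0,1)$, $\langle\dot\phi_t,\mu\rangle_\varpi+\frac1{2b^2}\|\nabla\phi_t\|_\mu^2\le0$ for all $\mu\in\mathcal M$. *)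

theory Defs
  imports "HOL-Analysis.Analysis"
begin

section \<open>Markov kernels\<close>

definition markov_kernel :: "('x::finite \<Rightarrow> 'x \<Rightarrow> real) \<Rightarrow> bool" where
  "markov_kernel K \<longleftrightarrow> (\<forall>x y. 0 \<le> K x y) \<and> (\<forall>x. (\<Sum>y\<in>UNIV. K x y) = 1)"

primrec kernel_power :: "('x::finite \<Rightarrow> 'x \<Rightarrow> real) \<Rightarrow> nat \<Rightarrow> 'x \<Rightarrow> 'x \<Rightarrow> real" where
  "kernel_power K 0 x y = (if x = y then 1 else 0)"
| "kernel_power K (Suc n) x y = (\<Sum>z\<in>UNIV. K x z * kernel_power K n z y)"

definition irreducible_kernel :: "('x::finite \<Rightarrow> 'x \<Rightarrow> real) \<Rightarrow> bool" where
  "irreducible_kernel K \<longleftrightarrow> (\<forall>x y. \<exists>n. 0 < kernel_power K n x y)"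

definition invariant_probability :: "('x::finite \<Rightarrow> 'x \<Rightarrow> real) \<Rightarrow> ('x \<Rightarrow> real) \<Rightarrow> bool" where
  "invariant_probability K \<pi> \<longleftrightarrow>
     (\<forall>x. 0 \<le> \<pi> x) \<and> (\<Sum>y\<in>UNIV. \<pi> y) = 1 \<and> (\<forall>x. \<pi> x = (\<Sum>y\<in>UNIV. \<pi> y * K y x))"

definition reversible :: "('x \<Rightarrow> 'x \<Rightarrow> real) \<Rightarrow> ('x \<Rightarrow> real) \<Rightarrow> bool" where
  "reversible K \<pi> \<longleftrightarrow> (\<forall>x y. K x y * \<pi> x = K y x * \<pi> y)"

section \<open>Densities, logarithmic mean and discrete gradients\<close>

definition densities :: "('x \<Rightarrow> real) set" where
  "densities = {\<mu>. \<forall>x. 0 \<le> \<mu> x}"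

definition pos_densities :: "('x \<Rightarrow> real) set" where
  "pos_densities = {\<mu>. \<forall>x. 0 < \<mu> x}"

definition pairing :: "('x::finite \<Rightarrow> real) \<Rightarrow> ('x \<Rightarrow> real) \<Rightarrow> ('x \<Rightarrow> real) \<Rightarrow> real" where
  "pairing \<pi> \<phi> \<psi> = (\<Sum>x\<in>UNIV. \<phi> x * \<psi> x * \<pi> x)"

definition grad :: "('x \<Rightarrow> real) \<Rightarrow> 'x \<Rightarrow> 'x \<Rightarrow> real" where
  "grad \<psi> x y = \<psi> y - \<psi> x"

text \<open>Since \<^term>\<open>(0::real) powr 0 = 0\<close>, the integrand below differs from the usual one in at most
  the two endpoints when an argument vanishes, which does not affect the integral.\<close>

definition log_mean :: "real \<Rightarrow> real \<Rightarrow> real" where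
  "log_mean u v = integral {0..1} (\<lambda>\<xi>. u powr \<xi> * v powr (1 - \<xi>))"

lemma log_mean_same: "0 \<le> u \<Longrightarrow> log_mean u u = u"
  by (cases "u = 0") (simp_all add: log_mean_def flip: powr_add)

lemma log_mean_zero: "log_mean 0 v = 0" "log_mean u 0 = 0"
  by (simp_all add: log_mean_def)

lemma log_mean_neq:
  assumes "0 < u" "0 < v" "u \<noteq> v"
  shows "log_mean u v = (u - v) / (ln u - ln v)"
proof -
  define c where "c = ln u - ln v"
  have c: "c \<noteq> 0"
    using assms by (simp add: c_def)
  have eq: "u powr \<xi> * v powr (1 - \<xi>) = v * exp (c * \<xi>)" for \<xi>
  proof -
    have "u powr \<xi> * v powr (1 - \<xi>) = exp (ln v + c * \<xi>)"
      using assms by (simp add: powr_def c_def algebra_simps flip: exp_add)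
    then show ?thesis
      using assms by (simp add: exp_add)
  qed
  have "((\<lambda>\<xi>. v * exp (c * \<xi>)) has_integral (v * exp (c * 1) / c - v * exp (c * 0) / c)) {0..1}"
    using c by (intro fundamental_theorem_of_calculus)
      (auto intro!: derivative_eq_intros simp flip: has_real_derivative_iff_has_vector_derivative)
  moreover have "v * exp c = u"
    using assms by (simp add: c_def exp_diff)
  ultimately have "((\<lambda>\<xi>. v * exp (c * \<xi>)) has_integral (u - v) / c) {0..1}"
    by (simp add: diff_divide_distrib)
  then show ?thesis
    unfolding log_mean_def eq c_def[symmetric] by (rule integral_unique)
qed

definition mean_density :: "('x \<Rightarrow> real) \<Rightarrow> 'x \<Rightarrow> 'x \<Rightarrow> real" where
  "mean_density \<mu> x y = log_mean (\<mu> x) (\<mu> y)"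

definition norm_sq ::
  "('x::finite \<Rightarrow> 'x \<Rightarrow> real) \<Rightarrow> ('x \<Rightarrow> real) \<Rightarrow> ('x \<Rightarrow> real) \<Rightarrow> ('x \<Rightarrow> 'x \<Rightarrow> real) \<Rightarrow> real" where
  "norm_sq K \<pi> \<mu> \<Phi> =
     1 / 2 * (\<Sum>x\<in>UNIV. \<Sum>y\<in>UNIV. (\<Phi> x y)\<^sup>2 * mean_density \<mu> x y * K x y * \<pi> x)"

section \<open>The transport metric\<close>

text \<open>Absolute continuity on \<open>[c, d]\<close>: the elements \<open>(u, v)\<close> of \<open>D\<close> are the endpoints of finitely
  many non-overlapping subintervals.\<close>

definition abs_continuous_on_interval :: "real \<Rightarrow> real \<Rightarrow> (real \<Rightarrow> real) \<Rightarrow> bool" where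
  "abs_continuous_on_interval c d f \<longleftrightarrow>
     (\<forall>\<epsilon>>0. \<exists>\<delta>>0. \<forall>D. finite D \<longrightarrow>
        (\<forall>(u, v)\<in>D. c \<le> u \<and> u \<le> v \<and> v \<le> d) \<longrightarrow>
        pairwise (\<lambda>(u, v) (u', v'). disjnt {u<..<v} {u'<..<v'}) D \<longrightarrow>
        (\<Sum>(u, v)\<in>D. v - u) < \<delta> \<longrightarrow>
        (\<Sum>(u, v)\<in>D. \<bar>f v - f u\<bar>) < \<epsilon>)"

definition admissible ::
  "('x::finite \<Rightarrow> 'x \<Rightarrow> real) \<Rightarrow> ('x \<Rightarrow> real) \<Rightarrow> ('x \<Rightarrow> real) \<Rightarrow> ('x \<Rightarrow> real) \<Rightarrow>
     ((real \<Rightarrow> 'x \<Rightarrow> real) \<times> (real \<Rightarrow> 'x \<Rightarrow> real) \<times> (real \<Rightarrow> real)) set" where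
  "admissible K p \<mu>\<^sub>0 \<mu>\<^sub>1 = {(\<mu>, \<psi>, h).
     (\<forall>t\<in>{0..1}. \<mu> t \<in> densities) \<and>
     (\<forall>x. abs_continuous_on_interval 0 1 (\<lambda>t. \<mu> t x)) \<and>
     \<mu> 0 = \<mu>\<^sub>0 \<and> \<mu> 1 = \<mu>\<^sub>1 \<and>
     (\<forall>x. (\<lambda>t. \<psi> t x) \<in> borel_measurable (lebesgue_on {0..1})) \<and>
     h \<in> borel_measurable (lebesgue_on {0..1}) \<and>
     (AE t in lebesgue_on {0..1}. \<forall>x. \<exists>d.
        ((\<lambda>s. \<mu> s x) has_real_derivative d) (at t within {0..1}) \<and>
        d + (\<Sum>y\<in>UNIV. (\<psi> t y - \<psi> t x) * mean_density (\<mu> t) x y * K x y) = h t * p x)}"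

definition action ::
  "('x::finite \<Rightarrow> 'x \<Rightarrow> real) \<Rightarrow> ('x \<Rightarrow> real) \<Rightarrow> real \<Rightarrow> real \<Rightarrow>
     (real \<Rightarrow> 'x \<Rightarrow> real) \<Rightarrow> (real \<Rightarrow> 'x \<Rightarrow> real) \<Rightarrow> (real \<Rightarrow> real) \<Rightarrow> ennreal" where
  "action K \<pi> a b \<mu> \<psi> h =
     ennreal (a\<^sup>2) * (\<integral>\<^sup>+t. ennreal ((h t)\<^sup>2) \<partial>lebesgue_on {0..1}) +
     ennreal (b\<^sup>2) * (\<integral>\<^sup>+t. ennreal (norm_sq K \<pi> (\<mu> t) (grad (\<psi> t))) \<partial>lebesgue_on {0..1})"

definition min_action ::
  "('x::finite \<Rightarrow> 'x \<Rightarrow> real) \<Rightarrow> ('x \<Rightarrow> real) \<Rightarrow> real \<Rightarrow> real \<Rightarrow> ('x \<Rightarrow> real) \<Rightarrow>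
     ('x \<Rightarrow> real) \<Rightarrow> ('x \<Rightarrow> real) \<Rightarrow> ennreal" where
  "min_action K \<pi> a b p \<mu>\<^sub>0 \<mu>\<^sub>1 =
     (INF (\<mu>, \<psi>, h)\<in>admissible K p \<mu>\<^sub>0 \<mu>\<^sub>1. action K \<pi> a b \<mu> \<psi> h)"

definition transport_dist ::
  "('x::finite \<Rightarrow> 'x \<Rightarrow> real) \<Rightarrow> ('x \<Rightarrow> real) \<Rightarrow> real \<Rightarrow> real \<Rightarrow> ('x \<Rightarrow> real) \<Rightarrow>
     ('x \<Rightarrow> real) \<Rightarrow> ('x \<Rightarrow> real) \<Rightarrow> ereal" where
  "transport_dist K \<pi> a b p \<mu>\<^sub>0 \<mu>\<^sub>1 =
     (if min_action K \<pi> a b p \<mu>\<^sub>0 \<mu>\<^sub>1 = \<infinity> then \<infinity>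
      else ereal (sqrt (enn2real (min_action K \<pi> a b p \<mu>\<^sub>0 \<mu>\<^sub>1))))"

lemma transport_dist_nonneg: "0 \<le> transport_dist K \<pi> a b p \<mu>\<^sub>0 \<mu>\<^sub>1"
  by (simp add: transport_dist_def)

lemma transport_dist_square:
  "(transport_dist K \<pi> a b p \<mu>\<^sub>0 \<mu>\<^sub>1)\<^sup>2 = enn2ereal (min_action K \<pi> a b p \<mu>\<^sub>0 \<mu>\<^sub>1)"
proof (cases "min_action K \<pi> a b p \<mu>\<^sub>0 \<mu>\<^sub>1")
  case (real r)
  then show ?thesis by (simp add: transport_dist_def)
next
  case top
  then show ?thesis by (simp add: transport_dist_def power2_eq_square)
qed

section \<open>Hamilton--Jacobi subsolutions\<close>

text \<open>The weak derivative on \<open>(0, 1)\<close>, tested against continuously differentiable functions with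
  compact support in \<open>(0, 1)\<close>.\<close>

definition weak_derivative :: "(real \<Rightarrow> real) \<Rightarrow> (real \<Rightarrow> real) \<Rightarrow> bool" where
  "weak_derivative f g \<longleftrightarrow>
     (\<forall>\<eta> \<eta>'. (\<forall>t. (\<eta> has_real_derivative \<eta>' t) (at t)) \<longrightarrow> continuous_on UNIV \<eta>' \<longrightarrow>
        (\<exists>c d. 0 < c \<and> d < 1 \<and> (\<forall>t. t \<notin> {c..d} \<longrightarrow> \<eta> t = 0)) \<longrightarrow>
        (\<integral>t. f t * \<eta>' t \<partial>lebesgue_on {0<..<1}) = - (\<integral>t. g t * \<eta> t \<partial>lebesgue_on {0<..<1}))"

definition square_integrable :: "(real \<Rightarrow> real) \<Rightarrow> bool" where
  "square_integrable f \<longleftrightarrow>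
     f \<in> borel_measurable (lebesgue_on {0<..<1}) \<and>
     integrable (lebesgue_on {0<..<1}) (\<lambda>t. (f t)\<^sup>2)"

text \<open>\<open>H\<^sup>1((0, 1))\<close> with its elements represented by continuous functions on \<open>[0, 1]\<close>; the values
  outside of \<open>[0, 1]\<close> are irrelevant.\<close>

definition H1_with_derivative :: "(real \<Rightarrow> real) \<Rightarrow> (real \<Rightarrow> real) \<Rightarrow> bool" where
  "H1_with_derivative f g \<longleftrightarrow>
     continuous_on {0..1} f \<and> square_integrable f \<and> square_integrable g \<and> weak_derivative f g"

definition C1_with_derivative :: "(real \<Rightarrow> real) \<Rightarrow> (real \<Rightarrow> real) \<Rightarrow> bool" where
  "C1_with_derivative f g \<longleftrightarrow>
     (\<forall>t\<in>{0..1}. (f has_real_derivative g t) (at t within {0..1})) \<and> continuous_on {0..1} g"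

definition HJ_inequality ::
  "('x::finite \<Rightarrow> 'x \<Rightarrow> real) \<Rightarrow> ('x \<Rightarrow> real) \<Rightarrow> real \<Rightarrow>
     (real \<Rightarrow> 'x \<Rightarrow> real) \<Rightarrow> (real \<Rightarrow> 'x \<Rightarrow> real) \<Rightarrow> bool" where
  "HJ_inequality K \<pi> b \<phi> \<phi>' \<longleftrightarrow>
     (AE t in lebesgue_on {0<..<1}. \<forall>\<mu>\<in>densities.
        pairing \<pi> (\<phi>' t) \<mu> + 1 / (2 * b\<^sup>2) * norm_sq K \<pi> \<mu> (grad (\<phi> t)) \<le> 0)"

definition HJ_subsolutions ::
  "('x::finite \<Rightarrow> 'x \<Rightarrow> real) \<Rightarrow> ('x \<Rightarrow> real) \<Rightarrow> real \<Rightarrow> (real \<Rightarrow> 'x \<Rightarrow> real) set" where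
  "HJ_subsolutions K \<pi> b =
     {\<phi>. \<exists>\<phi>'. (\<forall>x. H1_with_derivative (\<lambda>t. \<phi> t x) (\<lambda>t. \<phi>' t x)) \<and> HJ_inequality K \<pi> b \<phi> \<phi>'}"

definition C1_HJ_subsolutions ::
  "('x::finite \<Rightarrow> 'x \<Rightarrow> real) \<Rightarrow> ('x \<Rightarrow> real) \<Rightarrow> real \<Rightarrow> (real \<Rightarrow> 'x \<Rightarrow> real) set" where
  "C1_HJ_subsolutions K \<pi> b =
     {\<phi>. \<exists>\<phi>'. (\<forall>x. C1_with_derivative (\<lambda>t. \<phi> t x) (\<lambda>t. \<phi>' t x)) \<and> HJ_inequality K \<pi> b \<phi> \<phi>'}"

definition dual_functional ::
  "('x::finite \<Rightarrow> real) \<Rightarrow> real \<Rightarrow> ('x \<Rightarrow> real) \<Rightarrow> ('x \<Rightarrow> real) \<Rightarrow> ('x \<Rightarrow> real) \<Rightarrow>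
     (real \<Rightarrow> 'x \<Rightarrow> real) \<Rightarrow> real" where
  "dual_functional \<pi> a p \<mu>\<^sub>0 \<mu>\<^sub>1 \<phi> =
     pairing \<pi> (\<phi> 1) \<mu>\<^sub>1 - pairing \<pi> (\<phi> 0) \<mu>\<^sub>0
     - 1 / (2 * a\<^sup>2) * (\<integral>t. (pairing \<pi> (\<phi> t) p)\<^sup>2 \<partial>lebesgue_on {0..1})"

end

theory Submission
  imports Defs
begin

text \<open>The identity is a minimax theorem for the Lagrangian that pairs a potential \<open>\<phi>\<close> with the
  continuity equation.

  One inequality is integration along curves. If \<open>\<phi>\<close> is a \<open>C\<^sup>1\<close> subsolution and \<open>(\<mu>, \<psi>, h)\<close> is
  admissible, then the derivative of \<open>t \<mapsto> \<langle>\<phi>\<^sub>t, \<mu>\<^sub>t\<rangle>\<close> is bounded, by the Hamilton--Jacobi inequality at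
  \<open>\<mu>\<^sub>t\<close> and Young's inequality, by half the integrand of the action plus \<open>\<langle>\<phi>\<^sub>t, p\<rangle>\<^sup>2 / (2 a\<^sup>2)\<close>
  (\<open>C1_weak_duality\<close>). For a subsolution in \<open>H\<^sup>1\<close> only the inequality integrated over time intervals
  is kept (\<open>HJ_subsolution_integrated\<close>). Since the squared norm is quadratic in \<open>\<phi>\<close>, averaging in
  time preserves it, and the averages, rescaled so that their windows stay in the unit interval, are
  \<open>C\<^sup>1\<close> subsolutions whose dual values converge. Hence all classes of subsolutions have the same
  supremum (\<open>dual_functional_le_of_C1\<close>).

  For the other inequality time is divided into \<open>N\<close> steps. The squared norm is concave in the
  density, because the logarithmic mean is homogeneous and superadditive; after adding a small
  quadratic penalty and confining the densities to a box, the discrete Lagrangian is strictly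
  convex in the density. A potential \<open>\<phi>\<close> maximizing the minimum over the densities is then
  stationary at the minimizing density (\<open>saddle_point\<close>). Therefore the density solves a discrete
  continuity equation with action bounded by the discrete dual value, and \<open>\<phi>\<close> satisfies the
  Hamilton--Jacobi inequality up to \<open>1 / N\<^sup>2\<close> per unit of mass (\<open>discrete_duality\<close>). The a priori
  bounds behind this hold because the minimum is not negative: they are read off from the value at
  explicit competitors, with the help of a Poincare inequality (\<open>lagrangian_test\<close>).

  Both halves of the saddle point return to continuous time with errors that can be made
  arbitrarily small. The total variation of \<open>\<phi>\<close> is bounded independently of \<open>N\<close>, so its piecewise
  linear interpolation, lowered slightly and scaled by a factor close to one, is a subsolution
  (\<open>discrete_subsolution_value\<close>). The discrete densities, mixed with a little of \<open>p\<close> to keep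
  them away from zero, are joined by segments whose potentials solve a linear equation
  (\<open>connects_segment\<close>, \<open>connects_discrete\<close>), and two short arcs of small cost lead from the given
  endpoints to the mixed ones (\<open>connects_to_reference\<close>). The mixing does not raise the
  supremum of the dual values (\<open>dual_functional_shifted\<close>), so the action is at most twice the supremum over the \<open>C\<^sup>1\<close>
  subsolutions.\<close>

section \<open>The logarithmic mean\<close>

lemma powr_mean_le:
  fixes u v \<xi> :: real
  assumes "0 \<le> u" "0 \<le> v" "\<xi> \<in> {0..1}"
  shows "u powr \<xi> * v powr (1 - \<xi>) \<le> \<xi> * u + (1 - \<xi>) * v"
proof (cases "u = 0 \<or> v = 0")
  case True
  then show ?thesis using assms by auto
next
  case False
  then have pos: "0 < u" "0 < v" using assms by auto
  have "exp ((1 - \<xi>) *\<^sub>R ln v + \<xi> *\<^sub>R ln u) \<le> (1 - \<xi>) * exp (ln v) + \<xi> * exp (ln u)"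
    using assms by (intro convex_onD[OF exp_convex]) auto
  then show ?thesis
    using pos by (simp add: powr_def exp_add mult.commute add.commute)
qed

lemma log_mean_integrable:
  fixes u v :: real
  assumes "0 \<le> u" "0 \<le> v"
  shows "(\<lambda>\<xi>. u powr \<xi> * v powr (1 - \<xi>)) integrable_on {0..1}"
proof (cases "u = 0 \<or> v = 0")
  case True
  then have "(\<lambda>\<xi>. u powr \<xi> * v powr (1 - \<xi>)) = (\<lambda>\<xi>. 0)" by auto
  then show ?thesis by (metis integrable_0)
next
  case False
  then show ?thesis
    using assms by (auto intro!: integrable_continuous_interval continuous_intros)
qed

lemma log_mean_nonneg: "0 \<le> log_mean u v"
  unfolding log_mean_def
  by (cases "(\<lambda>\<xi>. u powr \<xi> * v powr (1 - \<xi>)) integrable_on {0..1}")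
    (auto intro: integral_nonneg simp: not_integrable_integral)

lemma log_mean_le_add:
  assumes "0 \<le> u" "0 \<le> v"
  shows "log_mean u v \<le> u + v"
proof -
  have "log_mean u v \<le> integral {0..1::real} (\<lambda>\<xi>. u + v)"
    unfolding log_mean_def
  proof (rule integral_le[OF log_mean_integrable[OF assms]])
    fix \<xi> :: real assume xi: "\<xi> \<in> {0..1}"
    have "\<xi> * u \<le> 1 * u" "(1 - \<xi>) * v \<le> 1 * v"
      using xi assms by (intro mult_right_mono; simp)+
    then show "u powr \<xi> * v powr (1 - \<xi>) \<le> u + v"
      using powr_mean_le[OF assms xi] by simp
  qed auto
  then show ?thesis by simp
qed

lemma log_mean_mono:
  assumes "0 \<le> u" "u \<le> u'" "0 \<le> v" "v \<le> v'"
  shows "log_mean u v \<le> log_mean u' v'"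
  unfolding log_mean_def
  using assms
  by (intro integral_le log_mean_integrable mult_mono powr_mono2) auto

lemma log_mean_scale:
  assumes "0 \<le> c"  "0 \<le> u" "0 \<le> v"
  shows "log_mean (c * u) (c * v) = c * log_mean u v"
proof (cases "c = 0")
  case False
  have "(c * u) powr \<xi> * (c * v) powr (1 - \<xi>) = c * (u powr \<xi> * v powr (1 - \<xi>))" for \<xi>
  proof -
    have "c powr \<xi> * c powr (1 - \<xi>) = c"
      using False assms by (simp flip: powr_add)
    then show ?thesis
      using assms by (simp add: powr_mult mult_ac)
  qed
  then show ?thesis
    by (simp add: log_mean_def)
qed (simp add: log_mean_zero)

lemma log_mean_sym: "0 \<le> u \<Longrightarrow> 0 \<le> v \<Longrightarrow> log_mean u v = log_mean v u"
  by (cases "u = 0 \<or> v = 0"; cases "u = v")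
    (auto simp: log_mean_zero log_mean_neq field_simps)

lemma log_mean_ge:
  assumes "0 \<le> c" "c \<le> u" "c \<le> v"
  shows "c \<le> log_mean u v"
  using log_mean_mono[of c u c v] assms by (simp add: log_mean_same)

lemma log_mean_pos: "0 < u \<Longrightarrow> 0 < v \<Longrightarrow> 0 < log_mean u v"
  using log_mean_ge[of "min u v" u v] by simp

text \<open>The two-term Hoelder inequality under the integral. With homogeneity it makes the squared norm
  concave in the density.\<close>

lemma log_mean_superadditive:
  assumes "0 \<le> u" "0 \<le> v" "0 \<le> u'" "0 \<le> v'"
  shows "log_mean u v + log_mean u' v' \<le> log_mean (u + u') (v + v')"
proof (cases "u + u' = 0 \<or> v + v' = 0")
  case True
  then have "u = 0 \<and> u' = 0 \<or> v = 0 \<and> v' = 0"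
    using assms by linarith
  then show ?thesis
    by (auto simp: log_mean_zero)
next
  case False
  define U V where "U = u + u'" and "V = v + v'"
  have UV: "0 < U" "0 < V"
    using False assms by (auto simp: U_def V_def)
  have "u powr \<xi> * v powr (1 - \<xi>) + u' powr \<xi> * v' powr (1 - \<xi>) \<le> U powr \<xi> * V powr (1 - \<xi>)"
    if xi: "\<xi> \<in> {0..1}" for \<xi> :: real
  proof -
    let ?W = "U powr \<xi> * V powr (1 - \<xi>)"
    have summand: "x powr \<xi> * y powr (1 - \<xi>) \<le> ?W * (\<xi> * (x / U) + (1 - \<xi>) * (y / V))"
      if "0 \<le> x" "0 \<le> y" for x y
    proof -
      have "x powr \<xi> * y powr (1 - \<xi>) = ?W * ((x / U) powr \<xi> * (y / V) powr (1 - \<xi>))"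
        using that UV by (simp add: powr_divide)
      also have "\<dots> \<le> ?W * (\<xi> * (x / U) + (1 - \<xi>) * (y / V))"
        using that UV xi by (intro mult_left_mono powr_mean_le) auto
      finally show ?thesis .
    qed
    have "\<xi> * (u / U) + (1 - \<xi>) * (v / V) + (\<xi> * (u' / U) + (1 - \<xi>) * (v' / V))
        = \<xi> * ((u + u') / U) + (1 - \<xi>) * ((v + v') / V)"
      by (simp add: add_divide_distrib algebra_simps)
    also have "\<dots> = 1"
      using UV by (simp add: U_def[symmetric] V_def[symmetric])
    finally have "?W * (\<xi> * (u / U) + (1 - \<xi>) * (v / V)) + ?W * (\<xi> * (u' / U) + (1 - \<xi>) * (v' / V)) = ?W"
      by (metis distrib_left mult.right_neutral)
    then show ?thesis
      using summand[OF assms(1,2)] summand[OF assms(3,4)] by linarith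
  qed
  then have "integral {0..1} (\<lambda>\<xi>. u powr \<xi> * v powr (1 - \<xi>) + u' powr \<xi> * v' powr (1 - \<xi>))
      \<le> integral {0..1} (\<lambda>\<xi>. U powr \<xi> * V powr (1 - \<xi>))"
    using UV assms by (intro integral_le integrable_add log_mean_integrable) auto
  then show ?thesis
    using assms by (simp add: log_mean_def U_def V_def log_mean_integrable Henstock_Kurzweil_Integration.integral_add)
qed

text \<open>Dominated convergence handles the boundary of the quadrant, where the closed formula
  degenerates.\<close>

lemma continuous_on_log_mean:
  "continuous_on ({0..} \<times> {0..}) (\<lambda>(u, v). log_mean u v)"
proof (rule continuous_on_sequentiallyI)
  fix w :: "nat \<Rightarrow> real \<times> real" and l
  assume w: "\<forall>n. w n \<in> {0..} \<times> {0..}" and l: "l \<in> {0..} \<times> {0..}" and lim: "w \<longlonglongrightarrow> l"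
  define u v where "u n = fst (w n)" and "v n = snd (w n)" for n
  obtain x y where xy: "l = (x, y)" by fastforce
  have nn: "0 \<le> u n" "0 \<le> v n" "0 \<le> x" "0 \<le> y" for n
    using w l by (auto simp: u_def v_def xy mem_Times_iff)
  have ux: "u \<longlonglongrightarrow> x" and vy: "v \<longlonglongrightarrow> y"
    using tendsto_fst[OF lim] tendsto_snd[OF lim] by (simp_all add: u_def[abs_def] v_def[abs_def] xy)
  obtain B where B: "\<And>n. u n + v n \<le> B"
  proof -
    have "Bseq (\<lambda>n. u n + v n)"
      using tendsto_add[OF ux vy] by (intro convergent_imp_Bseq) (auto simp: convergent_def)
    then show ?thesis
      by (metis BseqD abs_le_D1 real_norm_def that)
  qed
  have "(\<lambda>n. integral {0<..<1} (\<lambda>\<xi>. u n powr \<xi> * v n powr (1 - \<xi>)))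
      \<longlonglongrightarrow> integral {0<..<1} (\<lambda>\<xi>. x powr \<xi> * y powr (1 - \<xi>))"
  proof (rule dominated_convergence(2))
    show "(\<lambda>\<xi>. u n powr \<xi> * v n powr (1 - \<xi>)) integrable_on {0<..<1}" for n
      using log_mean_integrable[OF nn(1,2)] by (simp add: integrable_on_Icc_iff_Ioo)
    show "(\<lambda>\<xi>. B) integrable_on {0<..<1::real}"
      by (simp add: integrable_const_ivl flip: integrable_on_Icc_iff_Ioo)
    show "norm (u n powr \<xi> * v n powr (1 - \<xi>)) \<le> B" if "\<xi> \<in> {0<..<1}" for n \<xi>
    proof -
      have "\<xi> * u n \<le> 1 * u n" "(1 - \<xi>) * v n \<le> 1 * v n"
        using that nn by (intro mult_right_mono; simp)+
      then show ?thesis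
        using powr_mean_le[OF nn(1,2), of \<xi> n n] that B[of n] by simp
    qed
    show "(\<lambda>n. u n powr \<xi> * v n powr (1 - \<xi>)) \<longlonglongrightarrow> x powr \<xi> * y powr (1 - \<xi>)"
      if "\<xi> \<in> {0<..<1}" for \<xi>
      using that nn ux vy by (intro tendsto_mult tendsto_powr') auto
  qed
  then have "(\<lambda>n. log_mean (u n) (v n)) \<longlonglongrightarrow> log_mean x y"
    by (simp add: log_mean_def integral_open_interval_real)
  then show "(\<lambda>n. case w n of (u, v) \<Rightarrow> log_mean u v) \<longlonglongrightarrow> (case l of (u, v) \<Rightarrow> log_mean u v)"
    by (simp add: u_def v_def xy case_prod_beta)
qed

lemma continuous_on_log_mean_compose [continuous_intros]:
  assumes "continuous_on S f" "continuous_on S g"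
    and "\<And>s. s \<in> S \<Longrightarrow> 0 \<le> f s" "\<And>s. s \<in> S \<Longrightarrow> 0 \<le> g s"
  shows "continuous_on S (\<lambda>s. log_mean (f s) (g s))"
  using continuous_on_compose2[OF continuous_on_log_mean continuous_on_Pair[OF assms(1,2)]] assms(3,4)
  by auto

section \<open>Discrete calculus for a reversible kernel\<close>

text \<open>The bilinear form that polarizes the squared norm of gradients.\<close>

definition energy ::
  "('x::finite \<Rightarrow> 'x \<Rightarrow> real) \<Rightarrow> ('x \<Rightarrow> real) \<Rightarrow> ('x \<Rightarrow> real) \<Rightarrow> ('x \<Rightarrow> real) \<Rightarrow> ('x \<Rightarrow> real) \<Rightarrow> real" where
  "energy K \<pi> w \<phi> \<psi> =
     1 / 2 * (\<Sum>x\<in>UNIV. \<Sum>y\<in>UNIV. grad \<phi> x y * grad \<psi> x y * mean_density w x y * K x y * \<pi> x)"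

definition divergence ::
  "('x::finite \<Rightarrow> 'x \<Rightarrow> real) \<Rightarrow> ('x \<Rightarrow> real) \<Rightarrow> ('x \<Rightarrow> real) \<Rightarrow> 'x \<Rightarrow> real" where
  "divergence K w \<psi> x = (\<Sum>y\<in>UNIV. (\<psi> y - \<psi> x) * mean_density w x y * K x y)"

locale reversible_chain =
  fixes K :: "'x::finite \<Rightarrow> 'x \<Rightarrow> real" and \<pi> :: "'x \<Rightarrow> real"
  assumes markov: "markov_kernel K" and irreducible: "irreducible_kernel K"
    and invariant: "invariant_probability K \<pi>" and reversible: "reversible K \<pi>"
begin

lemma K_nonneg: "0 \<le> K x y" and K_sum: "(\<Sum>y\<in>UNIV. K x y) = 1"
  using markov by (auto simp: markov_kernel_def)

lemma pi_nonneg: "0 \<le> \<pi> x" and pi_sum: "(\<Sum>x\<in>UNIV. \<pi> x) = 1"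
  and pi_invariant: "(\<Sum>y\<in>UNIV. \<pi> y * K y x) = \<pi> x"
  using invariant unfolding invariant_probability_def by metis+

lemma detailed_balance: "K x y * \<pi> x = K y x * \<pi> y"
  using reversible by (auto simp: reversible_def)

lemma invariant_kernel_power: "\<pi> x = (\<Sum>y\<in>UNIV. \<pi> y * kernel_power K n y x)"
proof (induction n)
  case 0
  then show ?case by (simp add: if_distrib cong: if_cong)
next
  case (Suc n)
  have "(\<Sum>y\<in>UNIV. \<pi> y * kernel_power K (Suc n) y x)
      = (\<Sum>z\<in>UNIV. \<Sum>y\<in>UNIV. \<pi> y * K y z * kernel_power K n z x)"
    by (subst sum.swap) (simp add: sum_distrib_left mult.assoc)
  also have "\<dots> = (\<Sum>z\<in>UNIV. \<pi> z * kernel_power K n z x)"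
    by (simp add: pi_invariant flip: sum_distrib_right)
  finally show ?case using Suc by simp
qed

lemma kernel_power_nonneg: "0 \<le> kernel_power K n x y"
  by (induction n arbitrary: x) (auto intro!: sum_nonneg mult_nonneg_nonneg K_nonneg)

lemma pi_pos: "0 < \<pi> x"
proof -
  have "\<exists>y. 0 < \<pi> y"
  proof (rule ccontr)
    assume "\<nexists>y. 0 < \<pi> y"
    then have "\<pi> y = 0" for y using pi_nonneg[of y] by (metis less_eq_real_def)
    then show False using pi_sum by simp
  qed
  then obtain y where y: "0 < \<pi> y" by blast
  obtain n where n: "0 < kernel_power K n y x"
    using irreducible by (auto simp: irreducible_kernel_def)
  have "0 < \<pi> y * kernel_power K n y x" using y n by simp
  also have "\<dots> \<le> (\<Sum>y\<in>UNIV. \<pi> y * kernel_power K n y x)"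
    by (rule member_le_sum) (auto intro: mult_nonneg_nonneg pi_nonneg kernel_power_nonneg)
  finally show ?thesis by (simp flip: invariant_kernel_power)
qed

lemma inverse_pi_bounded: "\<exists>D\<ge>0. \<forall>x. 1 / \<pi> x \<le> D"
  using pi_nonneg by (intro exI[of _ "\<Sum>x\<in>UNIV. 1 / \<pi> x"])
    (auto intro!: sum_nonneg member_le_sum[of _ UNIV "\<lambda>x. 1 / \<pi> x"])

lemma flat_imp_constant:
  assumes flat: "\<And>x y. 0 < K x y \<Longrightarrow> \<psi> x = \<psi> y"
  shows "\<psi> x = \<psi> y"
proof -
  have "0 < kernel_power K n x y \<Longrightarrow> \<psi> x = \<psi> y" for n x
  proof (induction n arbitrary: x)
    case 0
    then show ?case by (auto split: if_splits)
  next
    case (Suc n)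
    have "\<exists>z. 0 < K x z * kernel_power K n z y"
    proof (rule ccontr)
      assume "\<nexists>z. 0 < K x z * kernel_power K n z y"
      then have "kernel_power K (Suc n) x y \<le> 0"
        by (auto intro!: sum_nonpos simp: not_less)
      then show False using Suc.prems by simp
    qed
    then obtain z where "0 < K x z * kernel_power K n z y" by blast
    then have "0 < K x z" "0 < kernel_power K n z y"
      using K_nonneg[of x z] kernel_power_nonneg[of n z y] by (auto simp: zero_less_mult_iff)
    then show ?case using flat Suc.IH by metis
  qed
  then show ?thesis
    using irreducible unfolding irreducible_kernel_def by blast
qed

lemma mean_density_nonneg: "0 \<le> mean_density w x y"
  by (simp add: mean_density_def log_mean_nonneg)

lemma energy_term_nonneg: "0 \<le> grad \<phi> x y * grad \<phi> x y * mean_density w x y * K x y * \<pi> x"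
  by (intro mult_nonneg_nonneg[OF _ pi_nonneg] mult_nonneg_nonneg[OF _ K_nonneg]
      mult_nonneg_nonneg[OF _ mean_density_nonneg] zero_le_square)

lemma norm_sq_grad: "norm_sq K \<pi> w (grad \<phi>) = energy K \<pi> w \<phi> \<phi>"
  by (simp add: norm_sq_def energy_def power2_eq_square)

lemma energy_nonneg: "0 \<le> energy K \<pi> w \<phi> \<phi>"
  unfolding energy_def by (simp add: sum_nonneg energy_term_nonneg)

lemma energy_sym: "energy K \<pi> w \<phi> \<psi> = energy K \<pi> w \<psi> \<phi>"
  by (simp add: energy_def mult.commute)

lemma energy_add_left: "energy K \<pi> w (\<lambda>x. \<phi> x + \<phi>' x) \<psi> = energy K \<pi> w \<phi> \<psi> + energy K \<pi> w \<phi>' \<psi>"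
  unfolding energy_def distrib_left[symmetric] sum.distrib[symmetric] grad_def
  by (intro arg_cong[where f = "(*) (1 / 2)"] sum.cong refl) (simp add: algebra_simps)

lemma energy_scale_left: "energy K \<pi> w (\<lambda>x. c * \<phi> x) \<psi> = c * energy K \<pi> w \<phi> \<psi>"
  unfolding energy_def grad_def sum_distrib_left
  by (intro sum.cong refl) (simp add: algebra_simps)

lemma energy_add_right: "energy K \<pi> w \<psi> (\<lambda>x. \<phi> x + \<phi>' x) = energy K \<pi> w \<psi> \<phi> + energy K \<pi> w \<psi> \<phi>'"
  using energy_add_left energy_sym by metis

lemma energy_scale_right: "energy K \<pi> w \<psi> (\<lambda>x. c * \<phi> x) = c * energy K \<pi> w \<psi> \<phi>"
  using energy_scale_left energy_sym by metis

lemma energy_shift: "energy K \<pi> w (\<lambda>x. \<phi> x - c) (\<lambda>x. \<phi> x - c) = energy K \<pi> w \<phi> \<phi>"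
  by (simp add: energy_def grad_def)

lemma energy_perturb:
  "energy K \<pi> w (\<lambda>x. \<phi> x + s * \<xi> x) (\<lambda>x. \<phi> x + s * \<xi> x)
     = energy K \<pi> w \<phi> \<phi> + s * (2 * energy K \<pi> w \<phi> \<xi>) + s\<^sup>2 * energy K \<pi> w \<xi> \<xi>"
  by (simp add: energy_add_left energy_add_right energy_scale_left energy_scale_right
      energy_sym[of w \<xi> \<phi>] power2_eq_square algebra_simps)

lemma energy_Young:
  assumes "0 < c"
  shows "energy K \<pi> w \<phi> \<psi> \<le> c / 2 * energy K \<pi> w \<psi> \<psi> + 1 / (2 * c) * energy K \<pi> w \<phi> \<phi>"
proof -
  have "0 \<le> energy K \<pi> w (\<lambda>x. \<phi> x + (- c) * \<psi> x) (\<lambda>x. \<phi> x + (- c) * \<psi> x) / (2 * c)"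
    using energy_nonneg assms by simp
  also have "\<dots> = c / 2 * energy K \<pi> w \<psi> \<psi> + 1 / (2 * c) * energy K \<pi> w \<phi> \<phi> - energy K \<pi> w \<phi> \<psi>"
    unfolding energy_perturb using assms by (simp add: field_simps power2_eq_square)
  finally show ?thesis by simp
qed

lemma energy_sum_le:
  assumes "0 < c"
  shows "energy K \<pi> w (\<lambda>x. \<phi> x + s * \<xi> x) (\<lambda>x. \<phi> x + s * \<xi> x)
     \<le> (1 + c) * energy K \<pi> w \<phi> \<phi> + (1 + 1 / c) * (s\<^sup>2 * energy K \<pi> w \<xi> \<xi>)"
proof -
  have "energy K \<pi> w \<phi> (\<lambda>x. s * \<xi> x)
      \<le> (1 / c) / 2 * energy K \<pi> w (\<lambda>x. s * \<xi> x) (\<lambda>x. s * \<xi> x) + 1 / (2 * (1 / c)) * energy K \<pi> w \<phi> \<phi>"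
    using assms by (intro energy_Young) simp
  then have "2 * (s * energy K \<pi> w \<phi> \<xi>) \<le> (1 / c) * (s\<^sup>2 * energy K \<pi> w \<xi> \<xi>) + c * energy K \<pi> w \<phi> \<phi>"
    using assms by (simp add: energy_scale_left energy_scale_right power2_eq_square field_simps)
  then show ?thesis
    unfolding energy_perturb by (simp add: algebra_simps)
qed

lemma energy_Cauchy_Schwarz:
  "(energy K \<pi> w \<phi> \<psi>)\<^sup>2 \<le> energy K \<pi> w \<phi> \<phi> * energy K \<pi> w \<psi> \<psi>"
proof (cases "energy K \<pi> w \<psi> \<psi> = 0")
  case False
  let ?e = "energy K \<pi> w"
  have pos: "0 < ?e \<psi> \<psi>" using False energy_nonneg[of w \<psi>] by simp
  define s where "s = - ?e \<phi> \<psi> / ?e \<psi> \<psi>"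
  have "0 \<le> ?e \<psi> \<psi> * (?e \<phi> \<phi> + s * (2 * ?e \<phi> \<psi>) + s\<^sup>2 * ?e \<psi> \<psi>)"
    using energy_nonneg[of w "\<lambda>x. \<phi> x + s * \<psi> x"] pos unfolding energy_perturb by simp
  also have "\<dots> = ?e \<phi> \<phi> * ?e \<psi> \<psi> - (?e \<phi> \<psi>)\<^sup>2"
    using pos by (simp add: s_def field_simps power2_eq_square)
  finally show ?thesis by simp
next
  case True
  let ?e = "energy K \<pi> w"
  have "?e \<phi> \<psi> = 0"
  proof (rule ccontr)
    assume ne: "?e \<phi> \<psi> \<noteq> 0"
    define s where "s = - (?e \<phi> \<phi> + 1) / (2 * ?e \<phi> \<psi>)"
    have "0 \<le> ?e \<phi> \<phi> + s * (2 * ?e \<phi> \<psi>) + s\<^sup>2 * ?e \<psi> \<psi>"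
      using energy_nonneg[of w "\<lambda>x. \<phi> x + s * \<psi> x"] unfolding energy_perturb .
    also have "\<dots> = -1" using ne True by (simp add: s_def field_simps)
    finally show False by simp
  qed
  then show ?thesis using True by simp
qed

lemma energy_mono_density:
  assumes "\<And>x y. mean_density w x y \<le> mean_density w' x y"
  shows "energy K \<pi> w \<phi> \<phi> \<le> energy K \<pi> w' \<phi> \<phi>"
  unfolding energy_def
  by (intro mult_left_mono sum_mono mult_right_mono) (auto simp: assms K_nonneg pi_nonneg)

lemma energy_scale_density:
  assumes "0 \<le> c" "w \<in> densities"
  shows "energy K \<pi> (\<lambda>x. c * w x) \<phi> \<psi> = c * energy K \<pi> w \<phi> \<psi>"
  using assms by (simp add: energy_def mean_density_def log_mean_scale densities_def sum_distrib_left mult_ac)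

lemma energy_superadditive:
  assumes "w \<in> densities" "w' \<in> densities"
  shows "energy K \<pi> w \<phi> \<phi> + energy K \<pi> w' \<phi> \<phi> \<le> energy K \<pi> (\<lambda>x. w x + w' x) \<phi> \<phi>"
proof -
  have "energy K \<pi> w \<phi> \<phi> + energy K \<pi> w' \<phi> \<phi> = 1 / 2 * (\<Sum>x\<in>UNIV. \<Sum>y\<in>UNIV.
      grad \<phi> x y * grad \<phi> x y * (mean_density w x y + mean_density w' x y) * K x y * \<pi> x)"
    unfolding energy_def distrib_left[symmetric] sum.distrib[symmetric]
    by (intro arg_cong[where f = "(*) (1 / 2)"] sum.cong refl) (simp add: algebra_simps)
  also have "\<dots> \<le> energy K \<pi> (\<lambda>x. w x + w' x) \<phi> \<phi>"
    unfolding energy_def mean_density_def using assms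
    by (intro mult_left_mono sum_mono mult_right_mono log_mean_superadditive)
      (auto simp: K_nonneg pi_nonneg densities_def)
  finally show ?thesis .
qed

lemma sum_edges_left: "(\<Sum>x\<in>UNIV. \<Sum>y\<in>UNIV. f x * K x y * \<pi> x) = pairing \<pi> (\<lambda>_. 1) f"
  by (simp add: pairing_def K_sum flip: sum_distrib_left sum_distrib_right)

lemma sum_edges_right: "(\<Sum>x\<in>UNIV. \<Sum>y\<in>UNIV. f y * K x y * \<pi> x) = pairing \<pi> (\<lambda>_. 1) f"
proof -
  have "(\<Sum>x\<in>UNIV. \<Sum>y\<in>UNIV. f y * K x y * \<pi> x) = (\<Sum>x\<in>UNIV. \<Sum>y\<in>UNIV. f y * K y x * \<pi> y)"
    unfolding mult.assoc by (intro sum.cong refl arg_cong2[where f = "(*)"] detailed_balance)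
  also have "\<dots> = (\<Sum>y\<in>UNIV. \<Sum>x\<in>UNIV. f y * K y x * \<pi> y)" by (rule sum.swap)
  finally show ?thesis by (simp add: sum_edges_left)
qed

text \<open>A gradient is at most twice the supremum norm, the mean of two densities is at most their sum,
  and by reversibility both endpoints of an edge carry the same total weight.\<close>

lemma energy_le_sup_norm:
  assumes w: "w \<in> densities" and r: "\<And>x. \<bar>\<phi> x\<bar> \<le> r"
  shows "energy K \<pi> w \<phi> \<phi> \<le> 4 * r\<^sup>2 * pairing \<pi> (\<lambda>_. 1) w"
proof -
  have "energy K \<pi> w \<phi> \<phi> \<le> 1 / 2 * (\<Sum>x\<in>UNIV. \<Sum>y\<in>UNIV. (2 * r)\<^sup>2 * (w x + w y) * K x y * \<pi> x)"
    unfolding energy_def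
  proof (intro mult_left_mono sum_mono mult_right_mono mult_mono)
    fix x y
    have "\<bar>grad \<phi> x y\<bar> \<le> 2 * r"
      using r[of x] r[of y] by (simp add: grad_def)
    then have "(grad \<phi> x y)\<^sup>2 \<le> (2 * r)\<^sup>2"
      by (metis abs_ge_zero power2_abs power_mono)
    then show "grad \<phi> x y * grad \<phi> x y \<le> (2 * r)\<^sup>2"
      by (simp add: power2_eq_square)
    show "mean_density w x y \<le> w x + w y"
      using w by (simp add: mean_density_def log_mean_le_add densities_def)
  qed (auto simp: K_nonneg pi_nonneg mean_density_nonneg)
  also have "(\<Sum>x\<in>UNIV. \<Sum>y\<in>UNIV. (2 * r)\<^sup>2 * (w x + w y) * K x y * \<pi> x)
      = (2 * r)\<^sup>2 * ((\<Sum>x\<in>UNIV. \<Sum>y\<in>UNIV. w x * K x y * \<pi> x) + (\<Sum>x\<in>UNIV. \<Sum>y\<in>UNIV. w y * K x y * \<pi> x))"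
    by (simp add: sum_distrib_left distrib_left distrib_right sum.distrib mult_ac)
  finally show ?thesis
    unfolding sum_edges_left sum_edges_right by (simp add: power_mult_distrib algebra_simps)
qed

text \<open>Summation by parts: reversibility and the symmetry of the mean make the edge weights
  symmetric.\<close>

lemma pairing_divergence:
  assumes w: "w \<in> densities"
  shows "pairing \<pi> \<phi> (divergence K w \<psi>) = - energy K \<pi> w \<phi> \<psi>"
proof -
  define c where "c x y = mean_density w x y * K x y * \<pi> x" for x y
  have c_sym: "c x y = c y x" for x y
    using detailed_balance[of x y] log_mean_sym[of "w x" "w y"] w
    by (simp add: c_def mean_density_def densities_def)
  have 1: "pairing \<pi> \<phi> (divergence K w \<psi>) = (\<Sum>x\<in>UNIV. \<Sum>y\<in>UNIV. \<phi> x * grad \<psi> x y * c x y)"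
    by (simp add: pairing_def divergence_def sum_distrib_left sum_distrib_right c_def grad_def mult_ac)
  also have "\<dots> = (\<Sum>y\<in>UNIV. \<Sum>x\<in>UNIV. \<phi> x * grad \<psi> x y * c x y)" by (rule sum.swap)
  also have "\<dots> = (\<Sum>x\<in>UNIV. \<Sum>y\<in>UNIV. - (\<phi> y * grad \<psi> x y * c x y))"
  proof (intro sum.cong refl)
    fix x y
    show "\<phi> y * grad \<psi> y x * c y x = - (\<phi> y * grad \<psi> x y * c x y)"
      unfolding c_sym[of y x] by (simp add: grad_def algebra_simps)
  qed
  also have "\<dots> = - (\<Sum>x\<in>UNIV. \<Sum>y\<in>UNIV. \<phi> y * grad \<psi> x y * c x y)"
    by (simp add: sum_negf)
  finally have 2: "pairing \<pi> \<phi> (divergence K w \<psi>) = - (\<Sum>x\<in>UNIV. \<Sum>y\<in>UNIV. \<phi> y * grad \<psi> x y * c x y)" .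
  have "energy K \<pi> w \<phi> \<psi> = 1 / 2 * ((\<Sum>x\<in>UNIV. \<Sum>y\<in>UNIV. \<phi> y * grad \<psi> x y * c x y)
      - (\<Sum>x\<in>UNIV. \<Sum>y\<in>UNIV. \<phi> x * grad \<psi> x y * c x y))"
    unfolding energy_def sum_subtractf[symmetric] c_def grad_def
    by (intro arg_cong[where f = "(*) (1 / 2)"] sum.cong refl) (simp add: algebra_simps)
  then show ?thesis using 1 2 by simp
qed

lemma pairing_one_divergence: "w \<in> densities \<Longrightarrow> pairing \<pi> (\<lambda>_. 1) (divergence K w \<psi>) = 0"
  by (simp add: pairing_divergence energy_def grad_def)

lemma energy_eq_0_imp_constant:
  assumes w: "w \<in> pos_densities" and 0: "energy K \<pi> w \<phi> \<phi> = 0"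
  shows "\<phi> x = \<phi> y"
proof (rule flat_imp_constant)
  fix x y assume K: "0 < K x y"
  let ?t = "\<lambda>x y. grad \<phi> x y * grad \<phi> x y * mean_density w x y * K x y * \<pi> x"
  have nn: "0 \<le> ?t x y" for x y
    by (rule energy_term_nonneg)
  have "(\<Sum>x\<in>UNIV. \<Sum>y\<in>UNIV. ?t x y) = 0"
    using 0 by (simp add: energy_def)
  then have "(\<Sum>y\<in>UNIV. ?t x y) = 0" for x
    using nn by (subst (asm) sum_nonneg_eq_0_iff) (auto intro: sum_nonneg)
  then have "?t x y = 0"
    using nn by (subst (asm) sum_nonneg_eq_0_iff) auto
  moreover have "0 < mean_density w x y"
    using w by (simp add: mean_density_def pos_densities_def log_mean_pos)
  ultimately show "\<phi> x = \<phi> y"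
    using K pi_pos[of x] by (simp add: grad_def)
qed

lemma pairing_add_left: "pairing \<pi> (\<lambda>x. \<phi> x + \<phi>' x) \<psi> = pairing \<pi> \<phi> \<psi> + pairing \<pi> \<phi>' \<psi>"
  by (simp add: pairing_def algebra_simps sum.distrib)

lemma pairing_diff_left: "pairing \<pi> (\<lambda>x. \<phi> x - \<phi>' x) \<psi> = pairing \<pi> \<phi> \<psi> - pairing \<pi> \<phi>' \<psi>"
  by (simp add: pairing_def algebra_simps sum_subtractf)

lemma pairing_scale_left: "pairing \<pi> (\<lambda>x. c * \<phi> x) \<psi> = c * pairing \<pi> \<phi> \<psi>"
  by (simp add: pairing_def sum_distrib_left mult_ac)

lemma pairing_add_right: "pairing \<pi> \<psi> (\<lambda>x. \<phi> x + \<phi>' x) = pairing \<pi> \<psi> \<phi> + pairing \<pi> \<psi> \<phi>'"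
  by (simp add: pairing_def algebra_simps sum.distrib)

lemma pairing_diff_right: "pairing \<pi> \<psi> (\<lambda>x. \<phi> x - \<phi>' x) = pairing \<pi> \<psi> \<phi> - pairing \<pi> \<psi> \<phi>'"
  by (simp add: pairing_def algebra_simps sum_subtractf)

lemma pairing_scale_right: "pairing \<pi> \<psi> (\<lambda>x. c * \<phi> x) = c * pairing \<pi> \<psi> \<phi>"
  by (simp add: pairing_def sum_distrib_left mult_ac)

lemmas pairing_linear = pairing_add_left pairing_diff_left pairing_scale_left
  pairing_add_right pairing_diff_right pairing_scale_right

lemma pairing_const_left: "pairing \<pi> (\<lambda>x. c) \<psi> = c * pairing \<pi> (\<lambda>_. 1) \<psi>"
  using pairing_scale_left[of c "\<lambda>_. 1"] by simp

lemma pairing_one_nonneg: "w \<in> densities \<Longrightarrow> 0 \<le> pairing \<pi> (\<lambda>_. 1) w"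
  by (auto simp: pairing_def densities_def intro!: sum_nonneg mult_nonneg_nonneg pi_nonneg)

subsection \<open>Poincare inequality\<close>

text \<open>The form on the right vanishes only at zero: zero energy forces \<open>\<phi>\<close> to be constant by
  irreducibility, and pairing with \<open>p\<close> detects constants. Compactness of the unit sphere gives \<open>\<kappa>\<close>
  for the density constantly equal to \<open>c\<close>, and larger densities have larger energy.\<close>

lemma Poincare:
  assumes p: "p \<in> pos_densities" and c: "0 < c"
  obtains \<kappa> where "0 < \<kappa>"
    and "\<And>w \<phi>. (\<And>x. c \<le> w x) \<Longrightarrow>
      \<kappa> * (\<Sum>x\<in>UNIV. (\<phi> x)\<^sup>2) \<le> (pairing \<pi> \<phi> p)\<^sup>2 + energy K \<pi> w \<phi> \<phi>"
proof -
  define Q where "Q \<phi> = (pairing \<pi> \<phi> p)\<^sup>2 + energy K \<pi> (\<lambda>_. c) \<phi> \<phi>" for \<phi>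
  define q where "q \<phi> = (\<Sum>x\<in>UNIV. (\<phi> x)\<^sup>2)" for \<phi> :: "'x \<Rightarrow> real"
  define B :: "('x \<Rightarrow> real) set" where "B = PiE UNIV (\<lambda>_. {-1..1})"
  define S where "S = B \<inter> {\<phi>. q \<phi> = 1}"
  have cont_q: "continuous_on UNIV q"
    unfolding q_def by (intro continuous_intros continuous_on_product_coordinates)
  have cont_Q: "continuous_on UNIV Q"
    unfolding Q_def pairing_def energy_def grad_def
    by (intro continuous_intros continuous_on_product_coordinates)
  have "compactin (product_topology (\<lambda>_. euclidean) UNIV) B"
    unfolding B_def by (subst compactin_PiE) auto
  then have "compact B"
    by (simp add: euclidean_product_topology flip: compactin_euclidean_iff)
  moreover have "closed {\<phi>. q \<phi> = 1}"
    using continuous_closed_preimage_constant[OF cont_q, of 1] by simp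
  ultimately have "compact S"
    unfolding S_def by (rule compact_Int_closed)
  have S_I: "\<phi> \<in> S" if "q \<phi> = 1" for \<phi>
  proof -
    have "(\<phi> x)\<^sup>2 \<le> 1" for x
      using member_le_sum[of x UNIV "\<lambda>x. (\<phi> x)\<^sup>2"] that by (simp add: q_def)
    then show ?thesis
      using that by (auto simp: S_def B_def abs_square_le_1 abs_le_iff)
  qed
  have Q_pos: "0 < Q \<phi>" if "q \<phi> = 1" for \<phi>
  proof (rule ccontr)
    assume "\<not> 0 < Q \<phi>"
    then have z: "(pairing \<pi> \<phi> p)\<^sup>2 = 0" "energy K \<pi> (\<lambda>_. c) \<phi> \<phi> = 0"
      using energy_nonneg[of "\<lambda>_. c" \<phi>] zero_le_power2[of "pairing \<pi> \<phi> p"] unfolding Q_def by linarith+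
    obtain x0 :: 'x where True by blast
    have const: "\<phi> x = \<phi> x0" for x
      using energy_eq_0_imp_constant[OF _ z(2)] c by (simp add: pos_densities_def)
    have "pairing \<pi> \<phi> p = (\<Sum>x\<in>UNIV. \<phi> x0 * p x * \<pi> x)"
      unfolding pairing_def using const by (intro sum.cong refl) metis
    then have "pairing \<pi> \<phi> p = \<phi> x0 * (\<Sum>x\<in>UNIV. p x * \<pi> x)"
      by (simp add: sum_distrib_left mult.assoc)
    moreover have "0 < (\<Sum>x\<in>UNIV. p x * \<pi> x)"
      using p pi_pos by (intro sum_pos) (auto simp: pos_densities_def)
    ultimately have "\<phi> x0 = 0" using z(1) by auto
    then have "q \<phi> = 0" using const by (simp add: q_def)
    then show False using that by simp
  qed
  have "q (\<lambda>x. if x = x0 then 1 else 0) = 1" for x0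
    by (simp add: q_def if_distrib[of "\<lambda>z. z\<^sup>2"] cong: if_cong)
  then have "S \<noteq> {}" using S_I by blast
  then obtain \<phi>0 where \<phi>0: "\<phi>0 \<in> S" "\<And>\<phi>. \<phi> \<in> S \<Longrightarrow> Q \<phi>0 \<le> Q \<phi>"
    using continuous_attains_inf[OF \<open>compact S\<close> _ continuous_on_subset[OF cont_Q]] by auto
  have pos: "0 < Q \<phi>0" using \<phi>0(1) Q_pos by (simp add: S_def)
  show ?thesis
  proof (rule that[OF pos])
    fix w \<phi> assume w: "\<And>x::'x. c \<le> w x"
    have "Q \<phi>0 * q \<phi> \<le> Q \<phi>"
    proof (cases "q \<phi> = 0")
      case True
      then show ?thesis using energy_nonneg by (simp add: Q_def)
    next
      case False
      then have q: "0 < q \<phi>" by (simp add: q_def sum_nonneg less_le)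
      define s where "s = 1 / sqrt (q \<phi>)"
      have s2: "s\<^sup>2 = 1 / q \<phi>" using q by (simp add: s_def power_divide)
      have "q (\<lambda>x. s * \<phi> x) = s\<^sup>2 * q \<phi>"
        by (simp add: q_def power_mult_distrib sum_distrib_left)
      then have "q (\<lambda>x. s * \<phi> x) = 1" using s2 q by simp
      then have "Q \<phi>0 \<le> Q (\<lambda>x. s * \<phi> x)" using \<phi>0(2) S_I by blast
      also have "\<dots> = s\<^sup>2 * Q \<phi>"
        by (simp add: Q_def pairing_scale_left energy_scale_left energy_scale_right
            power2_eq_square algebra_simps)
      finally show ?thesis using s2 q by (simp add: field_simps)
    qed
    also have "Q \<phi> \<le> (pairing \<pi> \<phi> p)\<^sup>2 + energy K \<pi> w \<phi> \<phi>"
    proof -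
      have "energy K \<pi> (\<lambda>_. c) \<phi> \<phi> \<le> energy K \<pi> w \<phi> \<phi>"
        using w c by (intro energy_mono_density) (auto simp: mean_density_def intro!: log_mean_mono)
      then show ?thesis by (simp add: Q_def)
    qed
    finally show "Q \<phi>0 * (\<Sum>x\<in>UNIV. (\<phi> x)\<^sup>2) \<le> (pairing \<pi> \<phi> p)\<^sup>2 + energy K \<pi> w \<phi> \<phi>"
      by (simp add: q_def)
  qed
qed

subsection \<open>Solving for the potential\<close>

text \<open>The divergence operator for a positive density is inverted on the functions of mean zero.
  Adding the mean makes the operator invertible on the whole space, and Cramer's rule exhibits the
  inverse as a continuous function of the density.\<close>

lemma potential_exists:
  fixes w :: "real \<Rightarrow> 'x \<Rightarrow> real"
  assumes w: "\<And>t. t \<in> S \<Longrightarrow> w t \<in> pos_densities" and cont: "\<And>x. continuous_on S (\<lambda>t. w t x)"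
    and f: "pairing \<pi> (\<lambda>_. 1) f = 0"
  obtains \<psi> :: "real \<Rightarrow> 'x \<Rightarrow> real" where "\<And>x. continuous_on S (\<lambda>t. \<psi> t x)"
    and "\<And>t. t \<in> S \<Longrightarrow> divergence K (w t) (\<psi> t) = f"
proof -
  define A :: "real \<Rightarrow> real^'x^'x" where "A t = (\<chi> x y. mean_density (w t) x y * K x y + \<pi> y
      - (if x = y then \<Sum>z\<in>UNIV. mean_density (w t) x z * K x z else 0))" for t
  define b :: "real^'x" where "b = (\<chi> x. f x)"
  have A: "(A t *v v) $ x = divergence K (w t) (\<lambda>y. v $ y) x + (\<Sum>y\<in>UNIV. v $ y * \<pi> y)" for t v x
  proof -
    have "(A t *v v) $ x = (\<Sum>y\<in>UNIV. mean_density (w t) x y * K x y * v $ y + v $ y * \<pi> y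
        - (if x = y then (\<Sum>z\<in>UNIV. mean_density (w t) x z * K x z) * v $ y else 0))"
      unfolding A_def matrix_vector_mult_def by (simp add: algebra_simps) (intro sum.cong refl, auto simp: algebra_simps)
    also have "\<dots> = (\<Sum>y\<in>UNIV. mean_density (w t) x y * K x y * v $ y) + (\<Sum>y\<in>UNIV. v $ y * \<pi> y)
        - (\<Sum>z\<in>UNIV. mean_density (w t) x z * K x z) * v $ x"
      by (simp add: sum.distrib sum_subtractf)
    finally show ?thesis
      by (simp add: divergence_def algebra_simps sum_subtractf sum_distrib_left sum_distrib_right)
  qed
  have mean: "(\<Sum>y\<in>UNIV. v $ y * \<pi> y) = pairing \<pi> (\<lambda>_. 1) (\<lambda>x. (A t *v v) $ x)" if "t \<in> S" for t v
  proof -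
    have "w t \<in> densities" using w[OF that] by (auto simp: densities_def pos_densities_def less_imp_le)
    then show ?thesis
      unfolding A by (simp add: pairing_add_right pairing_one_divergence)
        (simp add: pairing_def pi_sum flip: sum_distrib_left)
  qed
  have det: "det (A t) \<noteq> 0" if t: "t \<in> S" for t
  proof -
    have wd: "w t \<in> densities" using w[OF t] by (auto simp: densities_def pos_densities_def less_imp_le)
    have "v = 0" if v: "A t *v v = 0" for v
    proof -
      have m: "(\<Sum>y\<in>UNIV. v $ y * \<pi> y) = 0"
        using mean[OF t, of v] v by (simp add: pairing_def)
      then have "divergence K (w t) (\<lambda>y. v $ y) = (\<lambda>_. 0)"
        using A[of t v] v by auto
      then have "energy K \<pi> (w t) (\<lambda>y. v $ y) (\<lambda>y. v $ y) = 0"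
        using pairing_divergence[OF wd, of "\<lambda>y. v $ y" "\<lambda>y. v $ y"] by (simp add: pairing_def)
      then have const: "v $ x = v $ y" for x y
        using energy_eq_0_imp_constant[OF w[OF t]] by blast
      have "v $ x = 0" for x
      proof -
        have "(\<Sum>y\<in>UNIV. v $ y * \<pi> y) = (\<Sum>y\<in>UNIV. v $ x * \<pi> y)"
          using const by (intro sum.cong refl) metis
        then show ?thesis using m pi_sum by (simp flip: sum_distrib_left)
      qed
      then show ?thesis by (simp add: vec_eq_iff)
    qed
    then have "invertible (A t)"
      using matrix_left_invertible_ker invertible_left_inverse by blast
    then show ?thesis by (simp add: invertible_det_nz)
  qed
  have contA: "continuous_on S (\<lambda>t. A t $ x $ y)" for x y
  proof -
    have "continuous_on S (\<lambda>t. mean_density (w t) x y)" for x y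
      unfolding mean_density_def using w
      by (intro continuous_on_log_mean_compose cont) (auto simp: pos_densities_def less_imp_le)
    then show ?thesis
      unfolding A_def by (cases "x = y") (auto intro!: continuous_intros)
  qed
  define \<psi> where "\<psi> t x = det (\<chi> i j. if j = x then b $ i else A t $ i $ j) / det (A t)" for t x
  show ?thesis
  proof (rule that)
    fix x
    have "continuous_on S (\<lambda>t. if j = x then b $ i else A t $ i $ j)" for i j
      by (cases "j = x") (auto intro: contA)
    then show "continuous_on S (\<lambda>t. \<psi> t x)"
      unfolding \<psi>_def det_def using det[unfolded det_def] contA
      by (intro continuous_on_divide continuous_on_sum continuous_on_mult continuous_on_prod
          continuous_on_const) auto
  next
    fix t assume t: "t \<in> S"
    have sol: "A t *v (\<chi> x. \<psi> t x) = b"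
      unfolding cramer[OF det[OF t]] \<psi>_def by simp
    then have m: "(\<Sum>y\<in>UNIV. \<psi> t y * \<pi> y) = 0"
      using mean[OF t, of "\<chi> x. \<psi> t x"] f by (simp add: b_def)
    show "divergence K (w t) (\<psi> t) = f"
    proof
      fix x
      show "divergence K (w t) (\<psi> t) x = f x"
        using A[of t "\<chi> x. \<psi> t x" x] sol m by (simp add: b_def)
    qed
  qed
qed

end

section \<open>Absolutely continuous functions\<close>

lemma abs_continuousE:
  assumes "abs_continuous_on_interval a b f" "0 < e"
  obtains \<delta> where "0 < \<delta>" and "\<And>D. \<lbrakk>finite D; \<forall>(u, v)\<in>D. a \<le> u \<and> u \<le> v \<and> v \<le> b;
      pairwise (\<lambda>(u, v) (u', v'). disjnt {u<..<v} {u'<..<v'}) D;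
      (\<Sum>(u, v)\<in>D. v - u) < \<delta>\<rbrakk> \<Longrightarrow> (\<Sum>(u, v)\<in>D. \<bar>f v - f u\<bar>) < e"
proof -
  from assms(1)[unfolded abs_continuous_on_interval_def, THEN spec, THEN mp, OF assms(2)]
  obtain \<delta> where "0 < \<delta>" and ac: "\<forall>D. finite D \<longrightarrow> (\<forall>(u, v)\<in>D. a \<le> u \<and> u \<le> v \<and> v \<le> b) \<longrightarrow>
        pairwise (\<lambda>(u, v) (u', v'). disjnt {u<..<v} {u'<..<v'}) D \<longrightarrow>
        (\<Sum>(u, v)\<in>D. v - u) < \<delta> \<longrightarrow> (\<Sum>(u, v)\<in>D. \<bar>f v - f u\<bar>) < e"
    by (elim exE conjE)
  show ?thesis
    by (rule that[OF \<open>0 < \<delta>\<close>]) (rule ac[THEN spec, THEN mp, THEN mp, THEN mp, THEN mp]; assumption)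
qed

text \<open>Absolute continuity speaks of sets of pairs of endpoints, gauge integration of tagged intervals.
  Degenerate intervals have to be discarded in between, since they may coincide for different tags.\<close>

lemma abs_continuous_small_variation:
  assumes AC: "abs_continuous_on_interval a b f" and e: "0 < e"
  shows "\<exists>\<delta>>0. \<forall>\<D> :: (real \<times> real set) set. finite \<D> \<longrightarrow>
      (\<forall>(x, k)\<in>\<D>. \<exists>u v. k = {u..v} \<and> a \<le> u \<and> u \<le> v \<and> v \<le> b) \<longrightarrow>
      (\<forall>z\<in>\<D>. \<forall>z'\<in>\<D>. z \<noteq> z' \<longrightarrow> interior (snd z) \<inter> interior (snd z') = {}) \<longrightarrow>
      (\<Sum>(x, k)\<in>\<D>. Sup k - Inf k) < \<delta> \<longrightarrow> (\<Sum>(x, k)\<in>\<D>. \<bar>f (Sup k) - f (Inf k)\<bar>) < e"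
proof -
  obtain \<delta> where \<delta>: "0 < \<delta>" and ac: "\<And>D. finite D \<Longrightarrow> (\<forall>(u, v)\<in>D. a \<le> u \<and> u \<le> v \<and> v \<le> b) \<Longrightarrow>
        pairwise (\<lambda>(u, v) (u', v'). disjnt {u<..<v} {u'<..<v'}) D \<Longrightarrow>
        (\<Sum>(u, v)\<in>D. v - u) < \<delta> \<Longrightarrow> (\<Sum>(u, v)\<in>D. \<bar>f v - f u\<bar>) < e"
    using abs_continuousE[OF AC e] by blast
  show ?thesis
  proof (intro exI[of _ \<delta>] conjI \<delta> allI impI)
    fix \<D> :: "(real \<times> real set) set"
    assume fin: "finite \<D>" and ivl': "\<forall>(x, k)\<in>\<D>. \<exists>u v. k = {u..v} \<and> a \<le> u \<and> u \<le> v \<and> v \<le> b"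
      and disj: "\<forall>z\<in>\<D>. \<forall>z'\<in>\<D>. z \<noteq> z' \<longrightarrow> interior (snd z) \<inter> interior (snd z') = {}"
      and small: "(\<Sum>(x, k)\<in>\<D>. Sup k - Inf k) < \<delta>"
    have ivl: "\<exists>u v. k = {u..v} \<and> a \<le> u \<and> u \<le> v \<and> v \<le> b" if "(x, k) \<in> \<D>" for x k
      using ivl' that by blast
    define ends where "ends z = (Inf (snd z), Sup (snd z))" for z :: "real \<times> real set"
    define \<D>' where "\<D>' = {z \<in> \<D>. Inf (snd z) < Sup (snd z)}"
    have \<D>': "finite \<D>'" "\<D>' \<subseteq> \<D>" using fin by (auto simp: \<D>'_def)
    have ends: "snd z = {fst (ends z)..snd (ends z)} \<and> a \<le> fst (ends z) \<and> fst (ends z) < snd (ends z) \<and> snd (ends z) \<le> b"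
      if z: "z \<in> \<D>'" for z
    proof -
      have "(fst z, snd z) \<in> \<D>" using z \<D>'(2) by auto
      then obtain u v where uv: "snd z = {u..v}" "a \<le> u" "u \<le> v" "v \<le> b" using ivl by meson
      moreover have "Inf (snd z) < Sup (snd z)" using z by (simp add: \<D>'_def)
      ultimately show ?thesis by (simp add: ends_def)
    qed
    have disj': "{fst (ends z)<..<snd (ends z)} \<inter> {fst (ends z')<..<snd (ends z')} = {}"
      if "z \<in> \<D>'" "z' \<in> \<D>'" "z \<noteq> z'" for z z'
    proof -
      have "interior (snd z) \<inter> interior (snd z') = {}"
        using disj that \<D>'(2) by blast
      moreover have "interior (snd z) = {fst (ends z)<..<snd (ends z)}"
        "interior (snd z') = {fst (ends z')<..<snd (ends z')}"
        using that ends interior_atLeastAtMost_real by metis+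
      ultimately show ?thesis by simp
    qed
    have inj: "inj_on ends \<D>'"
    proof (rule inj_onI, rule ccontr)
      fix z z' assume z: "z \<in> \<D>'" "z' \<in> \<D>'" "ends z = ends z'" "z \<noteq> z'"
      then have "{fst (ends z)<..<snd (ends z)} = {}" using disj'[of z z'] by simp
      then show False using ends[of z] z by simp
    qed
    have sum_eq: "(\<Sum>(x, k)\<in>\<D>. g (Inf k) (Sup k)) = (\<Sum>(u, v)\<in>ends ` \<D>'. g u v)"
      if "\<And>u. g u u = 0" for g :: "real \<Rightarrow> real \<Rightarrow> real"
    proof -
      have "(\<Sum>(x, k)\<in>\<D>. g (Inf k) (Sup k)) = (\<Sum>(x, k)\<in>\<D>'. g (Inf k) (Sup k))"
      proof (rule sum.mono_neutral_right[OF fin \<D>'(2)], safe)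
        fix x k assume xk: "(x, k) \<in> \<D>" "(x, k) \<notin> \<D>'"
        obtain u v where "k = {u..v}" "u \<le> v" using ivl[OF xk(1)] by blast
        then show "g (Inf k) (Sup k) = 0" using xk that by (auto simp: \<D>'_def)
      qed
      also have "\<dots> = (\<Sum>(u, v)\<in>ends ` \<D>'. g u v)"
        by (subst sum.reindex[OF inj]) (simp add: ends_def case_prod_beta)
      finally show ?thesis .
    qed
    have "(\<Sum>(u, v)\<in>ends ` \<D>'. \<bar>f v - f u\<bar>) < e"
    proof (rule ac)
      show "finite (ends ` \<D>')" using \<D>' by simp
      show "\<forall>(u, v)\<in>ends ` \<D>'. a \<le> u \<and> u \<le> v \<and> v \<le> b"
        using ends by (simp add: case_prod_beta less_imp_le)
      show "pairwise (\<lambda>(u, v) (u', v'). disjnt {u<..<v} {u'<..<v'}) (ends ` \<D>')"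
        using disj' by (auto simp: pairwise_def case_prod_beta disjnt_def)
      show "(\<Sum>(u, v)\<in>ends ` \<D>'. v - u) < \<delta>"
        using small sum_eq[of "\<lambda>u v. v - u"] by simp
    qed
    then show "(\<Sum>(x, k)\<in>\<D>. \<bar>f (Sup k) - f (Inf k)\<bar>) < e"
      using sum_eq[of "\<lambda>u v. \<bar>f v - f u\<bar>"] by simp
  qed
qed

lemma sum_lengths_le_measure:
  fixes \<D> :: "(real \<times> real set) set"
  assumes fin: "finite \<D>" and ivl: "\<And>x k. (x, k) \<in> \<D> \<Longrightarrow> \<exists>u v. k = {u..v} \<and> u \<le> v"
    and disj: "\<And>x k y l. \<lbrakk>(x, k) \<in> \<D>; (y, l) \<in> \<D>; (x, k) \<noteq> (y, l)\<rbrakk> \<Longrightarrow> interior k \<inter> interior l = {}"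
    and U: "U \<in> lmeasurable" and sub: "\<And>x k. (x, k) \<in> \<D> \<Longrightarrow> k \<subseteq> U"
  shows "(\<Sum>(x, k)\<in>\<D>. Sup k - Inf k) \<le> measure lebesgue U"
proof -
  have "(\<Sum>(x, k)\<in>\<D>. Sup k - Inf k) = (\<Sum>z\<in>\<D>. measure lebesgue (interior (snd z)))"
  proof (intro sum.cong refl, safe)
    fix x k assume "(x, k) \<in> \<D>"
    then obtain u v where "k = {u..v}" "u \<le> v" using ivl by blast
    then show "Sup k - Inf k = measure lebesgue (interior (snd (x, k)))" by simp
  qed
  also have "\<dots> = measure lebesgue (\<Union>z\<in>\<D>. interior (snd z))"
  proof (rule measure_UNION'[symmetric, OF fin])
    show "interior (snd z) \<in> lmeasurable" if "z \<in> \<D>" for z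
      using ivl[of "fst z" "snd z"] that by auto
    show "pairwise (\<lambda>z z'. disjnt (interior (snd z)) (interior (snd z'))) \<D>"
      using disj by (fastforce simp: pairwise_def disjnt_def)
  qed
  also have "\<dots> \<le> measure lebesgue U"
  proof (rule measure_mono_fmeasurable[OF _ _ U])
    show "(\<Union>z\<in>\<D>. interior (snd z)) \<subseteq> U"
      using sub interior_subset by fastforce
    show "(\<Union>z\<in>\<D>. interior (snd z)) \<in> sets lebesgue"
      by (rule lebesgue_openin[of UNIV]) (simp_all add: open_UN)
  qed
  finally show ?thesis .
qed

text \<open>The fundamental theorem of calculus for absolutely continuous functions, by a gauge:
  around a point of differentiability it is chosen from the derivative, and around the exceptional
  null set it keeps the intervals inside an open set so small that absolute continuity bounds the
  increments over them.\<close>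

lemma abs_continuous_has_integral:
  fixes f g :: "real \<Rightarrow> real"
  assumes ab: "a \<le> b" and AC: "abs_continuous_on_interval a b f" and N: "negligible N"
    and der: "\<And>t. t \<in> {a..b} - N \<Longrightarrow> (f has_real_derivative g t) (at t within {a..b})"
  shows "(g has_integral (f b - f a)) {a..b}"
proof -
  define g' where "g' t = (if t \<in> N then 0 else g t)" for t
  have "(g' has_integral (f b - f a)) {a..b}"
    unfolding has_integral_real
  proof (intro allI impI)
    fix e :: real assume e: "0 < e"
    define e' where "e' = e / (4 * (b - a + 1))"
    have e': "0 < e'" using e ab by (simp add: e'_def)
    obtain \<delta> where \<delta>: "0 < \<delta>" and var: "\<forall>\<D> :: (real \<times> real set) set. finite \<D> \<longrightarrow>
      (\<forall>(x, k)\<in>\<D>. \<exists>u v. k = {u..v} \<and> a \<le> u \<and> u \<le> v \<and> v \<le> b) \<longrightarrow>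
      (\<forall>z\<in>\<D>. \<forall>z'\<in>\<D>. z \<noteq> z' \<longrightarrow> interior (snd z) \<inter> interior (snd z') = {}) \<longrightarrow>
      (\<Sum>(x, k)\<in>\<D>. Sup k - Inf k) < \<delta> \<longrightarrow> (\<Sum>(x, k)\<in>\<D>. \<bar>f (Sup k) - f (Inf k)\<bar>) < e / 2"
      using abs_continuous_small_variation[OF AC half_gt_zero[OF e]] by (elim exE conjE)
    obtain U where U: "open U" "N \<subseteq> U" "U \<in> lmeasurable" "measure lebesgue U < \<delta>"
    proof -
      have "N \<in> sets lebesgue" using N by (simp add: negligible_iff_null_sets null_setsD2)
      then obtain U where U: "open U" "N \<subseteq> U" "U - N \<in> lmeasurable" "emeasure lebesgue (U - N) < ennreal \<delta>"
        using sets_lebesgue_outer_open[of N \<delta>] \<delta> by blast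
      have "U = (U - N) \<union> N" using U by blast
      moreover have "N \<in> lmeasurable" "measure lebesgue N = 0"
        using N by (simp_all add: negligible_iff_measure)
      ultimately have "U \<in> lmeasurable" "measure lebesgue U \<le> measure lebesgue (U - N) + 0"
        using U(3) measure_Un_le[of "U - N" lebesgue N] by (metis fmeasurable.Un, metis fmeasurableD)
      moreover have "measure lebesgue (U - N) < \<delta>"
        using U(3,4) \<delta> by (simp add: emeasure_eq_measure2 ennreal_less_iff)
      ultimately show ?thesis using that U by simp
    qed
    have "\<exists>r>0. ball t r \<subseteq> U" if "t \<in> N" for t
      using U that open_contains_ball by blast
    then obtain r where r: "\<And>t. t \<in> N \<Longrightarrow> 0 < r t \<and> ball t (r t) \<subseteq> U" by metis
    have "\<exists>d>0. \<forall>y\<in>{a..b}. dist y t < d \<longrightarrow> \<bar>f y - f t - g t * (y - t)\<bar> \<le> e' * \<bar>y - t\<bar>"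
      if t: "t \<in> {a..b} - N" for t
    proof -
      have "(f has_derivative (\<lambda>h. g t * h)) (at t within {a..b})"
        using der[OF t] by (simp add: has_field_derivative_def)
      then have "\<forall>e>0. \<exists>d>0. \<forall>y\<in>{a..b}. norm (y - t) < d \<longrightarrow> norm (f y - f t - g t * (y - t)) \<le> e * norm (y - t)"
        by (simp add: has_derivative_within_alt)
      then show ?thesis using e' by (simp add: dist_real_def)
    qed
    then obtain d where d: "\<And>t. t \<in> {a..b} - N \<Longrightarrow> 0 < d t"
      "\<And>t y. \<lbrakk>t \<in> {a..b} - N; y \<in> {a..b}; dist y t < d t\<rbrakk> \<Longrightarrow> \<bar>f y - f t - g t * (y - t)\<bar> \<le> e' * \<bar>y - t\<bar>"
      by metis
    define \<gamma> where "\<gamma> t = (if t \<in> N then ball t (r t) else if t \<in> {a..b} then ball t (d t) else UNIV)" for t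
    have gauge: "gauge \<gamma>" using r d(1) by (auto simp: gauge_def \<gamma>_def)
    have "norm ((\<Sum>(x, k)\<in>\<D>. measure lborel k *\<^sub>R g' x) - (f b - f a)) < e"
      if \<D>: "\<D> tagged_division_of {a..b}" and fine: "\<gamma> fine \<D>" for \<D>
    proof -
      note td = tagged_division_ofD[OF \<D>]
      have ivl: "\<exists>u v. k = {u..v} \<and> a \<le> u \<and> u \<le> x \<and> x \<le> v \<and> v \<le> b \<and> {u..v} \<subseteq> \<gamma> x" if xk: "(x, k) \<in> \<D>" for x k
      proof -
        obtain u v where k: "k = {u..v}" using td(4)[OF xk] by auto
        have "x \<in> {u..v}" "{u..v} \<subseteq> {a..b}" "{u..v} \<subseteq> \<gamma> x"
          using td(2,3)[OF xk] fineD[OF fine xk] unfolding k by auto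
        then show ?thesis
          using k by (intro exI[of _ u] exI[of _ v]) simp
      qed
      define \<D>\<^sub>0 where "\<D>\<^sub>0 = {z \<in> \<D>. fst z \<in> N}"
      have \<D>\<^sub>0_sub: "\<D>\<^sub>0 \<subseteq> \<D>" by (auto simp: \<D>\<^sub>0_def)
      define err where "err = (\<lambda>(x, k). measure lborel k *\<^sub>R g' x - (f (Sup k) - f (Inf k)))"
      have "(\<Sum>z\<in>\<D>. err z) = (\<Sum>(x, k)\<in>\<D>. measure lborel k *\<^sub>R g' x) - (f b - f a)"
        using additive_tagged_division_1[OF ab \<D>, of f]
        by (simp add: err_def case_prod_beta sum_subtractf)
      moreover have "(\<Sum>z\<in>\<D>. err z) = (\<Sum>z\<in>\<D>\<^sub>0. err z) + (\<Sum>z\<in>\<D> - \<D>\<^sub>0. err z)"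
        using sum.subset_diff[of \<D>\<^sub>0 \<D> err] td(1) \<D>\<^sub>0_sub by (simp only: add.commute)
      moreover have "\<bar>\<Sum>z\<in>\<D>\<^sub>0. err z\<bar> < e / 2"
      proof -
        have "\<bar>\<Sum>z\<in>\<D>\<^sub>0. err z\<bar> \<le> (\<Sum>z\<in>\<D>\<^sub>0. \<bar>err z\<bar>)" by (rule sum_abs)
        also have "\<dots> = (\<Sum>(x, k)\<in>\<D>\<^sub>0. \<bar>f (Sup k) - f (Inf k)\<bar>)"
          by (intro sum.cong refl) (auto simp: \<D>\<^sub>0_def err_def g'_def)
        also have "\<dots> < e / 2"
        proof (rule var[THEN spec, THEN mp, THEN mp, THEN mp, THEN mp])
          show "finite \<D>\<^sub>0" using td(1) by (simp add: \<D>\<^sub>0_def)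
          show "\<forall>(x, k)\<in>\<D>\<^sub>0. \<exists>u v. k = {u..v} \<and> a \<le> u \<and> u \<le> v \<and> v \<le> b"
          proof safe
            fix x k assume "(x, k) \<in> \<D>\<^sub>0"
            then have "(x, k) \<in> \<D>" using \<D>\<^sub>0_sub by blast
            then obtain u v where "k = {u..v}" "a \<le> u" "u \<le> x" "x \<le> v" "v \<le> b" using ivl by blast
            then show "\<exists>u v. k = {u..v} \<and> a \<le> u \<and> u \<le> v \<and> v \<le> b"
              by (intro exI[of _ u] exI[of _ v]) simp
          qed
          show "\<forall>z\<in>\<D>\<^sub>0. \<forall>z'\<in>\<D>\<^sub>0. z \<noteq> z' \<longrightarrow> interior (snd z) \<inter> interior (snd z') = {}"
            using td(5) \<D>\<^sub>0_sub by (metis prod.collapse subsetD)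
          have "(\<Sum>(x, k)\<in>\<D>\<^sub>0. Sup k - Inf k) \<le> measure lebesgue U"
          proof (rule sum_lengths_le_measure[OF _ _ _ U(3)])
            show "finite \<D>\<^sub>0" using td(1) by (simp add: \<D>\<^sub>0_def)
            show "\<exists>u v. k = {u..v} \<and> u \<le> v" if "(x, k) \<in> \<D>\<^sub>0" for x k
              using that ivl[of x k] by (force simp: \<D>\<^sub>0_def)
            show "interior k \<inter> interior l = {}" if "(x, k) \<in> \<D>\<^sub>0" "(y, l) \<in> \<D>\<^sub>0" "(x, k) \<noteq> (y, l)" for x k y l
              using td(5)[of x k y l] that \<D>\<^sub>0_sub by (meson subsetD)
            show "k \<subseteq> U" if "(x, k) \<in> \<D>\<^sub>0" for x k
            proof -
              have "x \<in> N" "k \<subseteq> \<gamma> x" using that ivl[of x k] by (auto simp: \<D>\<^sub>0_def)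
              then show ?thesis using r[of x] by (auto simp: \<gamma>_def)
            qed
          qed
          then show "(\<Sum>(x, k)\<in>\<D>\<^sub>0. Sup k - Inf k) < \<delta>" using U(4) by simp
        qed
        finally show ?thesis .
      qed
      moreover have "\<bar>\<Sum>z\<in>\<D> - \<D>\<^sub>0. err z\<bar> \<le> e / 4"
      proof -
        have "\<bar>\<Sum>z\<in>\<D> - \<D>\<^sub>0. err z\<bar> \<le> (\<Sum>z\<in>\<D> - \<D>\<^sub>0. \<bar>err z\<bar>)" by (rule sum_abs)
        also have "\<dots> \<le> (\<Sum>(x, k)\<in>\<D> - \<D>\<^sub>0. e' * measure lborel k)"
        proof (rule sum_mono, safe)
          fix x k assume xk: "(x, k) \<in> \<D>" "(x, k) \<notin> \<D>\<^sub>0"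
          then obtain u v where k: "k = {u..v}" "a \<le> u" "u \<le> x" "x \<le> v" "v \<le> b" "{u..v} \<subseteq> \<gamma> x"
            using ivl[of x k] by blast
          have x: "x \<in> {a..b} - N" using xk k by (auto simp: \<D>\<^sub>0_def)
          have near: "dist u x < d x" "dist v x < d x"
          proof -
            have "u \<in> \<gamma> x" "v \<in> \<gamma> x" using k by auto
            then show "dist u x < d x" "dist v x < d x" using x by (simp_all add: \<gamma>_def dist_commute)
          qed
          have "\<bar>f u - f x - g x * (u - x)\<bar> \<le> e' * (x - u)" "\<bar>f v - f x - g x * (v - x)\<bar> \<le> e' * (v - x)"
            using d(2)[OF x _ near(1)] d(2)[OF x _ near(2)] k by simp_all
          then show "\<bar>err (x, k)\<bar> \<le> e' * measure lborel k"
            using k x by (simp add: err_def g'_def algebra_simps abs_le_iff)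
        qed
        also have "\<dots> \<le> (\<Sum>(x, k)\<in>\<D>. e' * measure lborel k)"
          using td(1) e' by (intro sum_mono2) auto
        also have "\<dots> = e' * (b - a)"
          using additive_content_tagged_division[of \<D> a b] \<D> ab
          by (simp add: case_prod_beta flip: sum_distrib_left)
        also have "\<dots> \<le> e / 4"
          using e ab by (simp add: e'_def field_simps)
        finally show ?thesis .
      qed
      ultimately show ?thesis using e unfolding real_norm_def by linarith
    qed
    then show "\<exists>\<gamma>. gauge \<gamma> \<and> (\<forall>\<D>. \<D> tagged_division_of {a..b} \<and> \<gamma> fine \<D> \<longrightarrow>
        norm ((\<Sum>(x, k)\<in>\<D>. measure lborel k *\<^sub>R g' x) - (f b - f a)) < e)"
      using gauge by blast
  qed
  then show ?thesis
    by (rule has_integral_spike[OF N, rotated]) (simp add: g'_def)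
qed

lemma abs_continuous_mult_C1:
  fixes f g :: "real \<Rightarrow> real"
  assumes ab: "a \<le> b" and AC: "abs_continuous_on_interval a b f"
    and lip: "\<And>u v. \<lbrakk>a \<le> u; u \<le> v; v \<le> b\<rbrakk> \<Longrightarrow> \<bar>g v - g u\<bar> \<le> L * (v - u)"
    and gb: "\<And>t. t \<in> {a..b} \<Longrightarrow> \<bar>g t\<bar> \<le> M" and fb: "\<And>t. t \<in> {a..b} \<Longrightarrow> \<bar>f t\<bar> \<le> M"
    and M: "0 < M" and L: "0 \<le> L"
  shows "abs_continuous_on_interval a b (\<lambda>t. g t * f t)"
  unfolding abs_continuous_on_interval_def
proof (intro allI impI)
  fix e :: real assume e: "0 < e"
  have eM: "0 < e / (2 * M)" using e M by simp
  obtain \<delta> where \<delta>: "0 < \<delta>" and ac: "\<And>D. finite D \<Longrightarrow> (\<forall>(u, v)\<in>D. a \<le> u \<and> u \<le> v \<and> v \<le> b) \<Longrightarrow>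
        pairwise (\<lambda>(u, v) (u', v'). disjnt {u<..<v} {u'<..<v'}) D \<Longrightarrow>
        (\<Sum>(u, v)\<in>D. v - u) < \<delta> \<Longrightarrow> (\<Sum>(u, v)\<in>D. \<bar>f v - f u\<bar>) < e / (2 * M)"
    using abs_continuousE[OF AC eM] by blast
  define \<delta>' where "\<delta>' = min \<delta> (e / (2 * (M * L + 1)))"
  have MLpos: "0 < 2 * (M * L + 1)" using M L by (simp add: add_nonneg_pos)
  then have \<delta>': "0 < \<delta>'" using \<delta> e by (simp add: \<delta>'_def)
  have key: "(\<Sum>(u, v)\<in>D. \<bar>g v * f v - g u * f u\<bar>) < e"
    if D: "finite D" "\<forall>(u, v)\<in>D. a \<le> u \<and> u \<le> v \<and> v \<le> b"
      "pairwise (\<lambda>(u, v) (u', v'). disjnt {u<..<v} {u'<..<v'}) D" "(\<Sum>(u, v)\<in>D. v - u) < \<delta>'" for D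
  proof -
    have "(\<Sum>(u, v)\<in>D. \<bar>g v * f v - g u * f u\<bar>) \<le> (\<Sum>(u, v)\<in>D. M * \<bar>f v - f u\<bar> + M * L * (v - u))"
    proof (rule sum_mono, safe)
      fix u v assume "(u, v) \<in> D"
      then have uv: "a \<le> u" "u \<le> v" "v \<le> b" using D by auto
      have "\<bar>g v * f v - g u * f u\<bar> \<le> \<bar>g v\<bar> * \<bar>f v - f u\<bar> + \<bar>f u\<bar> * \<bar>g v - g u\<bar>"
      proof -
        have "g v * f v - g u * f u = g v * (f v - f u) + f u * (g v - g u)" by (simp add: algebra_simps)
        then show ?thesis by (metis abs_mult abs_triangle_ineq)
      qed
      also have "\<dots> \<le> M * \<bar>f v - f u\<bar> + M * (L * (v - u))"
      proof (intro add_mono)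
        show "\<bar>g v\<bar> * \<bar>f v - f u\<bar> \<le> M * \<bar>f v - f u\<bar>"
          using gb[of v] uv by (intro mult_right_mono) simp_all
        show "\<bar>f u\<bar> * \<bar>g v - g u\<bar> \<le> M * (L * (v - u))"
          using fb[of u] lip[OF uv] uv M by (intro mult_mono) simp_all
      qed
      finally show "\<bar>g v * f v - g u * f u\<bar> \<le> M * \<bar>f v - f u\<bar> + M * L * (v - u)" by simp
    qed
    also have "\<dots> = M * (\<Sum>(u, v)\<in>D. \<bar>f v - f u\<bar>) + M * L * (\<Sum>(u, v)\<in>D. v - u)"
      by (simp add: case_prod_beta sum.distrib sum_distrib_left)
    also have "\<dots> < M * (e / (2 * M)) + e / 2"
    proof (rule add_less_le_mono)
      show "M * (\<Sum>(u, v)\<in>D. \<bar>f v - f u\<bar>) < M * (e / (2 * M))"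
      proof (intro mult_strict_left_mono ac D(1-3) M)
        show "(\<Sum>(u, v)\<in>D. v - u) < \<delta>" using D(4) by (simp add: \<delta>'_def)
      qed
      define S where "S = (\<Sum>(u, v)\<in>D. v - u)"
      have "0 \<le> S" unfolding S_def using D(2) by (intro sum_nonneg) (simp add: case_prod_beta)
      have "S \<le> e / (2 * (M * L + 1))" using D(4) by (simp add: S_def \<delta>'_def)
      then have "S * (2 * (M * L + 1)) \<le> e" using MLpos by (simp only: pos_le_divide_eq)
      then show "M * L * (\<Sum>(u, v)\<in>D. v - u) \<le> e / 2"
        using \<open>0 \<le> S\<close> unfolding S_def[symmetric] by (simp add: algebra_simps)
    qed
    finally show ?thesis using M by simp
  qed
  show "\<exists>\<delta>>0. \<forall>D. finite D \<longrightarrow> (\<forall>(u, v)\<in>D. a \<le> u \<and> u \<le> v \<and> v \<le> b) \<longrightarrow>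
        pairwise (\<lambda>(u, v) (u', v'). disjnt {u<..<v} {u'<..<v'}) D \<longrightarrow>
        (\<Sum>(u, v)\<in>D. v - u) < \<delta> \<longrightarrow> (\<Sum>(u, v)\<in>D. \<bar>g v * f v - g u * f u\<bar>) < e"
    by (intro exI[of _ \<delta>'] conjI \<delta>' allI impI, rule key)
qed

lemma abs_continuous_imp_continuous:
  assumes AC: "abs_continuous_on_interval a b f"
  shows "continuous_on {a..b} f"
  unfolding continuous_on_iff
proof (intro ballI allI impI)
  fix x e :: real assume x: "x \<in> {a..b}" and e: "0 < e"
  then obtain \<delta> where \<delta>: "0 < \<delta>" and ac: "\<And>D. finite D \<Longrightarrow> (\<forall>(u, v)\<in>D. a \<le> u \<and> u \<le> v \<and> v \<le> b) \<Longrightarrow>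
        pairwise (\<lambda>(u, v) (u', v'). disjnt {u<..<v} {u'<..<v'}) D \<Longrightarrow>
        (\<Sum>(u, v)\<in>D. v - u) < \<delta> \<Longrightarrow> (\<Sum>(u, v)\<in>D. \<bar>f v - f u\<bar>) < e"
    using abs_continuousE[OF AC e] by blast
  have "dist (f y) (f x) < e" if "y \<in> {a..b}" "dist y x < \<delta>" for y
  proof (cases "x \<le> y")
    case True
    then show ?thesis
      using ac[of "{(x, y)}"] x that by (simp add: dist_real_def pairwise_singleton)
  next
    case False
    then show ?thesis
      using ac[of "{(y, x)}"] x that by (simp add: dist_real_def abs_minus_commute pairwise_singleton)
  qed
  then show "\<exists>d>0. \<forall>x'\<in>{a..b}. dist x' x < d \<longrightarrow> dist (f x') (f x) < e"
    using \<delta> by blast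
qed

section \<open>Weak duality\<close>

lemma AE_lebesgue_on_negligible:
  assumes "AE t in lebesgue_on S. P t" "S \<in> sets lebesgue"
  obtains N where "negligible N" "\<And>t. t \<in> S - N \<Longrightarrow> P t"
proof -
  have "AE t in lebesgue. t \<in> S \<longrightarrow> P t"
    using assms by (simp add: AE_restrict_space_iff)
  then obtain N where "N \<in> null_sets lebesgue" "{t. \<not> (t \<in> S \<longrightarrow> P t)} \<subseteq> N"
    by (auto simp: eventually_ae_filter)
  then show ?thesis
    by (intro that[of N]) (auto simp: negligible_iff_null_sets)
qed

lemma C1_with_derivative_continuous: "C1_with_derivative f g \<Longrightarrow> continuous_on {0..1} f"
  unfolding C1_with_derivative_def by (meson DERIV_continuous_on)

lemma C1_with_derivative_lipschitz:
  assumes "C1_with_derivative f g"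
  obtains L where "0 \<le> L" "\<And>u v. \<lbrakk>0 \<le> u; u \<le> v; v \<le> 1\<rbrakk> \<Longrightarrow> \<bar>f v - f u\<bar> \<le> L * (v - u)"
proof -
  have "compact (g ` {0..1})"
    using assms by (intro compact_continuous_image) (auto simp: C1_with_derivative_def)
  then obtain L where L: "\<And>t. t \<in> {0..1} \<Longrightarrow> norm (g t) \<le> L"
    by (meson bounded_iff compact_imp_bounded image_eqI)
  have "norm (f v - f u) \<le> L * norm (v - u)" if "0 \<le> u" "u \<le> v" "v \<le> 1" for u v
    using assms L that
    by (intro field_differentiable_bound[of "{0..1}" f g]) (auto simp: C1_with_derivative_def)
  moreover have "0 \<le> L" using L[of 0] norm_ge_zero[of "g 0"] by simp
  ultimately show ?thesis by (intro that[of L]) auto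
qed

context reversible_chain
begin

text \<open>The pointwise form of weak duality. Young's inequality is applied to the source and to the flux,
  and the Hamilton--Jacobi inequality at the current density absorbs the energy of \<open>\<phi>\<close>.\<close>

lemma integrand_bound:
  assumes w: "w \<in> densities" and a: "0 < a" and b: "0 < b"
    and HJ: "pairing \<pi> \<phi>' w + 1 / (2 * b\<^sup>2) * energy K \<pi> w \<phi> \<phi> \<le> 0"
  shows "pairing \<pi> \<phi>' w + pairing \<pi> \<phi> (\<lambda>x. h * p x - divergence K w \<psi> x)
    \<le> a\<^sup>2 / 2 * h\<^sup>2 + b\<^sup>2 / 2 * energy K \<pi> w \<psi> \<psi> + 1 / (2 * a\<^sup>2) * (pairing \<pi> \<phi> p)\<^sup>2"
proof -
  have "pairing \<pi> \<phi> (\<lambda>x. h * p x - divergence K w \<psi> x) = h * pairing \<pi> \<phi> p + energy K \<pi> w \<phi> \<psi>"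
    by (simp add: pairing_linear pairing_divergence[OF w])
  moreover have "energy K \<pi> w \<phi> \<psi> \<le> b\<^sup>2 / 2 * energy K \<pi> w \<psi> \<psi> + 1 / (2 * b\<^sup>2) * energy K \<pi> w \<phi> \<phi>"
    using b by (intro energy_Young) simp
  moreover have "h * pairing \<pi> \<phi> p \<le> a\<^sup>2 / 2 * h\<^sup>2 + 1 / (2 * a\<^sup>2) * (pairing \<pi> \<phi> p)\<^sup>2"
  proof -
    have "0 \<le> (a * h - pairing \<pi> \<phi> p / a)\<^sup>2 / 2" by simp
    also have "\<dots> = a\<^sup>2 / 2 * h\<^sup>2 + 1 / (2 * a\<^sup>2) * (pairing \<pi> \<phi> p)\<^sup>2 - h * pairing \<pi> \<phi> p"
      using a by (simp add: field_simps power2_eq_square)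
    finally show ?thesis by simp
  qed
  ultimately show ?thesis using HJ by linarith
qed

text \<open>Along an absolutely continuous curve the duality pairing with a \<open>C\<^sup>1\<close> function is absolutely
  continuous, so its increment is the integral of its derivative, to which the pointwise bound applies.\<close>

lemma C1_weak_duality:
  assumes a: "0 < a" and b: "0 < b" and \<phi>: "\<phi> \<in> C1_HJ_subsolutions K \<pi> b"
    and adm: "(\<mu>, \<psi>, h) \<in> admissible K p \<mu>\<^sub>0 \<mu>\<^sub>1"
  shows "ennreal (2 * dual_functional \<pi> a p \<mu>\<^sub>0 \<mu>\<^sub>1 \<phi>) \<le> action K \<pi> a b \<mu> \<psi> h"
proof (cases "action K \<pi> a b \<mu> \<psi> h = \<infinity>")
  case False
  let ?T = "lebesgue_on {0..1::real}"
  have dens: "\<mu> t \<in> densities" if "t \<in> {0..1}" for t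
    using adm that by (simp add: admissible_def)
  have AC: "abs_continuous_on_interval 0 1 (\<lambda>t. \<mu> t x)" for x
    using adm by (simp add: admissible_def)
  have ends: "\<mu> 0 = \<mu>\<^sub>0" "\<mu> 1 = \<mu>\<^sub>1" using adm by (auto simp: admissible_def)
  have meas: "(\<lambda>t. \<psi> t x) \<in> borel_measurable ?T" "h \<in> borel_measurable ?T" for x
    using adm by (auto simp: admissible_def)
  have cont_\<mu>: "continuous_on {0..1} (\<lambda>t. \<mu> t x)" for x
    using abs_continuous_imp_continuous[OF AC] .
  obtain \<phi>' where C1: "\<And>x. C1_with_derivative (\<lambda>t. \<phi> t x) (\<lambda>t. \<phi>' t x)" and HJ: "HJ_inequality K \<pi> b \<phi> \<phi>'"
    using \<phi> by (auto simp: C1_HJ_subsolutions_def)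
  define n where "n t = norm_sq K \<pi> (\<mu> t) (grad (\<psi> t))" for t
  have n_nonneg: "0 \<le> n t" for t by (simp add: n_def norm_sq_grad energy_nonneg)
  have "continuous_on {0..1} (\<lambda>t. mean_density (\<mu> t) x y)" for x y
    unfolding mean_density_def using dens
    by (intro continuous_on_log_mean_compose cont_\<mu>) (auto simp: densities_def)
  then have [measurable]: "(\<lambda>t. mean_density (\<mu> t) x y) \<in> borel_measurable ?T" for x y
    by (intro continuous_imp_measurable_on_sets_lebesgue) auto
  note [measurable] = meas
  have n_meas: "n \<in> borel_measurable ?T"
    unfolding n_def[abs_def] norm_sq_def grad_def by measurable
  have "(\<integral>\<^sup>+t. ennreal ((h t)\<^sup>2) \<partial>?T) < \<infinity>" "(\<integral>\<^sup>+t. ennreal (n t) \<partial>?T) < \<infinity>"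
    using False a b unfolding action_def n_def[symmetric]
    by (auto simp: ennreal_mult_eq_top_iff less_top[symmetric])
  then have int: "integrable ?T (\<lambda>t. (h t)\<^sup>2)" "integrable ?T n"
    using n_meas n_nonneg by (auto intro!: integrableI_nonneg)
  have action: "action K \<pi> a b \<mu> \<psi> h = ennreal (a\<^sup>2 * (\<integral>t. (h t)\<^sup>2 \<partial>?T) + b\<^sup>2 * (\<integral>t. n t \<partial>?T))"
    unfolding action_def n_def[symmetric]
    using int n_nonneg by (simp add: nn_integral_eq_integral ennreal_mult'' ennreal_plus integral_nonneg_AE)
  define P where "P t = (pairing \<pi> (\<phi> t) p)\<^sup>2" for t
  have "continuous_on {0..1} P"
    unfolding P_def pairing_def by (intro continuous_intros C1_with_derivative_continuous[OF C1])
  then have int_P: "integrable ?T P"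
    by (rule continuous_imp_integrable_real)
  define F where "F t = a\<^sup>2 / 2 * (h t)\<^sup>2 + b\<^sup>2 / 2 * n t + 1 / (2 * a\<^sup>2) * P t" for t
  have int_F: "integrable ?T F"
    unfolding F_def by (intro Bochner_Integration.integrable_add integrable_mult_right int int_P)
  have val_F: "(\<integral>t. F t \<partial>?T) = a\<^sup>2 / 2 * (\<integral>t. (h t)\<^sup>2 \<partial>?T) + b\<^sup>2 / 2 * (\<integral>t. n t \<partial>?T) + 1 / (2 * a\<^sup>2) * (\<integral>t. P t \<partial>?T)"
    unfolding F_def using int int_P by simp
  have F_int: "(F has_integral (\<integral>t. F t \<partial>?T)) {0..1}"
    by (rule has_integral_integral_lebesgue_on[OF int_F]) simp
  obtain N1 where N1: "negligible N1" "\<And>t. t \<in> {0..1} - N1 \<Longrightarrow> \<forall>x. \<exists>d.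
        ((\<lambda>s. \<mu> s x) has_real_derivative d) (at t within {0..1}) \<and>
        d + (\<Sum>y\<in>UNIV. (\<psi> t y - \<psi> t x) * mean_density (\<mu> t) x y * K x y) = h t * p x"
    using adm by (auto simp: admissible_def elim!: AE_lebesgue_on_negligible)
  obtain N2 where N2: "negligible N2" "\<And>t. t \<in> {0<..<1} - N2 \<Longrightarrow> \<forall>\<nu>\<in>densities.
        pairing \<pi> (\<phi>' t) \<nu> + 1 / (2 * b\<^sup>2) * norm_sq K \<pi> \<nu> (grad (\<phi> t)) \<le> 0"
    using HJ by (auto simp: HJ_inequality_def elim!: AE_lebesgue_on_negligible)
  define m where "m t x = h t * p x - divergence K (\<mu> t) (\<psi> t) x" for t x
  have der_\<mu>: "((\<lambda>s. \<mu> s x) has_real_derivative m t x) (at t within {0..1})" if t: "t \<in> {0..1} - N1" for t x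
  proof -
    obtain d where "((\<lambda>s. \<mu> s x) has_real_derivative d) (at t within {0..1})"
      "d + divergence K (\<mu> t) (\<psi> t) x = h t * p x"
      using N1(2)[OF t] unfolding divergence_def by blast
    then show ?thesis by (simp add: m_def eq_diff_eq[symmetric])
  qed
  define G where "G t = pairing \<pi> (\<phi>' t) (\<mu> t) + pairing \<pi> (\<phi> t) (m t)" for t
  have "((\<lambda>t. \<phi>' t x * \<mu> t x + \<phi> t x * m t x) has_integral (\<phi> 1 x * \<mu> 1 x - \<phi> 0 x * \<mu> 0 x)) {0..1}" for x
  proof (rule abs_continuous_has_integral[OF _ _ N1(1)])
    obtain L where L: "0 \<le> L" "\<And>u v. \<lbrakk>0 \<le> u; u \<le> v; v \<le> 1\<rbrakk> \<Longrightarrow> \<bar>\<phi> v x - \<phi> u x\<bar> \<le> L * (v - u)"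
      using C1_with_derivative_lipschitz[OF C1] by metis
    have "bounded ((\<lambda>t. \<phi> t x) ` {0..1})" "bounded ((\<lambda>t. \<mu> t x) ` {0..1})"
      using cont_\<mu> C1_with_derivative_continuous[OF C1]
      by (auto intro!: compact_imp_bounded compact_continuous_image)
    then obtain M1 M2 where "\<forall>t\<in>{0..1}. \<bar>\<phi> t x\<bar> \<le> M1" "\<forall>t\<in>{0..1}. \<bar>\<mu> t x\<bar> \<le> M2"
      unfolding bounded_iff by auto
    then have M: "\<bar>\<phi> t x\<bar> \<le> M1" "\<bar>\<mu> t x\<bar> \<le> M2" if "t \<in> {0..1}" for t
      using that by blast+
    show "abs_continuous_on_interval 0 1 (\<lambda>t. \<phi> t x * \<mu> t x)"
    proof (rule abs_continuous_mult_C1[OF _ AC L(2)])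
      show "\<bar>\<phi> t x\<bar> \<le> max 1 (max M1 M2)" "\<bar>\<mu> t x\<bar> \<le> max 1 (max M1 M2)" if "t \<in> {0..1}" for t
        using M[OF that] by linarith+
    qed (use L in auto)
    show "((\<lambda>t. \<phi> t x * \<mu> t x) has_real_derivative \<phi>' t x * \<mu> t x + \<phi> t x * m t x) (at t within {0..1})"
      if "t \<in> {0..1} - N1" for t
    proof -
      have "((\<lambda>t. \<phi> t x) has_real_derivative \<phi>' t x) (at t within {0..1})"
        using C1[of x] that by (simp add: C1_with_derivative_def)
      then show ?thesis
        unfolding add.commute[of "\<phi>' t x * \<mu> t x"] by (rule DERIV_mult'[OF _ der_\<mu>[OF that]])
    qed
  qed simp
  then have "((\<lambda>t. \<Sum>x\<in>UNIV. (\<phi>' t x * \<mu> t x + \<phi> t x * m t x) * \<pi> x) has_integral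
      (\<Sum>x\<in>UNIV. (\<phi> 1 x * \<mu> 1 x - \<phi> 0 x * \<mu> 0 x) * \<pi> x)) {0..1}"
    by (intro has_integral_sum has_integral_mult_left) auto
  then have G_int: "(G has_integral (pairing \<pi> (\<phi> 1) \<mu>\<^sub>1 - pairing \<pi> (\<phi> 0) \<mu>\<^sub>0)) {0..1}"
    by (simp add: G_def[abs_def] pairing_def ends algebra_simps sum.distrib sum_subtractf)
  define N where "N = N1 \<union> N2 \<union> {0, 1}"
  have N: "negligible N" using N1(1) N2(1) by (simp add: N_def negligible_Un)
  have "((\<lambda>t. if t \<in> N then G t else F t) has_integral (\<integral>t. F t \<partial>?T)) {0..1}"
    by (rule has_integral_spike[OF N _ F_int]) auto
  then have "pairing \<pi> (\<phi> 1) \<mu>\<^sub>1 - pairing \<pi> (\<phi> 0) \<mu>\<^sub>0 \<le> (\<integral>t. F t \<partial>?T)"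
  proof (rule has_integral_le[OF G_int])
    fix t :: real assume t: "t \<in> {0..1}"
    show "G t \<le> (if t \<in> N then G t else F t)"
    proof (cases "t \<in> N")
      case False
      then have "pairing \<pi> (\<phi>' t) (\<mu> t) + 1 / (2 * b\<^sup>2) * energy K \<pi> (\<mu> t) (\<phi> t) (\<phi> t) \<le> 0"
        using N2(2)[of t] t dens[OF t] by (auto simp: N_def norm_sq_grad)
      then show ?thesis
        using integrand_bound[OF dens[OF t] a b, of "\<phi>' t" "\<phi> t" "h t" p "\<psi> t"] False
        by (simp add: G_def m_def[abs_def] F_def n_def P_def norm_sq_grad)
    qed simp
  qed
  then have "2 * dual_functional \<pi> a p \<mu>\<^sub>0 \<mu>\<^sub>1 \<phi> \<le> a\<^sup>2 * (\<integral>t. (h t)\<^sup>2 \<partial>?T) + b\<^sup>2 * (\<integral>t. n t \<partial>?T)"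
    unfolding val_F dual_functional_def P_def[symmetric] by simp
  then show ?thesis unfolding action by (rule ennreal_leI)
qed simp

end

section \<open>Hamilton--Jacobi subsolutions in integrated form\<close>

subsection \<open>Weak derivatives and increments\<close>

text \<open>The integral of the hat function on \<open>[0, 2]\<close>, written with truncated squares so that it is
  continuously differentiable by a single differentiation rule.\<close>

definition smooth_step :: "real \<Rightarrow> real" where
  "smooth_step z = ((max 0 z)\<^sup>2 - 2 * (max 0 (z - 1))\<^sup>2 + (max 0 (z - 2))\<^sup>2) / 2"

definition hat :: "real \<Rightarrow> real" where
  "hat z = max 0 z - 2 * max 0 (z - 1) + max 0 (z - 2)"

lemma truncated_square_deriv:
  "((\<lambda>z::real. (max 0 z)\<^sup>2) has_real_derivative 2 * max 0 z) (at z)"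
proof -
  consider "z < 0" | "z = 0" | "0 < z" by linarith
  then show ?thesis
  proof cases
    case 1
    have "((\<lambda>z::real. 0) has_real_derivative 0) (at z)" by simp
    then have "((\<lambda>z::real. (max 0 z)\<^sup>2) has_real_derivative 0) (at z)"
      by (rule has_field_derivative_transform_within_open[of _ _ _ "{..<0}"]) (use 1 in auto)
    then show ?thesis using 1 by simp
  next
    case 2
    have "((\<lambda>y. ((max 0 y)\<^sup>2 - (max 0 0)\<^sup>2) / (y - 0)) \<longlongrightarrow> 0) (at (0::real))"
    proof (rule Lim_null_comparison)
      show "\<forall>\<^sub>F y in at (0::real). norm (((max 0 y)\<^sup>2 - (max 0 0)\<^sup>2) / (y - 0)) \<le> \<bar>y\<bar>"
        by (auto simp: max_def power2_eq_square)
      show "((\<lambda>y::real. \<bar>y\<bar>) \<longlongrightarrow> 0) (at 0)"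
        by (rule tendsto_eq_intros refl | simp)+
    qed
    then show ?thesis using 2 by (simp add: has_field_derivative_iff)
  next
    case 3
    have "((\<lambda>z::real. z\<^sup>2) has_real_derivative 2 * z) (at z)"
      by (auto intro!: derivative_eq_intros)
    then have "((\<lambda>z::real. (max 0 z)\<^sup>2) has_real_derivative 2 * z) (at z)"
      by (rule has_field_derivative_transform_within_open[of _ _ _ "{0<..}"]) (use 3 in auto)
    then show ?thesis using 3 by simp
  qed
qed

lemma smooth_step_deriv: "(smooth_step has_real_derivative hat z) (at z)"
proof -
  have sq: "((\<lambda>z. (max 0 (z - c))\<^sup>2) has_real_derivative 2 * max 0 (z - c)) (at z)" for c :: real
  proof -
    have "((\<lambda>z. z - c) has_real_derivative 1) (at z)"
      by (auto intro!: derivative_eq_intros)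
    then show ?thesis
      using DERIV_chain2[of "\<lambda>z. (max 0 z)\<^sup>2" "2 * max 0 (z - c)" "\<lambda>z. z - c" z 1 UNIV]
        truncated_square_deriv[of "z - c"] by simp
  qed
  show ?thesis
    unfolding smooth_step_def[abs_def] hat_def
    by (rule DERIV_cong[OF DERIV_cdivide[OF DERIV_add[OF DERIV_diff[OF truncated_square_deriv
          DERIV_cmult[OF sq]] sq]]]) (simp add: field_simps)
qed

lemma continuous_hat: "continuous_on S hat"
  unfolding hat_def[abs_def] by (intro continuous_intros)

lemma hat_nonneg: "0 \<le> hat z" and hat_outside: "z \<notin> {0..2} \<Longrightarrow> hat z = 0"
  by (auto simp: hat_def max_def)

lemma smooth_step_low: "z \<le> 0 \<Longrightarrow> smooth_step z = 0"
  and smooth_step_high: "2 \<le> z \<Longrightarrow> smooth_step z = 1"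
  by (auto simp: smooth_step_def max_def power2_eq_square field_simps)

lemma smooth_step_mono: "y \<le> z \<Longrightarrow> smooth_step y \<le> smooth_step z"
  by (rule DERIV_nonneg_imp_nondecreasing) (use smooth_step_deriv hat_nonneg in blast)+

lemma smooth_step_bounds: "0 \<le> smooth_step z" "smooth_step z \<le> 1"
  using smooth_step_mono[of "min z 0" z] smooth_step_mono[of z "max z 2"]
  by (auto simp: smooth_step_low smooth_step_high min_def max_def split: if_splits)

lemma scaled_step_deriv:
  "((\<lambda>r. smooth_step (n * (r - s))) has_real_derivative n * hat (n * (r - s))) (at r)"
proof -
  have "((\<lambda>r. n * (r - s)) has_real_derivative n) (at r)"
    by (auto intro!: derivative_eq_intros)
  then show ?thesis
    using DERIV_chain2[of smooth_step "hat (n * (r - s))" "\<lambda>r. n * (r - s)" r n UNIV]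
      smooth_step_deriv by (simp add: mult.commute)
qed

lemma hat_approximate_identity:
  assumes f: "continuous_on {0..1} f" and s: "0 \<le> s" "s < 1"
  shows "(\<lambda>n. integral {0..1} (\<lambda>r. f r * (real n * hat (real n * (r - s))))) \<longlonglongrightarrow> f s"
proof (rule LIMSEQ_I)
  fix e :: real assume e: "0 < e"
  obtain d where d: "0 < d" "\<And>r. \<lbrakk>r \<in> {0..1}; \<bar>r - s\<bar> < d\<rbrakk> \<Longrightarrow> \<bar>f r - f s\<bar> < e / 2"
    using f e s unfolding continuous_on_iff dist_real_def
    by (metis atLeastAtMost_iff half_gt_zero less_imp_le)
  \<comment> \<open>the hat scaled by \<open>n\<close> lives on \<open>[s, s + 2 / n]\<close>, which has to lie in \<open>[0, 1]\<close> and within \<open>d\<close> of \<open>s\<close>\<close>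
  define N where "N = nat \<lceil>3 / min d (1 - s)\<rceil>"
  have "norm (integral {0..1} (\<lambda>r. f r * (real n * hat (real n * (r - s)))) - f s) < e" if n: "N \<le> n" for n
  proof -
    have m: "0 < min d (1 - s)" using d s by simp
    have "3 / min d (1 - s) \<le> real n" using n unfolding N_def by linarith
    then have "3 \<le> real n * min d (1 - s)" using m by (simp add: pos_divide_le_eq)
    moreover have "real n * min d (1 - s) \<le> real n * d" "real n * min d (1 - s) \<le> real n * (1 - s)"
      by (intro mult_left_mono; simp)+
    ultimately have nn: "3 \<le> real n * d" "3 \<le> real n * (1 - s)" by linarith+
    have n0: "0 < real n"
    proof (rule ccontr)
      assume "\<not> 0 < real n"
      then show False using nn by simp
    qed
    define k where "k r = real n * hat (real n * (r - s))" for r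
    have "(k has_integral (smooth_step (real n * (1 - s)) - smooth_step (real n * (0 - s)))) {0..1}"
      unfolding k_def[abs_def]
      by (rule fundamental_theorem_of_calculus)
        (auto simp flip: has_real_derivative_iff_has_vector_derivative
          intro: has_field_derivative_at_within[OF scaled_step_deriv])
    moreover have "smooth_step (real n * (1 - s)) = 1" "smooth_step (real n * (0 - s)) = 0"
      using nn s by (auto intro!: smooth_step_high smooth_step_low mult_nonneg_nonpos)
    ultimately have k1: "(k has_integral 1) {0..1}" by simp
    have kc: "continuous_on {0..1} k"
      unfolding k_def by (intro continuous_intros continuous_on_compose2[OF continuous_hat[of UNIV]]) auto
    have fk: "(\<lambda>r. f r * k r) integrable_on {0..1}"
      by (intro integrable_continuous_interval continuous_intros f kc)
    have diff: "((\<lambda>r. f r * k r - f s * k r) has_integral (integral {0..1} (\<lambda>r. f r * k r) - f s * 1)) {0..1}"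
      by (intro has_integral_diff integrable_integral fk has_integral_mult_right k1)
    have bnd: "((\<lambda>r. e / 2 * k r) has_integral (e / 2 * 1)) {0..1}"
      by (intro has_integral_mult_right k1)
    have "norm (integral {0..1} (\<lambda>r. f r * k r) - f s * 1) \<le> e / 2 * 1"
    proof -
      have "\<bar>f r * k r - f s * k r\<bar> \<le> e / 2 * k r" if r: "r \<in> {0..1}" for r
      proof (cases "k r = 0")
        case False
        then have "real n * (r - s) \<in> {0..2}"
          using hat_outside by (auto simp: k_def)
        moreover from this have "0 \<le> r - s" using n0 by (auto simp: zero_le_mult_iff)
        ultimately have "real n * \<bar>r - s\<bar> < real n * d"
          using nn by simp
        then have "\<bar>r - s\<bar> < d" using n0 by (simp only: mult_less_cancel_left_pos)
        then have "\<bar>f r - f s\<bar> \<le> e / 2" using d(2)[OF r] by fastforce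
        moreover have "0 \<le> k r" by (simp add: k_def hat_nonneg)
        ultimately show ?thesis
          by (metis abs_mult abs_of_nonneg left_diff_distrib mult_right_mono)
      qed simp
      then have "norm (integral {0..1} (\<lambda>r. f r * k r - f s * k r)) \<le> integral {0..1} (\<lambda>r. e / 2 * k r)"
        using diff bnd by (intro integral_norm_bound_integral) (auto intro: has_integral_integrable)
      then show ?thesis
        unfolding integral_unique[OF diff] integral_unique[OF bnd] .
    qed
    then show ?thesis using e by (simp add: k_def)
  qed
  then show "\<exists>N. \<forall>n\<ge>N. norm (integral {0..1} (\<lambda>r. f r * (real n * hat (real n * (r - s)))) - f s) < e"
    by blast
qed

lemma square_integrable_imp_integrable:
  assumes "square_integrable g"
  shows "integrable (lebesgue_on {0<..<1}) g"
proof -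
  have m: "g \<in> borel_measurable (lebesgue_on {0<..<1})" and i: "integrable (lebesgue_on {0<..<1}) (\<lambda>t. (g t)\<^sup>2)"
    using assms by (auto simp: square_integrable_def)
  have "finite_measure (lebesgue_on {0<..<1::real})"
    by (intro finite_measure_lebesgue_on) simp
  then have "integrable (lebesgue_on {0<..<1::real}) (\<lambda>_. 1::real)"
    using finite_measure.integrable_const by blast
  then have "integrable (lebesgue_on {0<..<1}) (\<lambda>t. 1 + (g t)\<^sup>2)"
    using i by (rule Bochner_Integration.integrable_add)
  then show ?thesis
  proof (rule Bochner_Integration.integrable_bound[OF _ m])
    have "\<bar>g t\<bar> \<le> 1 + (g t)\<^sup>2" for t
      using zero_le_power2[of "\<bar>g t\<bar> - 1 / 2"] by (simp add: power2_eq_square algebra_simps)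
    then show "AE t in lebesgue_on {0<..<1}. norm (g t) \<le> norm (1 + (g t)\<^sup>2)"
      by (simp add: add_nonneg_nonneg)
  qed
qed

lemma continuous_lebesgue_integral:
  assumes "continuous_on {0..1} (f :: real \<Rightarrow> real)"
  shows "integrable (lebesgue_on {0<..<1}) f" "(\<integral>t. f t \<partial>lebesgue_on {0<..<1}) = integral {0..1} f"
proof -
  have "f absolutely_integrable_on {0<..<1}"
    using absolutely_integrable_continuous_real[OF assms] by (simp add: absolutely_integrable_on_Icc_iff_Ioo)
  then show i: "integrable (lebesgue_on {0<..<1}) f"
    by (simp add: integrable_restrict_space set_integrable_def)
  then have "(\<integral>t. f t \<partial>lebesgue_on {0<..<1}) = integral {0<..<1} f"
    by (rule lebesgue_integral_eq_integral) simp
  then show "(\<integral>t. f t \<partial>lebesgue_on {0<..<1}) = integral {0..1} f"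
    by (simp add: integral_open_interval_real)
qed

lemma C1_imp_H1:
  assumes "C1_with_derivative f g"
  shows "H1_with_derivative f g"
proof -
  have f: "continuous_on {0..1} f" using assms by (rule C1_with_derivative_continuous)
  have g: "continuous_on {0..1} g" using assms by (simp add: C1_with_derivative_def)
  have sq: "square_integrable h" if h: "continuous_on {0..1} h" for h
    unfolding square_integrable_def
    using borel_measurable_integrable[OF continuous_lebesgue_integral(1)[OF h]]
      continuous_lebesgue_integral(1)[OF continuous_on_power[OF h]] by blast
  have "weak_derivative f g"
    unfolding weak_derivative_def
  proof (intro allI impI)
    fix \<eta> \<eta>' :: "real \<Rightarrow> real"
    assume d: "\<forall>t. (\<eta> has_real_derivative \<eta>' t) (at t)" and c: "continuous_on UNIV \<eta>'"
      and supp: "\<exists>c d. 0 < c \<and> d < 1 \<and> (\<forall>t. t \<notin> {c..d} \<longrightarrow> \<eta> t = 0)"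
    have ends: "\<eta> 0 = 0" "\<eta> 1 = 0" using supp by auto
    have c\<eta>: "continuous_on {0..1} \<eta>"
      using d by (intro DERIV_continuous_on[OF has_field_derivative_at_within[of \<eta> "\<eta>' t" for t]]) blast
    have c\<eta>': "continuous_on {0..1} \<eta>'" using c by (rule continuous_on_subset) simp
    have c1: "continuous_on {0..1} (\<lambda>t. f t * \<eta>' t)" and c2: "continuous_on {0..1} (\<lambda>t. g t * \<eta> t)"
      by (intro continuous_on_mult f g c\<eta> c\<eta>')+
    have "((\<lambda>t. f t * \<eta>' t + g t * \<eta> t) has_integral (f 1 * \<eta> 1 - f 0 * \<eta> 0)) {0..1}"
    proof (rule fundamental_theorem_of_calculus)
      fix t :: real assume t: "t \<in> {0..1}"
      have "(f has_real_derivative g t) (at t within {0..1})" using assms t by (simp add: C1_with_derivative_def)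
      moreover have "(\<eta> has_real_derivative \<eta>' t) (at t within {0..1})"
        using d[rule_format] by (rule has_field_derivative_at_within)
      ultimately have "((\<lambda>t. f t * \<eta> t) has_real_derivative g t * \<eta> t + \<eta>' t * f t) (at t within {0..1})"
        by (rule DERIV_mult)
      then show "((\<lambda>t. f t * \<eta> t) has_vector_derivative f t * \<eta>' t + g t * \<eta> t) (at t within {0..1})"
        by (simp add: has_real_derivative_iff_has_vector_derivative mult.commute add.commute)
    qed simp
    then have "integral {0..1} (\<lambda>t. f t * \<eta>' t + g t * \<eta> t) = 0"
      unfolding ends by (simp add: integral_unique)
    also have "integral {0..1} (\<lambda>t. f t * \<eta>' t + g t * \<eta> t)
        = integral {0..1} (\<lambda>t. f t * \<eta>' t) + integral {0..1} (\<lambda>t. g t * \<eta> t)"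
      by (intro Henstock_Kurzweil_Integration.integral_add integrable_continuous_interval c1 c2)
    finally show "(\<integral>t. f t * \<eta>' t \<partial>lebesgue_on {0<..<1}) = - (\<integral>t. g t * \<eta> t \<partial>lebesgue_on {0<..<1})"
      unfolding continuous_lebesgue_integral(2)[OF c1] continuous_lebesgue_integral(2)[OF c2] by linarith
  qed
  then show ?thesis using f sq[OF f] sq[OF g] by (simp add: H1_with_derivative_def)
qed

text \<open>The weak derivative is tested with a smooth approximation of the indicator of \<open>[s, t]\<close>, whose
  derivative is the difference of two approximate identities.\<close>

lemma weak_derivative_increment:
  assumes H1: "H1_with_derivative f g" and st: "0 < s" "s < t" "t < 1"
  shows "(g has_integral (f t - f s)) {s..t}"
proof -
  let ?L = "lebesgue_on {0<..<1::real}"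
  have f: "continuous_on {0..1} f" and wd: "weak_derivative f g"
    using H1 by (auto simp: H1_with_derivative_def)
  have g: "integrable ?L g"
    using H1 by (intro square_integrable_imp_integrable) (simp add: H1_with_derivative_def)
  define \<eta> where "\<eta> n r = smooth_step (real n * (r - s)) - smooth_step (real n * (r - t))" for n r
  define \<eta>' where "\<eta>' n r = real n * hat (real n * (r - s)) - real n * hat (real n * (r - t))" for n r
  have cont_hat: "continuous_on S (\<lambda>r. real n * hat (real n * (r - c)))" for S n c
    by (intro continuous_intros continuous_on_compose2[OF continuous_hat[of UNIV]]) auto
  obtain N where N: "2 \<le> real N * (1 - t) / 2"
  proof -
    obtain N :: nat where "4 / (1 - t) < real N" using reals_Archimedean2 by blast
    then show ?thesis using st by (intro that[of N]) (simp add: field_simps)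
  qed
  have test: "(\<integral>r. f r * \<eta>' n r \<partial>?L) = - (\<integral>r. g r * \<eta> n r \<partial>?L)" if n: "N \<le> n" for n
  proof (rule wd[unfolded weak_derivative_def, rule_format])
    show "(\<eta> n has_real_derivative \<eta>' n r) (at r)" for r
      unfolding \<eta>_def[abs_def] \<eta>'_def by (intro DERIV_diff scaled_step_deriv)
    show "continuous_on UNIV (\<eta>' n)"
      unfolding \<eta>'_def[abs_def] by (intro continuous_on_diff cont_hat)
    have "real N * (1 - t) / 2 \<le> real n * (1 - t) / 2"
      using n st by (simp add: mult_right_mono)
    then have n2: "2 \<le> real n * ((1 - t) / 2)" using N by simp
    show "\<exists>c d. 0 < c \<and> d < 1 \<and> (\<forall>r. r \<notin> {c..d} \<longrightarrow> \<eta> n r = 0)"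
    proof (intro exI conjI allI impI)
      show "0 < s" "(1 + t) / 2 < 1" using st by simp_all
      fix r assume "r \<notin> {s..(1 + t) / 2}"
      then consider "r < s" | "(1 + t) / 2 < r" by force
      then show "\<eta> n r = 0"
      proof cases
        case 1
        then show ?thesis
          using st by (simp add: \<eta>_def smooth_step_low mult_nonneg_nonpos)
      next
        case 2
        have "real n * ((1 - t) / 2) \<le> real n * (r - t)" "real n * (r - t) \<le> real n * (r - s)"
          using 2 st by (intro mult_left_mono; simp add: field_simps)+
        then show ?thesis
          using n2 by (simp add: \<eta>_def smooth_step_high)
      qed
    qed
  qed
  have "(\<lambda>n. - (\<integral>r. g r * \<eta> n r \<partial>?L)) \<longlonglongrightarrow> f s - f t"
  proof (rule Lim_transform_eventually)
    show "(\<lambda>n. integral {0..1} (\<lambda>r. f r * (real n * hat (real n * (r - s))))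
        - integral {0..1} (\<lambda>r. f r * (real n * hat (real n * (r - t))))) \<longlonglongrightarrow> f s - f t"
      using st by (intro tendsto_diff hat_approximate_identity f) auto
    have "integral {0..1} (\<lambda>r. f r * (real n * hat (real n * (r - s))))
        - integral {0..1} (\<lambda>r. f r * (real n * hat (real n * (r - t)))) = - (\<integral>r. g r * \<eta> n r \<partial>?L)"
      if n: "N \<le> n" for n
    proof -
      have c: "continuous_on {0..1} (\<lambda>r. f r * \<eta>' n r)"
        unfolding \<eta>'_def by (intro continuous_on_mult continuous_on_diff cont_hat f)
      have "(\<integral>r. f r * \<eta>' n r \<partial>?L) = integral {0..1} (\<lambda>r. f r * \<eta>' n r)"
        by (rule continuous_lebesgue_integral(2)[OF c])
      also have "\<dots> = integral {0..1} (\<lambda>r. f r * (real n * hat (real n * (r - s))))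
        - integral {0..1} (\<lambda>r. f r * (real n * hat (real n * (r - t))))"
        unfolding \<eta>'_def right_diff_distrib[of "f _"]
        by (intro Henstock_Kurzweil_Integration.integral_diff; intro integrable_continuous_interval
            continuous_on_mult[OF f cont_hat])
      finally show ?thesis using test[OF n] by simp
    qed
    then show "\<forall>\<^sub>F n in sequentially. integral {0..1} (\<lambda>r. f r * (real n * hat (real n * (r - s))))
        - integral {0..1} (\<lambda>r. f r * (real n * hat (real n * (r - t)))) = - (\<integral>r. g r * \<eta> n r \<partial>?L)"
      by (auto simp: eventually_sequentially)
  qed
  moreover have gm: "g \<in> borel_measurable ?L" using g by (rule borel_measurable_integrable)
  moreover have ind: "(\<lambda>r. g r * indicator {s<..t} r) \<in> borel_measurable ?L"
    using st by (intro borel_measurable_times[OF gm] borel_measurable_indicator) (auto simp: sets_restrict_space_iff)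
  moreover have "(\<lambda>n. \<integral>r. g r * \<eta> n r \<partial>?L) \<longlonglongrightarrow> (\<integral>r. g r * indicator {s<..t} r \<partial>?L)"
  proof (rule integral_dominated_convergence)
    have "continuous_on UNIV (\<eta> n)" for n
      unfolding \<eta>_def[abs_def]
      by (intro continuous_on_diff DERIV_continuous_on[OF has_field_derivative_at_within[OF scaled_step_deriv]])
    then have "\<eta> n \<in> borel_measurable ?L" for n
      by (intro continuous_imp_measurable_on_sets_lebesgue) (auto intro: continuous_on_subset)
    then show "(\<lambda>r. g r * \<eta> n r) \<in> borel_measurable ?L" for n
      using gm by measurable
    show "(\<lambda>r. g r * indicator {s<..t} r) \<in> borel_measurable ?L"
      by (rule ind)
    show "integrable ?L (\<lambda>r. \<bar>g r\<bar>)" using g by (rule integrable_abs)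
    have "\<bar>\<eta> n r\<bar> \<le> 1" for n r
      using smooth_step_bounds[of "real n * (r - s)"] smooth_step_bounds[of "real n * (r - t)"]
      by (simp add: \<eta>_def abs_le_iff)
    then show "AE r in ?L. norm (g r * \<eta> n r) \<le> \<bar>g r\<bar>" for n
      by (simp add: abs_mult mult_left_le)
    have step_lim: "(\<lambda>n. smooth_step (real n * (r - c))) \<longlonglongrightarrow> (if c < r then 1 else 0)" for r c
    proof (cases "c < r")
      case True
      obtain M :: nat where M: "2 / (r - c) < real M" using reals_Archimedean2 by blast
      have "smooth_step (real n * (r - c)) = 1" if "M \<le> n" for n
      proof -
        have "2 < real M * (r - c)" using M True by (simp add: field_simps)
        also have "\<dots> \<le> real n * (r - c)" using that True by (intro mult_right_mono) auto
        finally show ?thesis by (simp add: smooth_step_high)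
      qed
      then show ?thesis using True
        by (intro tendsto_eventually) (auto simp: eventually_sequentially)
    next
      case False
      then show ?thesis by (simp add: smooth_step_low mult_nonneg_nonpos)
    qed
    have "(\<lambda>n. \<eta> n r) \<longlonglongrightarrow> indicator {s<..t} r" for r
    proof -
      have "(\<lambda>n. \<eta> n r) \<longlonglongrightarrow> (if s < r then 1 else 0) - (if t < r then 1 else 0)"
        unfolding \<eta>_def by (intro tendsto_diff step_lim)
      also have "(if s < r then 1 else 0) - (if t < r then 1 else 0) = (indicator {s<..t} r :: real)"
        using st by (auto simp: indicator_def)
      finally show ?thesis .
    qed
    then show "AE r in ?L. (\<lambda>n. g r * \<eta> n r) \<longlonglongrightarrow> g r * indicator {s<..t} r"
      by (intro AE_I2 tendsto_mult tendsto_const)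
  qed
  ultimately have "f s - f t = - (\<integral>r. g r * indicator {s<..t} r \<partial>?L)"
    by (intro LIMSEQ_unique[of "\<lambda>n. - (\<integral>r. g r * \<eta> n r \<partial>?L)"] tendsto_minus)
  moreover have "(g has_integral (\<integral>r. g r * indicator {s<..t} r \<partial>?L)) {s..t}"
  proof -
    have "integrable ?L (\<lambda>r. g r * indicator {s<..t} r)"
      by (rule Bochner_Integration.integrable_bound[OF g ind]) (auto simp: indicator_def intro!: AE_I2)
    then have "((\<lambda>r. g r * indicator {s<..t} r) has_integral (\<integral>r. g r * indicator {s<..t} r \<partial>?L)) {0<..<1}"
      by (rule has_integral_integral_lebesgue_on) (rule lmeasurable_interval(2)[THEN fmeasurableD])
    moreover have "(\<lambda>r. g r * indicator {s<..t} r) = (\<lambda>r. if r \<in> {s<..t} then g r else 0)"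
      by (auto simp: indicator_def)
    ultimately have "((\<lambda>r. if r \<in> {s<..t} then g r else 0) has_integral
        (\<integral>r. g r * indicator {s<..t} r \<partial>?L)) {0<..<1}"
      by metis
    then have "(g has_integral (\<integral>r. g r * indicator {s<..t} r \<partial>?L)) {s<..t}"
      using st by (subst (asm) has_integral_restrict) auto
    moreover have "(g has_integral y) {s<..t} \<longleftrightarrow> (g has_integral y) {s..t}" for y
      by (rule has_integral_spike_set_eq) (rule negligible_subset[of "{s}"]; force)+
    ultimately show ?thesis by blast
  qed
  ultimately show ?thesis by (metis minus_diff_eq neg_equal_iff_equal)
qed

subsection \<open>The integrated inequality\<close>

text \<open>Tested against a fixed density, the inequality of a subsolution integrates over any
  subinterval. The integrated form needs no derivative, holds for subsolutions of either class, and
  is stable under averaging in time.\<close>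

definition integrated_HJ ::
  "('x::finite \<Rightarrow> 'x \<Rightarrow> real) \<Rightarrow> ('x \<Rightarrow> real) \<Rightarrow> real \<Rightarrow> (real \<Rightarrow> 'x \<Rightarrow> real) \<Rightarrow> bool" where
  "integrated_HJ K \<pi> b \<phi> \<longleftrightarrow> (\<forall>x. continuous_on {0..1} (\<lambda>t. \<phi> t x)) \<and>
     (\<forall>\<nu>\<in>densities. \<forall>s t. 0 < s \<longrightarrow> s < t \<longrightarrow> t < 1 \<longrightarrow>
        pairing \<pi> (\<lambda>x. \<phi> t x - \<phi> s x) \<nu>
          + 1 / (2 * b\<^sup>2) * integral {s..t} (\<lambda>r. energy K \<pi> \<nu> (\<phi> r) (\<phi> r)) \<le> 0)"

context reversible_chain
begin

lemma continuous_on_energy: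
  assumes "\<And>x. continuous_on S (\<lambda>t. \<phi> t x)" "\<And>x. continuous_on S (\<lambda>t. \<psi> t x)"
  shows "continuous_on S (\<lambda>t. energy K \<pi> \<nu> (\<phi> t) (\<psi> t))"
  unfolding energy_def grad_def by (intro continuous_intros assms)

lemma continuous_on_pairing_left:
  assumes "\<And>x. continuous_on S (\<lambda>t. \<phi> t x)"
  shows "continuous_on S (\<lambda>t. pairing \<pi> (\<phi> t) \<nu>)"
  unfolding pairing_def by (intro continuous_intros assms)

lemma HJ_subsolution_integrated:
  assumes \<phi>: "\<phi> \<in> HJ_subsolutions K \<pi> b"
  shows "integrated_HJ K \<pi> b \<phi>"
proof -
  obtain \<phi>' where H1: "\<And>x. H1_with_derivative (\<lambda>t. \<phi> t x) (\<lambda>t. \<phi>' t x)" and HJ: "HJ_inequality K \<pi> b \<phi> \<phi>'"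
    using \<phi> by (auto simp: HJ_subsolutions_def)
  have cont: "continuous_on {0..1} (\<lambda>t. \<phi> t x)" for x
    using H1 by (simp add: H1_with_derivative_def)
  obtain N where N: "negligible N" "\<And>t. t \<in> {0<..<1} - N \<Longrightarrow> \<forall>\<nu>\<in>densities.
        pairing \<pi> (\<phi>' t) \<nu> + 1 / (2 * b\<^sup>2) * norm_sq K \<pi> \<nu> (grad (\<phi> t)) \<le> 0"
    using HJ by (auto simp: HJ_inequality_def elim!: AE_lebesgue_on_negligible)
  show ?thesis
    unfolding integrated_HJ_def
  proof (intro conjI allI ballI impI cont)
    fix \<nu> :: "'x \<Rightarrow> real" and s t :: real assume \<nu>: "\<nu> \<in> densities" and st: "0 < s" "s < t" "t < 1"
    define I where "I = integral {s..t} (\<lambda>r. energy K \<pi> \<nu> (\<phi> r) (\<phi> r))"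
    have "((\<lambda>r. \<Sum>x\<in>UNIV. \<phi>' r x * (\<nu> x * \<pi> x)) has_integral (\<Sum>x\<in>UNIV. (\<phi> t x - \<phi> s x) * (\<nu> x * \<pi> x))) {s..t}"
      by (intro has_integral_sum has_integral_mult_left weak_derivative_increment[OF H1 st]) auto
    then have lhs: "((\<lambda>r. pairing \<pi> (\<phi>' r) \<nu>) has_integral pairing \<pi> (\<lambda>x. \<phi> t x - \<phi> s x) \<nu>) {s..t}"
      by (simp add: pairing_def mult.assoc)
    have "continuous_on {s..t} (\<lambda>r. energy K \<pi> \<nu> (\<phi> r) (\<phi> r))"
      using st by (intro continuous_on_energy continuous_on_subset[OF cont]) auto
    then have "((\<lambda>r. - (1 / (2 * b\<^sup>2)) * energy K \<pi> \<nu> (\<phi> r) (\<phi> r)) has_integral - (1 / (2 * b\<^sup>2)) * I) {s..t}"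
      unfolding I_def by (intro has_integral_mult_right integrable_integral integrable_continuous_interval)
    then have "((\<lambda>r. if r \<in> N then pairing \<pi> (\<phi>' r) \<nu> else - (1 / (2 * b\<^sup>2)) * energy K \<pi> \<nu> (\<phi> r) (\<phi> r))
        has_integral - (1 / (2 * b\<^sup>2)) * I) {s..t}"
      by (rule has_integral_spike[OF N(1), rotated]) auto
    then have "pairing \<pi> (\<lambda>x. \<phi> t x - \<phi> s x) \<nu> \<le> - (1 / (2 * b\<^sup>2)) * I"
    proof (rule has_integral_le[OF lhs])
      fix r assume r: "r \<in> {s..t}"
      show "pairing \<pi> (\<phi>' r) \<nu> \<le> (if r \<in> N then pairing \<pi> (\<phi>' r) \<nu> else - (1 / (2 * b\<^sup>2)) * energy K \<pi> \<nu> (\<phi> r) (\<phi> r))"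
      proof (cases "r \<in> N")
        case False
        then have "pairing \<pi> (\<phi>' r) \<nu> + 1 / (2 * b\<^sup>2) * energy K \<pi> \<nu> (\<phi> r) (\<phi> r) \<le> 0"
          using N(2)[of r] r st \<nu> by (auto simp: norm_sq_grad)
        then show ?thesis using False by simp
      qed simp
    qed
    then show "pairing \<pi> (\<lambda>x. \<phi> t x - \<phi> s x) \<nu>
        + 1 / (2 * b\<^sup>2) * integral {s..t} (\<lambda>r. energy K \<pi> \<nu> (\<phi> r) (\<phi> r)) \<le> 0"
      by (simp add: I_def)
  qed
qed

subsection \<open>Averaging in time\<close>

definition time_average :: "real \<Rightarrow> (real \<Rightarrow> 'x \<Rightarrow> real) \<Rightarrow> real \<Rightarrow> 'x \<Rightarrow> real" where
  "time_average e \<phi> s x = integral {s..s + e} (\<lambda>r. \<phi> r x) / e"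

text \<open>Jensen's inequality for the quadratic form \<open>energy\<close>.\<close>

lemma energy_time_average:
  assumes \<nu>: "\<nu> \<in> densities" and e: "0 < e" and cont: "\<And>x. continuous_on {s..s + e} (\<lambda>t. \<phi> t x)"
  shows "energy K \<pi> \<nu> (time_average e \<phi> s) (time_average e \<phi> s)
    \<le> integral {s..s + e} (\<lambda>r. energy K \<pi> \<nu> (\<phi> r) (\<phi> r)) / e"
proof -
  let ?I = "{s..s + e}" and ?E = "energy K \<pi> \<nu>" and ?M = "time_average e \<phi> s"
  have "((\<lambda>r. \<Sum>x\<in>UNIV. \<phi> r x * (divergence K \<nu> ?M x * \<pi> x)) has_integral
      (\<Sum>x\<in>UNIV. (e * ?M x) * (divergence K \<nu> ?M x * \<pi> x))) ?I"
    using e by (intro has_integral_sum has_integral_mult_left)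
      (auto simp: time_average_def intro!: integrable_integral integrable_continuous_interval cont)
  then have "((\<lambda>r. pairing \<pi> (\<phi> r) (divergence K \<nu> ?M)) has_integral pairing \<pi> (\<lambda>x. e * ?M x) (divergence K \<nu> ?M)) ?I"
    by (simp add: pairing_def mult.assoc)
  from has_integral_neg[OF this] have lin: "((\<lambda>r. ?E (\<phi> r) ?M) has_integral e * ?E ?M ?M) ?I"
    by (simp add: pairing_divergence[OF \<nu>] energy_scale_left)
  have "((\<lambda>r. ?E (\<phi> r) (\<phi> r) - 2 * ?E (\<phi> r) ?M + ?E ?M ?M) has_integral
      (integral ?I (\<lambda>r. ?E (\<phi> r) (\<phi> r)) - 2 * (e * ?E ?M ?M) + e * ?E ?M ?M)) ?I"
    using e has_integral_const_real[of "?E ?M ?M" s "s + e"]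
    by (intro has_integral_add has_integral_diff has_integral_mult_right lin integrable_integral
        integrable_continuous_interval continuous_on_energy cont) simp
  then have "0 \<le> integral ?I (\<lambda>r. ?E (\<phi> r) (\<phi> r)) - 2 * (e * ?E ?M ?M) + e * ?E ?M ?M"
  proof (rule has_integral_nonneg)
    fix r
    show "0 \<le> ?E (\<phi> r) (\<phi> r) - 2 * ?E (\<phi> r) ?M + ?E ?M ?M"
      using energy_nonneg[of \<nu> "\<lambda>x. \<phi> r x + (- 1) * ?M x"] unfolding energy_perturb by simp
  qed
  then show ?thesis using e by (simp add: field_simps)
qed

text \<open>Averages over windows of length \<open>e\<close> inside \<open>(0, 1)\<close>. Squeezing the time axis by the
  factor \<open>c = 1 - 2 e\<close> multiplies the time derivative by \<open>c\<close>; the values are multiplied by \<open>c\<close> as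
  well, which makes both terms of the inequality scale like \<open>c\<^sup>2\<close>.\<close>

definition mollified :: "real \<Rightarrow> (real \<Rightarrow> 'x \<Rightarrow> real) \<Rightarrow> real \<Rightarrow> 'x \<Rightarrow> real" where
  "mollified e \<phi> t x = (1 - 2 * e) * time_average e \<phi> ((1 - 2 * e) * t + e / 2) x"

lemma mollified_subsolution:
  assumes \<phi>: "integrated_HJ K \<pi> b \<phi>" and e: "0 < e" "e < 1 / 4" and b: "0 < b"
  shows "mollified e \<phi> \<in> C1_HJ_subsolutions K \<pi> b"
proof -
  define c where "c = 1 - 2 * e"
  define w where "w t = c * t + e / 2" for t
  have c: "0 < c" using e by (simp add: c_def)
  have w: "0 < w t" "w t < w t + e" "w t + e < 1" if "t \<in> {0..1}" for t
  proof -
    have "0 \<le> c * t" using that c by simp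
    moreover have "c * t \<le> c * 1" using that c by (intro mult_left_mono) auto
    ultimately show "0 < w t" "w t < w t + e" "w t + e < 1" unfolding w_def using e c_def by linarith+
  qed
  have cont: "continuous_on {0..1} (\<lambda>t. \<phi> t x)" for x
    using \<phi> by (simp add: integrated_HJ_def)
  define \<phi>' where "\<phi>' t x = c * (c / e) * (\<phi> (w t + e) x - \<phi> (w t) x)" for t x
  have "C1_with_derivative (\<lambda>t. mollified e \<phi> t x) (\<lambda>t. \<phi>' t x)" for x
    unfolding C1_with_derivative_def
  proof (intro conjI ballI)
    fix t :: real assume t: "t \<in> {0..1}"
    define \<Phi> where "\<Phi> s = integral {0..s} (\<lambda>r. \<phi> r x)" for s
    have \<Phi>_deriv: "(\<Phi> has_real_derivative \<phi> s x) (at s)" if s: "s \<in> {0<..<1}" for s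
    proof -
      have "(\<Phi> has_real_derivative \<phi> s x) (at s within {0..1})"
        unfolding \<Phi>_def[abs_def] using integral_has_real_derivative[OF cont] s by auto
      then show ?thesis using s at_within_interior[of s "{0..1}"] by simp
    qed
    have wd: "(w has_real_derivative c) (at t within {0..1})" "((\<lambda>t. w t + e) has_real_derivative c) (at t within {0..1})"
      unfolding w_def[abs_def] by (auto intro!: derivative_eq_intros)
    have d: "((\<lambda>t. \<Phi> (w t + e)) has_real_derivative \<phi> (w t + e) x * c) (at t within {0..1})"
      "((\<lambda>t. \<Phi> (w t)) has_real_derivative \<phi> (w t) x * c) (at t within {0..1})"
      using DERIV_chain2[OF \<Phi>_deriv wd(2)] DERIV_chain2[OF \<Phi>_deriv wd(1)] w[OF t] by auto
    have eq: "c / e * (\<Phi> (w t + e) - \<Phi> (w t)) = mollified e \<phi> t x" if t: "t \<in> {0..1}" for t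
    proof -
      have "\<Phi> (w t) + integral {w t..w t + e} (\<lambda>r. \<phi> r x) = \<Phi> (w t + e)"
        unfolding \<Phi>_def using w[OF t]
        by (intro Henstock_Kurzweil_Integration.integral_combine integrable_continuous_interval
            continuous_on_subset[OF cont]) auto
      then have "integral {w t..w t + e} (\<lambda>r. \<phi> r x) = \<Phi> (w t + e) - \<Phi> (w t)" by linarith
      moreover have "mollified e \<phi> t x = c * (integral {w t..w t + e} (\<lambda>r. \<phi> r x) / e)"
        by (simp add: mollified_def time_average_def c_def w_def)
      ultimately show ?thesis by simp
    qed
    have "((\<lambda>t. c / e * (\<Phi> (w t + e) - \<Phi> (w t))) has_real_derivative c / e * (\<phi> (w t + e) x * c - \<phi> (w t) x * c))
        (at t within {0..1})"
      by (intro DERIV_cmult DERIV_diff d)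
    then have "((\<lambda>t. mollified e \<phi> t x) has_real_derivative c / e * (\<phi> (w t + e) x * c - \<phi> (w t) x * c))
        (at t within {0..1})"
      by (rule has_field_derivative_transform_within[OF _ zero_less_one t]) (rule eq)
    then show "((\<lambda>t. mollified e \<phi> t x) has_real_derivative \<phi>' t x) (at t within {0..1})"
      by (rule DERIV_cong) (simp add: \<phi>'_def algebra_simps)
  next
    have wc: "continuous_on {0..1} w" unfolding w_def[abs_def] by (intro continuous_intros)
    have sub: "w ` {0..1} \<subseteq> {0..1}" "(\<lambda>t. w t + e) ` {0..1} \<subseteq> {0..1}"
      using w by (force simp: less_imp_le)+
    have "continuous_on {0..1} (\<lambda>t. \<phi> (w t + e) x)"
      by (rule continuous_on_compose2[OF cont _ sub(2)]) (intro continuous_on_add wc continuous_on_const)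
    moreover have "continuous_on {0..1} (\<lambda>t. \<phi> (w t) x)"
      by (rule continuous_on_compose2[OF cont wc sub(1)])
    ultimately show "continuous_on {0..1} (\<lambda>t. \<phi>' t x)"
      unfolding \<phi>'_def by (intro continuous_intros)
  qed
  moreover have "HJ_inequality K \<pi> b (mollified e \<phi>) \<phi>'"
    unfolding HJ_inequality_def
  proof (intro AE_I2 ballI)
    fix t :: real and \<nu> :: "'x \<Rightarrow> real" assume "t \<in> space (lebesgue_on {0<..<1::real})" and \<nu>: "\<nu> \<in> densities"
    then have t: "t \<in> {0..1}" by simp
    define I where "I = integral {w t..w t + e} (\<lambda>r. energy K \<pi> \<nu> (\<phi> r) (\<phi> r))"
    let ?M = "time_average e \<phi> (w t)"
    have "pairing \<pi> (\<lambda>x. \<phi> (w t + e) x - \<phi> (w t) x) \<nu> + 1 / (2 * b\<^sup>2) * I \<le> 0"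
      using \<phi> \<nu> w[OF t] unfolding integrated_HJ_def I_def by blast
    then have 1: "c * (c / e) * pairing \<pi> (\<lambda>x. \<phi> (w t + e) x - \<phi> (w t) x) \<nu> + c * (c / e) * (1 / (2 * b\<^sup>2) * I) \<le> 0"
      unfolding distrib_left[symmetric] using c e by (intro mult_nonneg_nonpos) auto
    have "energy K \<pi> \<nu> ?M ?M \<le> I / e"
      unfolding I_def using w[OF t] by (intro energy_time_average \<nu> e continuous_on_subset[OF cont]) auto
    then have "1 / (2 * b\<^sup>2) * (c * (c * energy K \<pi> \<nu> ?M ?M)) \<le> 1 / (2 * b\<^sup>2) * (c * (c * (I / e)))"
      using c by (intro mult_left_mono) auto
    moreover have "energy K \<pi> \<nu> (mollified e \<phi> t) (mollified e \<phi> t) = c * (c * energy K \<pi> \<nu> ?M ?M)"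
      by (simp add: mollified_def[abs_def] energy_scale_left energy_scale_right c_def[symmetric] w_def[symmetric])
    moreover have "pairing \<pi> (\<phi>' t) \<nu> = c * (c / e) * pairing \<pi> (\<lambda>x. \<phi> (w t + e) x - \<phi> (w t) x) \<nu>"
      unfolding \<phi>'_def by (rule pairing_scale_left)
    ultimately show "pairing \<pi> (\<phi>' t) \<nu> + 1 / (2 * b\<^sup>2) * norm_sq K \<pi> \<nu> (grad (mollified e \<phi> t)) \<le> 0"
      using 1 by (simp add: norm_sq_grad mult_ac)
  qed
  ultimately show ?thesis unfolding C1_HJ_subsolutions_def by blast
qed

lemma time_average_close:
  assumes cont: "continuous_on {s..s + e} (\<lambda>r. \<phi> r x)" and e: "0 < e"
    and close: "\<And>r. r \<in> {s..s + e} \<Longrightarrow> \<bar>\<phi> r x - y\<bar> \<le> d"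
  shows "\<bar>time_average e \<phi> s x - y\<bar> \<le> d"
proof -
  have "((\<lambda>r. \<phi> r x) has_integral e * time_average e \<phi> s x) {s..s + e}"
    using e by (auto simp: time_average_def intro!: integrable_integral integrable_continuous_interval cont)
  then have int: "((\<lambda>r. \<phi> r x - y) has_integral (e * time_average e \<phi> s x - e * y)) {s..s + e}"
    using has_integral_const_real[of y s "s + e"] e by (intro has_integral_diff) simp_all
  have "norm (e * time_average e \<phi> s x - e * y) \<le> d * e"
  proof -
    have "0 \<le> d" using close[of s] e by force
    then show ?thesis
      using has_integral_bound_real[OF _ finite.emptyI int, of d] close e by simp
  qed
  then have "e * \<bar>time_average e \<phi> s x - y\<bar> \<le> e * d"
    using e by (simp add: abs_mult mult.commute flip: right_diff_distrib)
  then show ?thesis using e by simp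
qed

text \<open>The offset in \<open>n + 5\<close> keeps the window length below \<open>1 / 4\<close>.\<close>

lemma mollified_tendsto:
  assumes cont: "continuous_on {0..1} (\<lambda>t. \<phi> t x)" and t: "t \<in> {0..1}"
  shows "(\<lambda>n. mollified (1 / real (n + 5)) \<phi> t x) \<longlonglongrightarrow> \<phi> t x"
proof -
  define e where "e n = 1 / real (n + 5)" for n
  have e: "0 < e n" "e n < 1 / 4" for n by (auto simp: e_def field_simps)
  have e_lim: "e \<longlonglongrightarrow> 0"
    unfolding e_def[abs_def] by (rule LIMSEQ_ignore_initial_segment[of "\<lambda>n. 1 / real n" 0 5]) (rule lim_1_over_n)
  define w where "w n = (1 - 2 * e n) * t + e n / 2" for n
  have w: "0 < w n" "w n + e n < 1" "\<bar>w n - t\<bar> \<le> 2 * e n" for n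
  proof -
    have "0 \<le> e n * t" "e n * t \<le> e n * 1" "e n * t \<le> t / 4 "
      using t e[of n] mult_left_mono[of t 1 "e n"] mult_right_mono[of "e n" "1 / 4" t] by auto
    moreover have "w n = t - 2 * (e n * t) + e n / 2" by (simp add: w_def algebra_simps)
    moreover have "1 - 2 * e n - (t - 2 * (e n * t)) = (1 - 2 * e n) * (1 - t)" by (simp add: algebra_simps)
    moreover have "0 \<le> (1 - 2 * e n) * (1 - t)" using t e[of n] by (intro mult_nonneg_nonneg) auto
    moreover have "0 \<le> t" "t \<le> 1" using t by auto
    ultimately show "0 < w n" "w n + e n < 1" "\<bar>w n - t\<bar> \<le> 2 * e n"
      using e[of n] by linarith+
  qed
  have "(\<lambda>n. time_average (e n) \<phi> (w n) x) \<longlonglongrightarrow> \<phi> t x"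
  proof (rule LIMSEQ_I)
    fix r :: real assume r: "0 < r"
    obtain d where d: "0 < d" "\<And>s. \<lbrakk>s \<in> {0..1}; \<bar>s - t\<bar> < d\<rbrakk> \<Longrightarrow> \<bar>\<phi> s x - \<phi> t x\<bar> < r / 2"
      using cont t r unfolding continuous_on_iff dist_real_def by (meson half_gt_zero)
    obtain N where N: "\<And>n. N \<le> n \<Longrightarrow> e n < d / 3"
      using LIMSEQ_D[OF e_lim, of "d / 3"] d(1) e by (auto simp: less_imp_le)
    have "norm (time_average (e n) \<phi> (w n) x - \<phi> t x) < r" if n: "N \<le> n" for n
    proof -
      have "\<bar>time_average (e n) \<phi> (w n) x - \<phi> t x\<bar> \<le> r / 2"
      proof (rule time_average_close)
        show "continuous_on {w n..w n + e n} (\<lambda>r. \<phi> r x)"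
          using w[of n] by (intro continuous_on_subset[OF cont]) auto
        fix s assume s: "s \<in> {w n..w n + e n}"
        then have "\<bar>s - t\<bar> < d" using w(3)[of n] N[OF n] by auto
        then show "\<bar>\<phi> s x - \<phi> t x\<bar> \<le> r / 2"
          using d(2)[of s] s w[of n] by fastforce
      qed (rule e)
      then show ?thesis using r by simp
    qed
    then show "\<exists>N. \<forall>n\<ge>N. norm (time_average (e n) \<phi> (w n) x - \<phi> t x) < r" by blast
  qed
  then have "(\<lambda>n. (1 - 2 * e n) * time_average (e n) \<phi> (w n) x) \<longlonglongrightarrow> (1 - 2 * 0) * \<phi> t x"
    by (intro tendsto_intros e_lim)
  then show ?thesis by (simp add: mollified_def e_def w_def)
qed

lemma mollified_dual_functional_tendsto:
  assumes \<phi>: "integrated_HJ K \<pi> b \<phi>" and b: "0 < b"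
  shows "(\<lambda>n. dual_functional \<pi> a p \<mu>\<^sub>0 \<mu>\<^sub>1 (mollified (1 / real (n + 5)) \<phi>))
    \<longlonglongrightarrow> dual_functional \<pi> a p \<mu>\<^sub>0 \<mu>\<^sub>1 \<phi>"
proof -
  define \<phi>n where "\<phi>n n = mollified (1 / real (n + 5)) \<phi>" for n
  have cont: "continuous_on {0..1} (\<lambda>t. \<phi> t x)" for x
    using \<phi> by (simp add: integrated_HJ_def)
  have lim: "(\<lambda>n. \<phi>n n t x) \<longlonglongrightarrow> \<phi> t x" if "t \<in> {0..1}" for t x
    unfolding \<phi>n_def by (rule mollified_tendsto[OF cont that])
  have "\<phi>n n \<in> C1_HJ_subsolutions K \<pi> b" for n
    unfolding \<phi>n_def by (rule mollified_subsolution[OF \<phi> _ _ b]) (auto simp: field_simps)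
  then have contn: "continuous_on {0..1} (\<lambda>t. \<phi>n n t x)" for n x
    using C1_with_derivative_continuous by (fastforce simp: C1_HJ_subsolutions_def)
  have lim_pair: "(\<lambda>n. pairing \<pi> (\<phi>n n t) \<nu>) \<longlonglongrightarrow> pairing \<pi> (\<phi> t) \<nu>" if "t \<in> {0..1}" for t \<nu>
    unfolding pairing_def by (intro tendsto_intros lim that)
  have "\<exists>B. \<forall>t\<in>{0..1}. \<bar>\<phi> t x\<bar> \<le> B" for x
  proof -
    have "compact ((\<lambda>t. \<phi> t x) ` {0..1})" by (intro compact_continuous_image cont) simp
    then have "bounded ((\<lambda>t. \<phi> t x) ` {0..1})" by (rule compact_imp_bounded)
    then show ?thesis by (auto simp: bounded_iff)
  qed
  then obtain B where B: "\<And>t x. t \<in> {0..1} \<Longrightarrow> \<bar>\<phi> t x\<bar> \<le> B x" by metis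
  have Bn: "\<bar>\<phi>n n t x\<bar> \<le> B x" if t: "t \<in> {0..1}" for n t x
  proof -
    define e where "e = 1 / real (n + 5)"
    have e: "0 < e" "e < 1 / 4" by (auto simp: e_def field_simps)
    define s where "s = (1 - 2 * e) * t + e / 2"
    have "0 \<le> (1 - 2 * e) * t" "(1 - 2 * e) * t \<le> (1 - 2 * e) * 1"
      using t e mult_left_mono[of t 1 "1 - 2 * e"] by auto
    then have "0 \<le> (1 - 2 * e) * t" "(1 - 2 * e) * t \<le> 1 - 2 * e" by simp_all
    then have s: "0 < s" "s + e < 1" unfolding s_def using e by linarith+
    have "\<bar>time_average e \<phi> s x - 0\<bar> \<le> B x"
      using s e B by (intro time_average_close continuous_on_subset[OF cont]) auto
    moreover have "\<phi>n n t x = (1 - 2 * e) * time_average e \<phi> s x"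
      by (simp add: \<phi>n_def mollified_def e_def s_def)
    moreover have "\<bar>1 - 2 * e\<bar> * \<bar>time_average e \<phi> s x\<bar> \<le> 1 * \<bar>time_average e \<phi> s x\<bar>"
      using e by (intro mult_right_mono) auto
    ultimately show ?thesis by (simp add: abs_mult)
  qed
  define C where "C = (\<Sum>x\<in>UNIV. B x * \<bar>p x\<bar> * \<pi> x)"
  have C: "\<bar>pairing \<pi> (\<phi>n n t) p\<bar> \<le> C" if "t \<in> {0..1}" for n t
    unfolding pairing_def C_def
    by (rule order_trans[OF sum_abs]) (auto simp: abs_mult pi_nonneg intro!: sum_mono mult_right_mono Bn[OF that])
  have leb: "(\<integral>t. (pairing \<pi> (f t) p)\<^sup>2 \<partial>lebesgue_on {0..1}) = integral {0..1} (\<lambda>t. (pairing \<pi> (f t) p)\<^sup>2)"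
    if "\<And>x. continuous_on {0..1} (\<lambda>t. f t x)" for f :: "real \<Rightarrow> 'x \<Rightarrow> real"
  proof (rule lebesgue_integral_eq_integral)
    show "integrable (lebesgue_on {0..1}) (\<lambda>t. (pairing \<pi> (f t) p)\<^sup>2)"
      by (intro continuous_imp_integrable_real continuous_on_power continuous_on_pairing_left that)
  qed simp
  have "(\<lambda>n. integral {0..1} (\<lambda>t. (pairing \<pi> (\<phi>n n t) p)\<^sup>2)) \<longlonglongrightarrow> integral {0..1} (\<lambda>t. (pairing \<pi> (\<phi> t) p)\<^sup>2)"
  proof (rule dominated_convergence(2))
    show "(\<lambda>t. (pairing \<pi> (\<phi>n n t) p)\<^sup>2) integrable_on {0..1}" for n
      by (intro integrable_continuous_interval continuous_on_power continuous_on_pairing_left contn)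
    show "(\<lambda>t. C\<^sup>2) integrable_on {0..1::real}" by (rule integrable_const_ivl)
    show "norm ((pairing \<pi> (\<phi>n n t) p)\<^sup>2) \<le> C\<^sup>2" if "t \<in> {0..1}" for n t
      using power_mono[OF C[OF that, of n], of 2] by simp
    show "(\<lambda>n. (pairing \<pi> (\<phi>n n t) p)\<^sup>2) \<longlonglongrightarrow> (pairing \<pi> (\<phi> t) p)\<^sup>2" if "t \<in> {0..1}" for t
      by (intro tendsto_intros lim_pair that)
  qed
  then show ?thesis
    unfolding \<phi>n_def[symmetric] dual_functional_def leb[OF cont] leb[OF contn]
    by (intro tendsto_intros lim_pair) auto
qed

text \<open>An upper bound for the \<open>C\<^sup>1\<close> subsolutions bounds every function satisfying the integrated
  inequality.\<close>

lemma dual_functional_le_of_C1: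
  assumes \<phi>: "integrated_HJ K \<pi> b \<phi>" and b: "0 < b"
    and U: "\<And>\<psi>. \<psi> \<in> C1_HJ_subsolutions K \<pi> b \<Longrightarrow> ereal (dual_functional \<pi> a p \<mu>\<^sub>0 \<mu>\<^sub>1 \<psi>) \<le> U"
  shows "ereal (dual_functional \<pi> a p \<mu>\<^sub>0 \<mu>\<^sub>1 \<phi>) \<le> U"
proof (rule LIMSEQ_le_const2)
  show "(\<lambda>n. ereal (dual_functional \<pi> a p \<mu>\<^sub>0 \<mu>\<^sub>1 (mollified (1 / real (n + 5)) \<phi>)))
    \<longlonglongrightarrow> ereal (dual_functional \<pi> a p \<mu>\<^sub>0 \<mu>\<^sub>1 \<phi>)"
    using mollified_dual_functional_tendsto[OF \<phi> b] by simp
  show "\<exists>N. \<forall>n\<ge>N. ereal (dual_functional \<pi> a p \<mu>\<^sub>0 \<mu>\<^sub>1 (mollified (1 / real (n + 5)) \<phi>)) \<le> U"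
    by (intro exI allI impI U mollified_subsolution[OF \<phi> _ _ b]) (auto simp: field_simps)
qed

end

section \<open>Saddle points\<close>

text \<open>A maximin argument in the style of Danskin's theorem. A maximizer of the inner minimum exists
  by compactness and coercivity; the strict quasiconvexity in the inner variable makes the inner
  minimizer unique, hence stable along perturbations of the outer variable, and this is what turns
  maximality of the inner minimum into stationarity of the function itself.\<close>

lemma saddle_point:
  fixes \<Lambda> :: "'a::metric_space \<Rightarrow> 'b::metric_space \<Rightarrow> real"
  assumes C: "compact C" "C \<noteq> {}" and B: "compact B" "B \<subseteq> V"
    and contL: "\<And>\<nu>. \<nu> \<in> C \<Longrightarrow> continuous_on B (\<lambda>\<phi>. \<Lambda> \<phi> \<nu>)"
    and contR: "\<And>\<phi>. \<phi> \<in> V \<Longrightarrow> continuous_on C (\<Lambda> \<phi>)"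
    and \<phi>0: "\<phi>0 \<in> V" "\<And>\<nu>. \<nu> \<in> C \<Longrightarrow> 0 \<le> \<Lambda> \<phi>0 \<nu>"
    and coercive: "\<And>\<phi>. \<phi> \<in> V \<Longrightarrow> \<phi> \<notin> B \<Longrightarrow> \<exists>\<nu>\<in>C. \<Lambda> \<phi> \<nu> < 0"
    and strict: "\<And>\<phi> \<nu> \<nu>'. \<phi> \<in> V \<Longrightarrow> \<nu> \<in> C \<Longrightarrow> \<nu>' \<in> C \<Longrightarrow> \<nu> \<noteq> \<nu>' \<Longrightarrow>
      \<exists>\<nu>''\<in>C. \<Lambda> \<phi> \<nu>'' < max (\<Lambda> \<phi> \<nu>) (\<Lambda> \<phi> \<nu>')"
  shows "\<exists>\<phi>\<in>V. \<exists>m\<in>C. (\<forall>\<nu>\<in>C. \<Lambda> \<phi> m \<le> \<Lambda> \<phi> \<nu>) \<and> 0 \<le> \<Lambda> \<phi> m \<and>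
    (\<forall>c \<Lambda>1 \<Lambda>2. (\<forall>s. c s \<in> V) \<longrightarrow> (\<forall>s. \<forall>\<nu>\<in>C. \<Lambda> (c s) \<nu> = \<Lambda> \<phi> \<nu> + s * \<Lambda>1 \<nu> + s\<^sup>2 * \<Lambda>2 \<nu>) \<longrightarrow>
      continuous_on C \<Lambda>1 \<longrightarrow> continuous_on C \<Lambda>2 \<longrightarrow> \<Lambda>1 m = 0)"
proof -
  have "\<exists>\<nu>\<in>C. \<forall>\<nu>'\<in>C. \<Lambda> \<phi> \<nu> \<le> \<Lambda> \<phi> \<nu>'" if "\<phi> \<in> V" for \<phi>
    using continuous_attains_inf[OF C contR[OF that]] by blast
  then obtain n where n: "\<And>\<phi>. \<phi> \<in> V \<Longrightarrow> n \<phi> \<in> C" "\<And>\<phi> \<nu>. \<phi> \<in> V \<Longrightarrow> \<nu> \<in> C \<Longrightarrow> \<Lambda> \<phi> (n \<phi>) \<le> \<Lambda> \<phi> \<nu>"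
    by metis
  define J where "J \<phi> = \<Lambda> \<phi> (n \<phi>)" for \<phi>
  have \<phi>0B: "\<phi>0 \<in> B" using coercive[OF \<phi>0(1)] \<phi>0(2) by force
  have "bdd_above (J ` B)"
  proof -
    obtain \<nu> where \<nu>: "\<nu> \<in> C" using C by blast
    have "compact ((\<lambda>\<phi>. \<Lambda> \<phi> \<nu>) ` B)" by (intro compact_continuous_image contL \<nu> B)
    then obtain R where "\<And>\<phi>. \<phi> \<in> B \<Longrightarrow> \<Lambda> \<phi> \<nu> \<le> R"
      by (meson bounded_imp_bdd_above compact_imp_bounded bdd_above.unfold imageI)
    moreover have "J \<phi> \<le> \<Lambda> \<phi> \<nu>" if "\<phi> \<in> B" for \<phi> using n(2) \<nu> that B by (auto simp: J_def)
    ultimately show ?thesis by (intro bdd_aboveI[of _ R]) (auto intro: order_trans)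
  qed
  then have J_le: "J \<phi> \<le> Sup (J ` B)" if "\<phi> \<in> B" for \<phi>
    using that by (intro cSup_upper) auto
  have "\<exists>\<phi>\<in>B. Sup (J ` B) - 1 / real (Suc k) < J \<phi>" for k
    using less_cSupD[of "J ` B" "Sup (J ` B) - 1 / real (Suc k)"] \<phi>0B by auto
  then obtain f where f: "\<And>k. f k \<in> B" "\<And>k. Sup (J ` B) - 1 / real (Suc k) < J (f k)" by metis
  obtain \<phi> r where \<phi>: "\<phi> \<in> B" and r: "strict_mono r" "(f \<circ> r) \<longlonglongrightarrow> \<phi>"
    using B(1) f(1) unfolding compact_def by metis
  have inv_lim: "(\<lambda>k. 1 / real (Suc (r k))) \<longlonglongrightarrow> 0" if "strict_mono r" for r
    using LIMSEQ_subseq_LIMSEQ[OF LIMSEQ_inverse_real_of_nat that] by (simp add: o_def inverse_eq_divide)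
  have sup_le: "Sup (J ` B) \<le> \<Lambda> \<phi> \<nu>" if \<nu>: "\<nu> \<in> C" for \<nu>
  proof (rule LIMSEQ_le)
    show "(\<lambda>k. \<Lambda> (f (r k)) \<nu>) \<longlonglongrightarrow> \<Lambda> \<phi> \<nu>"
      using continuous_on_tendsto_compose[OF contL[OF \<nu>] _ \<phi>, of "f \<circ> r" sequentially] r f by (simp add: o_def)
    show "(\<lambda>k. Sup (J ` B) - 1 / real (Suc (r k))) \<longlonglongrightarrow> Sup (J ` B)"
      using tendsto_diff[OF tendsto_const inv_lim[OF r(1)], of "Sup (J ` B)"] by simp
    have "Sup (J ` B) - 1 / real (Suc (r k)) \<le> \<Lambda> (f (r k)) \<nu>" for k
      using f(2)[of "r k"] n(2)[OF _ \<nu>, of "f (r k)"] f(1) B(2) by (force simp: J_def)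
    then show "\<exists>N. \<forall>k\<ge>N. Sup (J ` B) - 1 / real (Suc (r k)) \<le> \<Lambda> (f (r k)) \<nu>" by blast
  qed
  have \<phi>V: "\<phi> \<in> V" using \<phi> B by blast
  define m where "m = n \<phi>"
  have mC: "m \<in> C" and m_min: "\<And>\<nu>. \<nu> \<in> C \<Longrightarrow> \<Lambda> \<phi> m \<le> \<Lambda> \<phi> \<nu>"
    using n \<phi>V by (auto simp: m_def)
  have m_nonneg: "0 \<le> \<Lambda> \<phi> m"
    using sup_le[OF mC] J_le[OF \<phi>0B] \<phi>0(2) n(1)[OF \<phi>0(1)] by (force simp: J_def)
  have J_max: "J \<psi> \<le> \<Lambda> \<phi> m" if \<psi>: "\<psi> \<in> V" for \<psi>
  proof (cases "\<psi> \<in> B")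
    case True
    then show ?thesis using J_le sup_le[OF mC] by force
  next
    case False
    then obtain \<nu> where "\<nu> \<in> C" "\<Lambda> \<psi> \<nu> < 0" using coercive \<psi> by blast
    then show ?thesis using n(2)[OF \<psi>] m_nonneg by (force simp: J_def)
  qed
  have one_sided: "\<Lambda>1 m \<le> 0"
    if c: "\<And>s. c s \<in> V" and ex: "\<And>s \<nu>. \<nu> \<in> C \<Longrightarrow> \<Lambda> (c s) \<nu> = \<Lambda> \<phi> \<nu> + s * \<Lambda>1 \<nu> + s\<^sup>2 * \<Lambda>2 \<nu>"
      and cont: "continuous_on C \<Lambda>1" "continuous_on C \<Lambda>2" for c :: "real \<Rightarrow> 'a" and \<Lambda>1 \<Lambda>2
  proof -
    define s where "s k = 1 / real (Suc k)" for k
    have s: "0 < s k" for k by (simp add: s_def)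
    define \<nu> where "\<nu> k = n (c (s k))" for k
    have \<nu>C: "\<nu> k \<in> C" for k using n(1) c by (simp add: \<nu>_def)
    obtain l q where l: "l \<in> C" and q: "strict_mono q" "(\<nu> \<circ> q) \<longlonglongrightarrow> l"
      using C(1) \<nu>C unfolding compact_def by metis
    have lim: "(\<lambda>k. g (\<nu> (q k))) \<longlonglongrightarrow> g l" if "continuous_on C g" for g :: "'b \<Rightarrow> real"
      using continuous_on_tendsto_compose[OF that _ l, of "\<nu> \<circ> q" sequentially] q \<nu>C by (simp add: o_def)
    have s_lim: "(\<lambda>k. s (q k)) \<longlonglongrightarrow> 0" unfolding s_def by (rule inv_lim[OF q(1)])
    have le: "\<Lambda> \<phi> (\<nu> k) + s k * \<Lambda>1 (\<nu> k) + (s k)\<^sup>2 * \<Lambda>2 (\<nu> k) \<le> \<Lambda> \<phi> m" for k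
      using J_max[OF c, of "s k"] ex[OF \<nu>C, of "s k" k] by (simp add: J_def \<nu>_def)
    have "\<Lambda> \<phi> l + 0 * \<Lambda>1 l + 0\<^sup>2 * \<Lambda>2 l \<le> \<Lambda> \<phi> m"
    proof (rule LIMSEQ_le_const2)
      show "(\<lambda>k. \<Lambda> \<phi> (\<nu> (q k)) + s (q k) * \<Lambda>1 (\<nu> (q k)) + (s (q k))\<^sup>2 * \<Lambda>2 (\<nu> (q k)))
          \<longlonglongrightarrow> \<Lambda> \<phi> l + 0 * \<Lambda>1 l + 0\<^sup>2 * \<Lambda>2 l"
        by (intro tendsto_add tendsto_mult tendsto_power s_lim lim cont contR \<phi>V)
    qed (use le in blast)
    then have "l = m"
      using strict[OF \<phi>V l mC] m_min by force
    have "\<Lambda>1 l + 0 * \<Lambda>2 l \<le> 0"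
    proof (rule LIMSEQ_le_const2)
      show "(\<lambda>k. \<Lambda>1 (\<nu> (q k)) + s (q k) * \<Lambda>2 (\<nu> (q k))) \<longlonglongrightarrow> \<Lambda>1 l + 0 * \<Lambda>2 l"
        by (intro tendsto_add tendsto_mult s_lim lim cont)
      have "\<Lambda>1 (\<nu> k) + s k * \<Lambda>2 (\<nu> k) \<le> 0" for k
      proof -
        have "s k * (\<Lambda>1 (\<nu> k) + s k * \<Lambda>2 (\<nu> k)) \<le> 0"
          using le[of k] m_min[OF \<nu>C[of k]] by (simp add: power2_eq_square algebra_simps)
        then show ?thesis using s[of k] by (simp add: mult_le_0_iff)
      qed
      then show "\<exists>N. \<forall>k\<ge>N. \<Lambda>1 (\<nu> (q k)) + s (q k) * \<Lambda>2 (\<nu> (q k)) \<le> 0" by blast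
    qed
    then show ?thesis using \<open>l = m\<close> by simp
  qed
  have "\<Lambda>1 m = 0"
    if c: "\<forall>s. c s \<in> V" and ex: "\<forall>s. \<forall>\<nu>\<in>C. \<Lambda> (c s) \<nu> = \<Lambda> \<phi> \<nu> + s * \<Lambda>1 \<nu> + s\<^sup>2 * \<Lambda>2 \<nu>"
      and cont: "continuous_on C \<Lambda>1" "continuous_on C \<Lambda>2" for c :: "real \<Rightarrow> 'a" and \<Lambda>1 \<Lambda>2
  proof -
    have "\<Lambda>1 m \<le> 0" by (rule one_sided[of c \<Lambda>1 \<Lambda>2]) (use c ex cont in auto)
    moreover have "- \<Lambda>1 m \<le> 0"
      by (rule one_sided[of "\<lambda>s. c (- s)" "\<lambda>\<nu>. - \<Lambda>1 \<nu>" \<Lambda>2])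
        (use c ex cont in \<open>auto intro: continuous_on_minus\<close>)
    ultimately show ?thesis by simp
  qed
  then show ?thesis
    using \<phi>V mC m_min m_nonneg by blast
qed

lemma compact_box:
  fixes l u :: "nat \<Rightarrow> 'x::finite \<Rightarrow> real"
  shows "compact {\<nu>. \<forall>k x. l k x \<le> \<nu> k x \<and> \<nu> k x \<le> u k x}"
proof -
  have cPi: "compact (PiE UNIV S)" if "\<And>i. compact (S i)" for S :: "'i \<Rightarrow> 'b::topological_space set"
  proof -
    have "compactin (product_topology (\<lambda>_. euclidean) UNIV) (PiE UNIV S)"
      using that by (subst compactin_PiE) auto
    then show ?thesis by (simp add: euclidean_product_topology flip: compactin_euclidean_iff)
  qed
  have "{\<nu>. \<forall>k x. l k x \<le> \<nu> k x \<and> \<nu> k x \<le> u k x} = PiE UNIV (\<lambda>k. PiE UNIV (\<lambda>x. {l k x..u k x}))"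
    by (auto simp: PiE_iff)
  then show ?thesis by (simp add: cPi)
qed

lemma continuous_on_entry: "continuous_on S (\<lambda>\<nu>::nat \<Rightarrow> 'x::finite \<Rightarrow> real. \<nu> k x)"
  by (intro continuous_on_subset[OF continuous_on_compose2[OF continuous_on_product_coordinates[of x]
        continuous_on_product_coordinates[of k]]]) auto

section \<open>Duality in discrete time\<close>

context reversible_chain
begin

text \<open>The time axis is divided into \<open>N\<close> steps. Each step uses the potential at its left end and the
  density at its right end; this choice makes the continuity equation the stationarity condition of
  the Lagrangian below. The Hamilton--Jacobi inequality is relaxed by a slack proportional to the mass.\<close>

abbreviation source_cost :: "nat \<Rightarrow> real \<Rightarrow> ('x \<Rightarrow> real) \<Rightarrow> (nat \<Rightarrow> 'x \<Rightarrow> real) \<Rightarrow> real" where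
  "source_cost N a p \<phi> \<equiv> (\<Sum>k<N. 1 / real N * (1 / (2 * a\<^sup>2) * (pairing \<pi> (\<phi> k) p)\<^sup>2))"

abbreviation discrete_action ::
  "nat \<Rightarrow> real \<Rightarrow> real \<Rightarrow> ('x \<Rightarrow> real) \<Rightarrow> (nat \<Rightarrow> 'x \<Rightarrow> real) \<Rightarrow> (nat \<Rightarrow> 'x \<Rightarrow> real) \<Rightarrow> real" where
  "discrete_action N a b p \<phi> m \<equiv> (\<Sum>k<N. 1 / real N * (1 / (2 * a\<^sup>2) * (pairing \<pi> (\<phi> k) p)\<^sup>2)
     + 1 / real N * (1 / (2 * b\<^sup>2) * energy K \<pi> (m (Suc k)) (\<phi> k) (\<phi> k)))"

abbreviation discrete_continuity ::
  "nat \<Rightarrow> real \<Rightarrow> real \<Rightarrow> ('x \<Rightarrow> real) \<Rightarrow> (nat \<Rightarrow> 'x \<Rightarrow> real) \<Rightarrow> (nat \<Rightarrow> 'x \<Rightarrow> real) \<Rightarrow> bool" where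
  "discrete_continuity N a b p \<phi> m \<equiv> (\<forall>k<N. \<forall>x. m (Suc k) x - m k x
     = 1 / real N * (pairing \<pi> (\<phi> k) p / a\<^sup>2 * p x - divergence K (m (Suc k)) (\<phi> k) x / b\<^sup>2))"

abbreviation discrete_HJ :: "nat \<Rightarrow> real \<Rightarrow> (nat \<Rightarrow> 'x \<Rightarrow> real) \<Rightarrow> bool" where
  "discrete_HJ N b \<phi> \<equiv> (\<forall>k<N. \<forall>\<nu>\<in>densities. pairing \<pi> (\<lambda>x. \<phi> (Suc k) x - \<phi> k x) \<nu>
     + 1 / real N * (1 / (2 * b\<^sup>2) * energy K \<pi> \<nu> (\<phi> k) (\<phi> k)) \<le> 1 / (real N)\<^sup>2 * pairing \<pi> (\<lambda>_. 1) \<nu>)"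

text \<open>The discrete dual functional minus the discrete Hamilton--Jacobi expression tested with \<open>\<nu>\<close>. The
  penalty with factor \<open>\<epsilon>\<close> makes the minimizer in \<open>\<nu>\<close> unique. The Lagrangian is a quadratic
  polynomial in \<open>\<phi>\<close>, with the two coefficients defined next.\<close>

definition lagrangian ::
  "nat \<Rightarrow> real \<Rightarrow> real \<Rightarrow> real \<Rightarrow> ('x \<Rightarrow> real) \<Rightarrow> ('x \<Rightarrow> real) \<Rightarrow> ('x \<Rightarrow> real) \<Rightarrow>
     (nat \<Rightarrow> 'x \<Rightarrow> real) \<Rightarrow> (nat \<Rightarrow> 'x \<Rightarrow> real) \<Rightarrow> real" where
  "lagrangian N a b \<epsilon> p \<mu>\<^sub>0 \<mu>\<^sub>1 \<phi> \<nu> = pairing \<pi> (\<phi> N) \<mu>\<^sub>1 - pairing \<pi> (\<phi> 0) \<mu>\<^sub>0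
     - source_cost N a p \<phi>
     - (\<Sum>k<N. pairing \<pi> (\<lambda>x. \<phi> (Suc k) x - \<phi> k x) (\<nu> (Suc k))
          + 1 / real N * (1 / (2 * b\<^sup>2) * energy K \<pi> (\<nu> (Suc k)) (\<phi> k) (\<phi> k))
          - \<epsilon> / 2 * pairing \<pi> (\<nu> (Suc k)) (\<nu> (Suc k)))"

definition lagrangian_derivative ::
  "nat \<Rightarrow> real \<Rightarrow> real \<Rightarrow> ('x \<Rightarrow> real) \<Rightarrow> ('x \<Rightarrow> real) \<Rightarrow> ('x \<Rightarrow> real) \<Rightarrow>
     (nat \<Rightarrow> 'x \<Rightarrow> real) \<Rightarrow> (nat \<Rightarrow> 'x \<Rightarrow> real) \<Rightarrow> (nat \<Rightarrow> 'x \<Rightarrow> real) \<Rightarrow> real" where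
  "lagrangian_derivative N a b p \<mu>\<^sub>0 \<mu>\<^sub>1 \<phi> \<xi> \<nu> = pairing \<pi> (\<xi> N) \<mu>\<^sub>1 - pairing \<pi> (\<xi> 0) \<mu>\<^sub>0
     - (\<Sum>k<N. 1 / real N * (1 / a\<^sup>2 * (pairing \<pi> (\<phi> k) p * pairing \<pi> (\<xi> k) p)))
     - (\<Sum>k<N. pairing \<pi> (\<lambda>x. \<xi> (Suc k) x - \<xi> k x) (\<nu> (Suc k))
          + 1 / real N * (1 / b\<^sup>2 * energy K \<pi> (\<nu> (Suc k)) (\<phi> k) (\<xi> k)))"

definition lagrangian_second ::
  "nat \<Rightarrow> real \<Rightarrow> real \<Rightarrow> ('x \<Rightarrow> real) \<Rightarrow> (nat \<Rightarrow> 'x \<Rightarrow> real) \<Rightarrow> (nat \<Rightarrow> 'x \<Rightarrow> real) \<Rightarrow> real" where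
  "lagrangian_second N a b p \<xi> \<nu> = - source_cost N a p \<xi>
     - (\<Sum>k<N. 1 / real N * (1 / (2 * b\<^sup>2) * energy K \<pi> (\<nu> (Suc k)) (\<xi> k) (\<xi> k)))"

lemma lagrangian_perturb:
  "lagrangian N a b \<epsilon> p \<mu>\<^sub>0 \<mu>\<^sub>1 (\<lambda>k x. \<phi> k x + s * \<xi> k x) \<nu> = lagrangian N a b \<epsilon> p \<mu>\<^sub>0 \<mu>\<^sub>1 \<phi> \<nu>
     + s * lagrangian_derivative N a b p \<mu>\<^sub>0 \<mu>\<^sub>1 \<phi> \<xi> \<nu> + s\<^sup>2 * lagrangian_second N a b p \<xi> \<nu>"
proof -
  let ?\<zeta> = "\<lambda>k x. \<phi> k x + s * \<xi> k x"
  have p: "pairing \<pi> (?\<zeta> k) w = pairing \<pi> (\<phi> k) w + s * pairing \<pi> (\<xi> k) w" for k w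
    by (simp add: pairing_add_left pairing_scale_left)
  have d: "pairing \<pi> (\<lambda>x. ?\<zeta> (Suc k) x - ?\<zeta> k x) w = pairing \<pi> (\<lambda>x. \<phi> (Suc k) x - \<phi> k x) w
      + s * pairing \<pi> (\<lambda>x. \<xi> (Suc k) x - \<xi> k x) w" for k w
    by (simp add: pairing_linear algebra_simps)
  have Q: "(\<Sum>k<N. 1 / real N * (1 / (2 * a\<^sup>2) * (pairing \<pi> (?\<zeta> k) p)\<^sup>2))
      = source_cost N a p \<phi>
      + s * (\<Sum>k<N. 1 / real N * (1 / a\<^sup>2 * (pairing \<pi> (\<phi> k) p * pairing \<pi> (\<xi> k) p)))
      + s\<^sup>2 * source_cost N a p \<xi>"
    unfolding sum_distrib_left sum.distrib[symmetric] p
    by (intro sum.cong refl) (simp add: power2_sum power_mult_distrib add_divide_distrib distrib_left mult_ac)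
  have G: "(\<Sum>k<N. pairing \<pi> (\<lambda>x. ?\<zeta> (Suc k) x - ?\<zeta> k x) (\<nu> (Suc k))
          + 1 / real N * (1 / (2 * b\<^sup>2) * energy K \<pi> (\<nu> (Suc k)) (?\<zeta> k) (?\<zeta> k))
          - \<epsilon> / 2 * pairing \<pi> (\<nu> (Suc k)) (\<nu> (Suc k)))
      = (\<Sum>k<N. pairing \<pi> (\<lambda>x. \<phi> (Suc k) x - \<phi> k x) (\<nu> (Suc k))
          + 1 / real N * (1 / (2 * b\<^sup>2) * energy K \<pi> (\<nu> (Suc k)) (\<phi> k) (\<phi> k))
          - \<epsilon> / 2 * pairing \<pi> (\<nu> (Suc k)) (\<nu> (Suc k)))
      + s * (\<Sum>k<N. pairing \<pi> (\<lambda>x. \<xi> (Suc k) x - \<xi> k x) (\<nu> (Suc k))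
          + 1 / real N * (1 / b\<^sup>2 * energy K \<pi> (\<nu> (Suc k)) (\<phi> k) (\<xi> k)))
      + s\<^sup>2 * (\<Sum>k<N. 1 / real N * (1 / (2 * b\<^sup>2) * energy K \<pi> (\<nu> (Suc k)) (\<xi> k) (\<xi> k)))"
    unfolding sum_distrib_left sum.distrib[symmetric] d energy_perturb
    by (intro sum.cong refl) (simp add: add_divide_distrib distrib_left mult_ac)
  show ?thesis
    unfolding lagrangian_def lagrangian_derivative_def lagrangian_second_def
    unfolding Q G unfolding p by (simp add: algebra_simps)
qed

lemma summation_by_parts:
  "(\<Sum>k<N. pairing \<pi> (\<lambda>x. \<phi> (Suc k) x - \<phi> k x) (l (Suc k)))
     = pairing \<pi> (\<phi> N) (l N) - pairing \<pi> (\<phi> 0) (l 0)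
       - (\<Sum>k<N. pairing \<pi> (\<phi> k) (\<lambda>x. l (Suc k) x - l k x))"
proof -
  have "(\<Sum>k<N. pairing \<pi> (\<phi> (Suc k)) (l (Suc k)) - pairing \<pi> (\<phi> k) (l k))
      = pairing \<pi> (\<phi> N) (l N) - pairing \<pi> (\<phi> 0) (l 0)"
    by (rule sum_lessThan_telescope)
  then show ?thesis
    by (simp add: pairing_linear sum_subtractf)
qed

lemma continuous_on_energy_density:
  assumes "\<And>\<nu> x. \<nu> \<in> C \<Longrightarrow> 0 \<le> \<nu> k x"
  shows "continuous_on C (\<lambda>\<nu>::nat \<Rightarrow> 'x \<Rightarrow> real. energy K \<pi> (\<nu> k) \<phi> \<psi>)"
  unfolding energy_def mean_density_def
  by (intro continuous_intros continuous_on_log_mean_compose continuous_on_entry assms)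

lemma continuous_on_pairing_entry:
  "continuous_on C (\<lambda>\<nu>::nat \<Rightarrow> 'x \<Rightarrow> real. pairing \<pi> \<phi> (\<nu> k))"
  "continuous_on C (\<lambda>\<nu>::nat \<Rightarrow> 'x \<Rightarrow> real. pairing \<pi> (\<nu> k) (\<nu> k))"
  unfolding pairing_def by (intro continuous_intros continuous_on_entry)+

lemma continuous_on_lagrangian:
  assumes "\<And>\<nu> k x. \<nu> \<in> C \<Longrightarrow> 0 \<le> \<nu> k x"
  shows "continuous_on C (lagrangian N a b \<epsilon> p \<mu>\<^sub>0 \<mu>\<^sub>1 \<phi>)"
    and "continuous_on C (lagrangian_derivative N a b p \<mu>\<^sub>0 \<mu>\<^sub>1 \<phi> \<xi>)"
    and "continuous_on C (lagrangian_second N a b p \<xi>)"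
  unfolding lagrangian_def[abs_def] lagrangian_derivative_def[abs_def] lagrangian_second_def[abs_def]
  by (intro continuous_intros continuous_on_energy_density continuous_on_pairing_entry assms; assumption)+

lemma continuous_on_lagrangian_left:
  "continuous_on B (\<lambda>\<phi>. lagrangian N a b \<epsilon> p \<mu>\<^sub>0 \<mu>\<^sub>1 \<phi> \<nu>)"
  unfolding lagrangian_def pairing_def energy_def grad_def
  by (intro continuous_intros continuous_on_entry)

lemma pairing_self_midpoint:
  "pairing \<pi> (\<lambda>x. (u x + v x) / 2) (\<lambda>x. (u x + v x) / 2)
     = (pairing \<pi> u u + pairing \<pi> v v) / 2 - pairing \<pi> (\<lambda>x. u x - v x) (\<lambda>x. u x - v x) / 4"
  unfolding pairing_def sum.distrib[symmetric] sum_divide_distrib sum_subtractf[symmetric]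
  by (intro sum.cong refl) (simp add: field_simps)

lemma energy_midpoint:
  assumes "u \<in> densities" "v \<in> densities"
  shows "(energy K \<pi> u \<phi> \<phi> + energy K \<pi> v \<phi> \<phi>) / 2 \<le> energy K \<pi> (\<lambda>x. (u x + v x) / 2) \<phi> \<phi>"
proof -
  have d: "(\<lambda>x. 1 / 2 * u x) \<in> densities" "(\<lambda>x. 1 / 2 * v x) \<in> densities"
    using assms by (auto simp: densities_def)
  have "energy K \<pi> (\<lambda>x. 1 / 2 * u x) \<phi> \<phi> + energy K \<pi> (\<lambda>x. 1 / 2 * v x) \<phi> \<phi>
      \<le> energy K \<pi> (\<lambda>x. 1 / 2 * u x + 1 / 2 * v x) \<phi> \<phi>"
    by (rule energy_superadditive[OF d])
  moreover have "energy K \<pi> (\<lambda>x. 1 / 2 * u x) \<phi> \<phi> = 1 / 2 * energy K \<pi> u \<phi> \<phi>"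
    "energy K \<pi> (\<lambda>x. 1 / 2 * v x) \<phi> \<phi> = 1 / 2 * energy K \<pi> v \<phi> \<phi>"
    using assms by (intro energy_scale_density; simp)+
  moreover have "(\<lambda>x. 1 / 2 * u x + 1 / 2 * v x) = (\<lambda>x. (u x + v x) / 2)"
    by (simp add: add_divide_distrib)
  ultimately show ?thesis by simp
qed

text \<open>The energy is concave in the density and enters with a negative sign; the penalty contributes
  strict convexity wherever \<open>\<nu>\<close> and \<open>\<nu>'\<close> differ.\<close>

lemma lagrangian_strict:
  assumes \<epsilon>: "0 < \<epsilon>" and nn: "\<And>k x. 0 \<le> \<nu> k x" "\<And>k x. 0 \<le> \<nu>' k x"
    and k: "k < N" "\<nu> (Suc k) x \<noteq> \<nu>' (Suc k) x"
  shows "lagrangian N a b \<epsilon> p \<mu>\<^sub>0 \<mu>\<^sub>1 \<phi> (\<lambda>k x. (\<nu> k x + \<nu>' k x) / 2)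
    < max (lagrangian N a b \<epsilon> p \<mu>\<^sub>0 \<mu>\<^sub>1 \<phi> \<nu>) (lagrangian N a b \<epsilon> p \<mu>\<^sub>0 \<mu>\<^sub>1 \<phi> \<nu>')"
proof -
  define G where "G \<nu> k = pairing \<pi> (\<lambda>x. \<phi> (Suc k) x - \<phi> k x) (\<nu> (Suc k))
          + 1 / real N * (1 / (2 * b\<^sup>2) * energy K \<pi> (\<nu> (Suc k)) (\<phi> k) (\<phi> k))
          - \<epsilon> / 2 * pairing \<pi> (\<nu> (Suc k)) (\<nu> (Suc k))" for \<nu> k
  let ?m = "\<lambda>k x. (\<nu> k x + \<nu>' k x) / 2"
  let ?q = "\<lambda>k. pairing \<pi> (\<lambda>x. \<nu> (Suc k) x - \<nu>' (Suc k) x) (\<lambda>x. \<nu> (Suc k) x - \<nu>' (Suc k) x)"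
  have q0: "0 \<le> ?q k" for k
    unfolding pairing_def by (intro sum_nonneg mult_nonneg_nonneg zero_le_square pi_nonneg)
  have G: "(G \<nu> k + G \<nu>' k) / 2 + \<epsilon> / 8 * ?q k \<le> G ?m k" for k
  proof -
    have "(energy K \<pi> (\<nu> (Suc k)) (\<phi> k) (\<phi> k) + energy K \<pi> (\<nu>' (Suc k)) (\<phi> k) (\<phi> k)) / 2
        \<le> energy K \<pi> (?m (Suc k)) (\<phi> k) (\<phi> k)"
      using nn by (intro energy_midpoint) (auto simp: densities_def)
    then have "1 / real N * (1 / (2 * b\<^sup>2) *
        ((energy K \<pi> (\<nu> (Suc k)) (\<phi> k) (\<phi> k) + energy K \<pi> (\<nu>' (Suc k)) (\<phi> k) (\<phi> k)) / 2))
        \<le> 1 / real N * (1 / (2 * b\<^sup>2) * energy K \<pi> (?m (Suc k)) (\<phi> k) (\<phi> k))"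
      by (intro mult_left_mono) auto
    moreover have "pairing \<pi> f (?m (Suc k)) = (pairing \<pi> f (\<nu> (Suc k)) + pairing \<pi> f (\<nu>' (Suc k))) / 2" for f
      by (simp add: pairing_def sum_divide_distrib sum.distrib[symmetric] add_divide_distrib distrib_left distrib_right)
    moreover have "1 / real N * (1 / (2 * b\<^sup>2) * ((e + e') / 2))
        = (1 / real N * (1 / (2 * b\<^sup>2) * e) + 1 / real N * (1 / (2 * b\<^sup>2) * e')) / 2" for e e'
      by (simp add: add_divide_distrib distrib_left)
    moreover have "\<epsilon> / 2 * ((P + P') / 2 - Q / 4) = (\<epsilon> / 2 * P + \<epsilon> / 2 * P') / 2 - \<epsilon> / 8 * Q" for P P' Q
      by (simp add: field_simps)
    ultimately show ?thesis
      unfolding G_def pairing_self_midpoint by (simp only:) argo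
  qed
  have "0 < (\<nu> (Suc k) x - \<nu>' (Suc k) x) * (\<nu> (Suc k) x - \<nu>' (Suc k) x) * \<pi> x"
    using k(2) pi_pos[of x] by (simp add: zero_less_mult_iff) linarith
  also have "\<dots> \<le> ?q k"
    unfolding pairing_def
    by (rule member_le_sum[of x UNIV "\<lambda>x. (\<nu> (Suc k) x - \<nu>' (Suc k) x) * (\<nu> (Suc k) x - \<nu>' (Suc k) x) * \<pi> x"])
      (auto intro!: mult_nonneg_nonneg[OF zero_le_square pi_nonneg])
  also have "\<dots> \<le> (\<Sum>k<N. ?q k)"
    by (rule member_le_sum) (use k q0 in auto)
  finally have q: "0 < (\<Sum>k<N. ?q k)" .
  define Q where "Q = \<epsilon> / 8 * (\<Sum>k<N. ?q k)"
  have Q: "0 < Q" unfolding Q_def using q \<epsilon> by simp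
  have "(\<Sum>k<N. (G \<nu> k + G \<nu>' k) / 2 + \<epsilon> / 8 * ?q k) \<le> (\<Sum>k<N. G ?m k)"
    by (intro sum_mono G)
  then have "((\<Sum>k<N. G \<nu> k) + (\<Sum>k<N. G \<nu>' k)) / 2 + Q \<le> (\<Sum>k<N. G ?m k)"
    unfolding Q_def by (simp add: sum.distrib add_divide_distrib sum_divide_distrib sum_distrib_left)
  moreover have lag: "lagrangian N a b \<epsilon> p \<mu>\<^sub>0 \<mu>\<^sub>1 \<phi> \<nu> = lagrangian N a b \<epsilon> p \<mu>\<^sub>0 \<mu>\<^sub>1 \<phi> (\<lambda>_ _. 0) - (\<Sum>k<N. G \<nu> k)" for \<nu>
    by (simp add: lagrangian_def G_def pairing_def energy_def mean_density_def log_mean_zero)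
  ultimately have "lagrangian N a b \<epsilon> p \<mu>\<^sub>0 \<mu>\<^sub>1 \<phi> ?m
      < (lagrangian N a b \<epsilon> p \<mu>\<^sub>0 \<mu>\<^sub>1 \<phi> \<nu> + lagrangian N a b \<epsilon> p \<mu>\<^sub>0 \<mu>\<^sub>1 \<phi> \<nu>') / 2"
    using Q unfolding lag[of \<nu>] lag[of \<nu>'] lag[of ?m] by argo
  then show ?thesis by (simp add: max_def)
qed

text \<open>Testing the inner minimum with a perturbation of the linear interpolation between the
  endpoints. By summation by parts the interpolation turns the boundary terms into a bulk term which
  the Poincare inequality absorbs, so what remains bounds the perturbation. All a priori bounds
  below are instances.\<close>

lemma lagrangian_test:
  assumes N: "0 < N"
    and \<nu>: "\<And>k x. k < N \<Longrightarrow> \<nu> (Suc k) x = \<mu>\<^sub>0 x + real (Suc k) / real N * (\<mu>\<^sub>1 x - \<mu>\<^sub>0 x) + u (Suc k) x"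
    and box: "\<And>k x. 0 \<le> \<nu> k x" "\<And>k x. \<nu> k x \<le> M" and \<epsilon>: "0 \<le> \<epsilon>" "\<epsilon> * real N * M\<^sup>2 \<le> 2"
    and w: "\<And>k x. k < N \<Longrightarrow> c \<le> w k x"
    and e: "\<And>k. k < N \<Longrightarrow> energy K \<pi> (w k) (\<phi> k) (\<phi> k) + e k \<le> energy K \<pi> (\<nu> (Suc k)) (\<phi> k) (\<phi> k)"
    and \<kappa>: "0 < \<kappa>" "\<And>w \<phi>. (\<And>x. c \<le> w x) \<Longrightarrow> \<kappa> * (\<Sum>x\<in>UNIV. (\<phi> x)\<^sup>2)
        \<le> 1 / (2 * a\<^sup>2) * (pairing \<pi> \<phi> p)\<^sup>2 + 1 / (2 * b\<^sup>2) * energy K \<pi> w \<phi> \<phi>"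
    and C\<^sub>0: "C\<^sub>0 = 1 + (\<Sum>x\<in>UNIV. ((\<mu>\<^sub>1 x - \<mu>\<^sub>0 x) * \<pi> x)\<^sup>2) / (2 * \<kappa>)"
    and pos: "0 \<le> lagrangian N a b \<epsilon> p \<mu>\<^sub>0 \<mu>\<^sub>1 \<phi> \<nu>"
  shows "(\<Sum>k<N. pairing \<pi> (\<lambda>x. \<phi> (Suc k) x - \<phi> k x) (u (Suc k)) + 1 / real N * (1 / (2 * b\<^sup>2) * e k)
      + 1 / real N * (\<kappa> / 2 * (\<Sum>x\<in>UNIV. (\<phi> k x)\<^sup>2))) \<le> C\<^sub>0"
proof -
  define d where "d x = \<mu>\<^sub>1 x - \<mu>\<^sub>0 x" for x
  define l where "l k x = \<mu>\<^sub>0 x + real k / real N * d x" for k x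
  let ?q = "\<lambda>k. \<Sum>x\<in>UNIV. (\<phi> k x)\<^sup>2"
  let ?\<Delta> = "\<lambda>k x. \<phi> (Suc k) x - \<phi> k x"
  have l: "l 0 = \<mu>\<^sub>0" "l N = \<mu>\<^sub>1" using N by (auto simp: l_def d_def)
  have step: "(\<lambda>x. l (Suc k) x - l k x) = (\<lambda>x. 1 / real N * d x)" for k
    using N by (auto simp: l_def field_simps)
  have split: "pairing \<pi> (?\<Delta> k) (\<nu> (Suc k)) = pairing \<pi> (?\<Delta> k) (l (Suc k)) + pairing \<pi> (?\<Delta> k) (u (Suc k))" if "k < N" for k
  proof -
    have "\<nu> (Suc k) = (\<lambda>x. l (Suc k) x + u (Suc k) x)"
      using \<nu>[OF that] by (auto simp: l_def d_def)
    then show ?thesis by (simp add: pairing_add_right)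
  qed
  have boundary: "pairing \<pi> (\<phi> N) \<mu>\<^sub>1 - pairing \<pi> (\<phi> 0) \<mu>\<^sub>0 = (\<Sum>k<N. pairing \<pi> (?\<Delta> k) (l (Suc k)) + 1 / real N * pairing \<pi> (\<phi> k) d)"
    using summation_by_parts[of \<phi> l N] unfolding step pairing_scale_right l
    by (simp add: sum.distrib)
  have young: "pairing \<pi> (\<phi> k) d \<le> \<kappa> / 2 * ?q k + (C\<^sub>0 - 1)" for k
  proof -
    have "pairing \<pi> (\<phi> k) d \<le> (\<Sum>x\<in>UNIV. \<kappa> / 2 * (\<phi> k x)\<^sup>2 + (d x * \<pi> x)\<^sup>2 / (2 * \<kappa>))"
      unfolding pairing_def
    proof (rule sum_mono)
      fix x
      have "0 \<le> (\<kappa> * \<phi> k x - d x * \<pi> x)\<^sup>2 / (2 * \<kappa>)" using \<kappa> by simp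
      also have "\<dots> = \<kappa> / 2 * (\<phi> k x)\<^sup>2 + (d x * \<pi> x)\<^sup>2 / (2 * \<kappa>) - \<phi> k x * d x * \<pi> x"
        using \<kappa> by (simp add: power2_eq_square field_simps)
      finally show "\<phi> k x * d x * \<pi> x \<le> \<kappa> / 2 * (\<phi> k x)\<^sup>2 + (d x * \<pi> x)\<^sup>2 / (2 * \<kappa>)" by simp
    qed
    also have "\<dots> = \<kappa> / 2 * ?q k + (C\<^sub>0 - 1)"
      unfolding C\<^sub>0 d_def by (simp add: sum.distrib sum_distrib_left sum_divide_distrib)
    finally show ?thesis .
  qed
  have quad: "\<epsilon> / 2 * pairing \<pi> (\<nu> (Suc k)) (\<nu> (Suc k)) \<le> 1 / real N" for k
  proof -
    have "pairing \<pi> (\<nu> (Suc k)) (\<nu> (Suc k)) \<le> (\<Sum>x\<in>UNIV. M * M * \<pi> x)"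
      unfolding pairing_def using box order_trans[OF box]
      by (intro sum_mono mult_right_mono mult_mono pi_nonneg)
    also have "\<dots> = M\<^sup>2" by (simp add: pi_sum power2_eq_square flip: sum_distrib_left)
    finally have "\<epsilon> / 2 * pairing \<pi> (\<nu> (Suc k)) (\<nu> (Suc k)) \<le> \<epsilon> / 2 * M\<^sup>2"
      using \<epsilon> by (intro mult_left_mono) auto
    also have "\<dots> \<le> 1 / real N" using \<epsilon> N by (simp add: field_simps)
    finally show ?thesis .
  qed
  have "(\<Sum>k<N. pairing \<pi> (?\<Delta> k) (u (Suc k)) + 1 / real N * (1 / (2 * b\<^sup>2) * e k) + 1 / real N * (\<kappa> / 2 * ?q k))
      \<le> (\<Sum>k<N. 1 / real N * C\<^sub>0
          + (1 / real N * (1 / (2 * a\<^sup>2) * (pairing \<pi> (\<phi> k) p)\<^sup>2)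
          + (pairing \<pi> (?\<Delta> k) (\<nu> (Suc k))
          + 1 / real N * (1 / (2 * b\<^sup>2) * energy K \<pi> (\<nu> (Suc k)) (\<phi> k) (\<phi> k))
          - \<epsilon> / 2 * pairing \<pi> (\<nu> (Suc k)) (\<nu> (Suc k)))
          - (pairing \<pi> (?\<Delta> k) (l (Suc k)) + 1 / real N * pairing \<pi> (\<phi> k) d)))"
  proof (rule sum_mono)
    fix k assume "k \<in> {..<N}"
    then have k: "k < N" by simp
    have "\<kappa> * ?q k \<le> 1 / (2 * a\<^sup>2) * (pairing \<pi> (\<phi> k) p)\<^sup>2 + 1 / (2 * b\<^sup>2) * energy K \<pi> (w k) (\<phi> k) (\<phi> k)"
      by (rule \<kappa>(2)) (rule w[OF k])
    moreover have "1 / (2 * b\<^sup>2) * (energy K \<pi> (w k) (\<phi> k) (\<phi> k) + e k)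
        \<le> 1 / (2 * b\<^sup>2) * energy K \<pi> (\<nu> (Suc k)) (\<phi> k) (\<phi> k)"
      by (intro mult_left_mono e[OF k]) simp
    ultimately have "1 / (2 * b\<^sup>2) * e k + \<kappa> / 2 * ?q k
        \<le> (C\<^sub>0 - 1) + 1 / (2 * a\<^sup>2) * (pairing \<pi> (\<phi> k) p)\<^sup>2
          + 1 / (2 * b\<^sup>2) * energy K \<pi> (\<nu> (Suc k)) (\<phi> k) (\<phi> k) - pairing \<pi> (\<phi> k) d"
      using young[of k] unfolding distrib_left by linarith
    then have "1 / real N * (1 / (2 * b\<^sup>2) * e k + \<kappa> / 2 * ?q k)
        \<le> 1 / real N * ((C\<^sub>0 - 1) + 1 / (2 * a\<^sup>2) * (pairing \<pi> (\<phi> k) p)\<^sup>2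
          + 1 / (2 * b\<^sup>2) * energy K \<pi> (\<nu> (Suc k)) (\<phi> k) (\<phi> k) - pairing \<pi> (\<phi> k) d)"
      by (intro mult_left_mono) auto
    then show "pairing \<pi> (?\<Delta> k) (u (Suc k)) + 1 / real N * (1 / (2 * b\<^sup>2) * e k) + 1 / real N * (\<kappa> / 2 * ?q k)
      \<le> 1 / real N * C\<^sub>0
          + (1 / real N * (1 / (2 * a\<^sup>2) * (pairing \<pi> (\<phi> k) p)\<^sup>2)
          + (pairing \<pi> (?\<Delta> k) (\<nu> (Suc k))
          + 1 / real N * (1 / (2 * b\<^sup>2) * energy K \<pi> (\<nu> (Suc k)) (\<phi> k) (\<phi> k))
          - \<epsilon> / 2 * pairing \<pi> (\<nu> (Suc k)) (\<nu> (Suc k)))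
          - (pairing \<pi> (?\<Delta> k) (l (Suc k)) + 1 / real N * pairing \<pi> (\<phi> k) d))"
      using split[OF k] quad[of k] unfolding distrib_left right_diff_distrib by linarith
  qed
  also have "\<dots> = (\<Sum>k<N. 1 / real N * C\<^sub>0) - lagrangian N a b \<epsilon> p \<mu>\<^sub>0 \<mu>\<^sub>1 \<phi> \<nu>"
    unfolding lagrangian_def boundary sum.distrib sum_subtractf by simp
  also have "\<dots> \<le> C\<^sub>0" using pos N by simp
  finally show ?thesis .
qed

text \<open>Stationarity of the Lagrangian in the potential is the discrete continuity equation.\<close>

lemma lagrangian_stationary:
  assumes m: "\<And>k. m k \<in> densities"
    and stat: "\<And>\<xi>. (\<And>k x. N < k \<Longrightarrow> \<xi> k x = 0) \<Longrightarrow> lagrangian_derivative N a b p \<mu>\<^sub>0 \<mu>\<^sub>1 \<phi> \<xi> m = 0"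
    and m0: "m 0 = \<mu>\<^sub>0"
  shows "m N = \<mu>\<^sub>1"
    and "k < N \<Longrightarrow> m (Suc k) x - m k x = 1 / real N * (pairing \<pi> (\<phi> k) p / a\<^sup>2 * p x
          - divergence K (m (Suc k)) (\<phi> k) x / b\<^sup>2)"
proof -
  define r where "r k x = (m (Suc k) x - m k x) - 1 / real N * (pairing \<pi> (\<phi> k) p / a\<^sup>2 * p x
          - divergence K (m (Suc k)) (\<phi> k) x / b\<^sup>2)" for k x
  have val: "lagrangian_derivative N a b p \<mu>\<^sub>0 \<mu>\<^sub>1 \<phi> \<xi> m
      = pairing \<pi> (\<xi> N) (\<lambda>x. \<mu>\<^sub>1 x - m N x) + (\<Sum>k<N. pairing \<pi> (\<xi> k) (r k))" for \<xi>
  proof -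
    have "pairing \<pi> (\<xi> k) (r k) = pairing \<pi> (\<xi> k) (\<lambda>x. m (Suc k) x - m k x)
        - 1 / real N * (1 / a\<^sup>2 * (pairing \<pi> (\<phi> k) p * pairing \<pi> (\<xi> k) p))
        - 1 / real N * (1 / b\<^sup>2 * energy K \<pi> (m (Suc k)) (\<phi> k) (\<xi> k))" for k
    proof -
      have "r k = (\<lambda>x. (m (Suc k) x - m k x) - 1 / real N * ((pairing \<pi> (\<phi> k) p / a\<^sup>2) * p x
          - (1 / b\<^sup>2) * divergence K (m (Suc k)) (\<phi> k) x))"
        by (auto simp: r_def)
      then show ?thesis
        unfolding pairing_diff_right[of _ "\<lambda>x. m (Suc k) x - m k x"]
        by (simp only: pairing_diff_right pairing_scale_right pairing_divergence[OF m] energy_sym[of _ "\<xi> k"])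
          (simp add: algebra_simps)
    qed
    then show ?thesis
      unfolding lagrangian_derivative_def sum.distrib summation_by_parts m0
      by (simp add: sum_subtractf pairing_diff_right)
  qed
  have point: "pairing \<pi> (\<lambda>x'. if x' = x then 1 else 0) f = f x * \<pi> x" for x f
    by (simp add: pairing_def if_distrib if_distribR cong: if_cong)
  have zero: "pairing \<pi> (\<lambda>x. 0) f = 0" for f by (simp add: pairing_def)
  show "m N = \<mu>\<^sub>1"
  proof
    fix x
    define \<xi> :: "nat \<Rightarrow> 'x \<Rightarrow> real" where "\<xi> k x' = (if k = N then if x' = x then 1 else 0 else 0)" for k :: nat and x' :: 'x
    have "lagrangian_derivative N a b p \<mu>\<^sub>0 \<mu>\<^sub>1 \<phi> \<xi> m = 0" by (rule stat) (simp add: \<xi>_def)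
    moreover have "\<xi> N = (\<lambda>x'. if x' = x then 1 else 0)" "\<And>k. k < N \<Longrightarrow> \<xi> k = (\<lambda>_. 0)"
      by (auto simp: \<xi>_def)
    ultimately show "m N x = \<mu>\<^sub>1 x"
      unfolding val using pi_pos[of x] by (simp add: point zero)
  qed
  assume k: "k < N"
  define \<xi> :: "nat \<Rightarrow> 'x \<Rightarrow> real" where "\<xi> j x' = (if j = k then if x' = x then 1 else 0 else 0)" for j :: nat and x' :: 'x
  have "lagrangian_derivative N a b p \<mu>\<^sub>0 \<mu>\<^sub>1 \<phi> \<xi> m = 0" by (rule stat) (use k in \<open>simp add: \<xi>_def\<close>)
  moreover have "\<xi> N = (\<lambda>_. 0)" using k by (auto simp: \<xi>_def)
  moreover have "(\<Sum>j<N. pairing \<pi> (\<xi> j) (r j)) = (\<Sum>j<N. if j = k then r k x * \<pi> x else 0)"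
  proof (intro sum.cong refl)
    fix j
    have "\<xi> j = (if j = k then (\<lambda>x'. if x' = x then 1 else 0) else (\<lambda>_. 0))" by (auto simp: \<xi>_def)
    then show "pairing \<pi> (\<xi> j) (r j) = (if j = k then r k x * \<pi> x else 0)" by (simp add: point zero)
  qed
  ultimately have "r k x * \<pi> x = 0" unfolding val using k by (simp add: zero)
  then show "m (Suc k) x - m k x = 1 / real N * (pairing \<pi> (\<phi> k) p / a\<^sup>2 * p x
          - divergence K (m (Suc k)) (\<phi> k) x / b\<^sup>2)"
    using pi_pos[of x] by (simp add: r_def)
qed

text \<open>Exact duality in discrete time up to a penalty. The maximizer \<open>\<phi>\<close> of the inner minimum and the
  minimizer \<open>m\<close> are dual and primal competitors at the same time. The size of the box controls by how
  much \<open>\<phi>\<close> violates the Hamilton--Jacobi inequality; the decrease of \<open>\<phi>\<close> over the whole time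
  interval is bounded independently of the number of steps.\<close>

lemma discrete_duality:
  assumes p: "p \<in> pos_densities" and a: "0 < a" and b: "0 < b" and c: "0 < c"
    and \<mu>0: "\<And>x. 2 * c \<le> \<mu>\<^sub>0 x" and \<mu>1: "\<And>x. 2 * c \<le> \<mu>\<^sub>1 x"
  shows "\<exists>X. \<forall>N>0. \<exists>\<phi> m. m 0 = \<mu>\<^sub>0 \<and> m N = \<mu>\<^sub>1 \<and> (\<forall>k. m k \<in> densities) \<and>
    discrete_continuity N a b p \<phi> m \<and>
    discrete_action N a b p \<phi> m
      \<le> pairing \<pi> (\<phi> N) \<mu>\<^sub>1 - pairing \<pi> (\<phi> 0) \<mu>\<^sub>0
        - source_cost N a p \<phi> \<and>
    discrete_HJ N b \<phi> \<and>
    pairing \<pi> (\<lambda>_. 1) (\<lambda>x. \<phi> 0 x - \<phi> N x) \<le> X"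
proof -
  obtain \<kappa>0 where \<kappa>0: "0 < \<kappa>0" "\<And>w \<phi>. (\<And>x. c \<le> w x) \<Longrightarrow>
      \<kappa>0 * (\<Sum>x\<in>UNIV. (\<phi> x)\<^sup>2) \<le> (pairing \<pi> \<phi> p)\<^sup>2 + energy K \<pi> w \<phi> \<phi>"
    using Poincare[OF p c] by blast
  define \<alpha> where "\<alpha> = min (1 / (2 * a\<^sup>2)) (1 / (2 * b\<^sup>2))"
  have \<alpha>: "0 < \<alpha>" "\<alpha> \<le> 1 / (2 * a\<^sup>2)" "\<alpha> \<le> 1 / (2 * b\<^sup>2)" using a b by (auto simp: \<alpha>_def)
  define \<kappa> where "\<kappa> = \<alpha> * \<kappa>0"
  have \<kappa>: "0 < \<kappa>" using \<alpha> \<kappa>0 by (simp add: \<kappa>_def)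
  have \<kappa>2: "\<kappa> * (\<Sum>x\<in>UNIV. (\<phi> x)\<^sup>2) \<le> 1 / (2 * a\<^sup>2) * (pairing \<pi> \<phi> p)\<^sup>2 + 1 / (2 * b\<^sup>2) * energy K \<pi> w \<phi> \<phi>"
    if "\<And>x. c \<le> w x" for w \<phi>
  proof -
    have "\<kappa> * (\<Sum>x\<in>UNIV. (\<phi> x)\<^sup>2) \<le> \<alpha> * ((pairing \<pi> \<phi> p)\<^sup>2 + energy K \<pi> w \<phi> \<phi>)"
      unfolding \<kappa>_def mult.assoc using \<kappa>0(2)[OF that] \<alpha> by (intro mult_left_mono) auto
    also have "\<dots> \<le> 1 / (2 * a\<^sup>2) * (pairing \<pi> \<phi> p)\<^sup>2 + 1 / (2 * b\<^sup>2) * energy K \<pi> w \<phi> \<phi>"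
      unfolding distrib_left using \<alpha> energy_nonneg by (intro add_mono mult_right_mono) auto
    finally show ?thesis .
  qed
  define C\<^sub>0 where "C\<^sub>0 = 1 + (\<Sum>x\<in>UNIV. ((\<mu>\<^sub>1 x - \<mu>\<^sub>0 x) * \<pi> x)\<^sup>2) / (2 * \<kappa>)"
  have C\<^sub>0: "0 < C\<^sub>0" unfolding C\<^sub>0_def using \<kappa> by (intro add_pos_nonneg divide_nonneg_nonneg sum_nonneg) auto
  define Lm where "Lm = (\<Sum>x\<in>UNIV. \<mu>\<^sub>0 x + \<mu>\<^sub>1 x)"
  have nn: "0 \<le> \<mu>\<^sub>0 x" "0 \<le> \<mu>\<^sub>1 x" for x using c \<mu>0[of x] \<mu>1[of x] by linarith+
  have Lm: "\<mu>\<^sub>0 x + \<mu>\<^sub>1 x \<le> Lm" for x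
    unfolding Lm_def using nn by (intro member_le_sum[of x UNIV "\<lambda>x. \<mu>\<^sub>0 x + \<mu>\<^sub>1 x"]) auto
  obtain D where D: "1 / \<pi> x \<le> D" and D0: "0 \<le> D" for x using inverse_pi_bounded by metis
  show ?thesis
  proof (rule exI[of _ "C\<^sub>0 / c"], intro allI impI)
    fix N :: nat assume N: "0 < N"
    \<comment> \<open>Tests of mass \<open>M'\<close> bound the violation of the Hamilton--Jacobi inequality by \<open>C\<^sub>0 / M'\<close> per unit of mass, so \<open>M'\<close>
      grows like \<open>N\<^sup>2\<close>. The box has room for such tests on top of the interpolation, and \<open>\<epsilon>\<close> makes the
      total penalty at most one half on the whole box.\<close>
    define M' where "M' = C\<^sub>0 * (real N)\<^sup>2"
    have M': "0 < M'" using C\<^sub>0 N by (simp add: M'_def)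
    define M where "M = Lm + c + M' * D"
    have "0 < Lm" using Lm[of undefined] \<mu>0[of undefined] \<mu>1[of undefined] c by linarith
    then have M: "0 < M" unfolding M_def using c M' D0 by (simp add: add_pos_nonneg)
    define \<epsilon> where "\<epsilon> = 1 / (real N * M\<^sup>2)"
    have \<epsilon>: "0 < \<epsilon>" "\<epsilon> * real N * M\<^sup>2 \<le> 2" using M N by (auto simp: \<epsilon>_def)
    define l where "l k x = \<mu>\<^sub>0 x + real k / real N * (\<mu>\<^sub>1 x - \<mu>\<^sub>0 x)" for k x
    have l: "2 * c \<le> l k x" "l k x \<le> Lm" if "k \<le> N" for k x
    proof -
      have *: "l k x = (1 - real k / real N) * \<mu>\<^sub>0 x + real k / real N * \<mu>\<^sub>1 x" by (simp add: l_def algebra_simps diff_divide_distrib)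
      have t: "0 \<le> real k / real N" "real k / real N \<le> 1" using that N by auto
      have "(1 - real k / real N) * (2 * c) + real k / real N * (2 * c) \<le> l k x"
        unfolding * using t \<mu>0 \<mu>1 by (intro add_mono mult_left_mono) auto
      then show "2 * c \<le> l k x" by (simp add: algebra_simps)
      have "l k x \<le> 1 * \<mu>\<^sub>0 x + 1 * \<mu>\<^sub>1 x"
        unfolding * using t nn by (intro add_mono mult_right_mono) auto
      then show "l k x \<le> Lm" using Lm[of x] by simp
    qed
    define C :: "(nat \<Rightarrow> 'x \<Rightarrow> real) set" where
      "C = {\<nu>. \<forall>k x. 0 \<le> \<nu> k x \<and> \<nu> k x \<le> (if k \<in> {1..N} then M else 0)}"
    define V :: "(nat \<Rightarrow> 'x \<Rightarrow> real) set" where "V = {\<phi>. \<forall>k x. N < k \<longrightarrow> \<phi> k x = 0}"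
    let ?L = "lagrangian N a b \<epsilon> p \<mu>\<^sub>0 \<mu>\<^sub>1"
    have C_nonneg: "0 \<le> \<nu> k x" if "\<nu> \<in> C" for \<nu> k x using that by (auto simp: C_def)
    have compC: "compact C" unfolding C_def by (rule compact_box)
    define test where "test u k x = (if k \<in> {1..N} then l k x + u k x else 0)" for u :: "nat \<Rightarrow> 'x \<Rightarrow> real" and k x
    have test_Suc: "test u (Suc k) = (\<lambda>x. l (Suc k) x + u (Suc k) x)" if "k < N" for u k
      using that by (auto simp: test_def)
    have testC: "test u \<in> C" if "\<And>k x. - c \<le> u k x" "\<And>k x. u k x \<le> c + M' * D" for u
    proof -
      have "0 \<le> l k x + u k x" "l k x + u k x \<le> M" if "k \<le> N" for k x
        using l[OF that, of x] \<open>- c \<le> u k x\<close> \<open>u k x \<le> c + M' * D\<close> c by (auto simp: M_def)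
      then show ?thesis by (auto simp: C_def test_def)
    qed
    have test: "(\<Sum>k<N. pairing \<pi> (\<lambda>x. \<phi> (Suc k) x - \<phi> k x) (u (Suc k)) + 1 / real N * (1 / (2 * b\<^sup>2) * e k)
        + 1 / real N * (\<kappa> / 2 * (\<Sum>x\<in>UNIV. (\<phi> k x)\<^sup>2))) \<le> C\<^sub>0"
      if u: "\<And>k x. - c \<le> u k x" "\<And>k x. u k x \<le> c + M' * D" and pos: "\<And>\<nu>. \<nu> \<in> C \<Longrightarrow> 0 \<le> ?L \<phi> \<nu>"
        and w: "\<And>k x. k < N \<Longrightarrow> c \<le> w k x"
        and e: "\<And>k. k < N \<Longrightarrow> energy K \<pi> (w k) (\<phi> k) (\<phi> k) + e k \<le> energy K \<pi> (test u (Suc k)) (\<phi> k) (\<phi> k)"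
      for u \<phi> w e
    proof (rule lagrangian_test[where \<nu> = "test u" and M = M and \<epsilon> = \<epsilon> and w = w and c = c and a = a and p = p
          and \<mu>\<^sub>0 = \<mu>\<^sub>0 and \<mu>\<^sub>1 = \<mu>\<^sub>1])
      show "test u (Suc k) x = \<mu>\<^sub>0 x + real (Suc k) / real N * (\<mu>\<^sub>1 x - \<mu>\<^sub>0 x) + u (Suc k) x" if "k < N" for k x
        using that by (simp add: test_def l_def)
      have "test u \<in> C" by (rule testC) (rule u)+
      then have in_box: "0 \<le> test u k x \<and> test u k x \<le> (if k \<in> {1..N} then M else 0)" for k x
        unfolding C_def by blast
      show "0 \<le> test u k x" for k x using in_box by blast
      show "test u k x \<le> M" for k x using in_box[of k x] M by (auto split: if_splits)
      show "0 \<le> ?L \<phi> (test u)" by (rule pos, rule testC) (rule u)+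
    qed (use N \<epsilon> w e \<kappa> \<kappa>2 C\<^sub>0_def in auto)
    \<comment> \<open>perturbations of size at most \<open>c\<close> leave the interpolation above \<open>c\<close>\<close>
    have test_small: "(\<Sum>k<N. pairing \<pi> (\<lambda>x. \<phi> (Suc k) x - \<phi> k x) (u (Suc k))
        + 1 / real N * (\<kappa> / 2 * (\<Sum>x\<in>UNIV. (\<phi> k x)\<^sup>2))) \<le> C\<^sub>0"
      if u: "\<And>k x. \<bar>u k x\<bar> \<le> c" and pos: "\<And>\<nu>. \<nu> \<in> C \<Longrightarrow> 0 \<le> ?L \<phi> \<nu>" for u \<phi>
    proof -
      have "- c \<le> u k x" "u k x \<le> c" for k x using u[of k x] by auto
      moreover from this have "u k x \<le> c + M' * D" for k x
        using M' D0 by (smt (verit) mult_nonneg_nonneg)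
      moreover have "c \<le> test u (Suc k) x" if "k < N" for k x
        using l(1)[of "Suc k" x] \<open>- c \<le> u (Suc k) x\<close> that by (simp add: test_def)
      ultimately show ?thesis
        using test[of u \<phi> "\<lambda>k. test u (Suc k)" "\<lambda>_. 0"] pos by simp
    qed
    \<comment> \<open>If the minimum over the box is nonnegative, then the values of \<open>\<phi>\<close> before the last time are bounded through the
      quadratic term of the test, and the last one by a test supported at the last time.\<close>
    define R0 where "R0 = sqrt (2 * real N * C\<^sub>0 / \<kappa>)"
    define R where "R = R0 + (\<Sum>x\<in>UNIV. C\<^sub>0 / (c * \<pi> x))"
    have R0: "0 \<le> R0" "R0\<^sup>2 = 2 * real N * C\<^sub>0 / \<kappa>" using C\<^sub>0 \<kappa> by (auto simp: R0_def)
    define B :: "(nat \<Rightarrow> 'x \<Rightarrow> real) set" where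
      "B = {\<phi>. \<forall>k x. (if k \<le> N then - R else 0) \<le> \<phi> k x \<and> \<phi> k x \<le> (if k \<le> N then R else 0)}"
    have bound: "\<bar>\<phi> k x\<bar> \<le> R" if pos: "\<And>\<nu>. \<nu> \<in> C \<Longrightarrow> 0 \<le> ?L \<phi> \<nu>" and k: "k \<le> N" for \<phi> k x
    proof -
      have Rx: "C\<^sub>0 / (c * \<pi> x) \<le> (\<Sum>x\<in>UNIV. C\<^sub>0 / (c * \<pi> x))"
        using C\<^sub>0 c pi_nonneg by (intro member_le_sum[of x UNIV "\<lambda>x. C\<^sub>0 / (c * \<pi> x)"]) auto
      have Rx0: "0 \<le> C\<^sub>0 / (c * \<pi> x)" using C\<^sub>0 c pi_nonneg by simp
      have early: "\<bar>\<phi> j x\<bar> \<le> R0" if j: "j < N" for j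
      proof -
        have "1 / real N * (\<kappa> / 2 * (\<phi> j x)\<^sup>2) \<le> 1 / real N * (\<kappa> / 2 * (\<Sum>x\<in>UNIV. (\<phi> j x)\<^sup>2))"
          using \<kappa> by (intro mult_left_mono member_le_sum[of x UNIV "\<lambda>x. (\<phi> j x)\<^sup>2"]) auto
        also have "\<dots> \<le> (\<Sum>k<N. 1 / real N * (\<kappa> / 2 * (\<Sum>x\<in>UNIV. (\<phi> k x)\<^sup>2)))"
          using \<kappa> j by (intro member_le_sum[of j "{..<N}" "\<lambda>j. 1 / real N * (\<kappa> / 2 * (\<Sum>x\<in>UNIV. (\<phi> j x)\<^sup>2))"])
            (auto intro!: sum_nonneg divide_nonneg_nonneg mult_nonneg_nonneg)
        also have "\<dots> \<le> C\<^sub>0"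
          using test_small[of "\<lambda>_ _. 0" \<phi>] pos c by (simp add: pairing_def)
        finally have "(\<phi> j x)\<^sup>2 \<le> R0\<^sup>2"
          unfolding R0 using \<kappa> N by (simp add: field_simps)
        then show ?thesis using R0(1) by (metis abs_le_square_iff abs_of_nonneg)
      qed
      show ?thesis
      proof (cases "k < N")
        case True
        then show ?thesis using early[OF True] Rx Rx0 by (simp add: R_def)
      next
        case False
        then have [simp]: "k = N" using k by simp
        obtain j where j: "N = Suc j" using N by (cases N) auto
        have "\<sigma> * (\<phi> N x - \<phi> j x) \<le> C\<^sub>0 / (c * \<pi> x)" if \<sigma>: "\<bar>\<sigma>\<bar> = 1" for \<sigma> :: real
        proof -
          define u where "u k x' = (if k = N \<and> x' = x then \<sigma> * c else 0)" for k x'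
          have "(\<Sum>k<N. pairing \<pi> (\<lambda>x. \<phi> (Suc k) x - \<phi> k x) (u (Suc k))
            + 1 / real N * (\<kappa> / 2 * (\<Sum>x\<in>UNIV. (\<phi> k x)\<^sup>2))) \<le> C\<^sub>0"
            using \<sigma> c by (intro test_small pos) (auto simp: u_def abs_mult)
          moreover have "0 \<le> (\<Sum>k<N. 1 / real N * (\<kappa> / 2 * (\<Sum>x\<in>UNIV. (\<phi> k x)\<^sup>2)))"
            using \<kappa> by (intro sum_nonneg mult_nonneg_nonneg) auto
          moreover have "(\<Sum>k<N. pairing \<pi> (\<lambda>x. \<phi> (Suc k) x - \<phi> k x) (u (Suc k))) = (\<phi> N x - \<phi> j x) * (\<sigma> * c) * \<pi> x"
          proof -
            have "pairing \<pi> (\<lambda>x. \<phi> (Suc k) x - \<phi> k x) (u (Suc k))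
                = (if k = j then (\<phi> N x - \<phi> j x) * (\<sigma> * c) * \<pi> x else 0)" for k
              by (simp add: pairing_def u_def j if_distrib if_distribR cong: if_cong)
            then show ?thesis using j by simp
          qed
          ultimately have "(\<phi> N x - \<phi> j x) * (\<sigma> * c) * \<pi> x \<le> C\<^sub>0" by (simp add: sum.distrib)
          then show ?thesis using c pi_pos[of x] by (simp add: pos_le_divide_eq mult_ac)
        qed
        from this[of 1] this[of "-1"] have "\<bar>\<phi> N x - \<phi> j x\<bar> \<le> C\<^sub>0 / (c * \<pi> x)" by (auto simp: abs_le_iff)
        then show ?thesis using early[of j] Rx unfolding R_def j[symmetric] by (simp add: j)
      qed
    qed
    have "\<exists>\<phi>\<in>V. \<exists>m\<in>C. (\<forall>\<nu>\<in>C. ?L \<phi> m \<le> ?L \<phi> \<nu>) \<and> 0 \<le> ?L \<phi> m \<and>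
      (\<forall>c \<Lambda>1 \<Lambda>2. (\<forall>s. c s \<in> V) \<longrightarrow> (\<forall>s. \<forall>\<nu>\<in>C. ?L (c s) \<nu> = ?L \<phi> \<nu> + s * \<Lambda>1 \<nu> + s\<^sup>2 * \<Lambda>2 \<nu>) \<longrightarrow>
        continuous_on C \<Lambda>1 \<longrightarrow> continuous_on C \<Lambda>2 \<longrightarrow> \<Lambda>1 m = 0)"
    proof (rule saddle_point[OF compC _ _ _ continuous_on_lagrangian_left])
      show "C \<noteq> {}" using testC[of "\<lambda>_ _. 0"] c M' D0 by force
      show "compact B" unfolding B_def by (rule compact_box)
      show "B \<subseteq> V"
      proof
        fix \<phi> assume "\<phi> \<in> B"
        then have "(if k \<le> N then - R else 0) \<le> \<phi> k x \<and> \<phi> k x \<le> (if k \<le> N then R else 0)" for k x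
          unfolding B_def by blast
        then have "\<phi> k x = 0" if "N < k" for k x
          using that by (metis antisym not_le)
        then show "\<phi> \<in> V" by (simp add: V_def)
      qed
      show "continuous_on C (?L \<phi>)" for \<phi> using C_nonneg by (rule continuous_on_lagrangian)
      show "(\<lambda>_ _. 0) \<in> V" by (simp add: V_def)
      show "0 \<le> ?L (\<lambda>_ _. 0) \<nu>" if "\<nu> \<in> C" for \<nu>
        using \<epsilon> C_nonneg[OF that]
        by (auto simp: lagrangian_def pairing_def energy_def grad_def intro!: sum_nonpos sum_nonneg mult_nonneg_nonneg pi_nonneg)
      show "\<exists>\<nu>\<in>C. ?L \<phi> \<nu> < 0" if \<phi>: "\<phi> \<in> V" "\<phi> \<notin> B" for \<phi>
      proof (rule ccontr)
        assume "\<not> (\<exists>\<nu>\<in>C. ?L \<phi> \<nu> < 0)"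
        then have "\<bar>\<phi> k x\<bar> \<le> R" if "k \<le> N" for k x using bound[of \<phi> k x] that by force
        then have "\<phi> \<in> B" using \<phi>(1) by (auto simp: B_def V_def abs_le_iff minus_le_iff)
        then show False using \<phi>(2) by blast
      qed
      show "\<exists>\<nu>''\<in>C. ?L \<phi> \<nu>'' < max (?L \<phi> \<nu>) (?L \<phi> \<nu>')" if \<nu>: "\<nu> \<in> C" "\<nu>' \<in> C" "\<nu> \<noteq> \<nu>'" for \<phi> \<nu> \<nu>'
      proof (rule bexI)
        obtain k x where kx: "\<nu> k x \<noteq> \<nu>' k x" using \<nu>(3) by blast
        have "k \<in> {1..N}"
        proof (rule ccontr)
          assume "k \<notin> {1..N}"
          moreover have "0 \<le> \<nu> k x \<and> \<nu> k x \<le> (if k \<in> {1..N} then M else 0)"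
            "0 \<le> \<nu>' k x \<and> \<nu>' k x \<le> (if k \<in> {1..N} then M else 0)"
            using \<nu> unfolding C_def by blast+
          ultimately have "\<nu> k x = 0" "\<nu>' k x = 0" by (metis antisym)+
          then show False using kx by simp
        qed
        then obtain j where j: "k = Suc j" "j < N" by (cases k) auto
        show "?L \<phi> (\<lambda>k x. (\<nu> k x + \<nu>' k x) / 2) < max (?L \<phi> \<nu>) (?L \<phi> \<nu>')"
          using C_nonneg \<nu> kx j by (intro lagrangian_strict[OF \<epsilon>(1)]) auto
        have "0 \<le> (\<nu> k x + \<nu>' k x) / 2 \<and> (\<nu> k x + \<nu>' k x) / 2 \<le> (if k \<in> {1..N} then M else 0)" for k x
        proof -
          have "0 \<le> \<nu> k x" "0 \<le> \<nu>' k x" "\<nu> k x \<le> (if k \<in> {1..N} then M else 0)" "\<nu>' k x \<le> (if k \<in> {1..N} then M else 0)"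
            using \<nu> unfolding C_def by blast+
          then show ?thesis by (cases "k \<in> {1..N}") auto
        qed
        then show "(\<lambda>k x. (\<nu> k x + \<nu>' k x) / 2) \<in> C" unfolding C_def by blast
      qed
    qed
    then obtain \<phi> m where \<phi>V: "\<phi> \<in> V" and mC: "m \<in> C" and m_min: "\<And>\<nu>. \<nu> \<in> C \<Longrightarrow> ?L \<phi> m \<le> ?L \<phi> \<nu>"
      and m_nonneg: "0 \<le> ?L \<phi> m"
      and stat: "\<And>c \<Lambda>1 \<Lambda>2. \<lbrakk>\<forall>s. c s \<in> V; \<forall>s. \<forall>\<nu>\<in>C. ?L (c s) \<nu> = ?L \<phi> \<nu> + s * \<Lambda>1 \<nu> + s\<^sup>2 * \<Lambda>2 \<nu>;
        continuous_on C \<Lambda>1; continuous_on C \<Lambda>2\<rbrakk> \<Longrightarrow> \<Lambda>1 m = 0"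
      by blast
    have L_pos: "0 \<le> ?L \<phi> \<nu>" if "\<nu> \<in> C" for \<nu> using m_min[OF that] m_nonneg by linarith
    have stat1: "lagrangian_derivative N a b p \<mu>\<^sub>0 \<mu>\<^sub>1 \<phi> \<xi> m = 0" if \<xi>: "\<And>k x. N < k \<Longrightarrow> \<xi> k x = 0" for \<xi>
    proof (rule stat)
      show "\<forall>s. (\<lambda>k x. \<phi> k x + s * \<xi> k x) \<in> V" using \<phi>V \<xi> by (simp add: V_def)
      show "\<forall>s. \<forall>\<nu>\<in>C. ?L (\<lambda>k x. \<phi> k x + s * \<xi> k x) \<nu> = ?L \<phi> \<nu>
          + s * lagrangian_derivative N a b p \<mu>\<^sub>0 \<mu>\<^sub>1 \<phi> \<xi> \<nu> + s\<^sup>2 * lagrangian_second N a b p \<xi> \<nu>"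
        by (simp add: lagrangian_perturb)
    qed (use C_nonneg in \<open>auto intro: continuous_on_lagrangian\<close>)
    \<comment> \<open>the Lagrangian does not see the density at time \<open>0\<close>, where the box is degenerate\<close>
    define m' where "m' = m(0 := \<mu>\<^sub>0)"
    have m'_Suc: "m' (Suc k) = m (Suc k)" for k by (simp add: m'_def)
    have m'd: "m' k \<in> densities" for k
      using C_nonneg[OF mC] nn by (auto simp: m'_def densities_def)
    have same: "lagrangian_derivative N a b p \<mu>\<^sub>0 \<mu>\<^sub>1 \<phi> \<xi> m' = lagrangian_derivative N a b p \<mu>\<^sub>0 \<mu>\<^sub>1 \<phi> \<xi> m" for \<xi>
      by (simp add: lagrangian_derivative_def m'_Suc)
    note eqs = lagrangian_stationary[of m', OF m'd, of N a b p \<mu>\<^sub>0 \<mu>\<^sub>1 \<phi>, unfolded same, OF stat1]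
    have end_eq: "m' N = \<mu>\<^sub>1" by (rule eqs(1)) (auto simp: m'_def)
    have step_eq: "m' (Suc k) x - m' k x = 1 / real N * (pairing \<pi> (\<phi> k) p / a\<^sup>2 * p x
          - divergence K (m' (Suc k)) (\<phi> k) x / b\<^sup>2)" if "k < N" for k x
      by (rule eqs(2)) (use that in \<open>auto simp: m'_def\<close>)
    define G where "G = source_cost N a p \<phi>"
    define H where "H = (\<Sum>k<N. 1 / real N * (1 / (2 * b\<^sup>2) * energy K \<pi> (m (Suc k)) (\<phi> k) (\<phi> k)))"
    define P where "P = (\<Sum>k<N. pairing \<pi> (\<lambda>x. \<phi> (Suc k) x - \<phi> k x) (m (Suc k)))"
    define q where "q = (\<Sum>k<N. \<epsilon> / 2 * pairing \<pi> (m (Suc k)) (m (Suc k)))"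
    define E where "E = pairing \<pi> (\<phi> N) \<mu>\<^sub>1 - pairing \<pi> (\<phi> 0) \<mu>\<^sub>0"
    \<comment> \<open>Stationarity along \<open>\<phi>\<close> itself, combined with the competitor \<open>0\<close>.\<close>
    have value_le: "G + H \<le> E - G"
    proof -
      have "0 = E - 2 * G - (P + 2 * H)"
      proof -
        have "lagrangian_derivative N a b p \<mu>\<^sub>0 \<mu>\<^sub>1 \<phi> \<phi> m = E - 2 * G - (P + 2 * H)"
          unfolding lagrangian_derivative_def E_def G_def P_def H_def sum.distrib sum_distrib_left
          by (simp add: power2_eq_square)
        then show ?thesis using stat1[of \<phi>] \<phi>V by (simp add: V_def)
      qed
      moreover have "?L \<phi> m = E - G - (P + H - q)"
        unfolding lagrangian_def E_def G_def P_def H_def q_def by (simp add: sum.distrib sum_subtractf)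
      moreover have "?L \<phi> (\<lambda>_ _. 0) = E - G"
        unfolding lagrangian_def E_def G_def by (simp add: pairing_def energy_def mean_density_def log_mean_zero)
      moreover have "(\<lambda>_ _. 0) \<in> C" using M by (simp add: C_def)
      moreover have "0 \<le> q"
        unfolding q_def pairing_def using \<epsilon> by (intro sum_nonneg mult_nonneg_nonneg pi_nonneg) (auto simp: C_nonneg[OF mC])
      ultimately show ?thesis using m_min[of "\<lambda>_ _. 0"] by linarith
    qed
    have drop: "pairing \<pi> (\<lambda>_. 1) (\<lambda>x. \<phi> 0 x - \<phi> N x) \<le> C\<^sub>0 / c"
    proof -
      have "(\<Sum>k<N. pairing \<pi> (\<lambda>x. \<phi> (Suc k) x - \<phi> k x) (\<lambda>_. - c) + 1 / real N * (\<kappa> / 2 * (\<Sum>x\<in>UNIV. (\<phi> k x)\<^sup>2))) \<le> C\<^sub>0"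
        using c by (intro test_small[of "\<lambda>_ _. - c"] L_pos) auto
      moreover have "0 \<le> (\<Sum>k<N. 1 / real N * (\<kappa> / 2 * (\<Sum>x\<in>UNIV. (\<phi> k x)\<^sup>2)))"
        using \<kappa> by (intro sum_nonneg mult_nonneg_nonneg) auto
      moreover have "(\<Sum>k<N. pairing \<pi> (\<lambda>x. \<phi> (Suc k) x - \<phi> k x) (\<lambda>_. - c)) = c * pairing \<pi> (\<lambda>_. 1) (\<lambda>x. \<phi> 0 x - \<phi> N x)"
      proof -
        have "pairing \<pi> (\<lambda>x. \<phi> (Suc k) x - \<phi> k x) (\<lambda>_. - c)
            = - c * pairing \<pi> (\<lambda>_. 1) (\<phi> (Suc k)) - - c * pairing \<pi> (\<lambda>_. 1) (\<phi> k)" for k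
          by (simp add: pairing_def sum_distrib_left algebra_simps flip: sum_subtractf)
        then have "(\<Sum>k<N. pairing \<pi> (\<lambda>x. \<phi> (Suc k) x - \<phi> k x) (\<lambda>_. - c))
            = - c * pairing \<pi> (\<lambda>_. 1) (\<phi> N) - - c * pairing \<pi> (\<lambda>_. 1) (\<phi> 0)"
          using sum_lessThan_telescope[of "\<lambda>k. - c * pairing \<pi> (\<lambda>_. 1) (\<phi> k)" N] by simp
        then show ?thesis by (simp add: pairing_diff_right algebra_simps)
      qed
      ultimately have "c * pairing \<pi> (\<lambda>_. 1) (\<lambda>x. \<phi> 0 x - \<phi> N x) \<le> C\<^sub>0" by (simp add: sum.distrib)
      then show ?thesis using c by (simp add: pos_le_divide_eq mult.commute)
    qed
    have violation: "pairing \<pi> (\<lambda>x. \<phi> (Suc k) x - \<phi> k x) \<nu>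
        + 1 / real N * (1 / (2 * b\<^sup>2) * energy K \<pi> \<nu> (\<phi> k) (\<phi> k)) \<le> 1 / (real N)\<^sup>2 * pairing \<pi> (\<lambda>_. 1) \<nu>"
      if k: "k < N" and \<nu>: "\<nu> \<in> densities" for k \<nu>
    proof (cases "pairing \<pi> (\<lambda>_. 1) \<nu> = 0")
      case True
      have "\<nu> = (\<lambda>_. 0)"
      proof
        fix x
        have "1 * \<nu> x * \<pi> x \<le> pairing \<pi> (\<lambda>_. 1) \<nu>"
          unfolding pairing_def using \<nu> by (intro member_le_sum[of x UNIV "\<lambda>x. 1 * \<nu> x * \<pi> x"])
            (auto simp: densities_def pi_nonneg)
        then have "\<nu> x * \<pi> x \<le> 0" using True by simp
        moreover have "0 \<le> \<nu> x" using \<nu> by (simp add: densities_def)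
        ultimately show "\<nu> x = 0" using pi_pos[of x] by (simp add: mult_le_0_iff)
      qed
      then show ?thesis by (simp add: pairing_def energy_def mean_density_def log_mean_zero)
    next
      case False
      define s where "s = pairing \<pi> (\<lambda>_. 1) \<nu>"
      have s: "0 < s" using False pairing_one_nonneg[OF \<nu>] by (simp add: s_def)
      have \<nu>0: "0 \<le> \<nu> x" for x using \<nu> by (simp add: densities_def)
      have \<chi>_le: "\<nu> x / s \<le> D" for x
      proof -
        have "1 * \<nu> x * \<pi> x \<le> s"
          unfolding s_def pairing_def using \<nu>0 by (intro member_le_sum[of x UNIV "\<lambda>x. 1 * \<nu> x * \<pi> x"])
            (auto simp: pi_nonneg)
        then have "\<nu> x / s \<le> 1 / \<pi> x" using s pi_pos[of x] by (simp add: field_simps)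
        then show ?thesis using D[of x] by linarith
      qed
      define u where "u j x = (if j = Suc k then M' / s * \<nu> x else 0)" for j x
      have "M' / s * \<nu> x \<le> M' * D" for x
        using mult_left_mono[OF \<chi>_le[of x], of M'] M' by simp
      then have u: "- c \<le> u j x" "u j x \<le> c + M' * D" "0 \<le> u j x" for j x
        using c M' D0 s \<nu>0[of x] by (auto simp: u_def add_increasing intro: order_trans[of "- c" 0])
      define e where "e j = (if j = k then M' / s * energy K \<pi> \<nu> (\<phi> k) (\<phi> k) else 0)" for j
      have "(\<Sum>j<N. pairing \<pi> (\<lambda>x. \<phi> (Suc j) x - \<phi> j x) (u (Suc j)) + 1 / real N * (1 / (2 * b\<^sup>2) * e j)
        + 1 / real N * (\<kappa> / 2 * (\<Sum>x\<in>UNIV. (\<phi> j x)\<^sup>2))) \<le> C\<^sub>0"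
      proof (rule test[where w = "\<lambda>j. l (Suc j)", OF u(1,2) L_pos])
        show "c \<le> l (Suc j) x" if "j < N" for j x using l(1)[of "Suc j" x] that c by simp
        fix j assume j: "j < N"
        show "energy K \<pi> (l (Suc j)) (\<phi> j) (\<phi> j) + e j \<le> energy K \<pi> (test u (Suc j)) (\<phi> j) (\<phi> j)"
        proof (cases "j = k")
          case True
          have ld: "l (Suc j) \<in> densities"
            using l(1)[of "Suc j"] j c by (auto simp: densities_def intro: order_trans[of 0 "2 * c"])
          have "energy K \<pi> (\<lambda>x. M' / s * \<nu> x) (\<phi> j) (\<phi> j) = e j"
            using energy_scale_density[of "M' / s" \<nu>] True \<nu> M' s by (simp add: e_def)
          moreover have "energy K \<pi> (l (Suc j)) (\<phi> j) (\<phi> j) + energy K \<pi> (\<lambda>x. M' / s * \<nu> x) (\<phi> j) (\<phi> j)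
              \<le> energy K \<pi> (\<lambda>x. l (Suc j) x + M' / s * \<nu> x) (\<phi> j) (\<phi> j)"
            using ld M' s \<nu>0 by (intro energy_superadditive) (auto simp: densities_def)
          moreover have "test u (Suc j) = (\<lambda>x. l (Suc j) x + M' / s * \<nu> x)"
            using True test_Suc[OF j] by (auto simp: u_def)
          ultimately show ?thesis by simp
        next
          case False
          then show ?thesis using test_Suc[OF j] by (simp add: e_def u_def)
        qed
      qed
      moreover have "0 \<le> (\<Sum>j<N. 1 / real N * (\<kappa> / 2 * (\<Sum>x\<in>UNIV. (\<phi> j x)\<^sup>2)))"
        using \<kappa> by (intro sum_nonneg mult_nonneg_nonneg) auto
      moreover have "(\<Sum>j<N. pairing \<pi> (\<lambda>x. \<phi> (Suc j) x - \<phi> j x) (u (Suc j)))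
          = M' / s * pairing \<pi> (\<lambda>x. \<phi> (Suc k) x - \<phi> k x) \<nu>"
      proof -
        have "pairing \<pi> (\<lambda>x. \<phi> (Suc j) x - \<phi> j x) (u (Suc j))
            = (if j = k then M' / s * pairing \<pi> (\<lambda>x. \<phi> (Suc k) x - \<phi> k x) \<nu> else 0)" for j
        proof -
          have "u (Suc j) = (if j = k then (\<lambda>x. M' / s * \<nu> x) else (\<lambda>_. 0))" by (auto simp: u_def)
          moreover have "pairing \<pi> f (\<lambda>_. 0) = 0" for f by (simp add: pairing_def)
          ultimately show ?thesis by (cases "j = k") (simp_all only: simp_thms if_True if_False pairing_scale_right)
        qed
        then show ?thesis using k by simp
      qed
      moreover have "(\<Sum>j<N. 1 / real N * (1 / (2 * b\<^sup>2) * e j)) = M' / s * (1 / real N * (1 / (2 * b\<^sup>2) * energy K \<pi> \<nu> (\<phi> k) (\<phi> k)))"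
      proof -
        have "1 / real N * (1 / (2 * b\<^sup>2) * e j)
          = (if j = k then M' / s * (1 / real N * (1 / (2 * b\<^sup>2) * energy K \<pi> \<nu> (\<phi> k) (\<phi> k))) else 0)" for j
          by (simp add: e_def)
        then show ?thesis using k by simp
      qed
      ultimately have "M' / s * (pairing \<pi> (\<lambda>x. \<phi> (Suc k) x - \<phi> k x) \<nu>
          + 1 / real N * (1 / (2 * b\<^sup>2) * energy K \<pi> \<nu> (\<phi> k) (\<phi> k))) \<le> C\<^sub>0"
        unfolding sum.distrib distrib_left[of "M' / s"] by linarith
      then have "pairing \<pi> (\<lambda>x. \<phi> (Suc k) x - \<phi> k x) \<nu>
          + 1 / real N * (1 / (2 * b\<^sup>2) * energy K \<pi> \<nu> (\<phi> k) (\<phi> k)) \<le> C\<^sub>0 / (M' / s)"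
        using M' s by (subst pos_le_divide_eq) (auto simp: mult.commute)
      also have "\<dots> = 1 / (real N)\<^sup>2 * s" using C\<^sub>0 N by (simp add: M'_def)
      finally show ?thesis by (simp add: s_def)
    qed
    show "\<exists>\<phi> m. m 0 = \<mu>\<^sub>0 \<and> m N = \<mu>\<^sub>1 \<and> (\<forall>k. m k \<in> densities) \<and>
      discrete_continuity N a b p \<phi> m \<and>
      discrete_action N a b p \<phi> m
        \<le> pairing \<pi> (\<phi> N) \<mu>\<^sub>1 - pairing \<pi> (\<phi> 0) \<mu>\<^sub>0
          - source_cost N a p \<phi> \<and>
      discrete_HJ N b \<phi> \<and>
      pairing \<pi> (\<lambda>_. 1) (\<lambda>x. \<phi> 0 x - \<phi> N x) \<le> C\<^sub>0 / c"
    proof (rule exI[of _ \<phi>], rule exI[of _ m'], intro conjI allI impI ballI)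
      show "m' 0 = \<mu>\<^sub>0" by (simp add: m'_def)
      show "(\<Sum>k<N. 1 / real N * (1 / (2 * a\<^sup>2) * (pairing \<pi> (\<phi> k) p)\<^sup>2)
          + 1 / real N * (1 / (2 * b\<^sup>2) * energy K \<pi> (m' (Suc k)) (\<phi> k) (\<phi> k)))
        \<le> pairing \<pi> (\<phi> N) \<mu>\<^sub>1 - pairing \<pi> (\<phi> 0) \<mu>\<^sub>0
          - source_cost N a p \<phi>"
        using value_le unfolding sum.distrib m'_Suc G_def H_def E_def .
    qed (rule end_eq m'd step_eq violation drop; assumption)+
  qed
qed

end

section \<open>From discrete to continuous subsolutions\<close>

definition interpolate :: "nat \<Rightarrow> (nat \<Rightarrow> 'x \<Rightarrow> real) \<Rightarrow> real \<Rightarrow> 'x \<Rightarrow> real" where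
  "interpolate N z t x = z 0 x + (\<Sum>k<N. max 0 (min 1 (real N * t - real k)) * (z (Suc k) x - z k x))"

lemma continuous_interpolate: "continuous_on S (\<lambda>t. interpolate N z t x)"
  unfolding interpolate_def by (intro continuous_intros)

lemma interpolate_on:
  assumes k: "k < N" and t: "real k \<le> real N * t" "real N * t \<le> real (Suc k)"
  shows "interpolate N z t x = z k x + (real N * t - real k) * (z (Suc k) x - z k x)"
proof -
  let ?f = "\<lambda>j. max 0 (min 1 (real N * t - real j)) * (z (Suc j) x - z j x)"
  have "(\<Sum>j<N. ?f j) = (\<Sum>j<Suc k. ?f j)"
  proof (rule sum.mono_neutral_right)
    show "\<forall>j\<in>{..<N} - {..<Suc k}. ?f j = 0"
    proof
      fix j assume "j \<in> {..<N} - {..<Suc k}"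
      then have "real (Suc k) \<le> real j" by simp
      then have "real N * t - real j \<le> 0" using t by linarith
      then show "?f j = 0" by simp
    qed
  qed (use k in auto)
  also have "\<dots> = (\<Sum>j<k. z (Suc j) x - z j x) + ?f k"
  proof -
    have "?f j = z (Suc j) x - z j x" if "j < k" for j
    proof -
      have "real (Suc j) \<le> real k" using that by simp
      then have "1 \<le> real N * t - real j" using t by simp
      then show ?thesis by simp
    qed
    then have "(\<Sum>j<k. ?f j) = (\<Sum>j<k. z (Suc j) x - z j x)"
      by (intro sum.cong refl) (simp only: lessThan_iff)
    then show ?thesis by (simp only: sum.lessThan_Suc)
  qed
  also have "?f k = (real N * t - real k) * (z (Suc k) x - z k x)"
    using t by simp
  finally show ?thesis
    by (simp add: interpolate_def sum_lessThan_telescope[of "\<lambda>j. z j x"])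
qed

lemma interpolate_ends:
  assumes "0 < N"
  shows "interpolate N z 0 = z 0" "interpolate N z 1 = z N"
proof -
  show "interpolate N z 0 = z 0"
    using interpolate_on[of 0 N 0 z] assms by auto
  show "interpolate N z 1 = z N"
    using interpolate_on[of "N - 1" N 1 z] assms by (auto simp: of_nat_diff)
qed

lemma grid_cell:
  fixes r :: real
  assumes r: "0 < r" "r < 1" and N: "0 < N"
  obtains k where "k < N" "real k \<le> real N * r" "real N * r < real (Suc k)"
proof (rule that)
  have pos: "0 \<le> real N * r" using r by simp
  show "real (nat \<lfloor>real N * r\<rfloor>) \<le> real N * r" using pos by simp
  show "real N * r < real (Suc (nat \<lfloor>real N * r\<rfloor>))" using pos by linarith
  have "real N * r < real N" using r N by simp
  then show "nat \<lfloor>real N * r\<rfloor> < N" using pos by linarith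
qed

lemma integral_le_grid_sum:
  fixes f :: "real \<Rightarrow> real"
  assumes f: "continuous_on {0..1} f" and N: "0 < N"
    and B: "\<And>k t. \<lbrakk>k < N; real k \<le> real N * t; real N * t \<le> real (Suc k)\<rbrakk> \<Longrightarrow> f t \<le> B k"
  shows "integral {0..1} f \<le> (\<Sum>k<N. 1 / real N * B k)"
proof -
  have "n \<le> N \<Longrightarrow> integral {0..real n / real N} f \<le> (\<Sum>k<n. 1 / real N * B k)" for n
  proof (induction n)
    case 0
    then show ?case by simp
  next
    case (Suc n)
    let ?s = "real n / real N" and ?t = "real (Suc n) / real N"
    have st: "0 \<le> ?s" "?s \<le> ?t" "?t \<le> 1" using Suc.prems N by (auto simp: field_simps)
    have int: "f integrable_on {c..d}" if "0 \<le> c" "d \<le> 1" for c d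
      using that by (intro integrable_continuous_interval continuous_on_subset[OF f]) auto
    have "integral {?s..?t} f \<le> integral {?s..?t} (\<lambda>_. B n)"
      using st Suc.prems N by (intro integral_le int B) (auto simp: field_simps)
    also have "\<dots> = 1 / real N * B n"
      using st N by (simp add: field_simps)
    finally have "integral {?s..?t} f \<le> 1 / real N * B n" .
    moreover have "integral {0..?s} f + integral {?s..?t} f = integral {0..?t} f"
      using st by (intro Henstock_Kurzweil_Integration.integral_combine int) auto
    ultimately show ?case using Suc by simp
  qed
  from this[of N] show ?thesis using N by simp
qed

context reversible_chain
begin

text \<open>Between two grid points the interpolation is affine in time, so the hypothesis is the differential
  inequality there; the finitely many grid points do not matter for the integral.\<close>

lemma interpolate_integrated_HJ:
  assumes N: "0 < N"
    and z: "\<And>k s \<nu>. \<lbrakk>k < N; 0 \<le> s; s \<le> 1; \<nu> \<in> densities\<rbrakk> \<Longrightarrow>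
      real N * pairing \<pi> (\<lambda>x. z (Suc k) x - z k x) \<nu> + 1 / (2 * b\<^sup>2) *
        energy K \<pi> \<nu> (\<lambda>x. z k x + s * (z (Suc k) x - z k x)) (\<lambda>x. z k x + s * (z (Suc k) x - z k x)) \<le> 0"
  shows "integrated_HJ K \<pi> b (interpolate N z)"
  unfolding integrated_HJ_def
proof (intro conjI allI ballI impI)
  show "continuous_on {0..1} (\<lambda>t. interpolate N z t x)" for x by (rule continuous_interpolate)
  fix \<nu> :: "'x \<Rightarrow> real" and s t :: real
  assume \<nu>: "\<nu> \<in> densities" and st: "0 < s" "s < t" "t < 1"
  define S where "S = (\<lambda>k. real k / real N) ` {..N}"
  define f where "f r = pairing \<pi> (interpolate N z r) \<nu>" for r
  define e where "e r = energy K \<pi> \<nu> (interpolate N z r) (interpolate N z r)" for r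
  have deriv: "\<exists>d. (f has_vector_derivative d) (at r) \<and> d \<le> - (1 / (2 * b\<^sup>2)) * e r" if r: "r \<in> {s<..<t} - S" for r
  proof -
    obtain k where k: "k < N" "real k \<le> real N * r" "real N * r < real (Suc k)"
      using grid_cell[of r N] r st N by auto
    have "real k \<noteq> real N * r"
    proof
      assume "real k = real N * r"
      then have "r = real k / real N" using N by simp
      then show False using r k(1) by (auto simp: S_def)
    qed
    then have kr: "real k / real N < r" "r < real (Suc k) / real N" using k N by (auto simp: field_simps)
    have on: "interpolate N z q x = z k x + (real N * q - real k) * (z (Suc k) x - z k x)"
      if "q \<in> {real k / real N<..<real (Suc k) / real N}" for q x
      using that N by (intro interpolate_on k(1)) (auto simp: field_simps)
    let ?d = "real N * pairing \<pi> (\<lambda>x. z (Suc k) x - z k x) \<nu>"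
    have "((\<lambda>q. pairing \<pi> (z k) \<nu> + (real N * q - real k) * pairing \<pi> (\<lambda>x. z (Suc k) x - z k x) \<nu>)
        has_real_derivative ?d) (at r)"
      by (auto intro!: derivative_eq_intros)
    then have "(f has_real_derivative ?d) (at r)"
    proof (rule has_field_derivative_transform_within_open[of _ _ _ "{real k / real N<..<real (Suc k) / real N}"])
      fix q assume "q \<in> {real k / real N<..<real (Suc k) / real N}"
      then have "interpolate N z q = (\<lambda>x. z k x + (real N * q - real k) * (z (Suc k) x - z k x))"
        using on by blast
      then show "pairing \<pi> (z k) \<nu> + (real N * q - real k) * pairing \<pi> (\<lambda>x. z (Suc k) x - z k x) \<nu> = f q"
        by (simp only: f_def pairing_add_left pairing_scale_left)
    qed (use kr in auto)
    moreover have "?d \<le> - (1 / (2 * b\<^sup>2)) * e r"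
    proof -
      have "interpolate N z r = (\<lambda>x. z k x + (real N * r - real k) * (z (Suc k) x - z k x))"
        using on kr by auto
      then show ?thesis
        using z[OF k(1) _ _ \<nu>, of "real N * r - real k"] k by (simp add: e_def)
    qed
    ultimately show ?thesis by (auto simp: has_real_derivative_iff_has_vector_derivative)
  qed
  then obtain d where d: "\<And>r. r \<in> {s<..<t} - S \<Longrightarrow> (f has_vector_derivative d r) (at r)"
    "\<And>r. r \<in> {s<..<t} - S \<Longrightarrow> d r \<le> - (1 / (2 * b\<^sup>2)) * e r" by metis
  have "continuous_on {s..t} e" unfolding e_def by (intro continuous_on_energy continuous_interpolate)
  then have e_int: "((\<lambda>r. - (1 / (2 * b\<^sup>2)) * e r) has_integral - (1 / (2 * b\<^sup>2)) * integral {s..t} e) {s..t}"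
    by (intro has_integral_mult_right integrable_integral integrable_continuous_interval)
  define d' where "d' r = (if r \<in> {s<..<t} - S then d r else - (1 / (2 * b\<^sup>2)) * e r)" for r
  have "(d' has_integral (f t - f s)) {s..t}"
  proof (rule fundamental_theorem_of_calculus_interior_strong[of S])
    show "finite S" by (simp add: S_def)
    show "continuous_on {s..t} f" unfolding f_def by (intro continuous_on_pairing_left continuous_interpolate)
    show "(f has_vector_derivative d' r) (at r)" if "r \<in> {s<..<t} - S" for r
      using d(1)[OF that] that by (simp add: d'_def)
  qed (use st in simp)
  then have "f t - f s \<le> - (1 / (2 * b\<^sup>2)) * integral {s..t} e"
    by (rule has_integral_le[OF _ e_int]) (use d(2) in \<open>auto simp: d'_def\<close>)
  then show "pairing \<pi> (\<lambda>x. interpolate N z t x - interpolate N z s x) \<nu>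
      + 1 / (2 * b\<^sup>2) * integral {s..t} (\<lambda>r. energy K \<pi> \<nu> (interpolate N z r) (interpolate N z r)) \<le> 0"
    by (simp add: f_def e_def[abs_def] pairing_diff_left)
qed

text \<open>The discrete inequality only controls the left endpoint of each step. It also bounds the
  increments of \<open>\<phi>\<close> from above, so the bound \<open>X\<close> on the total decrease bounds the sum \<open>X'\<close> of their
  absolute values, and \<open>X'\<^sup>2\<close> the sum of their squares. Inside a step, the energy of the interpolation
  exceeds \<open>1 + \<eta>\<close> times the energy at the left endpoint by at most a multiple of the squared
  increment. The factor is removed by dividing \<open>\<phi>\<close> by \<open>1 + \<eta>\<close>, the excess by subtracting a constant
  that increases in time; since every excess acts for a time \<open>1 / N\<close>, the subtracted constant never
  exceeds a multiple of \<open>1 / N\<close>.\<close>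

lemma discrete_subsolution_value:
  assumes p: "p \<in> pos_densities" "(\<Sum>x\<in>UNIV. p x * \<pi> x) = 1" and a: "0 < a" and b: "0 < b" and \<eta>: "0 < \<eta>"
    and \<mu>1: "\<mu>\<^sub>1 \<in> densities"
  shows "\<exists>Z. \<forall>N>0. \<forall>\<phi>. discrete_HJ N b \<phi> \<longrightarrow>
    pairing \<pi> (\<lambda>_. 1) (\<lambda>x. \<phi> 0 x - \<phi> N x) \<le> X \<longrightarrow>
    (\<exists>\<psi>. integrated_HJ K \<pi> b \<psi> \<and> pairing \<pi> (\<phi> N) \<mu>\<^sub>1 - pairing \<pi> (\<phi> 0) \<mu>\<^sub>0
        - source_cost N a p \<phi>
      \<le> (1 + \<eta>) * dual_functional \<pi> a p \<mu>\<^sub>0 \<mu>\<^sub>1 \<psi> + Z / real N)"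
proof -
  obtain D where D: "1 / \<pi> x \<le> D" and D0: "0 \<le> D" for x using inverse_pi_bounded by metis
  define \<gamma> where "\<gamma> = 1 / (1 + \<eta>)"
  have \<gamma>: "0 \<le> \<gamma>" "(1 + \<eta>) * (\<gamma> * x) = x" "\<gamma> * ((1 + \<eta>) * x) = x" for x
    using \<eta> by (auto simp: \<gamma>_def)
  define X' where "X' = D * (2 + \<bar>X\<bar>)"
  define Y where "Y = 1 + 2 * X'\<^sup>2 / (\<eta> * b\<^sup>2)"
  define Z where "Z = Y * pairing \<pi> (\<lambda>_. 1) \<mu>\<^sub>1 + (Y\<^sup>2 + X'\<^sup>2) / (a\<^sup>2 * \<eta>)"
  have Y: "0 < Y" unfolding Y_def using \<eta> b by (intro add_pos_nonneg) auto
  show ?thesis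
  proof (intro exI[of _ Z] allI impI)
    fix N :: nat and \<phi> assume N: "0 < N"
      and viol: "discrete_HJ N b \<phi>"
      and drop: "pairing \<pi> (\<lambda>_. 1) (\<lambda>x. \<phi> 0 x - \<phi> N x) \<le> X"
    define \<Delta> where "\<Delta> k x = \<phi> (Suc k) x - \<phi> k x" for k x
    have \<Delta>_fun: "\<Delta> k = (\<lambda>x. \<phi> (Suc k) x - \<phi> k x)" for k by (auto simp: \<Delta>_def)
    define \<delta> where "\<delta> k = (\<Sum>x\<in>UNIV. \<bar>\<Delta> k x\<bar>)" for k
    have \<delta>: "\<bar>\<Delta> k x\<bar> \<le> \<delta> k" "0 \<le> \<delta> k" for k x
      unfolding \<delta>_def by (auto intro!: member_le_sum[of x UNIV "\<lambda>x. \<bar>\<Delta> k x\<bar>"] sum_nonneg)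
    have up: "\<Delta> k x \<le> 1 / (real N)\<^sup>2" if k: "k < N" for k x
    proof -
      define \<nu> where "\<nu> x' = (if x' = x then 1 else 0 :: real)" for x'
      have pt: "pairing \<pi> f \<nu> = f x * \<pi> x" for f
        by (simp add: pairing_def \<nu>_def if_distrib if_distribR cong: if_cong)
      have "\<nu> \<in> densities" by (auto simp: densities_def \<nu>_def)
      then have "\<Delta> k x * \<pi> x + 1 / real N * (1 / (2 * b\<^sup>2) * energy K \<pi> \<nu> (\<phi> k) (\<phi> k)) \<le> 1 / (real N)\<^sup>2 * \<pi> x"
        using viol k by (force simp: pt \<Delta>_def)
      moreover have "0 \<le> 1 / real N * (1 / (2 * b\<^sup>2) * energy K \<pi> \<nu> (\<phi> k) (\<phi> k))"
        using energy_nonneg by (intro mult_nonneg_nonneg) auto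
      ultimately have "\<Delta> k x * \<pi> x \<le> 1 / (real N)\<^sup>2 * \<pi> x" by linarith
      then show ?thesis using pi_pos[of x] by (simp only: mult_le_cancel_right_pos)
    qed
    have abs_\<Delta>: "\<bar>\<Delta> k x\<bar> \<le> D * ((2 / (real N)\<^sup>2 - \<Delta> k x) * \<pi> x)" if k: "k < N" for k x
    proof -
      have "\<bar>\<Delta> k x\<bar> \<le> 2 / (real N)\<^sup>2 - \<Delta> k x" using up[OF k, of x] zero_le_power2[of "real N"] by (auto simp: abs_le_iff)
      moreover from this have "0 \<le> 2 / (real N)\<^sup>2 - \<Delta> k x" by linarith
      moreover from this have "1 / \<pi> x * ((2 / (real N)\<^sup>2 - \<Delta> k x) * \<pi> x) \<le> D * ((2 / (real N)\<^sup>2 - \<Delta> k x) * \<pi> x)"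
        using D[of x] pi_nonneg by (intro mult_right_mono mult_nonneg_nonneg) auto
      moreover have "1 / \<pi> x * ((2 / (real N)\<^sup>2 - \<Delta> k x) * \<pi> x) = 2 / (real N)\<^sup>2 - \<Delta> k x"
        using pi_pos[of x] by simp
      ultimately show ?thesis by linarith
    qed
    have sum_\<delta>: "(\<Sum>k<N. \<delta> k) \<le> X'"
    proof -
      have "(\<Sum>k<N. \<delta> k) \<le> (\<Sum>k<N. \<Sum>x\<in>UNIV. D * ((2 / (real N)\<^sup>2 - \<Delta> k x) * \<pi> x))"
        unfolding \<delta>_def by (intro sum_mono abs_\<Delta>) simp
      also have "\<dots> = D * (\<Sum>k<N. 2 / (real N)\<^sup>2 * (\<Sum>x\<in>UNIV. \<pi> x) - pairing \<pi> (\<lambda>_. 1) (\<Delta> k))"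
      proof -
        have "(\<Sum>x\<in>UNIV. D * ((2 / (real N)\<^sup>2 - \<Delta> k x) * \<pi> x))
            = D * (2 / (real N)\<^sup>2 * (\<Sum>x\<in>UNIV. \<pi> x) - pairing \<pi> (\<lambda>_. 1) (\<Delta> k))" for k
          unfolding sum_distrib_left[symmetric] left_diff_distrib sum_subtractf pairing_def
          by (simp flip: sum_distrib_left)
        then show ?thesis by (simp only: sum_distrib_left[of D])
      qed
      also have "(\<Sum>k<N. 2 / (real N)\<^sup>2 * (\<Sum>x\<in>UNIV. \<pi> x) - pairing \<pi> (\<lambda>_. 1) (\<Delta> k))
          = real N * (2 / (real N)\<^sup>2) - (\<Sum>k<N. pairing \<pi> (\<lambda>_. 1) (\<phi> (Suc k)) - pairing \<pi> (\<lambda>_. 1) (\<phi> k))"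
        by (simp add: pi_sum sum_subtractf \<Delta>_fun pairing_diff_right)
      also have "\<dots> = 2 / real N + pairing \<pi> (\<lambda>_. 1) (\<lambda>x. \<phi> 0 x - \<phi> N x)"
        using N by (simp add: sum_lessThan_telescope[of "\<lambda>k. pairing \<pi> (\<lambda>_. 1) (\<phi> k)"] pairing_diff_right power2_eq_square)
      also have "D * \<dots> \<le> X'"
      proof -
        have "2 / real N \<le> 2" using N by (simp add: field_simps)
        then show ?thesis unfolding X'_def using drop D0 by (intro mult_left_mono) auto
      qed
      finally show ?thesis .
    qed
    have X'0: "0 \<le> X'" unfolding X'_def using D0 by simp
    have sum_\<delta>2: "(\<Sum>k<N. (\<delta> k)\<^sup>2) \<le> X'\<^sup>2"
    proof -
      have "\<delta> k \<le> X'" if "k < N" for k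
        using member_le_sum[of k "{..<N}" \<delta>] \<delta>(2) sum_\<delta> that by force
      then have "(\<Sum>k<N. (\<delta> k)\<^sup>2) \<le> (\<Sum>k<N. X' * \<delta> k)"
        unfolding power2_eq_square using \<delta>(2) by (intro sum_mono mult_right_mono) auto
      also have "\<dots> \<le> X' * X'"
        unfolding sum_distrib_left[symmetric] using sum_\<delta> X'0 by (rule mult_left_mono)
      finally show ?thesis by (simp add: power2_eq_square)
    qed
    \<comment> \<open>the decrease during step \<open>k\<close>: the slack of the discrete inequality plus the excess of the energy\<close>
    define c where "c k = 1 / (real N)\<^sup>2 + 1 / real N * (2 / (\<eta> * b\<^sup>2) * (\<delta> k)\<^sup>2)" for k
    have c0: "0 \<le> c k" for k using \<eta> by (simp add: c_def)
    define \<rho> where "\<rho> k = (\<Sum>j<k. c j)" for k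
    have \<rho>_Suc: "\<rho> (Suc k) = \<rho> k + c k" for k by (simp add: \<rho>_def)
    have \<rho>0: "0 \<le> \<rho> k" for k unfolding \<rho>_def by (intro sum_nonneg c0)
    have \<rho>N: "\<rho> N \<le> Y / real N"
    proof -
      have "\<rho> N = real N * (1 / (real N)\<^sup>2) + 1 / real N * (2 / (\<eta> * b\<^sup>2) * (\<Sum>k<N. (\<delta> k)\<^sup>2))"
        by (simp add: \<rho>_def c_def sum.distrib sum_distrib_left)
      also have "\<dots> \<le> real N * (1 / (real N)\<^sup>2) + 1 / real N * (2 / (\<eta> * b\<^sup>2) * X'\<^sup>2)"
        using sum_\<delta>2 \<eta> by (intro add_left_mono mult_left_mono) auto
      also have "\<dots> = Y / real N"
        using N by (simp add: Y_def power2_eq_square add_divide_distrib)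
      finally show ?thesis .
    qed
    have \<rho>_le: "\<rho> k \<le> Y / real N" if "k \<le> N" for k
      using sum_mono2[of "{..<N}" "{..<k}" c] c0 that \<rho>N by (force simp: \<rho>_def)
    define z where "z k x = \<gamma> * (\<phi> k x - \<rho> k)" for k x
    have z_diff: "z (Suc k) x - z k x = \<gamma> * (\<Delta> k x - c k)" for k x
      by (simp add: z_def \<Delta>_def \<rho>_Suc algebra_simps)
    have z_step: "z k x + s * (z (Suc k) x - z k x) = \<gamma> * ((\<phi> k x + s * \<Delta> k x) - (\<rho> k + s * c k))" for k s x
      unfolding z_diff by (simp add: z_def algebra_simps)
    have HJ: "integrated_HJ K \<pi> b (interpolate N z)"
    proof (rule interpolate_integrated_HJ[OF N])
      fix k and s :: real and \<nu> :: "'x \<Rightarrow> real" assume k: "k < N" and s: "0 \<le> s" "s \<le> 1" and \<nu>: "\<nu> \<in> densities"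
      let ?E = "energy K \<pi> \<nu> (\<phi> k) (\<phi> k)" and ?m = "pairing \<pi> (\<lambda>_. 1) \<nu>"
      have m: "0 \<le> ?m" by (rule pairing_one_nonneg[OF \<nu>])
      have en: "energy K \<pi> \<nu> (\<lambda>x. z k x + s * (z (Suc k) x - z k x)) (\<lambda>x. z k x + s * (z (Suc k) x - z k x))
          \<le> \<gamma> * (?E + 1 / \<eta> * (4 * (\<delta> k)\<^sup>2 * ?m))"
      proof -
        have "energy K \<pi> \<nu> (\<lambda>x. z k x + s * (z (Suc k) x - z k x)) (\<lambda>x. z k x + s * (z (Suc k) x - z k x))
          = \<gamma> * (\<gamma> * energy K \<pi> \<nu> (\<lambda>x. \<phi> k x + s * \<Delta> k x) (\<lambda>x. \<phi> k x + s * \<Delta> k x))"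
          unfolding z_step energy_scale_left energy_scale_right energy_shift ..
        also have "\<dots> \<le> \<gamma> * (\<gamma> * ((1 + \<eta>) * ?E + (1 + 1 / \<eta>) * (1 * (4 * (\<delta> k)\<^sup>2 * ?m))))"
        proof (intro mult_left_mono)
          have "energy K \<pi> \<nu> (\<lambda>x. \<phi> k x + s * \<Delta> k x) (\<lambda>x. \<phi> k x + s * \<Delta> k x)
              \<le> (1 + \<eta>) * ?E + (1 + 1 / \<eta>) * (s\<^sup>2 * energy K \<pi> \<nu> (\<Delta> k) (\<Delta> k))"
            by (rule energy_sum_le[OF \<eta>])
          also have "\<dots> \<le> (1 + \<eta>) * ?E + (1 + 1 / \<eta>) * (1 * (4 * (\<delta> k)\<^sup>2 * ?m))"
            using \<eta> s energy_nonneg energy_le_sup_norm[OF \<nu>, of "\<Delta> k" "\<delta> k"] \<delta>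
            by (intro add_left_mono mult_left_mono mult_mono) (auto simp: power_le_one)
          finally show "energy K \<pi> \<nu> (\<lambda>x. \<phi> k x + s * \<Delta> k x) (\<lambda>x. \<phi> k x + s * \<Delta> k x)
              \<le> (1 + \<eta>) * ?E + (1 + 1 / \<eta>) * (1 * (4 * (\<delta> k)\<^sup>2 * ?m))" .
        qed (use \<gamma> in auto)
        also have "(1 + \<eta>) * ?E + (1 + 1 / \<eta>) * (1 * (4 * (\<delta> k)\<^sup>2 * ?m))
            = (1 + \<eta>) * (?E + 1 / \<eta> * (4 * (\<delta> k)\<^sup>2 * ?m))"
          using \<eta> by (simp add: field_simps)
        also have "\<gamma> * (\<gamma> * \<dots>) = \<gamma> * (?E + 1 / \<eta> * (4 * (\<delta> k)\<^sup>2 * ?m))"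
          by (simp only: \<gamma>(3))
        finally show ?thesis .
      qed
      have lin: "real N * pairing \<pi> (\<lambda>x. z (Suc k) x - z k x) \<nu>
          \<le> \<gamma> * (- (1 / (2 * b\<^sup>2) * ?E) - 2 / (\<eta> * b\<^sup>2) * (\<delta> k)\<^sup>2 * ?m)"
      proof -
        have "pairing \<pi> (\<lambda>x. z (Suc k) x - z k x) \<nu> = \<gamma> * (pairing \<pi> (\<Delta> k) \<nu> - c k * ?m)"
          unfolding z_diff pairing_scale_left pairing_diff_left pairing_const_left[of "c k"] ..
        moreover have "pairing \<pi> (\<Delta> k) \<nu> \<le> 1 / (real N)\<^sup>2 * ?m - 1 / real N * (1 / (2 * b\<^sup>2) * ?E)"
          using viol k \<nu> unfolding \<Delta>_def by force
        moreover have "1 / (real N)\<^sup>2 * ?m - 1 / real N * (1 / (2 * b\<^sup>2) * ?E) - c k * ?m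
            = 1 / real N * (- (1 / (2 * b\<^sup>2) * ?E) - 2 / (\<eta> * b\<^sup>2) * (\<delta> k)\<^sup>2 * ?m)"
          by (simp add: c_def algebra_simps)
        ultimately have "pairing \<pi> (\<lambda>x. z (Suc k) x - z k x) \<nu>
          \<le> \<gamma> * (1 / real N * (- (1 / (2 * b\<^sup>2) * ?E) - 2 / (\<eta> * b\<^sup>2) * (\<delta> k)\<^sup>2 * ?m))"
          using \<gamma>(1) by (simp only:) (intro mult_left_mono, linarith)
        then have "real N * pairing \<pi> (\<lambda>x. z (Suc k) x - z k x) \<nu>
          \<le> real N * (\<gamma> * (1 / real N * (- (1 / (2 * b\<^sup>2) * ?E) - 2 / (\<eta> * b\<^sup>2) * (\<delta> k)\<^sup>2 * ?m)))"
          by (intro mult_left_mono) auto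
        then show ?thesis using N by simp
      qed
      have "1 / (2 * b\<^sup>2) * energy K \<pi> \<nu> (\<lambda>x. z k x + s * (z (Suc k) x - z k x)) (\<lambda>x. z k x + s * (z (Suc k) x - z k x))
          \<le> 1 / (2 * b\<^sup>2) * (\<gamma> * (?E + 1 / \<eta> * (4 * (\<delta> k)\<^sup>2 * ?m)))"
        by (intro mult_left_mono en) simp
      also have "\<dots> = \<gamma> * (1 / (2 * b\<^sup>2) * ?E + 2 / (\<eta> * b\<^sup>2) * (\<delta> k)\<^sup>2 * ?m)"
        using b by (simp add: field_simps)
      also have "\<dots> = - (\<gamma> * (- (1 / (2 * b\<^sup>2) * ?E) - 2 / (\<eta> * b\<^sup>2) * (\<delta> k)\<^sup>2 * ?m))"
        by (simp add: algebra_simps)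
      finally show "real N * pairing \<pi> (\<lambda>x. z (Suc k) x - z k x) \<nu> + 1 / (2 * b\<^sup>2) *
        energy K \<pi> \<nu> (\<lambda>x. z k x + s * (z (Suc k) x - z k x)) (\<lambda>x. z k x + s * (z (Suc k) x - z k x)) \<le> 0"
        using lin by linarith
    qed
    have mass_p: "pairing \<pi> (\<lambda>_. 1) p = 1" using p(2) by (simp add: pairing_def)
    define e where "e k = 2 * Y\<^sup>2 / (real N)\<^sup>2 + 2 * (\<delta> k)\<^sup>2" for k
    define Bd where "Bd k = \<gamma> * ((pairing \<pi> (\<phi> k) p)\<^sup>2 + 1 / \<eta> * e k)" for k
    have quad: "(pairing \<pi> (interpolate N z t) p)\<^sup>2 \<le> Bd k"
      if k: "k < N" and t: "real k \<le> real N * t" "real N * t \<le> real (Suc k)" for k t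
    proof -
      define s where "s = real N * t - real k"
      have s: "0 \<le> s" "s \<le> 1" using t by (auto simp: s_def)
      have fn: "interpolate N z t = (\<lambda>x. \<gamma> * ((\<phi> k x + s * \<Delta> k x) - (\<rho> k + s * c k)))"
        unfolding interpolate_on[OF k t] s_def by (intro ext) (simp only: interpolate_on[OF k t] z_step)
      have val: "pairing \<pi> (interpolate N z t) p
          = \<gamma> * (pairing \<pi> (\<phi> k) p + (s * pairing \<pi> (\<Delta> k) p - (\<rho> k + s * c k)))"
        unfolding fn pairing_scale_left pairing_diff_left
        unfolding pairing_const_left[of "\<rho> k + s * c k"] mass_p
        unfolding pairing_add_left pairing_scale_left by simp
      define r where "r = s * pairing \<pi> (\<Delta> k) p - (\<rho> k + s * c k)"
      have "\<bar>pairing \<pi> (\<Delta> k) p\<bar> \<le> (\<Sum>x\<in>UNIV. \<delta> k * (p x * \<pi> x))"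
        unfolding pairing_def using p(1) \<delta> pi_nonneg
        by (intro order_trans[OF sum_abs] sum_mono)
          (auto simp: abs_mult pos_densities_def less_imp_le mult.assoc intro!: mult_mono)
      also have "\<dots> = \<delta> k" using p(2) by (simp flip: sum_distrib_left)
      finally have "\<bar>pairing \<pi> (\<Delta> k) p\<bar> \<le> \<delta> k" .
      then have "\<bar>s * pairing \<pi> (\<Delta> k) p\<bar> \<le> 1 * \<delta> k"
        unfolding abs_mult using s by (intro mult_mono) auto
      moreover have "\<rho> k + s * c k \<le> \<rho> k + 1 * c k"
        using s c0 by (intro add_left_mono mult_right_mono) auto
      moreover have "\<rho> (Suc k) \<le> Y / real N" using k by (intro \<rho>_le) simp
      moreover have "0 \<le> \<rho> k + s * c k" using \<rho>0 s c0 by simp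
      ultimately have "\<bar>r\<bar> \<le> \<delta> k + Y / real N"
        unfolding r_def \<rho>_Suc by (simp add: abs_le_iff)
      then have "r\<^sup>2 \<le> (\<delta> k + Y / real N)\<^sup>2"
        by (metis abs_ge_zero power2_abs power_mono)
      also have "\<dots> \<le> e k"
      proof -
        have "(\<delta> k + q)\<^sup>2 \<le> 2 * q\<^sup>2 + 2 * (\<delta> k)\<^sup>2" for q
          using zero_le_power2[of "\<delta> k - q"] by (simp add: power2_eq_square algebra_simps)
        from this[of "Y / real N"] show ?thesis by (simp add: e_def power_divide)
      qed
      finally have r2: "r\<^sup>2 \<le> e k" .
      have "(pairing \<pi> (\<phi> k) p + r)\<^sup>2 \<le> (1 + \<eta>) * (pairing \<pi> (\<phi> k) p)\<^sup>2 + (1 + 1 / \<eta>) * r\<^sup>2"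
      proof -
        have "0 \<le> (\<eta> * pairing \<pi> (\<phi> k) p - r)\<^sup>2 / \<eta>" using \<eta> by simp
        also have "\<dots> = (1 + \<eta>) * (pairing \<pi> (\<phi> k) p)\<^sup>2 + (1 + 1 / \<eta>) * r\<^sup>2 - (pairing \<pi> (\<phi> k) p + r)\<^sup>2"
          using \<eta> by (simp add: power2_eq_square field_simps)
        finally show ?thesis by simp
      qed
      also have "\<dots> \<le> (1 + \<eta>) * (pairing \<pi> (\<phi> k) p)\<^sup>2 + (1 + 1 / \<eta>) * e k"
        using r2 \<eta> by (intro add_left_mono mult_left_mono) auto
      finally have "\<gamma>\<^sup>2 * (pairing \<pi> (\<phi> k) p + r)\<^sup>2
          \<le> \<gamma>\<^sup>2 * ((1 + \<eta>) * (pairing \<pi> (\<phi> k) p)\<^sup>2 + (1 + 1 / \<eta>) * e k)"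
        by (intro mult_left_mono) auto
      also have "\<dots> = Bd k"
      proof -
        have "(1 + \<eta>) * (pairing \<pi> (\<phi> k) p)\<^sup>2 + (1 + 1 / \<eta>) * e k = (1 + \<eta>) * ((pairing \<pi> (\<phi> k) p)\<^sup>2 + 1 / \<eta> * e k)"
          using \<eta> by (simp add: field_simps)
        then show ?thesis unfolding Bd_def power2_eq_square[of \<gamma>] mult.assoc by (simp only: \<gamma>(3))
      qed
      finally show ?thesis unfolding val r_def[symmetric] by (simp only: power_mult_distrib)
    qed
    define I where "I = (\<integral>t. (pairing \<pi> (interpolate N z t) p)\<^sup>2 \<partial>lebesgue_on {0..1})"
    have contI: "continuous_on {0..1} (\<lambda>t. (pairing \<pi> (interpolate N z t) p)\<^sup>2)"
      by (intro continuous_on_power continuous_on_pairing_left continuous_interpolate)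
    have "I = integral {0..1} (\<lambda>t. (pairing \<pi> (interpolate N z t) p)\<^sup>2)"
      unfolding I_def by (rule lebesgue_integral_eq_integral[OF continuous_imp_integrable_real[OF contI]]) simp
    also have "\<dots> \<le> (\<Sum>k<N. 1 / real N * Bd k)"
      by (rule integral_le_grid_sum[OF contI N quad])
    finally have I: "I \<le> (\<Sum>k<N. 1 / real N * Bd k)" .
    define G where "G = source_cost N a p \<phi>"
    define W where "W = (\<Sum>k<N. 1 / real N * (pairing \<pi> (\<phi> k) p)\<^sup>2)"
    have GW: "G = 1 / (2 * a\<^sup>2) * W" by (simp add: G_def W_def sum_distrib_left mult_ac)
    have "(1 + \<eta>) * I \<le> (1 + \<eta>) * (\<Sum>k<N. 1 / real N * Bd k)"
      using I \<eta> by (intro mult_left_mono) auto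
    also have "\<dots> = W + 1 / \<eta> * (\<Sum>k<N. 1 / real N * e k)"
    proof -
      have "(1 + \<eta>) * (1 / real N * Bd k) = 1 / real N * (pairing \<pi> (\<phi> k) p)\<^sup>2 + 1 / \<eta> * (1 / real N * e k)" for k
      proof -
        have "(1 + \<eta>) * (1 / real N * Bd k) = 1 / real N * ((1 + \<eta>) * Bd k)" by simp
        also have "(1 + \<eta>) * Bd k = (pairing \<pi> (\<phi> k) p)\<^sup>2 + 1 / \<eta> * e k" unfolding Bd_def by (rule \<gamma>(2))
        finally show ?thesis by (simp add: algebra_simps)
      qed
      then show ?thesis unfolding W_def sum_distrib_left sum.distrib[symmetric] by (simp only:)
    qed
    also have "\<dots> \<le> W + 1 / \<eta> * (2 * (Y\<^sup>2 + X'\<^sup>2) / real N)"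
    proof -
      have "(\<Sum>k<N. 1 / real N * e k) = 2 * Y\<^sup>2 / (real N)\<^sup>2 + 1 / real N * (2 * (\<Sum>k<N. (\<delta> k)\<^sup>2))"
        using N by (simp add: e_def sum.distrib add_divide_distrib sum_distrib_left sum_divide_distrib)
      also have "\<dots> \<le> 2 * Y\<^sup>2 / real N + 1 / real N * (2 * X'\<^sup>2)"
      proof (intro add_mono mult_left_mono sum_\<delta>2)
        have "real N \<le> (real N)\<^sup>2" using N by (simp add: power2_eq_square)
        then show "2 * Y\<^sup>2 / (real N)\<^sup>2 \<le> 2 * Y\<^sup>2 / real N" using N by (intro divide_left_mono) auto
      qed auto
      also have "\<dots> = 2 * (Y\<^sup>2 + X'\<^sup>2) / real N" by (simp add: add_divide_distrib)
      finally show ?thesis using \<eta> by (intro add_left_mono mult_left_mono) auto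
    qed
    finally have I2: "(1 + \<eta>) * I \<le> W + 1 / \<eta> * (2 * (Y\<^sup>2 + X'\<^sup>2) / real N)" .
    have "(1 + \<eta>) * (1 / (2 * a\<^sup>2) * I) = 1 / (2 * a\<^sup>2) * ((1 + \<eta>) * I)" by simp
    also have "\<dots> \<le> 1 / (2 * a\<^sup>2) * (W + 1 / \<eta> * (2 * (Y\<^sup>2 + X'\<^sup>2) / real N))"
      by (intro mult_left_mono I2) simp
    also have "\<dots> = G + (Y\<^sup>2 + X'\<^sup>2) / (a\<^sup>2 * \<eta>) / real N"
    proof -
      have "1 / (2 * a\<^sup>2) * (1 / \<eta> * (2 * S / n)) = S / (a\<^sup>2 * \<eta>) / n" for S n :: real by simp
      from this[of "Y\<^sup>2 + X'\<^sup>2" "real N"] show ?thesis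
        unfolding GW distrib_left[of "1 / (2 * a\<^sup>2)"] by (simp only:)
    qed
    finally have I3: "(1 + \<eta>) * (1 / (2 * a\<^sup>2) * I) \<le> G + (Y\<^sup>2 + X'\<^sup>2) / (a\<^sup>2 * \<eta>) / real N" .
    have ends: "(1 + \<eta>) * (pairing \<pi> (z N) \<mu>\<^sub>1 - pairing \<pi> (z 0) \<mu>\<^sub>0)
        = pairing \<pi> (\<phi> N) \<mu>\<^sub>1 - pairing \<pi> (\<phi> 0) \<mu>\<^sub>0 - \<rho> N * pairing \<pi> (\<lambda>_. 1) \<mu>\<^sub>1"
    proof -
      have "pairing \<pi> (z k) w = \<gamma> * (pairing \<pi> (\<phi> k) w - \<rho> k * pairing \<pi> (\<lambda>_. 1) w)" for k w
        unfolding z_def pairing_scale_left pairing_diff_left pairing_const_left[of "\<rho> k"] ..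
      moreover have "\<rho> 0 = 0" by (simp add: \<rho>_def)
      ultimately have "(1 + \<eta>) * pairing \<pi> (z N) \<mu>\<^sub>1 = pairing \<pi> (\<phi> N) \<mu>\<^sub>1 - \<rho> N * pairing \<pi> (\<lambda>_. 1) \<mu>\<^sub>1"
        "(1 + \<eta>) * pairing \<pi> (z 0) \<mu>\<^sub>0 = pairing \<pi> (\<phi> 0) \<mu>\<^sub>0"
        by (simp_all only: \<gamma>(2) mult_zero_left diff_zero)
      then show ?thesis unfolding right_diff_distrib by linarith
    qed
    have "\<rho> N * pairing \<pi> (\<lambda>_. 1) \<mu>\<^sub>1 \<le> Y / real N * pairing \<pi> (\<lambda>_. 1) \<mu>\<^sub>1"
      by (intro mult_right_mono \<rho>N pairing_one_nonneg \<mu>1)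
    moreover have "(1 + \<eta>) * dual_functional \<pi> a p \<mu>\<^sub>0 \<mu>\<^sub>1 (interpolate N z)
        = (1 + \<eta>) * (pairing \<pi> (z N) \<mu>\<^sub>1 - pairing \<pi> (z 0) \<mu>\<^sub>0) - (1 + \<eta>) * (1 / (2 * a\<^sup>2) * I)"
      by (simp add: dual_functional_def interpolate_ends[OF N] I_def right_diff_distrib)
    moreover have "Z / real N = Y / real N * pairing \<pi> (\<lambda>_. 1) \<mu>\<^sub>1 + (Y\<^sup>2 + X'\<^sup>2) / (a\<^sup>2 * \<eta>) / real N"
      by (simp add: Z_def add_divide_distrib)
    ultimately have "pairing \<pi> (\<phi> N) \<mu>\<^sub>1 - pairing \<pi> (\<phi> 0) \<mu>\<^sub>0 - G
      \<le> (1 + \<eta>) * dual_functional \<pi> a p \<mu>\<^sub>0 \<mu>\<^sub>1 (interpolate N z) + Z / real N"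
      using I3 ends by linarith
    then show "\<exists>\<psi>. integrated_HJ K \<pi> b \<psi> \<and> pairing \<pi> (\<phi> N) \<mu>\<^sub>1 - pairing \<pi> (\<phi> 0) \<mu>\<^sub>0
        - source_cost N a p \<phi>
      \<le> (1 + \<eta>) * dual_functional \<pi> a p \<mu>\<^sub>0 \<mu>\<^sub>1 \<psi> + Z / real N"
      using HJ unfolding G_def by blast
  qed
qed

end

section \<open>Curves of finite action\<close>

text \<open>A curve of densities on \<open>[0, T]\<close> with potential and source, of cost at most \<open>c\<close>. The
  cost is bounded through a Borel rate \<open>C\<close>, so that costs add along concatenations without measuring
  the actual integrand.\<close>

definition connects ::
  "('x::finite \<Rightarrow> 'x \<Rightarrow> real) \<Rightarrow> ('x \<Rightarrow> real) \<Rightarrow> real \<Rightarrow> real \<Rightarrow> ('x \<Rightarrow> real) \<Rightarrow>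
     real \<Rightarrow> ('x \<Rightarrow> real) \<Rightarrow> ('x \<Rightarrow> real) \<Rightarrow> real \<Rightarrow> bool" where
  "connects K \<pi> a b p T u v c \<longleftrightarrow> (\<exists>\<mu> \<psi> h S L C. finite S \<and>
     (\<forall>x. L-lipschitz_on {0..T} (\<lambda>t. \<mu> t x)) \<and> (\<forall>t\<in>{0..T}. \<mu> t \<in> densities) \<and> \<mu> 0 = u \<and> \<mu> T = v \<and>
     (\<forall>x. (\<lambda>t. \<psi> t x) \<in> borel_measurable borel) \<and> h \<in> borel_measurable borel \<and>
     C \<in> borel_measurable borel \<and>
     (\<forall>t\<in>{0<..<T} - S. (\<forall>x. ((\<lambda>s. \<mu> s x) has_real_derivative
         h t * p x - divergence K (\<mu> t) (\<psi> t) x) (at t)) \<and>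
       a\<^sup>2 * (h t)\<^sup>2 + b\<^sup>2 * energy K \<pi> (\<mu> t) (\<psi> t) (\<psi> t) \<le> C t) \<and>
     (\<integral>\<^sup>+t. ennreal (C t) * indicator {0..T} t \<partial>lborel) \<le> ennreal c)"

lemma connectsE:
  assumes "connects K \<pi> a b p T u v c"
  obtains \<mu> \<psi> h S L C where "finite S"
     and "\<forall>x. L-lipschitz_on {0..T} (\<lambda>t. \<mu> t x)" and "\<forall>t\<in>{0..T}. \<mu> t \<in> densities" and "\<mu> 0 = u" and "\<mu> T = v"
     and "\<forall>x. (\<lambda>t. \<psi> t x) \<in> borel_measurable borel" and "h \<in> borel_measurable borel"
     and "C \<in> borel_measurable borel"
     and "\<forall>t\<in>{0<..<T} - S. (\<forall>x. ((\<lambda>s. \<mu> s x) has_real_derivative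
         h t * p x - divergence K (\<mu> t) (\<psi> t) x) (at t)) \<and>
       a\<^sup>2 * (h t)\<^sup>2 + b\<^sup>2 * energy K \<pi> (\<mu> t) (\<psi> t) (\<psi> t) \<le> C t"
     and "(\<integral>\<^sup>+t. ennreal (C t) * indicator {0..T} t \<partial>lborel) \<le> ennreal c"
  using assms unfolding connects_def by (elim exE conjE) (rule that; assumption)

lemma connects_concat:
  assumes 1: "connects K \<pi> a b p T\<^sub>1 u v c\<^sub>1" and 2: "connects K \<pi> a b p T\<^sub>2 v w c\<^sub>2"
    and T: "0 \<le> T\<^sub>1" "0 \<le> T\<^sub>2" and c: "0 \<le> c\<^sub>1" "0 \<le> c\<^sub>2"
  shows "connects K \<pi> a b p (T\<^sub>1 + T\<^sub>2) u w (c\<^sub>1 + c\<^sub>2)"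
proof -
  obtain \<mu>1 \<psi>1 h1 S1 L1 C1 where S1: "finite S1" and L1': "\<forall>x. L1-lipschitz_on {0..T\<^sub>1} (\<lambda>t. \<mu>1 t x)"
    and d1': "\<forall>t\<in>{0..T\<^sub>1}. \<mu>1 t \<in> densities" and e1: "\<mu>1 0 = u" "\<mu>1 T\<^sub>1 = v"
    and m1: "\<forall>x. (\<lambda>t. \<psi>1 t x) \<in> borel_measurable borel" "h1 \<in> borel_measurable borel" "C1 \<in> borel_measurable borel"
    and D1': "\<forall>t\<in>{0<..<T\<^sub>1} - S1. (\<forall>x. ((\<lambda>s. \<mu>1 s x) has_real_derivative
         h1 t * p x - divergence K (\<mu>1 t) (\<psi>1 t) x) (at t)) \<and>
       a\<^sup>2 * (h1 t)\<^sup>2 + b\<^sup>2 * energy K \<pi> (\<mu>1 t) (\<psi>1 t) (\<psi>1 t) \<le> C1 t"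
    and I1: "(\<integral>\<^sup>+t. ennreal (C1 t) * indicator {0..T\<^sub>1} t \<partial>lborel) \<le> ennreal c\<^sub>1"
    by (rule connectsE[OF 1])
  note [measurable] = m1(1)[THEN spec] m1(2,3)
  note L1 = L1'[THEN spec] and d1 = d1'[THEN bspec]
    and D1 = D1'[THEN bspec, THEN conjunct1, THEN spec] and E1 = D1'[THEN bspec, THEN conjunct2]
  obtain \<mu>2 \<psi>2 h2 S2 L2 C2 where S2: "finite S2" and L2': "\<forall>x. L2-lipschitz_on {0..T\<^sub>2} (\<lambda>t. \<mu>2 t x)"
    and d2': "\<forall>t\<in>{0..T\<^sub>2}. \<mu>2 t \<in> densities" and e2: "\<mu>2 0 = v" "\<mu>2 T\<^sub>2 = w"
    and m2: "\<forall>x. (\<lambda>t. \<psi>2 t x) \<in> borel_measurable borel" "h2 \<in> borel_measurable borel" "C2 \<in> borel_measurable borel"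
    and D2': "\<forall>t\<in>{0<..<T\<^sub>2} - S2. (\<forall>x. ((\<lambda>s. \<mu>2 s x) has_real_derivative
         h2 t * p x - divergence K (\<mu>2 t) (\<psi>2 t) x) (at t)) \<and>
       a\<^sup>2 * (h2 t)\<^sup>2 + b\<^sup>2 * energy K \<pi> (\<mu>2 t) (\<psi>2 t) (\<psi>2 t) \<le> C2 t"
    and I2: "(\<integral>\<^sup>+t. ennreal (C2 t) * indicator {0..T\<^sub>2} t \<partial>lborel) \<le> ennreal c\<^sub>2"
    by (rule connectsE[OF 2])
  note [measurable] = m2(1)[THEN spec] m2(2,3)
  note L2 = L2'[THEN spec] and d2 = d2'[THEN bspec]
    and D2 = D2'[THEN bspec, THEN conjunct1, THEN spec] and E2 = D2'[THEN bspec, THEN conjunct2]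
  define \<mu> where "\<mu> t = (if t \<le> T\<^sub>1 then \<mu>1 t else \<mu>2 (t - T\<^sub>1))" for t
  define \<psi> where "\<psi> t x = (if t \<le> T\<^sub>1 then \<psi>1 t x else \<psi>2 (t - T\<^sub>1) x)" for t x
  define h where "h t = (if t \<le> T\<^sub>1 then h1 t else h2 (t - T\<^sub>1))" for t
  define C where "C t = (if t \<le> T\<^sub>1 then C1 t else C2 (t - T\<^sub>1))" for t
  define S where "S = insert T\<^sub>1 (S1 \<union> (\<lambda>s. s + T\<^sub>1) ` S2)"
  have "finite S" using S1 S2 by (simp add: S_def)
  moreover have "(max L1 L2)-lipschitz_on {0..T\<^sub>1 + T\<^sub>2} (\<lambda>t. \<mu> t x)" for x
  proof -
    have "L2-lipschitz_on {T\<^sub>1..T\<^sub>1 + T\<^sub>2} (\<lambda>t. \<mu>2 (t - T\<^sub>1) x)"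
    proof (rule lipschitz_onI)
      fix s t assume "s \<in> {T\<^sub>1..T\<^sub>1 + T\<^sub>2}" "t \<in> {T\<^sub>1..T\<^sub>1 + T\<^sub>2}"
      then show "dist (\<mu>2 (s - T\<^sub>1) x) (\<mu>2 (t - T\<^sub>1) x) \<le> L2 * dist s t"
        using lipschitz_onD[OF L2, of "s - T\<^sub>1" "t - T\<^sub>1" x] by (simp add: dist_real_def)
    qed (rule lipschitz_on_nonneg[OF L2])
    then have "(max L1 L2)-lipschitz_on {0..T\<^sub>1 + T\<^sub>2} (\<lambda>t. if t \<le> T\<^sub>1 then \<mu>1 t x else \<mu>2 (t - T\<^sub>1) x)"
      by (intro lipschitz_on_concat_max L1) (simp_all add: e1 e2)
    moreover have "(\<lambda>t. \<mu> t x) = (\<lambda>t. if t \<le> T\<^sub>1 then \<mu>1 t x else \<mu>2 (t - T\<^sub>1) x)"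
      by (auto simp: \<mu>_def)
    ultimately show ?thesis by (simp only:)
  qed
  moreover have "\<mu> t \<in> densities" if "t \<in> {0..T\<^sub>1 + T\<^sub>2}" for t
    using d1[of t] d2[of "t - T\<^sub>1"] that by (auto simp: \<mu>_def)
  moreover have "\<mu> 0 = u" using T e1 by (simp add: \<mu>_def)
  moreover have "\<mu> (T\<^sub>1 + T\<^sub>2) = w" using T e1 e2 by (auto simp: \<mu>_def)
  moreover have "(\<lambda>t. \<psi> t x) \<in> borel_measurable borel" for x unfolding \<psi>_def by measurable
  moreover have "h \<in> borel_measurable borel" unfolding h_def by measurable
  moreover have "C \<in> borel_measurable borel" unfolding C_def by measurable
  moreover have "(\<forall>x. ((\<lambda>s. \<mu> s x) has_real_derivative h t * p x - divergence K (\<mu> t) (\<psi> t) x) (at t)) \<and>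
       a\<^sup>2 * (h t)\<^sup>2 + b\<^sup>2 * energy K \<pi> (\<mu> t) (\<psi> t) (\<psi> t) \<le> C t"
    if t: "t \<in> {0<..<T\<^sub>1 + T\<^sub>2} - S" for t
  proof (cases "t < T\<^sub>1")
    case True
    then have tin: "t \<in> {0<..<T\<^sub>1} - S1" using t by (auto simp: S_def)
    have eq: "\<mu> t = \<mu>1 t" "\<psi> t = \<psi>1 t" "h t = h1 t" "C t = C1 t"
      using True by (auto simp: \<mu>_def \<psi>_def h_def C_def)
    have "((\<lambda>s. \<mu> s x) has_real_derivative h1 t * p x - divergence K (\<mu>1 t) (\<psi>1 t) x) (at t)" for x
      by (rule has_field_derivative_transform_within_open[OF D1[OF tin], of "{..<T\<^sub>1}"])
        (use True in \<open>auto simp: \<mu>_def\<close>)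
    then show ?thesis using E1[OF tin] by (simp add: eq)
  next
    case False
    then have t1: "T\<^sub>1 < t" using t by (auto simp: S_def)
    have "t - T\<^sub>1 \<notin> S2"
    proof
      assume "t - T\<^sub>1 \<in> S2"
      then have "t \<in> S" unfolding S_def by force
      then show False using t by simp
    qed
    then have tin: "t - T\<^sub>1 \<in> {0<..<T\<^sub>2} - S2" using t t1 by auto
    have eq: "\<mu> t = \<mu>2 (t - T\<^sub>1)" "\<psi> t = \<psi>2 (t - T\<^sub>1)" "h t = h2 (t - T\<^sub>1)" "C t = C2 (t - T\<^sub>1)"
      using t1 by (auto simp: \<mu>_def \<psi>_def h_def C_def)
    have "((\<lambda>s. \<mu> s x) has_real_derivative h2 (t - T\<^sub>1) * p x - divergence K (\<mu>2 (t - T\<^sub>1)) (\<psi>2 (t - T\<^sub>1)) x) (at t)" for x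
    proof -
      have "((\<lambda>s. \<mu>2 (s - T\<^sub>1) x) has_real_derivative
          (h2 (t - T\<^sub>1) * p x - divergence K (\<mu>2 (t - T\<^sub>1)) (\<psi>2 (t - T\<^sub>1)) x) * 1) (at t)"
        by (rule DERIV_chain2[of "\<lambda>s. \<mu>2 s x" _ "\<lambda>s. s - T\<^sub>1", OF D2[OF tin]]) (auto intro!: derivative_eq_intros)
      then have "((\<lambda>s. \<mu>2 (s - T\<^sub>1) x) has_real_derivative
          h2 (t - T\<^sub>1) * p x - divergence K (\<mu>2 (t - T\<^sub>1)) (\<psi>2 (t - T\<^sub>1)) x) (at t)" by simp
      then show ?thesis
        by (rule has_field_derivative_transform_within_open[of _ _ _ "{T\<^sub>1<..}"]) (use t1 in \<open>auto simp: \<mu>_def\<close>)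
    qed
    then show ?thesis using E2[OF tin] by (simp add: eq)
  qed
  moreover have "(\<integral>\<^sup>+t. ennreal (C t) * indicator {0..T\<^sub>1 + T\<^sub>2} t \<partial>lborel) \<le> ennreal (c\<^sub>1 + c\<^sub>2)"
  proof -
    have "(\<integral>\<^sup>+t. ennreal (C t) * indicator {0..T\<^sub>1 + T\<^sub>2} t \<partial>lborel)
        \<le> (\<integral>\<^sup>+t. ennreal (C1 t) * indicator {0..T\<^sub>1} t + ennreal (C2 (t - T\<^sub>1)) * indicator {0..T\<^sub>2} (t - T\<^sub>1) \<partial>lborel)"
      by (intro nn_integral_mono) (auto simp: C_def indicator_def)
    also have "\<dots> = (\<integral>\<^sup>+t. ennreal (C1 t) * indicator {0..T\<^sub>1} t \<partial>lborel)
        + (\<integral>\<^sup>+t. ennreal (C2 (t - T\<^sub>1)) * indicator {0..T\<^sub>2} (t - T\<^sub>1) \<partial>lborel)"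
      by (rule nn_integral_add) measurable
    also have "(\<integral>\<^sup>+t. ennreal (C2 (t - T\<^sub>1)) * indicator {0..T\<^sub>2} (t - T\<^sub>1) \<partial>lborel)
        = (\<integral>\<^sup>+t. ennreal (C2 t) * indicator {0..T\<^sub>2} t \<partial>lborel)"
      using nn_integral_real_affine[of "\<lambda>t. ennreal (C2 t) * indicator {0..T\<^sub>2} t" 1 "- T\<^sub>1"] by simp
    also have "(\<integral>\<^sup>+t. ennreal (C1 t) * indicator {0..T\<^sub>1} t \<partial>lborel) + \<dots> \<le> ennreal c\<^sub>1 + ennreal c\<^sub>2"
      by (intro add_mono I1 I2)
    finally show ?thesis using c by simp
  qed
  ultimately show ?thesis unfolding connects_def
    by (intro exI[of _ \<mu>] exI[of _ \<psi>] exI[of _ h] exI[of _ S] exI[of _ "max L1 L2"] exI[of _ C]) blast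
qed

lemma connects_refl: "u \<in> densities \<Longrightarrow> 0 \<le> T \<Longrightarrow> connects K \<pi> a b p T u u 0"
  unfolding connects_def
  by (intro exI[of _ "\<lambda>_. u"] exI[of _ "\<lambda>_ _. 0"] exI[of _ "\<lambda>_. 0"] exI[of _ "{}"] exI[of _ 0])
    (auto simp: divergence_def energy_def grad_def lipschitz_on_def)

lemma connects_chain:
  assumes "\<And>k. k < N \<Longrightarrow> connects K \<pi> a b p T (w k) (w (Suc k)) (c k)" "\<And>k. k < N \<Longrightarrow> 0 \<le> c k"
    and "0 \<le> T" "w 0 \<in> densities"
  shows "connects K \<pi> a b p (real N * T) (w 0) (w N) (\<Sum>k<N. c k)"
proof -
  have "n \<le> N \<Longrightarrow> connects K \<pi> a b p (real n * T) (w 0) (w n) (\<Sum>k<n. c k)" for n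
  proof (induction n)
    case 0
    then show ?case using connects_refl[OF assms(4)] by simp
  next
    case (Suc n)
    then have "connects K \<pi> a b p (real n * T + T) (w 0) (w (Suc n)) ((\<Sum>k<n. c k) + c n)"
      using assms by (intro connects_concat[of _ _ _ _ _ _ _ "w n"] sum_nonneg) auto
    then show ?case by (simp add: algebra_simps)
  qed
  then show ?thesis by simp
qed

lemma lipschitz_imp_abs_continuous:
  assumes "L-lipschitz_on {c..d} f"
  shows "abs_continuous_on_interval c d f"
  unfolding abs_continuous_on_interval_def
proof (intro allI impI)
  fix e :: real assume e: "0 < e"
  have L: "0 \<le> L" using assms by (rule lipschitz_on_nonneg)
  show "\<exists>\<delta>>0. \<forall>D. finite D \<longrightarrow> (\<forall>(u, v)\<in>D. c \<le> u \<and> u \<le> v \<and> v \<le> d) \<longrightarrow>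
        pairwise (\<lambda>(u, v) (u', v'). disjnt {u<..<v} {u'<..<v'}) D \<longrightarrow>
        (\<Sum>(u, v)\<in>D. v - u) < \<delta> \<longrightarrow> (\<Sum>(u, v)\<in>D. \<bar>f v - f u\<bar>) < e"
  proof (intro exI[of _ "e / (L + 1)"] conjI allI impI)
    show "0 < e / (L + 1)" using e L by simp
    fix D :: "(real \<times> real) set"
    assume D: "\<forall>(u, v)\<in>D. c \<le> u \<and> u \<le> v \<and> v \<le> d" and small: "(\<Sum>(u, v)\<in>D. v - u) < e / (L + 1)"
    have "(\<Sum>(u, v)\<in>D. \<bar>f v - f u\<bar>) \<le> (\<Sum>(u, v)\<in>D. (L + 1) * (v - u))"
    proof (rule sum_mono, safe)
      fix u v assume "(u, v) \<in> D"
      then have uv: "c \<le> u" "u \<le> v" "v \<le> d" using D by auto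
      then have "\<bar>f v - f u\<bar> \<le> L * (v - u)"
        using lipschitz_onD[OF assms, of v u] by (simp add: dist_real_def)
      also have "\<dots> \<le> (L + 1) * (v - u)" using uv by (intro mult_right_mono) auto
      finally show "\<bar>f v - f u\<bar> \<le> (L + 1) * (v - u)" .
    qed
    also have "\<dots> = (L + 1) * (\<Sum>(u, v)\<in>D. v - u)" by (simp add: sum_distrib_left case_prod_beta)
    also have "\<dots> < e" using small L by (simp add: pos_less_divide_eq mult.commute)
    finally show "(\<Sum>(u, v)\<in>D. \<bar>f v - f u\<bar>) < e" .
  qed
qed

context reversible_chain
begin

lemma connects_min_action:
  assumes conn: "connects K \<pi> a b p 1 \<mu>\<^sub>0 \<mu>\<^sub>1 c"
  shows "min_action K \<pi> a b p \<mu>\<^sub>0 \<mu>\<^sub>1 \<le> ennreal c"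
proof -
  let ?T = "lebesgue_on {0..1::real}"
  obtain \<mu> \<psi> h S L C where S: "finite S" and L': "\<forall>x. L-lipschitz_on {0..1} (\<lambda>t. \<mu> t x)"
    and dens': "\<forall>t\<in>{0..1}. \<mu> t \<in> densities" and ends: "\<mu> 0 = \<mu>\<^sub>0" "\<mu> 1 = \<mu>\<^sub>1"
    and meas': "\<forall>x. (\<lambda>t. \<psi> t x) \<in> borel_measurable borel" "h \<in> borel_measurable borel" "C \<in> borel_measurable borel"
    and D': "\<forall>t\<in>{0<..<1} - S. (\<forall>x. ((\<lambda>s. \<mu> s x) has_real_derivative
         h t * p x - divergence K (\<mu> t) (\<psi> t) x) (at t)) \<and>
       a\<^sup>2 * (h t)\<^sup>2 + b\<^sup>2 * energy K \<pi> (\<mu> t) (\<psi> t) (\<psi> t) \<le> C t"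
    and I: "(\<integral>\<^sup>+t. ennreal (C t) * indicator {0..1} t \<partial>lborel) \<le> ennreal c"
    by (rule connectsE[OF conn])
  note meas = meas'(1)[THEN spec] meas'(2,3)
  note L = L'[THEN spec] and dens = dens'[THEN bspec]
    and D = D'[THEN bspec, THEN conjunct1, THEN spec] and E = D'[THEN bspec, THEN conjunct2]
  have meas_leb: "f \<in> borel_measurable ?T" if "f \<in> borel_measurable borel" for f :: "real \<Rightarrow> real"
    using that by (intro measurable_restrict_space1 measurable_completion) simp
  have ae: "AE t in ?T. t \<in> {0<..<1} - S"
  proof -
    have "insert 0 (insert 1 S) \<in> null_sets lebesgue"
      using S by (intro finite_imp_null_set_lborel[THEN null_sets_completionI]) auto
    then have "AE t in lebesgue. t \<notin> insert 0 (insert 1 S)" by (rule AE_not_in)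
    then have "AE t in lebesgue. t \<in> {0..1} \<longrightarrow> t \<in> {0<..<1} - S" by (rule AE_mp) auto
    then show ?thesis by (subst AE_restrict_space_iff) (simp, assumption)
  qed
  have adm: "(\<mu>, \<psi>, h) \<in> admissible K p \<mu>\<^sub>0 \<mu>\<^sub>1"
  proof -
    have "AE t in ?T. \<forall>x. \<exists>d. ((\<lambda>s. \<mu> s x) has_real_derivative d) (at t within {0..1}) \<and>
        d + (\<Sum>y\<in>UNIV. (\<psi> t y - \<psi> t x) * mean_density (\<mu> t) x y * K x y) = h t * p x"
      using ae
    proof (rule AE_mp, intro AE_I2 impI allI)
      fix t x assume "t \<in> {0<..<1} - S"
      from has_field_derivative_at_within[OF D[OF this, of x]]
      have "((\<lambda>s. \<mu> s x) has_real_derivative h t * p x - divergence K (\<mu> t) (\<psi> t) x) (at t within {0..1})" .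
      then show "\<exists>d. ((\<lambda>s. \<mu> s x) has_real_derivative d) (at t within {0..1}) \<and>
        d + (\<Sum>y\<in>UNIV. (\<psi> t y - \<psi> t x) * mean_density (\<mu> t) x y * K x y) = h t * p x"
        by (intro exI[of _ "h t * p x - divergence K (\<mu> t) (\<psi> t) x"] conjI) (simp_all add: divergence_def)
    qed
    then show ?thesis
      unfolding admissible_def mem_Collect_eq prod.case
      by (intro conjI ballI allI dens ends lipschitz_imp_abs_continuous[OF L] meas_leb meas)
  qed
  have cont_\<mu>: "continuous_on {0..1} (\<lambda>t. \<mu> t x)" for x
    by (rule lipschitz_on_continuous_on[OF L])
  have "0 \<le> \<mu> t x" if "t \<in> {0..1}" for t x using dens[OF that] by (simp add: densities_def)
  then have "continuous_on {0..1} (\<lambda>t. mean_density (\<mu> t) x y)" for x y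
    unfolding mean_density_def by (intro continuous_on_log_mean_compose cont_\<mu>)
  then have [measurable]: "(\<lambda>t. mean_density (\<mu> t) x y) \<in> borel_measurable ?T" for x y
    by (intro continuous_imp_measurable_on_sets_lebesgue) auto
  have [measurable]: "(\<lambda>t. \<psi> t x) \<in> borel_measurable ?T" "h \<in> borel_measurable ?T" for x
    by (rule meas_leb, rule meas)+
  define n where "n t = norm_sq K \<pi> (\<mu> t) (grad (\<psi> t))" for t
  have [measurable]: "n \<in> borel_measurable ?T"
    unfolding n_def[abs_def] norm_sq_def grad_def by measurable
  have n0: "0 \<le> n t" for t by (simp add: n_def norm_sq_grad energy_nonneg)
  have "action K \<pi> a b \<mu> \<psi> h = (\<integral>\<^sup>+t. ennreal (a\<^sup>2 * (h t)\<^sup>2 + b\<^sup>2 * n t) \<partial>?T)"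
    unfolding action_def n_def[symmetric]
    by (simp add: nn_integral_cmult[symmetric] nn_integral_add[symmetric] ennreal_mult ennreal_plus n0)
  also have "\<dots> \<le> (\<integral>\<^sup>+t. ennreal (C t) \<partial>?T)"
  proof (rule nn_integral_mono_AE)
    show "AE t in ?T. ennreal (a\<^sup>2 * (h t)\<^sup>2 + b\<^sup>2 * n t) \<le> ennreal (C t)"
      using ae by (rule AE_mp) (auto simp: n_def norm_sq_grad intro!: AE_I2 ennreal_leI E)
  qed
  also have "\<dots> = (\<integral>\<^sup>+t. ennreal (C t) * indicator {0..1} t \<partial>lebesgue)"
    by (subst nn_integral_restrict_space) auto
  also have "\<dots> = (\<integral>\<^sup>+t. ennreal (C t) * indicator {0..1} t \<partial>lborel)"
    using meas by (intro nn_integral_completion)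
  also note I
  finally have "action K \<pi> a b \<mu> \<psi> h \<le> ennreal c" .
  then show ?thesis
    unfolding min_action_def by (intro INF_lower2[OF adm]) simp
qed

text \<open>The basic building block. Along a segment, run through at variable speed, the velocity is a
  multiple of a fixed divergence taken with respect to a reference density \<open>v\<close>. If the densities on
  the segment dominate \<open>v\<close> up to a factor, the same divergence is produced along the segment by a
  potential whose energy is controlled by duality.\<close>

lemma connects_segment:
  fixes \<sigma> \<sigma>' \<theta> :: "real \<Rightarrow> real"
  assumes T: "0 < T" and \<sigma>: "\<And>t. (\<sigma> has_real_derivative \<sigma>' t) (at t)" "continuous_on {0..T} \<sigma>'"
    and v: "v \<in> densities" and d: "\<And>x. d x = H * p x - divergence K v \<psi> x"
    and \<gamma>: "\<And>t x. \<gamma> t x = u x + \<sigma> t * d x"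
    and dens: "\<And>t. t \<in> {0..T} \<Longrightarrow> \<gamma> t \<in> densities" and pos: "\<And>t. t \<in> {0<..<T} \<Longrightarrow> \<gamma> t \<in> pos_densities"
    and \<theta>: "\<And>t. t \<in> {0<..<T} \<Longrightarrow> 0 < \<theta> t" "\<And>t. t \<in> {0<..<T} \<Longrightarrow> \<theta> t \<le> 1"
    and dom: "\<And>t x y. t \<in> {0<..<T} \<Longrightarrow> \<theta> t * mean_density v x y \<le> mean_density (\<gamma> t) x y"
    and B: "0 \<le> B" "\<And>t. t \<in> {0<..<T} \<Longrightarrow> (\<sigma>' t)\<^sup>2 \<le> B * \<theta> t"
  shows "connects K \<pi> a b p T (\<gamma> 0) (\<gamma> T) (T * (B * (a\<^sup>2 * H\<^sup>2 + b\<^sup>2 * energy K \<pi> v \<psi> \<psi>)))"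
proof -
  let ?E = "energy K \<pi>"
  have \<sigma>_cont: "continuous_on A \<sigma>" for A
    using \<sigma>(1) by (intro DERIV_continuous_on) (auto intro: has_field_derivative_at_within)
  have cont: "continuous_on A (\<lambda>t. \<gamma> t x)" for A x
    unfolding \<gamma> by (intro continuous_intros \<sigma>_cont)
  obtain \<Psi> :: "real \<Rightarrow> 'x \<Rightarrow> real" where \<Psi>: "\<And>x. continuous_on {0<..<T} (\<lambda>t. \<Psi> t x)"
    "\<And>t. t \<in> {0<..<T} \<Longrightarrow> divergence K (\<gamma> t) (\<Psi> t) = divergence K v \<psi>"
    using potential_exists[where w = \<gamma> and S = "{0<..<T}", OF pos cont pairing_one_divergence[OF v]] by blast
  define \<psi>t where "\<psi>t t x = (if t \<in> {0<..<T} then \<sigma>' t * \<Psi> t x else 0)" for t x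
  define h where "h t = (if t \<in> {0<..<T} then \<sigma>' t * H else 0)" for t
  have \<sigma>'_cont: "continuous_on {0<..<T} \<sigma>'" using \<sigma>(2) by (rule continuous_on_subset) auto
  define C where "C = B * (a\<^sup>2 * H\<^sup>2 + b\<^sup>2 * ?E v \<psi> \<psi>)"
  have C: "0 \<le> C" unfolding C_def using B energy_nonneg by simp
  have "(\<forall>x. ((\<lambda>s. \<gamma> s x) has_real_derivative h t * p x - divergence K (\<gamma> t) (\<psi>t t) x) (at t)) \<and>
      a\<^sup>2 * (h t)\<^sup>2 + b\<^sup>2 * ?E (\<gamma> t) (\<psi>t t) (\<psi>t t) \<le> C" if t: "t \<in> {0<..<T} - {}" for t
  proof -
    have t': "t \<in> {0<..<T}" using t by simp
    have eq: "\<psi>t t = (\<lambda>x. \<sigma>' t * \<Psi> t x)" "h t = \<sigma>' t * H" using t' by (auto simp: \<psi>t_def h_def)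
    have gd: "\<gamma> t \<in> densities" using t' by (intro dens) auto
    have div: "divergence K (\<gamma> t) (\<psi>t t) x = \<sigma>' t * divergence K v \<psi> x" for x
    proof -
      have "divergence K (\<gamma> t) (\<psi>t t) x = \<sigma>' t * divergence K (\<gamma> t) (\<Psi> t) x"
        by (simp add: divergence_def eq sum_distrib_left algebra_simps)
      then show ?thesis by (simp add: \<Psi>(2)[OF t'])
    qed
    have "((\<lambda>s. \<gamma> s x) has_real_derivative \<sigma>' t * d x) (at t)" for x
      unfolding \<gamma> by (auto intro!: derivative_eq_intros \<sigma>(1))
    then have der: "((\<lambda>s. \<gamma> s x) has_real_derivative h t * p x - divergence K (\<gamma> t) (\<psi>t t) x) (at t)" for x
      unfolding div eq(2) d by (simp add: algebra_simps)
    define e where "e = ?E (\<gamma> t) (\<Psi> t) (\<Psi> t)"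
    have e: "0 \<le> e" by (simp add: e_def energy_nonneg)
    have "e = ?E v (\<Psi> t) \<psi>"
      using pairing_divergence[OF gd, of "\<Psi> t" "\<Psi> t"] pairing_divergence[OF v, of "\<Psi> t" \<psi>] \<Psi>(2)[OF t']
      by (simp add: e_def)
    then have CS: "e\<^sup>2 \<le> ?E v (\<Psi> t) (\<Psi> t) * ?E v \<psi> \<psi>" using energy_Cauchy_Schwarz by simp
    have "\<theta> t * ?E v (\<Psi> t) (\<Psi> t) = ?E (\<lambda>x. \<theta> t * v x) (\<Psi> t) (\<Psi> t)"
      using \<theta>(1)[OF t'] v by (simp add: energy_scale_density)
    also have "\<dots> \<le> e"
      unfolding e_def using dom[OF t'] \<theta>(1)[OF t'] v
      by (intro energy_mono_density) (simp add: mean_density_def log_mean_scale densities_def)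
    finally have dom_e: "\<theta> t * ?E v (\<Psi> t) (\<Psi> t) \<le> e" .
    have le: "\<theta> t * e \<le> ?E v \<psi> \<psi>"
    proof (cases "e = 0")
      case False
      then have e0: "0 < e" using e by simp
      have "e * (\<theta> t * e) \<le> \<theta> t * (?E v (\<Psi> t) (\<Psi> t) * ?E v \<psi> \<psi>)"
        using mult_left_mono[OF CS, of "\<theta> t"] \<theta>(1)[OF t'] by (simp add: power2_eq_square mult_ac)
      also have "\<dots> \<le> e * ?E v \<psi> \<psi>"
        unfolding mult.assoc[symmetric] by (intro mult_right_mono dom_e energy_nonneg)
      finally show ?thesis using e0 by simp
    qed (simp add: energy_nonneg)
    have "a\<^sup>2 * (h t)\<^sup>2 = (\<sigma>' t)\<^sup>2 * (a\<^sup>2 * H\<^sup>2)" by (simp add: eq power_mult_distrib)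
    also have "\<dots> \<le> (B * \<theta> t) * (a\<^sup>2 * H\<^sup>2)" by (intro mult_right_mono B(2)[OF t']) simp
    also have "\<dots> \<le> (B * 1) * (a\<^sup>2 * H\<^sup>2)"
      by (intro mult_right_mono mult_left_mono \<theta>(2)[OF t'] B(1)) simp
    finally have 1: "a\<^sup>2 * (h t)\<^sup>2 \<le> B * (a\<^sup>2 * H\<^sup>2)" by simp
    have "b\<^sup>2 * ?E (\<gamma> t) (\<psi>t t) (\<psi>t t) = b\<^sup>2 * ((\<sigma>' t)\<^sup>2 * e)"
      by (simp add: eq energy_scale_left energy_scale_right e_def power2_eq_square)
    also have "\<dots> \<le> b\<^sup>2 * ((B * \<theta> t) * e)" by (intro mult_left_mono mult_right_mono B(2)[OF t'] e) simp
    also have "\<dots> \<le> b\<^sup>2 * (B * ?E v \<psi> \<psi>)"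
      unfolding mult.assoc by (intro mult_left_mono le B(1)) simp
    finally show ?thesis using der 1 by (simp add: C_def algebra_simps)
  qed
  moreover have "\<exists>L. \<forall>x. L-lipschitz_on {0..T} (\<lambda>t. \<gamma> t x)"
  proof -
    have "bounded (\<sigma>' ` {0..T})" by (intro compact_imp_bounded compact_continuous_image \<sigma>(2)) simp
    then obtain M where "\<forall>t\<in>{0..T}. norm (\<sigma>' t) \<le> M" by (auto simp: bounded_iff)
    then have M: "norm (\<sigma>' t) \<le> M" if "t \<in> {0..T}" for t using that by blast
    have M0: "0 \<le> M" using M[of 0] T norm_ge_zero[of "\<sigma>' 0"] by simp
    have sd: "0 \<le> (\<Sum>x\<in>UNIV. \<bar>d x\<bar>)" by (simp add: sum_nonneg)
    have "(M * (\<Sum>x\<in>UNIV. \<bar>d x\<bar>))-lipschitz_on {0..T} (\<lambda>t. \<gamma> t x)" for x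
    proof (rule lipschitz_onI)
      fix s t assume st: "s \<in> {0..T}" "t \<in> {0..T}"
      have "norm (\<sigma> s - \<sigma> t) \<le> M * norm (s - t)"
        using st \<sigma>(1) M by (intro field_differentiable_bound[of "{0..T}" \<sigma> \<sigma>'])
          (auto intro: has_field_derivative_at_within)
      moreover have "\<bar>d x\<bar> \<le> (\<Sum>x\<in>UNIV. \<bar>d x\<bar>)" by (intro member_le_sum[of x UNIV "\<lambda>x. \<bar>d x\<bar>"]) auto
      moreover have "\<gamma> s x - \<gamma> t x = (\<sigma> s - \<sigma> t) * d x" by (simp add: \<gamma> algebra_simps)
      ultimately have "\<bar>\<gamma> s x - \<gamma> t x\<bar> \<le> (M * \<bar>s - t\<bar>) * (\<Sum>x\<in>UNIV. \<bar>d x\<bar>)"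
        using M0 by (simp add: abs_mult) (intro mult_mono, auto)
      then show "dist (\<gamma> s x) (\<gamma> t x) \<le> M * (\<Sum>x\<in>UNIV. \<bar>d x\<bar>) * dist s t"
        by (simp add: dist_real_def mult_ac)
    qed (use M0 sd in simp)
    then show ?thesis by blast
  qed
  then obtain L where "\<forall>x. L-lipschitz_on {0..T} (\<lambda>t. \<gamma> t x)" by blast
  moreover have "(\<lambda>t. \<psi>t t x) \<in> borel_measurable borel" for x
    unfolding \<psi>t_def
    by (rule borel_measurable_continuous_on_if) (auto intro!: continuous_on_mult \<sigma>'_cont \<Psi>(1))
  moreover have "h \<in> borel_measurable borel"
    unfolding h_def[abs_def]
    by (rule borel_measurable_continuous_on_if) (auto intro!: continuous_on_mult \<sigma>'_cont)
  moreover have "(\<integral>\<^sup>+t. ennreal C * indicator {0..T} t \<partial>lborel) \<le> ennreal (T * C)"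
    using T C by (simp add: nn_integral_cmult_indicator ennreal_mult'' mult.commute)
  ultimately show ?thesis
    unfolding connects_def C_def[symmetric] using dens
    by (intro exI[of _ \<gamma>] exI[of _ \<psi>t] exI[of _ h] exI[of _ "{}"] exI[of _ L] exI[of _ "\<lambda>_. C"]) auto
qed

end

section \<open>From discrete to continuous curves\<close>

context reversible_chain
begin

text \<open>Leaving \<open>\<mu>\<close> towards \<open>p\<close> with the quadratic profile \<open>\<beta> (t / T)\<^sup>2\<close>. The density at time \<open>t\<close> dominates
  that multiple of \<open>p\<close>, while the squared speed is \<open>4 \<beta> / T\<^sup>2\<close> times the same multiple, so the cost
  rate stays bounded although \<open>\<mu>\<close> may vanish somewhere. The way back is the time reversal.\<close>

lemma connects_to_reference:
  assumes p: "p \<in> pos_densities" "(\<Sum>x\<in>UNIV. p x * \<pi> x) = 1" and \<mu>: "\<mu> \<in> densities"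
  obtains C where "0 \<le> C"
    and "\<And>\<beta> T. \<lbrakk>0 < \<beta>; \<beta> \<le> 1; 0 < T\<rbrakk> \<Longrightarrow>
      connects K \<pi> a b p T \<mu> (\<lambda>x. (1 - \<beta>) * \<mu> x + \<beta> * p x) (4 * \<beta> / T * C)"
    and "\<And>\<beta> T. \<lbrakk>0 < \<beta>; \<beta> \<le> 1; 0 < T\<rbrakk> \<Longrightarrow>
      connects K \<pi> a b p T (\<lambda>x. (1 - \<beta>) * \<mu> x + \<beta> * p x) \<mu> (4 * \<beta> / T * C)"
proof -
  have pd: "p \<in> densities" using p(1) by (auto simp: densities_def pos_densities_def less_imp_le)
  have mass_p: "pairing \<pi> (\<lambda>_. 1) p = 1" using p(2) by (simp add: pairing_def)
  define H where "H = 1 - pairing \<pi> (\<lambda>_. 1) \<mu>"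
  define f where "f x = H * p x - (p x - \<mu> x)" for x
  have "pairing \<pi> (\<lambda>_. 1) f = 0"
    unfolding f_def pairing_diff_right pairing_scale_right mass_p by (simp add: H_def)
  then obtain \<psi> :: "real \<Rightarrow> 'x \<Rightarrow> real" where \<psi>: "\<And>t. t \<in> {0} \<Longrightarrow> divergence K p (\<psi> t) = f"
    using potential_exists[where S = "{0}" and w = "\<lambda>_. p" and f = f] p(1) by auto
  have d: "p x - \<mu> x = H * p x - divergence K p (\<psi> 0) x" for x using \<psi>[of 0] by (simp add: f_def)
  define C where "C = a\<^sup>2 * H\<^sup>2 + b\<^sup>2 * energy K \<pi> p (\<psi> 0) (\<psi> 0)"
  have C: "0 \<le> C" by (simp add: C_def energy_nonneg)
  have seg: "connects K \<pi> a b p T (\<lambda>x. \<mu> x + \<sigma> 0 * (p x - \<mu> x)) (\<lambda>x. \<mu> x + \<sigma> T * (p x - \<mu> x)) (4 * \<beta> / T * C)"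
    if T: "0 < T" and \<beta>: "0 < \<beta>" "\<beta> \<le> 1" and \<sigma>: "\<And>t. (\<sigma> has_real_derivative \<sigma>' t) (at t)" "continuous_on {0..T} \<sigma>'"
      and r: "\<And>t. t \<in> {0..T} \<Longrightarrow> 0 \<le> \<sigma> t" "\<And>t. t \<in> {0..T} \<Longrightarrow> \<sigma> t \<le> 1" "\<And>t. t \<in> {0<..<T} \<Longrightarrow> 0 < \<sigma> t"
      and B: "\<And>t. t \<in> {0<..<T} \<Longrightarrow> (\<sigma>' t)\<^sup>2 \<le> 4 * \<beta> / T\<^sup>2 * \<sigma> t" for T \<beta> and \<sigma> \<sigma>' :: "real \<Rightarrow> real"
  proof -
    have \<mu>0: "0 \<le> \<mu> x" and p0: "0 < p x" for x using \<mu> p(1) by (auto simp: densities_def pos_densities_def)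
    have \<gamma>: "\<mu> x + \<sigma> t * (p x - \<mu> x) = (1 - \<sigma> t) * \<mu> x + \<sigma> t * p x" for t x by (simp add: algebra_simps)
    have ge: "\<sigma> t * p x \<le> \<mu> x + \<sigma> t * (p x - \<mu> x)" if "t \<in> {0..T}" for t x
      unfolding \<gamma> using r(2)[OF that] \<mu>0[of x] by simp
    have "connects K \<pi> a b p T (\<lambda>x. \<mu> x + \<sigma> 0 * (p x - \<mu> x)) (\<lambda>x. \<mu> x + \<sigma> T * (p x - \<mu> x))
        (T * (4 * \<beta> / T\<^sup>2 * (a\<^sup>2 * H\<^sup>2 + b\<^sup>2 * energy K \<pi> p (\<psi> 0) (\<psi> 0))))"
    proof (rule connects_segment[where \<gamma> = "\<lambda>t x. \<mu> x + \<sigma> t * (p x - \<mu> x)" and \<theta> = \<sigma> and u = \<mu>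
          and d = "\<lambda>x. p x - \<mu> x", OF T \<sigma> pd d refl])
      show "(\<lambda>x. \<mu> x + \<sigma> t * (p x - \<mu> x)) \<in> densities" if "t \<in> {0..T}" for t
      proof -
        have "0 \<le> \<sigma> t * p x" for x using r(1)[OF that] p0[of x] by simp
        then show ?thesis using order_trans[OF _ ge[OF that]] by (simp add: densities_def)
      qed
      show "(\<lambda>x. \<mu> x + \<sigma> t * (p x - \<mu> x)) \<in> pos_densities" if "t \<in> {0<..<T}" for t
        using ge[of t] r(3)[OF that] p0 that by (force simp: pos_densities_def intro: less_le_trans[OF mult_pos_pos])
      show "\<sigma> t * mean_density p x y \<le> mean_density (\<lambda>x. \<mu> x + \<sigma> t * (p x - \<mu> x)) x y" if "t \<in> {0<..<T}" for t x y
      proof -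
        have t: "t \<in> {0..T}" using that by auto
        have "\<sigma> t * mean_density p x y = log_mean (\<sigma> t * p x) (\<sigma> t * p y)"
          using r(1)[OF t] p0[of x] p0[of y] by (simp add: mean_density_def log_mean_scale)
        also have "\<dots> \<le> mean_density (\<lambda>x. \<mu> x + \<sigma> t * (p x - \<mu> x)) x y"
          unfolding mean_density_def using r(1)[OF t] p0[of x] p0[of y] by (intro log_mean_mono ge[OF t]) auto
        finally show ?thesis .
      qed
    qed (use r B \<beta> in auto)
    moreover have "T * (4 * \<beta> / T\<^sup>2 * C) = 4 * \<beta> / T * C" using T by (simp add: power2_eq_square)
    ultimately show ?thesis by (simp add: C_def)
  qed
  show ?thesis
  proof (rule that[OF C])
    fix \<beta> T :: real assume \<beta>: "0 < \<beta>" "\<beta> \<le> 1" and T: "0 < T"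
    have unit: "0 \<le> (t / T)\<^sup>2" "(t / T)\<^sup>2 \<le> 1" "0 \<le> (1 - t / T)\<^sup>2" "(1 - t / T)\<^sup>2 \<le> 1" if "t \<in> {0..T}" for t
      using that T by (auto simp: power_le_one)
    have "connects K \<pi> a b p T (\<lambda>x. \<mu> x + \<beta> * (0 / T)\<^sup>2 * (p x - \<mu> x)) (\<lambda>x. \<mu> x + \<beta> * (T / T)\<^sup>2 * (p x - \<mu> x)) (4 * \<beta> / T * C)"
    proof (rule seg[OF T \<beta>, of _ "\<lambda>t. \<beta> * (2 * (t / T) / T)"])
      show "((\<lambda>t. \<beta> * (t / T)\<^sup>2) has_real_derivative \<beta> * (2 * (t / T) / T)) (at t)" for t
        using T by (auto intro!: derivative_eq_intros simp: power2_eq_square)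
      show "continuous_on {0..T} (\<lambda>t. \<beta> * (2 * (t / T) / T))" using T by (intro continuous_intros) auto
      show "0 < \<beta> * (t / T)\<^sup>2" if "t \<in> {0<..<T}" for t using that \<beta> by auto
      show "0 \<le> \<beta> * (t / T)\<^sup>2" "\<beta> * (t / T)\<^sup>2 \<le> 1" if "t \<in> {0..T}" for t
        using unit[OF that] \<beta> by (simp_all add: mult_le_one)
      show "(\<beta> * (2 * (t / T) / T))\<^sup>2 \<le> 4 * \<beta> / T\<^sup>2 * (\<beta> * (t / T)\<^sup>2)" for t
        using T by (simp add: power2_eq_square field_simps)
    qed
    then show "connects K \<pi> a b p T \<mu> (\<lambda>x. (1 - \<beta>) * \<mu> x + \<beta> * p x) (4 * \<beta> / T * C)"
      using T by (simp add: algebra_simps)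
    have "connects K \<pi> a b p T (\<lambda>x. \<mu> x + \<beta> * (1 - 0 / T)\<^sup>2 * (p x - \<mu> x)) (\<lambda>x. \<mu> x + \<beta> * (1 - T / T)\<^sup>2 * (p x - \<mu> x)) (4 * \<beta> / T * C)"
    proof (rule seg[OF T \<beta>, of _ "\<lambda>t. \<beta> * (- (2 * (1 - t / T) / T))"])
      show "((\<lambda>t. \<beta> * (1 - t / T)\<^sup>2) has_real_derivative \<beta> * (- (2 * (1 - t / T) / T))) (at t)" for t
        using T by (auto intro!: derivative_eq_intros simp: power2_eq_square field_simps)
      show "continuous_on {0..T} (\<lambda>t. \<beta> * (- (2 * (1 - t / T) / T)))" using T by (intro continuous_intros) auto
      show "0 < \<beta> * (1 - t / T)\<^sup>2" if "t \<in> {0<..<T}" for t using that \<beta> by auto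
      show "0 \<le> \<beta> * (1 - t / T)\<^sup>2" "\<beta> * (1 - t / T)\<^sup>2 \<le> 1" if "t \<in> {0..T}" for t
        using unit[OF that] \<beta> by (simp_all add: mult_le_one)
      show "(\<beta> * (- (2 * (1 - t / T) / T)))\<^sup>2 \<le> 4 * \<beta> / T\<^sup>2 * (\<beta> * (1 - t / T)\<^sup>2)" for t
        using T by (simp add: power2_eq_square field_simps)
    qed
    then show "connects K \<pi> a b p T (\<lambda>x. (1 - \<beta>) * \<mu> x + \<beta> * p x) \<mu> (4 * \<beta> / T * C)"
      using T by (simp add: algebra_simps)
  qed
qed

text \<open>A discrete solution moves by at most the order of the square root of the step length in each
  step: the total mass is controlled by the source, and the flux by the energy.\<close>

lemma discrete_step_bound:
  assumes p: "p \<in> pos_densities" "(\<Sum>x\<in>UNIV. p x * \<pi> x) = 1" and a: "0 < a" and b: "0 < b"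
  shows "\<exists>Q. \<forall>N>0. \<forall>\<phi> m. m 0 = \<mu>\<^sub>0 \<longrightarrow> (\<forall>k. m k \<in> densities) \<longrightarrow>
    discrete_continuity N a b p \<phi> m \<longrightarrow>
    discrete_action N a b p \<phi> m \<le> A \<longrightarrow>
    (\<forall>k<N. \<forall>x. (m (Suc k) x - m k x)\<^sup>2 \<le> Q / real N)"
proof -
  obtain D where D: "1 / \<pi> x \<le> D" and D0: "0 \<le> D" for x using inverse_pi_bounded by metis
  have mass_p: "pairing \<pi> (\<lambda>_. 1) p = 1" using p(2) by (simp add: pairing_def)
  have p0: "0 < p x" for x using p(1) by (simp add: pos_densities_def)
  have pD: "p x \<le> D" for x
  proof -
    have "p x * \<pi> x \<le> 1"
      using member_le_sum[of x UNIV "\<lambda>x. p x * \<pi> x"] p0 pi_nonneg p(2) by (simp add: less_imp_le)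
    then have "p x \<le> 1 / \<pi> x" using pi_pos[of x] by (simp add: pos_le_divide_eq)
    then show ?thesis using D[of x] by linarith
  qed
  define R where "R = (pairing \<pi> (\<lambda>_. 1) \<mu>\<^sub>0 + 1 + 2 * A / a\<^sup>2) * D"
  define Q where "Q = 2 * (D\<^sup>2 * (2 * A / a\<^sup>2) + 4 * R * D * (2 * A / b\<^sup>2))"
  show ?thesis
  proof (intro exI[of _ Q] allI impI)
    fix N :: nat and \<phi> m k x assume N: "0 < N" and m0: "m 0 = \<mu>\<^sub>0" and md': "\<forall>k. m k \<in> densities"
      and eq': "discrete_continuity N a b p \<phi> m"
      and A: "discrete_action N a b p \<phi> m \<le> A"
      and k: "k < N"
    note md = md'[THEN spec]
    have eq: "m (Suc k) x - m k x = 1 / real N * (pairing \<pi> (\<phi> k) p / a\<^sup>2 * p x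
          - divergence K (m (Suc k)) (\<phi> k) x / b\<^sup>2)" if "k < N" for k x using eq' that by blast
    define h where "h k = pairing \<pi> (\<phi> k) p / a\<^sup>2" for k
    define e where "e k = energy K \<pi> (m (Suc k)) (\<phi> k) (\<phi> k)" for k
    have e0: "0 \<le> e k" for k by (simp add: e_def energy_nonneg)
    have A1: "(\<Sum>k<N. 1 / real N * (a\<^sup>2 / 2 * (h k)\<^sup>2)) + (\<Sum>k<N. 1 / real N * (1 / (2 * b\<^sup>2) * e k)) \<le> A"
    proof -
      have "a\<^sup>2 / 2 * (h k)\<^sup>2 = 1 / (2 * a\<^sup>2) * (pairing \<pi> (\<phi> k) p)\<^sup>2" for k
        using a by (simp add: h_def power_divide power2_eq_square)
      then show ?thesis using A by (simp only: sum.distrib e_def)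
    qed
    have s1: "0 \<le> (\<Sum>k<N. 1 / real N * (a\<^sup>2 / 2 * (h k)\<^sup>2))" by (intro sum_nonneg mult_nonneg_nonneg) auto
    have s2: "0 \<le> (\<Sum>k<N. 1 / real N * (1 / (2 * b\<^sup>2) * e k))" using e0 by (intro sum_nonneg mult_nonneg_nonneg) auto
    have sum_h: "(\<Sum>k<N. 1 / real N * (h k)\<^sup>2) \<le> 2 * A / a\<^sup>2"
    proof -
      have "(\<Sum>k<N. 1 / real N * (a\<^sup>2 / 2 * (h k)\<^sup>2)) = a\<^sup>2 / 2 * (\<Sum>k<N. 1 / real N * (h k)\<^sup>2)"
        by (simp add: sum_distrib_left mult_ac)
      then have "a\<^sup>2 / 2 * (\<Sum>k<N. 1 / real N * (h k)\<^sup>2) \<le> A" using A1 s2 by linarith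
      then show ?thesis using a by (simp add: field_simps)
    qed
    have sum_e: "(\<Sum>k<N. 1 / real N * e k) \<le> 2 * A * b\<^sup>2"
    proof -
      have "(\<Sum>k<N. 1 / real N * (1 / (2 * b\<^sup>2) * e k)) = 1 / (2 * b\<^sup>2) * (\<Sum>k<N. 1 / real N * e k)"
        by (simp add: sum_distrib_left sum_divide_distrib mult_ac)
      then have "1 / (2 * b\<^sup>2) * (\<Sum>k<N. 1 / real N * e k) \<le> A" using A1 s1 by linarith
      then show ?thesis using b by (simp add: field_simps)
    qed
    have single: "1 / real N * f k \<le> (\<Sum>k<N. 1 / real N * f k)" if "\<And>k. 0 \<le> f k" for f :: "nat \<Rightarrow> real"
      using that k by (intro member_le_sum[of k "{..<N}" "\<lambda>k. 1 / real N * f k"]) auto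
    have A0: "0 \<le> A" using A1 s1 s2 by linarith
    have mass_step: "pairing \<pi> (\<lambda>_. 1) (m (Suc k)) - pairing \<pi> (\<lambda>_. 1) (m k) = 1 / real N * h k" if "k < N" for k
    proof -
      have "(\<lambda>x. m (Suc k) x - m k x) = (\<lambda>x. 1 / real N * (h k * p x - 1 / b\<^sup>2 * divergence K (m (Suc k)) (\<phi> k) x))"
        using eq[OF that] by (simp add: h_def)
      then have "pairing \<pi> (\<lambda>_. 1) (\<lambda>x. m (Suc k) x - m k x) = 1 / real N * h k"
        by (simp only: pairing_scale_right pairing_diff_right[of _ "\<lambda>x. h k * p x"] mass_p pairing_one_divergence[OF md]) simp
      then show ?thesis by (simp add: pairing_diff_right)
    qed
    have mass: "pairing \<pi> (\<lambda>_. 1) (m n) \<le> pairing \<pi> (\<lambda>_. 1) \<mu>\<^sub>0 + 1 + 2 * A / a\<^sup>2" if n: "n \<le> N" for n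
    proof -
      have "pairing \<pi> (\<lambda>_. 1) (m n) - pairing \<pi> (\<lambda>_. 1) (m 0) = (\<Sum>k<n. pairing \<pi> (\<lambda>_. 1) (m (Suc k)) - pairing \<pi> (\<lambda>_. 1) (m k))"
        by (rule sum_lessThan_telescope[symmetric])
      also have "\<dots> = (\<Sum>k<n. 1 / real N * h k)"
        using n by (intro sum.cong refl mass_step) auto
      also have "\<dots> \<le> (\<Sum>k<n. 1 / real N * (1 + (h k)\<^sup>2))"
      proof (intro sum_mono mult_left_mono)
        fix k show "h k \<le> 1 + (h k)\<^sup>2"
          using zero_le_power2[of "h k - 1 / 2"] by (simp add: power2_eq_square algebra_simps)
      qed simp
      also have "\<dots> \<le> (\<Sum>k<N. 1 / real N * (1 + (h k)\<^sup>2))"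
        using n by (intro sum_mono2) auto
      also have "\<dots> = 1 + (\<Sum>k<N. 1 / real N * (h k)\<^sup>2)"
        using N by (simp add: distrib_left sum.distrib add_divide_distrib)
      finally show ?thesis using sum_h m0 by simp
    qed
    have m_le: "m n x \<le> R" and m_nn: "0 \<le> m n x" if n: "n \<le> N" for n x
    proof -
      show nn: "0 \<le> m n x" for x using md[of n] by (simp add: densities_def)
      have "1 * m n x * \<pi> x \<le> pairing \<pi> (\<lambda>_. 1) (m n)"
        unfolding pairing_def using nn by (intro member_le_sum[of x UNIV "\<lambda>x. 1 * m n x * \<pi> x"]) (auto simp: pi_nonneg)
      then have "m n x \<le> pairing \<pi> (\<lambda>_. 1) (m n) * (1 / \<pi> x)" using pi_pos[of x] by (simp add: pos_le_divide_eq)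
      also have "\<dots> \<le> pairing \<pi> (\<lambda>_. 1) (m n) * D"
        by (intro mult_left_mono D pairing_one_nonneg md)
      also have "\<dots> \<le> R" unfolding R_def by (intro mult_right_mono mass[OF n] D0)
      finally show "m n x \<le> R" .
    qed
    have R0: "0 \<le> R" using m_le[of 0 x] m_nn[of 0 x] by simp
    have div2: "(divergence K (m (Suc k)) (\<phi> k) x)\<^sup>2 \<le> 4 * R * D * e k"
    proof -
      define c where "c y = mean_density (m (Suc k)) x y * K x y" for y
      have c0: "0 \<le> c y" for y by (simp add: c_def mean_density_nonneg K_nonneg)
      have "divergence K (m (Suc k)) (\<phi> k) x = (\<Sum>y\<in>UNIV. (grad (\<phi> k) x y * sqrt (c y)) * sqrt (c y))"
        unfolding divergence_def grad_def by (intro sum.cong refl) (simp add: c_def[symmetric] c0 mult.assoc)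
      then have "(divergence K (m (Suc k)) (\<phi> k) x)\<^sup>2
          \<le> (\<Sum>y\<in>UNIV. (grad (\<phi> k) x y * sqrt (c y))\<^sup>2) * (\<Sum>y\<in>UNIV. (sqrt (c y))\<^sup>2)"
        by (simp only: Cauchy_Schwarz_ineq_sum)
      also have "\<dots> \<le> (2 * e k * D) * (2 * R)"
      proof (intro mult_mono)
        have "(\<Sum>y\<in>UNIV. (sqrt (c y))\<^sup>2) = (\<Sum>y\<in>UNIV. c y)" using c0 by simp
        also have "\<dots> \<le> (\<Sum>y\<in>UNIV. (2 * R) * K x y)"
        proof (intro sum_mono)
          fix y
          have "mean_density (m (Suc k)) x y \<le> m (Suc k) x + m (Suc k) y"
            using m_nn[of "Suc k"] k by (simp add: mean_density_def log_mean_le_add)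
          also have "\<dots> \<le> 2 * R" using m_le[of "Suc k" x] m_le[of "Suc k" y] k by simp
          finally show "c y \<le> 2 * R * K x y" unfolding c_def by (intro mult_right_mono K_nonneg)
        qed
        also have "\<dots> = 2 * R" by (simp add: K_sum flip: sum_distrib_left)
        finally show "(\<Sum>y\<in>UNIV. (sqrt (c y))\<^sup>2) \<le> 2 * R" .
        have "(\<Sum>y\<in>UNIV. (grad (\<phi> k) x y * sqrt (c y))\<^sup>2) * \<pi> x
            = (\<Sum>y\<in>UNIV. grad (\<phi> k) x y * grad (\<phi> k) x y * mean_density (m (Suc k)) x y * K x y * \<pi> x)"
          unfolding sum_distrib_right using c0
          by (intro sum.cong refl) (simp add: power_mult_distrib c_def power2_eq_square[of "grad (\<phi> k) x _"] mult_ac)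
        also have "\<dots> \<le> (\<Sum>x\<in>UNIV. \<Sum>y\<in>UNIV. grad (\<phi> k) x y * grad (\<phi> k) x y * mean_density (m (Suc k)) x y * K x y * \<pi> x)"
          by (intro member_le_sum[of x UNIV "\<lambda>x. \<Sum>y\<in>UNIV. grad (\<phi> k) x y * grad (\<phi> k) x y * mean_density (m (Suc k)) x y * K x y * \<pi> x"]
              sum_nonneg energy_term_nonneg) auto
        also have "\<dots> = 2 * e k" by (simp add: e_def energy_def)
        finally have "(\<Sum>y\<in>UNIV. (grad (\<phi> k) x y * sqrt (c y))\<^sup>2) \<le> 2 * e k * (1 / \<pi> x)"
          using pi_pos[of x] by (simp add: pos_le_divide_eq)
        also have "\<dots> \<le> 2 * e k * D" using e0 by (intro mult_left_mono D) simp
        finally show "(\<Sum>y\<in>UNIV. (grad (\<phi> k) x y * sqrt (c y))\<^sup>2) \<le> 2 * e k * D" .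
      qed (use e0 D0 c0 in \<open>auto intro!: sum_nonneg\<close>)
      finally show ?thesis by (simp add: mult_ac)
    qed
    have "(m (Suc k) x - m k x)\<^sup>2 = (1 / real N)\<^sup>2 * (h k * p x - divergence K (m (Suc k)) (\<phi> k) x / b\<^sup>2)\<^sup>2"
      unfolding eq[OF k] h_def power_mult_distrib ..
    also have "\<dots> \<le> (1 / real N)\<^sup>2 * (2 * (h k * p x)\<^sup>2 + 2 * (divergence K (m (Suc k)) (\<phi> k) x / b\<^sup>2)\<^sup>2)"
    proof (intro mult_left_mono)
      have "(u - v)\<^sup>2 \<le> 2 * u\<^sup>2 + 2 * v\<^sup>2" for u v :: real
        using zero_le_power2[of "u + v"] by (simp add: power2_eq_square algebra_simps)
      then show "(h k * p x - divergence K (m (Suc k)) (\<phi> k) x / b\<^sup>2)\<^sup>2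
          \<le> 2 * (h k * p x)\<^sup>2 + 2 * (divergence K (m (Suc k)) (\<phi> k) x / b\<^sup>2)\<^sup>2" .
    qed simp
    also have "\<dots> \<le> (1 / real N)\<^sup>2 * (2 * (D\<^sup>2 * (h k)\<^sup>2) + 2 * (4 * R * D * e k / (b\<^sup>2)\<^sup>2))"
    proof (intro mult_left_mono add_mono)
      show "(h k * p x)\<^sup>2 \<le> D\<^sup>2 * (h k)\<^sup>2"
        unfolding power_mult_distrib mult.commute[of "(h k)\<^sup>2"] using p0[of x] pD
        by (intro mult_right_mono power_mono) (auto simp: less_imp_le)
      show "(divergence K (m (Suc k)) (\<phi> k) x / b\<^sup>2)\<^sup>2 \<le> 4 * R * D * e k / (b\<^sup>2)\<^sup>2"
        unfolding power_divide by (intro divide_right_mono div2) simp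
    qed auto
    also have "\<dots> = 1 / real N * (2 * (D\<^sup>2 * (1 / real N * (h k)\<^sup>2)) + 2 * (4 * R * D * (1 / real N * e k) / (b\<^sup>2)\<^sup>2))"
      by (simp add: power2_eq_square[of "1 / real N"] algebra_simps)
    also have "\<dots> \<le> 1 / real N * (2 * (D\<^sup>2 * (2 * A / a\<^sup>2)) + 2 * (4 * R * D * (2 * A * b\<^sup>2) / (b\<^sup>2)\<^sup>2))"
      using single[of "\<lambda>k. (h k)\<^sup>2"] single[of e] e0 sum_h sum_e R0 D0
      by (intro mult_left_mono add_mono divide_right_mono) (auto intro: order_trans)
    also have "\<dots> = Q / real N"
    proof -
      have "4 * R * D * (2 * A * b\<^sup>2) / (b\<^sup>2)\<^sup>2 = 4 * R * D * (2 * A / b\<^sup>2)"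
      proof -
        have "u * (v * y) / y\<^sup>2 = u * (v / y)" if "y \<noteq> 0" for u v y :: real
          using that by (simp add: power2_eq_square)
        from this[of "b\<^sup>2" "4 * R * D" "2 * A"] show ?thesis using b by (simp only: power_eq_0_iff) simp
      qed
      then show ?thesis unfolding Q_def by (simp only:) (simp add: algebra_simps add_divide_distrib)
    qed
    finally show "(m (Suc k) x - m k x)\<^sup>2 \<le> Q / real N" .
  qed
qed

end

section \<open>Strong duality\<close>

context reversible_chain
begin

lemma C1_dual_le_min_action:
  assumes "0 < a" "0 < b" "\<phi> \<in> C1_HJ_subsolutions K \<pi> b"
  shows "ennreal (2 * dual_functional \<pi> a p \<mu>\<^sub>0 \<mu>\<^sub>1 \<phi>) \<le> min_action K \<pi> a b p \<mu>\<^sub>0 \<mu>\<^sub>1"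
  unfolding min_action_def by (rule INF_greatest) (auto intro: C1_weak_duality assms)

lemma zero_C1_subsolution: "(\<lambda>_ _. 0) \<in> C1_HJ_subsolutions K \<pi> b"
proof -
  have "HJ_inequality K \<pi> b (\<lambda>_ _. 0) (\<lambda>_ _. 0)"
    by (simp add: HJ_inequality_def pairing_def norm_sq_grad energy_def grad_def)
  then show ?thesis
    unfolding C1_HJ_subsolutions_def by (auto intro!: exI[of _ "\<lambda>_ _. 0"] simp: C1_with_derivative_def)
qed

text \<open>The dual value is affine in the endpoints and not positive at \<open>(p, p)\<close>, where the constant curve
  has no action. Mixing the endpoints with \<open>p\<close> therefore respects any upper bound.\<close>

lemma dual_functional_shifted:
  assumes p: "p \<in> pos_densities" and a: "0 < a" and b: "0 < b" and \<alpha>: "0 \<le> \<alpha>" "\<alpha> \<le> 1"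
    and U: "\<And>\<phi>. \<phi> \<in> C1_HJ_subsolutions K \<pi> b \<Longrightarrow> dual_functional \<pi> a p \<mu>\<^sub>0 \<mu>\<^sub>1 \<phi> \<le> U"
    and \<phi>: "\<phi> \<in> C1_HJ_subsolutions K \<pi> b"
  shows "dual_functional \<pi> a p (\<lambda>x. (1 - \<alpha>) * \<mu>\<^sub>0 x + \<alpha> * p x) (\<lambda>x. (1 - \<alpha>) * \<mu>\<^sub>1 x + \<alpha> * p x) \<phi> \<le> U"
proof -
  have "dual_functional \<pi> a p \<mu>\<^sub>0 \<mu>\<^sub>1 (\<lambda>_ _. 0) = 0"
    by (simp add: dual_functional_def pairing_def)
  then have U0: "0 \<le> U" using U[OF zero_C1_subsolution] by simp
  have pd: "p \<in> densities" using p by (auto simp: densities_def pos_densities_def less_imp_le)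
  have "ennreal (2 * dual_functional \<pi> a p p p \<phi>) \<le> ennreal 0"
    using C1_dual_le_min_action[OF a b \<phi>] connects_min_action[OF connects_refl[OF pd]] by (metis order_trans zero_le_one)
  then have pp: "dual_functional \<pi> a p p p \<phi> \<le> 0" by (simp add: ennreal_eq_0_iff mult_le_0_iff)
  have "dual_functional \<pi> a p (\<lambda>x. (1 - \<alpha>) * \<mu>\<^sub>0 x + \<alpha> * p x) (\<lambda>x. (1 - \<alpha>) * \<mu>\<^sub>1 x + \<alpha> * p x) \<phi>
      = (1 - \<alpha>) * dual_functional \<pi> a p \<mu>\<^sub>0 \<mu>\<^sub>1 \<phi> + \<alpha> * dual_functional \<pi> a p p p \<phi>"
    unfolding dual_functional_def pairing_add_right pairing_scale_right
    by (simp add: algebra_simps add_divide_distrib diff_divide_distrib)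
  also have "\<dots> \<le> (1 - \<alpha>) * U + \<alpha> * 0"
    using U[OF \<phi>] pp \<alpha> by (intro add_mono mult_left_mono) auto
  also have "\<dots> \<le> U" using \<alpha> U0 by (simp add: mult_left_le_one_le)
  finally show ?thesis .
qed

text \<open>A discrete solution becomes a curve: mixing with \<open>p\<close> makes it uniformly positive, so that for
  many steps the densities along each segment are comparable to its right end.\<close>

lemma connects_discrete:
  assumes p: "p \<in> pos_densities" "\<And>x. pm \<le> p x" "0 < pm" and a: "0 < a" and b: "0 < b"
    and N: "0 < N" and \<delta>: "0 < \<delta>" "\<delta> < 1" and \<alpha>: "0 < \<alpha>" "\<alpha> < 1" and T: "0 < T"
    and m: "\<And>k. m k \<in> densities"
    and eq: "\<And>k x. k < N \<Longrightarrow> m (Suc k) x - m k x = 1 / real N * (pairing \<pi> (\<phi> k) p / a\<^sup>2 * p x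
          - divergence K (m (Suc k)) (\<phi> k) x / b\<^sup>2)"
    and small: "\<And>k x. k < N \<Longrightarrow> \<bar>m (Suc k) x - m k x\<bar> \<le> \<delta> * (\<alpha> * pm)"
    and val: "discrete_action N a b p \<phi> m \<le> A"
  obtains c where "0 \<le> c" "c \<le> 2 * A / (T * (1 - \<delta>))"
    "connects K \<pi> a b p T (\<lambda>x. (1 - \<alpha>) * m 0 x + \<alpha> * p x) (\<lambda>x. (1 - \<alpha>) * m N x + \<alpha> * p x) c"
proof -
  define w where "w k x = (1 - \<alpha>) * m k x + \<alpha> * p x" for k x
  define T0 where "T0 = T / real N"
  have T0: "0 < T0" using T N by (simp add: T0_def)
  have p0: "0 < p x" for x using p(2)[of x] p(3) by linarith
  have m0: "0 \<le> m k x" for k x using m[of k] by (simp add: densities_def)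
  have w_ge: "\<alpha> * pm \<le> w k x" "(1 - \<alpha>) * m k x \<le> w k x" for k x
  proof -
    have "\<alpha> * pm \<le> \<alpha> * p x" "0 \<le> (1 - \<alpha>) * m k x" "0 \<le> \<alpha> * p x"
      using \<alpha> p(2) m0[of k x] p0[of x] by (auto intro!: mult_left_mono)
    then show "\<alpha> * pm \<le> w k x" "(1 - \<alpha>) * m k x \<le> w k x" unfolding w_def by linarith+
  qed
  have \<alpha>pm: "0 < \<alpha> * pm" using \<alpha> p by simp
  define e where "e k = 1 / real N * (1 / (2 * a\<^sup>2) * (pairing \<pi> (\<phi> k) p)\<^sup>2)
        + 1 / real N * (1 / (2 * b\<^sup>2) * energy K \<pi> (m (Suc k)) (\<phi> k) (\<phi> k))" for k
  have e0: "0 \<le> e k" for k unfolding e_def using energy_nonneg by (intro add_nonneg_nonneg mult_nonneg_nonneg) auto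
  define C where "C = 2 * (1 - \<alpha>) / (T * (1 - \<delta>))"
  have C: "0 \<le> C" unfolding C_def using \<alpha> \<delta> T by simp
  have step: "connects K \<pi> a b p T0 (w k) (w (Suc k)) (C * e k)" if k: "k < N" for k
  proof -
    define H where "H = (1 - \<alpha>) / real N * (pairing \<pi> (\<phi> k) p / a\<^sup>2)"
    define g where "g = (1 - \<alpha>) / real N / b\<^sup>2"
    define \<theta> where "\<theta> = (1 - \<delta>) * (1 - \<alpha>)"
    have \<theta>: "0 < \<theta>" "\<theta> \<le> 1" using \<delta> \<alpha> by (auto simp: \<theta>_def mult_le_one)
    have d: "w (Suc k) x - w k x = H * p x - divergence K (m (Suc k)) (\<lambda>x. g * \<phi> k x) x" for x
    proof -
      have "w (Suc k) x - w k x = (1 - \<alpha>) * (m (Suc k) x - m k x)" by (simp add: w_def algebra_simps)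
      moreover have "divergence K (m (Suc k)) (\<lambda>x. g * \<phi> k x) x = g * divergence K (m (Suc k)) (\<phi> k) x"
        by (simp add: divergence_def sum_distrib_left algebra_simps)
      ultimately show ?thesis unfolding eq[OF k] by (simp add: H_def g_def algebra_simps diff_divide_distrib)
    qed
    have near: "(1 - \<delta>) * w (Suc k) x \<le> w k x + t / T0 * (w (Suc k) x - w k x)" if t: "t \<in> {0..T0}" for t x
    proof -
      have "w (Suc k) x - w k x = (1 - \<alpha>) * (m (Suc k) x - m k x)" by (simp add: w_def algebra_simps)
      then have "\<bar>w (Suc k) x - w k x\<bar> \<le> 1 * \<bar>m (Suc k) x - m k x\<bar>"
        unfolding abs_mult using \<alpha> by (simp only:) (simp add: abs_mult mult_left_le_one_le)
      also have "\<dots> \<le> \<delta> * (\<alpha> * pm)" using small[OF k, of x] by simp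
      also have "\<dots> \<le> \<delta> * w (Suc k) x" using w_ge(1) \<delta> by (intro mult_left_mono) auto
      finally have diff: "\<bar>w (Suc k) x - w k x\<bar> \<le> \<delta> * w (Suc k) x" .
      have "0 \<le> 1 - t / T0" "1 - t / T0 \<le> 1" using t T0 by auto
      then have "(1 - t / T0) * (w (Suc k) x - w k x) \<le> 1 * \<bar>w (Suc k) x - w k x\<bar>"
        by (meson abs_ge_self abs_ge_zero mult_mono order_trans zero_le_one mult_left_mono mult_right_mono)
      moreover have "w k x + t / T0 * (w (Suc k) x - w k x) = w (Suc k) x - (1 - t / T0) * (w (Suc k) x - w k x)"
        by (simp add: algebra_simps)
      ultimately show ?thesis using diff by (simp add: left_diff_distrib)
    qed
    have pos: "0 < w k x + t / T0 * (w (Suc k) x - w k x)" if "t \<in> {0..T0}" for t x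
    proof -
      have "0 < (1 - \<delta>) * w (Suc k) x" using \<delta> w_ge(1)[of "Suc k" x] \<alpha>pm by simp
      then show ?thesis using near[OF that, of x] by linarith
    qed
    have "connects K \<pi> a b p T0 (\<lambda>x. w k x + 0 / T0 * (w (Suc k) x - w k x)) (\<lambda>x. w k x + T0 / T0 * (w (Suc k) x - w k x))
        (T0 * (1 / (T0\<^sup>2 * \<theta>) * (a\<^sup>2 * H\<^sup>2 + b\<^sup>2 * energy K \<pi> (m (Suc k)) (\<lambda>x. g * \<phi> k x) (\<lambda>x. g * \<phi> k x))))"
    proof (rule connects_segment[where \<sigma> = "\<lambda>t. t / T0" and \<sigma>' = "\<lambda>_. 1 / T0" and u = "w k" and \<theta> = "\<lambda>_. \<theta>"
          and d = "\<lambda>x. w (Suc k) x - w k x", OF T0 _ _ m d])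
      show "((\<lambda>t. t / T0) has_real_derivative 1 / T0) (at t)" for t
        using T0 by (auto intro!: derivative_eq_intros)
      show "\<theta> * mean_density (m (Suc k)) x y \<le> mean_density (\<lambda>x. w k x + t / T0 * (w (Suc k) x - w k x)) x y"
        if "t \<in> {0<..<T0}" for t x y
      proof -
        have t: "t \<in> {0..T0}" using that by auto
        have "\<theta> * mean_density (m (Suc k)) x y = log_mean (\<theta> * m (Suc k) x) (\<theta> * m (Suc k) y)"
          using \<theta> m0 by (simp add: mean_density_def log_mean_scale)
        also have "\<dots> \<le> mean_density (\<lambda>x. w k x + t / T0 * (w (Suc k) x - w k x)) x y"
          unfolding mean_density_def
        proof (intro log_mean_mono)
          have "\<theta> * m (Suc k) x \<le> (1 - \<delta>) * w (Suc k) x" for x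
            unfolding \<theta>_def mult.assoc using \<delta> by (intro mult_left_mono w_ge(2)) simp
          then show "\<theta> * m (Suc k) x \<le> w k x + t / T0 * (w (Suc k) x - w k x)"
            "\<theta> * m (Suc k) y \<le> w k y + t / T0 * (w (Suc k) y - w k y)"
            using near[OF t] order_trans by blast+
        qed (use \<theta> m0 in auto)
        finally show ?thesis .
      qed
      show "(1 / T0)\<^sup>2 \<le> 1 / (T0\<^sup>2 * \<theta>) * \<theta>" if "t \<in> {0<..<T0}" for t
        using \<theta> by (simp add: power_divide)
    qed (use pos \<theta> in \<open>auto simp: densities_def pos_densities_def less_imp_le\<close>)
    moreover have "T0 * (1 / (T0\<^sup>2 * \<theta>) * (a\<^sup>2 * H\<^sup>2 + b\<^sup>2 * energy K \<pi> (m (Suc k)) (\<lambda>x. g * \<phi> k x) (\<lambda>x. g * \<phi> k x))) = C * e k"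
    proof -
      define P where "P = (pairing \<pi> (\<phi> k) p)\<^sup>2"
      define E where "E = energy K \<pi> (m (Suc k)) (\<phi> k) (\<phi> k)"
      define n where "n = real N"
      have "a\<^sup>2 * H\<^sup>2 = ((1 - \<alpha>) / n)\<^sup>2 * (P / a\<^sup>2)"
        using a by (simp add: H_def P_def n_def power_mult_distrib power_divide power2_eq_square mult_ac)
      moreover have "b\<^sup>2 * energy K \<pi> (m (Suc k)) (\<lambda>x. g * \<phi> k x) (\<lambda>x. g * \<phi> k x) = ((1 - \<alpha>) / n)\<^sup>2 * (E / b\<^sup>2)"
        using b unfolding energy_scale_left energy_scale_right by (simp add: g_def E_def n_def power2_eq_square mult_ac)
      moreover have "e k = 1 / n * ((P / a\<^sup>2 + E / b\<^sup>2) / 2)"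
        by (simp add: e_def P_def E_def n_def algebra_simps add_divide_distrib)
      moreover have "T0 = T / n" "0 < n" using N by (auto simp: T0_def n_def)
      moreover have "T / n * (1 / ((T / n)\<^sup>2 * ((1 - \<delta>) * (1 - \<alpha>))) * (((1 - \<alpha>) / n)\<^sup>2 * q)) = 2 * (1 - \<alpha>) / (T * (1 - \<delta>)) * (1 / n * (q / 2))" for q
        using \<alpha> \<delta> T \<open>0 < n\<close> by (simp add: power2_eq_square divide_simps)
      ultimately show ?thesis
        unfolding \<theta>_def C_def by (simp only: distrib_left[symmetric])
    qed
    ultimately show ?thesis using T0 by simp
  qed
  have "connects K \<pi> a b p (real N * T0) (w 0) (w N) (\<Sum>k<N. C * e k)"
  proof (rule connects_chain[where w = w and c = "\<lambda>k. C * e k" and N = N, OF step])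
    show "w 0 \<in> densities" using w_ge(1)[of 0] \<alpha>pm by (auto simp: densities_def intro: order_trans[OF less_imp_le])
  qed (use C e0 T0 in auto)
  moreover have "real N * T0 = T" using N by (simp add: T0_def)
  moreover have "(\<Sum>k<N. C * e k) \<le> 2 * A / (T * (1 - \<delta>))"
  proof -
    have "0 \<le> (\<Sum>k<N. e k)" by (intro sum_nonneg e0)
    then have A0: "0 \<le> A" using val by (simp add: e_def)
    have "(\<Sum>k<N. C * e k) \<le> C * A"
      unfolding sum_distrib_left[symmetric] using val C by (intro mult_left_mono) (simp_all add: e_def)
    also have "\<dots> \<le> 2 * 1 / (T * (1 - \<delta>)) * A"
      unfolding C_def using \<alpha> \<delta> T A0 by (intro mult_right_mono divide_right_mono) auto
    finally show ?thesis by simp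
  qed
  moreover have "0 \<le> (\<Sum>k<N. C * e k)" by (intro sum_nonneg mult_nonneg_nonneg C e0)
  ultimately show ?thesis using that[of "\<Sum>k<N. C * e k"] unfolding w_def by simp
qed

text \<open>The curve consists of an arc of duration \<open>\<delta>\<close> from \<open>\<mu>\<^sub>0\<close>, a discrete solution in the remaining time,
  and an arc of duration \<open>\<delta>\<close> to \<open>\<mu>\<^sub>1\<close>. The endpoints are mixed with \<open>p\<close> twice with the same weight:
  once so that the discrete problem has positive data, once so that its solution is uniformly
  positive.\<close>

lemma min_action_approx:
  assumes p: "p \<in> pos_densities" "(\<Sum>x\<in>UNIV. p x * \<pi> x) = 1" and a: "0 < a" and b: "0 < b"
    and \<mu>0: "\<mu>\<^sub>0 \<in> densities" and \<mu>1: "\<mu>\<^sub>1 \<in> densities"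
    and U: "\<And>\<phi>. \<phi> \<in> C1_HJ_subsolutions K \<pi> b \<Longrightarrow> dual_functional \<pi> a p \<mu>\<^sub>0 \<mu>\<^sub>1 \<phi> \<le> U"
    and Ca: "0 \<le> Ca" "\<And>\<beta> T. \<lbrakk>0 < \<beta>; \<beta> \<le> 1; 0 < T\<rbrakk> \<Longrightarrow>
      connects K \<pi> a b p T \<mu>\<^sub>0 (\<lambda>x. (1 - \<beta>) * \<mu>\<^sub>0 x + \<beta> * p x) (4 * \<beta> / T * Ca)"
    and Cb: "0 \<le> Cb" "\<And>\<beta> T. \<lbrakk>0 < \<beta>; \<beta> \<le> 1; 0 < T\<rbrakk> \<Longrightarrow>
      connects K \<pi> a b p T (\<lambda>x. (1 - \<beta>) * \<mu>\<^sub>1 x + \<beta> * p x) \<mu>\<^sub>1 (4 * \<beta> / T * Cb)"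
    and \<delta>: "0 < \<delta>" "\<delta> < 1 / 4"
  shows "min_action K \<pi> a b p \<mu>\<^sub>0 \<mu>\<^sub>1
    \<le> ennreal (2 * ((1 + \<delta>) * U + \<delta>) / ((1 - 2 * \<delta>) * (1 - \<delta>)) + 8 * \<delta> * (Ca + Cb))"
proof -
  define pm where "pm = Min (range p)"
  have pm: "pm \<le> p x" "0 < pm" for x using p(1) by (auto simp: pm_def pos_densities_def)
  \<comment> \<open>an arc of duration \<open>\<delta>\<close> costs a multiple of \<open>\<alpha> / \<delta>\<close>, which has to vanish with \<open>\<delta>\<close>\<close>
  define \<alpha> where "\<alpha> = \<delta>\<^sup>2"
  have "\<delta> * \<delta> < 1 * 1" using \<delta> by (intro mult_strict_mono) auto
  then have \<alpha>: "0 < \<alpha>" "\<alpha> < 1" using \<delta> by (auto simp: \<alpha>_def power2_eq_square)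
  let ?\<mu>0 = "\<lambda>x. (1 - \<alpha>) * \<mu>\<^sub>0 x + \<alpha> * p x" and ?\<mu>1 = "\<lambda>x. (1 - \<alpha>) * \<mu>\<^sub>1 x + \<alpha> * p x"
  define c where "c = \<alpha> * pm / 2"
  have c: "0 < c" using \<alpha> pm by (simp add: c_def)
  have c_le: "2 * c \<le> (1 - \<alpha>) * \<mu> x + \<alpha> * p x" if "\<mu> \<in> densities" for \<mu> x
  proof -
    have "\<alpha> * pm \<le> \<alpha> * p x" using \<alpha> pm by (intro mult_left_mono) auto
    moreover have "0 \<le> (1 - \<alpha>) * \<mu> x" using that \<alpha> by (simp add: densities_def)
    ultimately show ?thesis by (simp add: c_def)
  qed
  have \<mu>1'd: "?\<mu>1 \<in> densities"
    using c_le[OF \<mu>1] c by (auto simp: densities_def intro: order_trans[of 0 "2 * c"])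
  obtain X where X: "\<forall>N>0. \<exists>\<phi> m. m 0 = ?\<mu>0 \<and> m N = ?\<mu>1 \<and> (\<forall>k. m k \<in> densities) \<and>
    discrete_continuity N a b p \<phi> m \<and>
    discrete_action N a b p \<phi> m
      \<le> pairing \<pi> (\<phi> N) ?\<mu>1 - pairing \<pi> (\<phi> 0) ?\<mu>0
        - source_cost N a p \<phi> \<and>
    discrete_HJ N b \<phi> \<and>
    pairing \<pi> (\<lambda>_. 1) (\<lambda>x. \<phi> 0 x - \<phi> N x) \<le> X"
    using discrete_duality[where \<mu>\<^sub>0 = ?\<mu>0 and \<mu>\<^sub>1 = ?\<mu>1, OF p(1) a b c c_le[OF \<mu>0] c_le[OF \<mu>1]] by (elim exE) (rule that)
  obtain Z where Z: "\<forall>N>0. \<forall>\<phi>. discrete_HJ N b \<phi> \<longrightarrow>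
    pairing \<pi> (\<lambda>_. 1) (\<lambda>x. \<phi> 0 x - \<phi> N x) \<le> X \<longrightarrow>
    (\<exists>\<psi>. integrated_HJ K \<pi> b \<psi> \<and> pairing \<pi> (\<phi> N) ?\<mu>1 - pairing \<pi> (\<phi> 0) ?\<mu>0
        - source_cost N a p \<phi>
      \<le> (1 + \<delta>) * dual_functional \<pi> a p ?\<mu>0 ?\<mu>1 \<psi> + Z / real N)"
    using discrete_subsolution_value[OF p a b \<delta>(1) \<mu>1'd, where X = X and \<mu>\<^sub>0 = ?\<mu>0] by (elim exE) (rule that)
  obtain Q where Q: "\<forall>N>0. \<forall>\<phi> m. m 0 = ?\<mu>0 \<longrightarrow> (\<forall>k. m k \<in> densities) \<longrightarrow>
    discrete_continuity N a b p \<phi> m \<longrightarrow>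
    discrete_action N a b p \<phi> m \<le> (1 + \<delta>) * U + \<delta> \<longrightarrow>
    (\<forall>k<N. \<forall>x. (m (Suc k) x - m k x)\<^sup>2 \<le> Q / real N)"
    using discrete_step_bound[OF p a b, where \<mu>\<^sub>0 = ?\<mu>0 and A = "(1 + \<delta>) * U + \<delta>"] by (elim exE) (rule that)
  define r where "r = \<delta> * (\<alpha> * pm)"
  have r: "0 < r" using \<delta> \<alpha> pm by (simp add: r_def)
  obtain N :: nat where N: "0 < N" "Z / real N \<le> \<delta>" "Q / real N \<le> r\<^sup>2"
  proof -
    obtain n :: nat where n: "max 1 (max (Z / \<delta>) (Q / r\<^sup>2)) < real n" using reals_Archimedean2 by blast
    then have n1: "1 < real n" "Z / \<delta> < real n" "Q / r\<^sup>2 < real n" by auto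
    show ?thesis
    proof (rule that[of n])
      show "0 < n" using n1 by simp
      show "Z / real n \<le> \<delta>" "Q / real n \<le> r\<^sup>2" using n1 \<delta> r by (simp_all add: field_simps)
    qed
  qed
  obtain \<phi> m where m: "m 0 = ?\<mu>0" "m N = ?\<mu>1" "\<forall>k. m k \<in> densities"
    and eq: "discrete_continuity N a b p \<phi> m"
    and val: "discrete_action N a b p \<phi> m
      \<le> pairing \<pi> (\<phi> N) ?\<mu>1 - pairing \<pi> (\<phi> 0) ?\<mu>0
        - source_cost N a p \<phi>"
    and viol: "discrete_HJ N b \<phi>"
    and drop: "pairing \<pi> (\<lambda>_. 1) (\<lambda>x. \<phi> 0 x - \<phi> N x) \<le> X"
    using X[THEN spec, THEN mp, OF N(1)] by (elim exE conjE) (rule that)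
  obtain \<psi> where \<psi>: "integrated_HJ K \<pi> b \<psi>" and \<psi>val: "pairing \<pi> (\<phi> N) ?\<mu>1 - pairing \<pi> (\<phi> 0) ?\<mu>0
        - source_cost N a p \<phi>
      \<le> (1 + \<delta>) * dual_functional \<pi> a p ?\<mu>0 ?\<mu>1 \<psi> + Z / real N"
    using Z[THEN spec, THEN mp, OF N(1), THEN spec, THEN mp, OF viol, THEN mp, OF drop] by (elim exE conjE) (rule that)
  have "ereal (dual_functional \<pi> a p ?\<mu>0 ?\<mu>1 \<psi>) \<le> ereal U"
  proof (rule dual_functional_le_of_C1[OF \<psi> b])
    fix \<zeta> assume "\<zeta> \<in> C1_HJ_subsolutions K \<pi> b"
    then show "ereal (dual_functional \<pi> a p ?\<mu>0 ?\<mu>1 \<zeta>) \<le> ereal U"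
      using dual_functional_shifted[OF p(1) a b _ _ U, of \<alpha> \<zeta>] \<alpha> by simp
  qed
  then have "(1 + \<delta>) * dual_functional \<pi> a p ?\<mu>0 ?\<mu>1 \<psi> \<le> (1 + \<delta>) * U"
    using \<delta> by (intro mult_left_mono) auto
  then have val': "discrete_action N a b p \<phi> m \<le> (1 + \<delta>) * U + \<delta>"
    using val \<psi>val N(2) by linarith
  have small: "\<bar>m (Suc k) x - m k x\<bar> \<le> \<delta> * (\<alpha> * pm)" if "k < N" for k x
  proof -
    have "(m (Suc k) x - m k x)\<^sup>2 \<le> r\<^sup>2" using Q[THEN spec, THEN mp, OF N(1), THEN spec[of _ \<phi>], THEN spec[of _ m], THEN mp, OF m(1), THEN mp, OF m(3), THEN mp, OF eq,
          THEN mp, OF val', THEN spec, THEN mp, OF that, THEN spec[of _ x]] N(3) by (rule order_trans)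
    then show ?thesis using r by (simp add: abs_le_square_iff[symmetric] r_def[symmetric])
  qed
  obtain cm where cm: "0 \<le> cm" "cm \<le> 2 * ((1 + \<delta>) * U + \<delta>) / ((1 - 2 * \<delta>) * (1 - \<delta>))"
    "connects K \<pi> a b p (1 - 2 * \<delta>) (\<lambda>x. (1 - \<alpha>) * m 0 x + \<alpha> * p x) (\<lambda>x. (1 - \<alpha>) * m N x + \<alpha> * p x) cm"
  proof (rule connects_discrete[OF p(1) pm a b N(1) \<delta>(1) _ \<alpha> _ m(3)[THEN spec] eq[THEN spec, THEN mp, THEN spec] small val'])
    show "\<delta> < 1" "0 < 1 - 2 * \<delta>" using \<delta> by auto
  qed (use that in blast)+
  define \<beta> where "\<beta> = 1 - (1 - \<alpha>)\<^sup>2"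
  have \<beta>: "0 < \<beta>" "\<beta> \<le> 1" "\<beta> \<le> 2 * \<delta>\<^sup>2"
  proof -
    have "\<beta> = \<alpha> * (2 - \<alpha>)" by (simp add: \<beta>_def power2_eq_square algebra_simps)
    then show "0 < \<beta>" using \<alpha> by simp
    show "\<beta> \<le> 1" by (simp add: \<beta>_def)
    have "\<beta> = 2 * \<delta>\<^sup>2 - \<alpha>\<^sup>2" by (simp add: \<beta>_def \<alpha>_def power2_eq_square algebra_simps)
    then show "\<beta> \<le> 2 * \<delta>\<^sup>2" by simp
  qed
  have mix: "(\<lambda>x. (1 - \<alpha>) * ((1 - \<alpha>) * \<mu> x + \<alpha> * p x) + \<alpha> * p x) = (\<lambda>x. (1 - \<beta>) * \<mu> x + \<beta> * p x)" for \<mu>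
    by (rule ext) (simp add: \<beta>_def power2_eq_square algebra_simps)
  have arc: "4 * \<beta> / \<delta> * C \<le> 8 * \<delta> * C" if "0 \<le> C" for C
  proof (rule mult_right_mono[OF _ that])
    have "4 * \<beta> \<le> 8 * \<delta> * \<delta>" using \<beta>(3) by (simp add: power2_eq_square)
    then show "4 * \<beta> / \<delta> \<le> 8 * \<delta>" using \<delta> by (simp add: pos_divide_le_eq)
  qed
  have "connects K \<pi> a b p (\<delta> + (1 - 2 * \<delta>)) \<mu>\<^sub>0 (\<lambda>x. (1 - \<beta>) * \<mu>\<^sub>1 x + \<beta> * p x) (4 * \<beta> / \<delta> * Ca + cm)"
    using cm(3) \<delta> \<beta> Ca(1) cm(1) unfolding m(1,2) mix
    by (intro connects_concat[OF Ca(2)[OF \<beta>(1,2) \<delta>(1)]]) auto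
  then have "connects K \<pi> a b p (\<delta> + (1 - 2 * \<delta>) + \<delta>) \<mu>\<^sub>0 \<mu>\<^sub>1 (4 * \<beta> / \<delta> * Ca + cm + 4 * \<beta> / \<delta> * Cb)"
    using \<delta> \<beta> Ca(1) Cb(1) cm(1) by (intro connects_concat[OF _ Cb(2)[OF \<beta>(1,2) \<delta>(1)]]) auto
  then have "connects K \<pi> a b p 1 \<mu>\<^sub>0 \<mu>\<^sub>1 (4 * \<beta> / \<delta> * Ca + cm + 4 * \<beta> / \<delta> * Cb)" by simp
  from connects_min_action[OF this]
  have "min_action K \<pi> a b p \<mu>\<^sub>0 \<mu>\<^sub>1 \<le> ennreal (4 * \<beta> / \<delta> * Ca + cm + 4 * \<beta> / \<delta> * Cb)" .
  also have "\<dots> \<le> ennreal (2 * ((1 + \<delta>) * U + \<delta>) / ((1 - 2 * \<delta>) * (1 - \<delta>)) + 8 * \<delta> * (Ca + Cb))"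
    using arc[OF Ca(1)] arc[OF Cb(1)] cm(2) by (intro ennreal_leI) (simp add: distrib_left)
  finally show ?thesis .
qed

lemma min_action_le_dual:
  assumes p: "p \<in> pos_densities" "(\<Sum>x\<in>UNIV. p x * \<pi> x) = 1" and a: "0 < a" and b: "0 < b"
    and \<mu>0: "\<mu>\<^sub>0 \<in> densities" and \<mu>1: "\<mu>\<^sub>1 \<in> densities"
    and U: "\<And>\<phi>. \<phi> \<in> C1_HJ_subsolutions K \<pi> b \<Longrightarrow> dual_functional \<pi> a p \<mu>\<^sub>0 \<mu>\<^sub>1 \<phi> \<le> U"
  shows "min_action K \<pi> a b p \<mu>\<^sub>0 \<mu>\<^sub>1 \<le> ennreal (2 * U)"
proof -
  obtain Ca where Ca: "0 \<le> Ca" "\<And>\<beta> T. \<lbrakk>0 < \<beta>; \<beta> \<le> 1; 0 < T\<rbrakk> \<Longrightarrow>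
      connects K \<pi> a b p T \<mu>\<^sub>0 (\<lambda>x. (1 - \<beta>) * \<mu>\<^sub>0 x + \<beta> * p x) (4 * \<beta> / T * Ca)"
    using connects_to_reference[OF p \<mu>0, of a b] by metis
  obtain Cb where Cb: "0 \<le> Cb" "\<And>\<beta> T. \<lbrakk>0 < \<beta>; \<beta> \<le> 1; 0 < T\<rbrakk> \<Longrightarrow>
      connects K \<pi> a b p T (\<lambda>x. (1 - \<beta>) * \<mu>\<^sub>1 x + \<beta> * p x) \<mu>\<^sub>1 (4 * \<beta> / T * Cb)"
    using connects_to_reference[OF p \<mu>1, of a b] by metis
  define g where "g \<delta> = 2 * ((1 + \<delta>) * U + \<delta>) / ((1 - 2 * \<delta>) * (1 - \<delta>)) + 8 * \<delta> * (Ca + Cb)" for \<delta>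
  have "(g \<longlongrightarrow> 2 * ((1 + 0) * U + 0) / ((1 - 2 * 0) * (1 - 0)) + 8 * 0 * (Ca + Cb)) (at_right 0)"
    unfolding g_def by (intro tendsto_intros) auto
  then have "((\<lambda>\<delta>. ennreal (g \<delta>)) \<longlongrightarrow> ennreal (2 * U)) (at_right 0)"
    by (intro tendsto_ennrealI) simp
  moreover have "\<forall>\<^sub>F \<delta> in at_right 0. min_action K \<pi> a b p \<mu>\<^sub>0 \<mu>\<^sub>1 \<le> ennreal (g \<delta>)"
  proof -
    have "\<forall>\<^sub>F \<delta> in at_right 0. \<delta> \<in> {0<..<1/4::real}" by (rule eventually_at_right_real) simp
    then show ?thesis
      by (rule eventually_mono) (use min_action_approx[OF p a b \<mu>0 \<mu>1 U Ca Cb] in \<open>auto simp: g_def\<close>)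
  qed
  ultimately show ?thesis
    by (rule tendsto_lowerbound) simp
qed

lemma C1_subset_HJ_subsolutions: "C1_HJ_subsolutions K \<pi> b \<subseteq> HJ_subsolutions K \<pi> b"
  unfolding C1_HJ_subsolutions_def HJ_subsolutions_def using C1_imp_H1 by blast

end

theorem theorem4p4:
  fixes K :: "'x::finite \<Rightarrow> 'x \<Rightarrow> real" and \<pi> p \<mu>\<^sub>0 \<mu>\<^sub>1 :: "'x \<Rightarrow> real" and a b :: real
  assumes "markov_kernel K" and "irreducible_kernel K"
    and "invariant_probability K \<pi>" and "reversible K \<pi>"
    and "0 < a" and "0 < b"
    and "p \<in> pos_densities" and "(\<Sum>x\<in>UNIV. p x * \<pi> x) = 1"
    and "\<mu>\<^sub>0 \<in> densities" and "\<mu>\<^sub>1 \<in> densities"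
  shows "1 / 2 * (transport_dist K \<pi> a b p \<mu>\<^sub>0 \<mu>\<^sub>1)\<^sup>2 =
           (SUP \<phi>\<in>HJ_subsolutions K \<pi> b. ereal (dual_functional \<pi> a p \<mu>\<^sub>0 \<mu>\<^sub>1 \<phi>)) \<and>
         1 / 2 * (transport_dist K \<pi> a b p \<mu>\<^sub>0 \<mu>\<^sub>1)\<^sup>2 =
           (SUP \<phi>\<in>C1_HJ_subsolutions K \<pi> b. ereal (dual_functional \<pi> a p \<mu>\<^sub>0 \<mu>\<^sub>1 \<phi>))"
proof -
  interpret reversible_chain K \<pi> by unfold_locales fact+
  let ?F = "\<lambda>\<phi>. ereal (dual_functional \<pi> a p \<mu>\<^sub>0 \<mu>\<^sub>1 \<phi>)"
  let ?A = "min_action K \<pi> a b p \<mu>\<^sub>0 \<mu>\<^sub>1"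
  let ?S = "SUP \<phi>\<in>C1_HJ_subsolutions K \<pi> b. ?F \<phi>"
  have half: "1 / 2 * (transport_dist K \<pi> a b p \<mu>\<^sub>0 \<mu>\<^sub>1)\<^sup>2 = ereal (1 / 2) * enn2ereal ?A"
    by (simp add: transport_dist_square one_ereal_def)
  have lower: "?F \<phi> \<le> ereal (1 / 2) * enn2ereal ?A" if "\<phi> \<in> C1_HJ_subsolutions K \<pi> b" for \<phi>
  proof (cases ?A)
    case (real r)
    then have "ennreal (2 * dual_functional \<pi> a p \<mu>\<^sub>0 \<mu>\<^sub>1 \<phi>) \<le> ennreal r"
      using C1_dual_le_min_action[OF assms(5,6) that, of p \<mu>\<^sub>0 \<mu>\<^sub>1] by simp
    then have "2 * dual_functional \<pi> a p \<mu>\<^sub>0 \<mu>\<^sub>1 \<phi> \<le> r"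
      using real by (simp add: ennreal_le_iff)
    then show ?thesis using real by (simp add: enn2ereal_ennreal)
  next
    case top
    then show ?thesis by simp
  qed
  have upper: "ereal (1 / 2) * enn2ereal ?A \<le> ?S"
  proof (cases ?S)
    case (real U)
    have "dual_functional \<pi> a p \<mu>\<^sub>0 \<mu>\<^sub>1 \<phi> \<le> U" if "\<phi> \<in> C1_HJ_subsolutions K \<pi> b" for \<phi>
      using SUP_upper[OF that, of ?F] by (simp add: real)
    then have A: "?A \<le> ennreal (2 * U)" by (intro min_action_le_dual assms)
    have "?F (\<lambda>_ _. 0) \<le> ?S" by (rule SUP_upper[OF zero_C1_subsolution])
    then have "0 \<le> U" unfolding real by (simp add: dual_functional_def pairing_def)
    with A have "enn2ereal ?A \<le> ereal (2 * U)" by (simp add: less_eq_ennreal.rep_eq enn2ereal_ennreal)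
    then have "ereal (1 / 2) * enn2ereal ?A \<le> ereal (1 / 2) * ereal (2 * U)" by (rule ereal_mult_left_mono) simp
    then show ?thesis by (simp add: real)
  next
    case MInf
    have "?F (\<lambda>_ _. 0) \<le> ?S" by (rule SUP_upper[OF zero_C1_subsolution])
    then show ?thesis using MInf by simp
  qed simp
  have C1_eq: "ereal (1 / 2) * enn2ereal ?A = ?S"
    using upper lower by (intro antisym SUP_least)
  have "?F \<phi> \<le> ?S" if "\<phi> \<in> HJ_subsolutions K \<pi> b" for \<phi>
    by (rule dual_functional_le_of_C1[OF HJ_subsolution_integrated[OF that] assms(6)]) (rule SUP_upper)
  then have "(SUP \<phi>\<in>HJ_subsolutions K \<pi> b. ?F \<phi>) = ?S"
    by (intro antisym SUP_least SUP_subset_mono C1_subset_HJ_subsolutions) auto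
  then show ?thesis unfolding half using C1_eq by simp
qed

end
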